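(* Let $G=\mathrm{SL}_2$ over an algebraically closed field of characteristic $2$, let $\delta=\frac32-\frac{\log 3}{2\log 2}$, and let $W$ be any tilting representation of $G$. Then there exists a constant $c_W>0$ such that for all integers $k\ge 1$, $$b_k^{G,W}\ge c_W\,k^{-\delta}(\dim W)^k.$$
   Context: For a finite-dimensional algebraic representation $W$ of $G$, $b_k^{G,W}$ denotes the number of indecomposable direct summands, counted with multiplicity, in a decomposition of the $G$-representation $W^{\otimes k}$ into indecomposables (well defined by Krull--Schmidt). Tilting representations are finite-dimensional tilting modules in the usual sense for reductive algebraic groups; each is a direct sum of the indecomposable tilting modules $T(n)$, $n\ge0$, where $T(n)$ is the unique indecomposable tilting module of highest weight $n$. *)

theory Defs
  imports
    Complex_Main
    "HOL-Computational_Algebra.Polynomial"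
    "Jordan_Normal_Form.Determinant"
    "Jordan_Normal_Form.Matrix_Kernel"
begin

text \<open>
  Over an algebraically closed field, \<open>SL\<^sub>2\<close> is identified with its group of rational points, and its
  coordinate ring with the algebra of functions generated by the four matrix entries.
\<close>

definition SL2 :: "'a :: field mat set" where
  "SL2 = {g \<in> carrier_mat 2 2. det g = 1}"

inductive_set regular_functions :: "('a :: field mat \<Rightarrow> 'a) set" where
  const: "(\<lambda>_. c) \<in> regular_functions"
| entry: "i < 2 \<Longrightarrow> j < 2 \<Longrightarrow> (\<lambda>g. g $$ (i, j)) \<in> regular_functions"
| add: "f \<in> regular_functions \<Longrightarrow> h \<in> regular_functions \<Longrightarrow> (\<lambda>g. f g + h g) \<in> regular_functions"
| mult: "f \<in> regular_functions \<Longrightarrow> h \<in> regular_functions \<Longrightarrow> (\<lambda>g. f g * h g) \<in> regular_functions"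

text \<open>
  A finite-dimensional representation is given, in coordinates, by the map sending a group element
  to the matrix by which it acts on column vectors. Only the values on \<open>SL2\<close> matter. The dimension,
  which may be zero, is read off from the action of the identity.
\<close>

type_synonym 'a rep = "'a mat \<Rightarrow> 'a mat"

definition rep_dim :: "'a :: field rep \<Rightarrow> nat" where
  "rep_dim \<rho> = dim_row (\<rho> (1\<^sub>m 2))"

definition algebraic_rep :: "'a :: field rep \<Rightarrow> bool" where
  "algebraic_rep \<rho> \<longleftrightarrow>
     (\<forall>g\<in>SL2. \<rho> g \<in> carrier_mat (rep_dim \<rho>) (rep_dim \<rho>)) \<and>
     \<rho> (1\<^sub>m 2) = 1\<^sub>m (rep_dim \<rho>) \<and>
     (\<forall>g\<in>SL2. \<forall>h\<in>SL2. \<rho> (g * h) = \<rho> g * \<rho> h) \<and>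
     (\<forall>i < rep_dim \<rho>. \<forall>j < rep_dim \<rho>. \<exists>f\<in>regular_functions. \<forall>g\<in>SL2. \<rho> g $$ (i, j) = f g)"

definition rep_hom :: "'a :: field rep \<Rightarrow> 'a rep \<Rightarrow> 'a mat \<Rightarrow> bool" where
  "rep_hom \<rho> \<sigma> A \<longleftrightarrow> A \<in> carrier_mat (rep_dim \<sigma>) (rep_dim \<rho>) \<and> (\<forall>g\<in>SL2. A * \<rho> g = \<sigma> g * A)"

definition rep_iso :: "'a :: field rep \<Rightarrow> 'a rep \<Rightarrow> bool" where
  "rep_iso \<rho> \<sigma> \<longleftrightarrow> (\<exists>A. rep_hom \<rho> \<sigma> A \<and> invertible_mat A)"

definition direct_sum :: "'a :: field rep list \<Rightarrow> 'a rep" where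
  "direct_sum \<rho>s = (\<lambda>g. diag_block_mat (map (\<lambda>\<rho>. \<rho> g) \<rho>s))"

definition indecomposable :: "'a :: field rep \<Rightarrow> bool" where
  "indecomposable \<rho> \<longleftrightarrow> algebraic_rep \<rho> \<and> rep_dim \<rho> > 0 \<and>
     (\<forall>\<sigma> \<tau>. algebraic_rep \<sigma> \<longrightarrow> algebraic_rep \<tau> \<longrightarrow> rep_iso \<rho> (direct_sum [\<sigma>, \<tau>]) \<longrightarrow>
        rep_dim \<sigma> = 0 \<or> rep_dim \<tau> = 0)"

text \<open>Kronecker product: \<open>e\<^sub>i \<otimes> e\<^sub>j\<close> is the basis vector with index \<open>i * m + j\<close>,
  where \<open>m\<close> is the dimension of the second factor.\<close>

definition kronecker :: "'a :: field mat \<Rightarrow> 'a mat \<Rightarrow> 'a mat" where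
  "kronecker A B = mat (dim_row A * dim_row B) (dim_col A * dim_col B)
     (\<lambda>(i, j). A $$ (i div dim_row B, j div dim_col B) * B $$ (i mod dim_row B, j mod dim_col B))"

definition tensor :: "'a :: field rep \<Rightarrow> 'a rep \<Rightarrow> 'a rep" where
  "tensor \<rho> \<sigma> = (\<lambda>g. kronecker (\<rho> g) (\<sigma> g))"

fun tensor_power :: "'a :: field rep \<Rightarrow> nat \<Rightarrow> 'a rep" where
  "tensor_power \<rho> 0 = (\<lambda>_. 1\<^sub>m 1)"
| "tensor_power \<rho> (Suc k) = tensor \<rho> (tensor_power \<rho> k)"

text \<open>On \<open>SL2\<close> the adjugate is the inverse, so this is the contragredient representation.\<close>

definition dual_rep :: "'a :: field rep \<Rightarrow> 'a rep" where
  "dual_rep \<rho> = (\<lambda>g. transpose_mat (\<rho> (adj_mat g)))"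

text \<open>
  The induced module \<open>H\<^sup>0(n)\<close> is the \<open>n\<close>-th symmetric power of the natural representation with
  basis \<open>x, y\<close>. In the basis \<open>x\<^bsup>n-j\<^esup> y\<^sup>j\<close>, a group element with rows \<open>(a, b)\<close> and \<open>(c, d)\<close> maps
  this monomial to \<open>(a x + c y)\<^bsup>n-j\<^esup> (b x + d y)\<^sup>j\<close>; below, \<open>x\<close> is set to \<open>1\<close>. The Weyl module is the
  dual of \<open>H\<^sup>0(n)\<close>, because \<open>-w\<^sub>0\<close> acts trivially on the weights of \<open>SL\<^sub>2\<close>.
\<close>

definition induced_module :: "nat \<Rightarrow> 'a :: field rep" where
  "induced_module n = (\<lambda>g. mat (n + 1) (n + 1) (\<lambda>(i, j).
     coeff ([:g $$ (0, 0), g $$ (1, 0):] ^ (n - j) * [:g $$ (0, 1), g $$ (1, 1):] ^ j) i))"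

definition weyl_module :: "nat \<Rightarrow> 'a :: field rep" where
  "weyl_module n = dual_rep (induced_module n)"

definition short_exact :: "'a :: field rep \<Rightarrow> 'a rep \<Rightarrow> 'a rep \<Rightarrow> bool" where
  "short_exact \<rho>' \<rho> \<rho>'' \<longleftrightarrow> (\<exists>A B. rep_hom \<rho>' \<rho> A \<and> rep_hom \<rho> \<rho>'' B \<and>
     inj_on (\<lambda>v. A *\<^sub>v v) (carrier_vec (rep_dim \<rho>')) \<and>
     (\<lambda>v. A *\<^sub>v v) ` carrier_vec (rep_dim \<rho>') = mat_kernel B \<and>
     (\<lambda>v. B *\<^sub>v v) ` carrier_vec (rep_dim \<rho>) = carrier_vec (rep_dim \<rho>''))"

text \<open>Existence of a finite filtration whose successive quotients are isomorphic to members of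
  the family \<open>M\<close>; the induction removes the top quotient.\<close>

inductive has_filtration :: "(nat \<Rightarrow> 'a :: field rep) \<Rightarrow> 'a rep \<Rightarrow> bool"
  for M :: "nat \<Rightarrow> 'a rep" where
  zero: "algebraic_rep \<rho> \<Longrightarrow> rep_dim \<rho> = 0 \<Longrightarrow> has_filtration M \<rho>"
| extend: "has_filtration M \<rho>' \<Longrightarrow> algebraic_rep \<rho> \<Longrightarrow> short_exact \<rho>' \<rho> (M n) \<Longrightarrow> has_filtration M \<rho>"

definition tilting :: "'a :: field rep \<Rightarrow> bool" where
  "tilting \<rho> \<longleftrightarrow> algebraic_rep \<rho> \<and>
     has_filtration induced_module \<rho> \<and> has_filtration weyl_module \<rho>"

definition indecomposable_decomposition :: "'a :: field rep \<Rightarrow> 'a rep list \<Rightarrow> bool" where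
  "indecomposable_decomposition \<rho> \<rho>s \<longleftrightarrow>
     (\<forall>\<sigma>\<in>set \<rho>s. indecomposable \<sigma>) \<and> rep_iso \<rho> (direct_sum \<rho>s)"

text \<open>By Krull--Schmidt, the length does not depend on the chosen decomposition.\<close>

definition num_summands :: "'a :: field rep \<Rightarrow> nat" where
  "num_summands \<rho> = length (SOME \<rho>s. indecomposable_decomposition \<rho> \<rho>s)"

definition b_tensor :: "'a :: field rep \<Rightarrow> nat \<Rightarrow> nat" where
  "b_tensor W k = num_summands (tensor_power W k)"

end

theory Submission
  imports Defs
begin

text \<open>In characteristic 2 the tensor cube of the natural module \<open>V\<close> is \<open>V \<oplus> V \<oplus> V \<otimes> V\<^sup>F\<close>, where \<open>F\<close>
  denotes the Frobenius twist. Rewriting cubes, and using that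
  tensoring a twisted module with \<open>V\<close> or \<open>V \<otimes> V\<close> loses no summands, bounds the number of summands of \<open>V\<^bsup>\<otimes> k\<^esup>\<close>,
  divided by \<open>2 ^ k\<close>, from below by \<open>1/2\<close> (\<open>k\<close> odd) or \<open>1/4\<close> (\<open>k\<close> even) of a binomial average of the same
  quantity centred at about \<open>k / 4\<close>. The mean of the two factors is \<open>3/8\<close> and \<open>4\<^sup>\<delta> = 8/3\<close>, so induction and convexity
  of \<open>x \<mapsto> x\<^sup>-\<^sup>\<delta>\<close> give the bound for \<open>V\<close>. A word, that is, a tensor product of twists of powers of \<open>V\<close>, costs only a
  constant depending on its length.

  A tilting module \<open>W\<close> is a direct sum of words whose letters are 1 and 2: extensions of Weyl modules by
  induced modules split, so by the Koszul sequence \<open>0 \<rightarrow> H\<^sup>0(m) \<rightarrow> V \<otimes> H\<^sup>0(m+1) \<rightarrow> H\<^sup>0(m+2) \<rightarrow> 0\<close> the identity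
  of \<open>W\<close> is a sum of maps that factor through powers of \<open>V\<close>, hence through words. These words are indecomposable, and the local
  endomorphism rings of the summands of \<open>W\<close> force each summand to be a word. Expanding \<open>W\<^bsup>\<otimes> k\<^esup>\<close> reduces
  the theorem to words. Throughout, summands are bounded from below by orthogonal families of retracts, through the
  Krull--Schmidt exchange argument.\<close>

section \<open>Matrices and Kronecker products\<close>

text \<open>\<open>num_summands\<close> is a choice and only lower bounds are wanted, so families of
  nonzero orthogonal idempotents replace complete decompositions: they survive tensoring, twisting
  and passage to a larger module. Characteristic two enters the cube through the loop value of
  \<open>V\<close>, which is 2 = 0. The composites that would mix the two copies of \<open>V\<close>
  vanish, and the zigzag identities normalise them. The two loss factors have one origin. In the
  power of \<open>V\<close> with exponent 2q + a, where a is 1 or 2, the q cube steps lose no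
  dimension, but the leftover a-th power of \<open>V\<close>, of dimension \<open>2^a\<close>, is
  counted as contributing no further summand. Expanding a tensor power of a sum of words must not
  produce ever longer words, as each letter costs a constant. Words with equal twists merge letter
  by letter, so the length stays bounded. Indecomposability of words rests on the Lie algebra acting
  on \<open>V \<otimes> V\<close> through two commuting operators of square zero: modulo their
  images only the twisted factor remains, and idempotents vanishing there are nilpotent.\<close>

lemma mat_mult_assoc:
  fixes A :: "'a :: semiring_0 mat"
  shows "dim_col A = dim_row B \<Longrightarrow> dim_col B = dim_row C \<Longrightarrow> A * B * C = A * (B * C)"
  by (rule assoc_mult_mat[of A "dim_row A" "dim_row B" B "dim_row C" C "dim_col C"]) auto

lemma mat_distrib_left:
  fixes A :: "'a :: semiring_0 mat"
  shows "dim_col A = dim_row B \<Longrightarrow> dim_row B = dim_row C \<Longrightarrow> dim_col B = dim_col C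
    \<Longrightarrow> A * (B + C) = A * B + A * C"
  by (rule mult_add_distrib_mat[of A "dim_row A" "dim_row B" B "dim_col C" C]) auto

lemma mat_distrib_right:
  fixes A :: "'a :: semiring_0 mat"
  shows "dim_row A = dim_row B \<Longrightarrow> dim_col A = dim_col B \<Longrightarrow> dim_col A = dim_row C
    \<Longrightarrow> (A + B) * C = A * C + B * C"
  by (rule add_mult_distrib_mat[of A "dim_row B" "dim_row C" B C]) auto

lemma mat_diff_left:
  fixes A :: "'a :: ring mat"
  shows "dim_col A = dim_row B \<Longrightarrow> dim_row B = dim_row C \<Longrightarrow> dim_col B = dim_col C
    \<Longrightarrow> A * (B - C) = A * B - A * C"
  by (rule mult_minus_distrib_mat[of A "dim_row A" "dim_row B" B "dim_col C" C]) auto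

lemma mat_diff_right:
  fixes A :: "'a :: ring mat"
  shows "dim_row A = dim_row B \<Longrightarrow> dim_col A = dim_col B \<Longrightarrow> dim_col A = dim_row C
    \<Longrightarrow> (A - B) * C = A * C - B * C"
  by (rule minus_mult_distrib_mat[of A "dim_row B" "dim_row C" B C]) auto

lemma mat_smult_left:
  fixes A :: "'a :: comm_semiring_0 mat"
  shows "dim_col A = dim_row B \<Longrightarrow> A * (c \<cdot>\<^sub>m B) = c \<cdot>\<^sub>m (A * B)"
  by (rule mult_smult_distrib[of A "dim_row A" "dim_row B" B "dim_col B"]) auto

lemma mat_smult_right:
  fixes A :: "'a :: comm_semiring_0 mat"
  shows "dim_col A = dim_row B \<Longrightarrow> (c \<cdot>\<^sub>m A) * B = c \<cdot>\<^sub>m (A * B)"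
  by (rule mult_smult_assoc_mat[of A "dim_row A" "dim_row B" B "dim_col B"]) auto

text \<open>Side conditions are equations between dimensions rather than carrier memberships, so
  that rewriting can discharge them. Used from left to right, the rules bring expressions into a
  right-nested, distributed form.\<close>

lemmas mat_ring = mat_mult_assoc mat_distrib_left mat_distrib_right mat_diff_left mat_diff_right

lemma mult_index:
  "i < dim_row A \<Longrightarrow> j < dim_col B \<Longrightarrow> dim_col A = dim_row B \<Longrightarrow>
    (A * B) $$ (i, j) = (\<Sum>k<dim_row B. A $$ (i, k) * B $$ (k, j))"
  by (auto simp: scalar_prod_def row_def col_def lessThan_atLeast0 intro!: sum.cong)

lemma minus_self_mat [simp]: "(A :: 'a :: ab_group_add mat) - A = 0\<^sub>m (dim_row A) (dim_col A)"
  by (rule eq_matI) auto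

lemma add_zero_mat_right [simp]:
  "dim_row A = n \<Longrightarrow> dim_col A = m \<Longrightarrow> (A :: 'a :: monoid_add mat) + 0\<^sub>m n m = A"
  by (rule eq_matI) auto

lemma add_zero_mat_left [simp]:
  "dim_row A = n \<Longrightarrow> dim_col A = m \<Longrightarrow> 0\<^sub>m n m + (A :: 'a :: monoid_add mat) = A"
  by (rule eq_matI) auto

lemma minus_zero_mat_right [simp]:
  "dim_row A = n \<Longrightarrow> dim_col A = m \<Longrightarrow> (A :: 'a :: group_add mat) - 0\<^sub>m n m = A"
  by (rule eq_matI) auto

lemma diff_eq_zero_mat_iff:
  fixes A :: "'a :: ab_group_add mat"
  assumes "dim_row A = n" "dim_col A = m" "dim_row B = n" "dim_col B = m"
  shows "A - B = 0\<^sub>m n m \<longleftrightarrow> A = B"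
proof
  assume h: "A - B = 0\<^sub>m n m"
  show "A = B"
  proof (rule eq_matI)
    fix i j assume "i < dim_row B" "j < dim_col B"
    then show "A $$ (i, j) = B $$ (i, j)"
      using arg_cong[OF h, of "\<lambda>X. X $$ (i, j)"] assms by simp
  qed (use assms in auto)
qed (use assms in auto)

lemma dim_one_mat [simp]: "dim_row (1\<^sub>m n) = n" "dim_col (1\<^sub>m n) = n"
  by auto

lemma dim_kronecker [simp]:
  "dim_row (kronecker A B) = dim_row A * dim_row B"
  "dim_col (kronecker A B) = dim_col A * dim_col B"
  by (auto simp: kronecker_def)

lemma index_kronecker [simp]:
  "i < dim_row A * dim_row B \<Longrightarrow> j < dim_col A * dim_col B \<Longrightarrow>
   kronecker A B $$ (i, j) =
     A $$ (i div dim_row B, j div dim_col B) * B $$ (i mod dim_row B, j mod dim_col B)"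
  by (auto simp: kronecker_def)

lemma div_mod_less: "(i :: nat) < a * b \<Longrightarrow> i div b < a \<and> i mod b < b"
  by (cases "b = 0") (auto simp: less_mult_imp_div_less)

lemma mult_add_less: "(i :: nat) < a \<Longrightarrow> j < b \<Longrightarrow> i * b + j < a * b"
proof -
  assume "i < a" "j < b"
  then have "i * b + j < Suc i * b" by simp
  also have "\<dots> \<le> a * b" using \<open>i < a\<close> by (intro mult_le_mono1) auto
  finally show ?thesis .
qed

text \<open>Pairs are encoded as \<open>i * b + j\<close>, as in \<open>kronecker\<close>; quotient
  and remainder decode them. This turns a sum over one Kronecker index into a double sum.\<close>

lemma sum_div_mod:
  "(\<Sum>k < a * (b :: nat). f (k div b) (k mod b)) = (\<Sum>i<a. \<Sum>j<b. f i j)"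
proof -
  have "(\<Sum>k < a * b. f (k div b) (k mod b)) = (\<Sum>p\<in>{..<a} \<times> {..<b}. f (fst p) (snd p))"
    by (rule sum.reindex_bij_witness[where i = "\<lambda>p. fst p * b + snd p"
          and j = "\<lambda>k. (k div b, k mod b)"])
       (auto simp: less_mult_imp_div_less intro: mult_add_less dest: div_mod_less)
  then show ?thesis
    by (simp add: sum.cartesian_product split_def)
qed

lemma kronecker_mult:
  fixes A :: "'a :: field mat"
  assumes "dim_col A = dim_row B" "dim_col C = dim_row D"
  shows "kronecker (A * B) (C * D) = kronecker A C * kronecker B D"
proof (rule eq_matI)
  fix i j
  assume "i < dim_row (kronecker A C * kronecker B D)" "j < dim_col (kronecker A C * kronecker B D)"
  then have i: "i < dim_row A * dim_row C" and j: "j < dim_col B * dim_col D" by auto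
  note l = div_mod_less[OF i] div_mod_less[OF j]
  let ?f = "\<lambda>k l. A $$ (i div dim_row C, k) * C $$ (i mod dim_row C, l) *
      (B $$ (k, j div dim_col D) * D $$ (l, j mod dim_col D))"
  have "(kronecker A C * kronecker B D) $$ (i, j) =
     (\<Sum>k<dim_row B * dim_row D. kronecker A C $$ (i, k) * kronecker B D $$ (k, j))"
    using i j assms by (subst mult_index) auto
  also have "\<dots> = (\<Sum>k<dim_row B * dim_row D. ?f (k div dim_row D) (k mod dim_row D))"
    using i j assms by (intro sum.cong) auto
  also have "\<dots> = (\<Sum>k<dim_row B. \<Sum>l<dim_row D. ?f k l)"
    by (rule sum_div_mod)
  also have "\<dots> = kronecker (A * B) (C * D) $$ (i, j)"
    using i j l assms
    by (subst index_kronecker) (auto simp: mult_index sum_product mult_ac simp del: index_mult_mat(1)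
        intro!: sum.cong)
  finally show "kronecker (A * B) (C * D) $$ (i, j) = (kronecker A C * kronecker B D) $$ (i, j)" ..
qed auto

text \<open>Both bracketings read the same mixed-radix digits of an index, so this is an equality
  and not only an isomorphism. Tensor products of representations thereby become strictly
  associative.\<close>

lemma kronecker_assoc:
  "kronecker (kronecker A B) C = kronecker A (kronecker B C)"
proof (rule eq_matI)
  fix i j
  assume "i < dim_row (kronecker A (kronecker B C))" "j < dim_col (kronecker A (kronecker B C))"
  then have i: "i < dim_row A * dim_row B * dim_row C" "i < dim_row A * (dim_row B * dim_row C)"
    and j: "j < dim_col A * dim_col B * dim_col C" "j < dim_col A * (dim_col B * dim_col C)"
    by (auto simp: mult.assoc)
  note l = div_mod_less[OF i(1)] div_mod_less[OF j(1)] div_mod_less[OF i(2)] div_mod_less[OF j(2)]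
  have e: "(k div c) mod b = (k mod (b * c)) div c" "(k mod (b * c)) mod c = k mod c"
    "k div c div b = k div (b * c)"
    for k b c :: nat
    using mod_mult2_eq[of k c b] div_mult2_eq[of k c b]
    by (cases "c = 0"; simp add: mult.commute)+
  show "kronecker (kronecker A B) C $$ (i, j) = kronecker A (kronecker B C) $$ (i, j)"
    using i j l by (simp add: e mult.assoc)
qed (auto simp: mult.assoc)

lemma kronecker_one_left [simp]: "kronecker (1\<^sub>m 1) A = A"
  by (rule eq_matI) (auto)

lemma kronecker_one_right [simp]: "kronecker A (1\<^sub>m 1) = A"
  by (rule eq_matI) (auto)

lemma kronecker_one_one [simp]: "kronecker (1\<^sub>m a) (1\<^sub>m b) = 1\<^sub>m (a * b)"
proof (rule eq_matI)
  fix i j assume "i < dim_row (1\<^sub>m (a * b) :: 'a mat)" "j < dim_col (1\<^sub>m (a * b) :: 'a mat)"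
  then have i: "i < a * b" "j < a * b" by auto
  have "i = j \<longleftrightarrow> i div b = j div b \<and> i mod b = j mod b"
    by (metis div_mult_mod_eq)
  then show "kronecker (1\<^sub>m a) (1\<^sub>m b) $$ (i, j) = (1\<^sub>m (a * b) :: 'a mat) $$ (i, j)"
    using i div_mod_less[OF i(1)] div_mod_less[OF i(2)] by auto
qed auto

lemma kronecker_add_left:
  "dim_row A = dim_row B \<Longrightarrow> dim_col A = dim_col B \<Longrightarrow>
    kronecker (A + B) C = kronecker A C + kronecker B C"
  by (rule eq_matI) (auto simp: div_mod_less distrib_right)

lemma kronecker_add_right:
  "dim_row A = dim_row B \<Longrightarrow> dim_col A = dim_col B \<Longrightarrow>
    kronecker C (A + B) = kronecker C A + kronecker C B"
  by (rule eq_matI) (auto simp: div_mod_less distrib_left)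

lemma kronecker_diff_right:
  "dim_row A = dim_row B \<Longrightarrow> dim_col A = dim_col B \<Longrightarrow>
    kronecker C (A - B) = kronecker C A - kronecker C B"
  by (rule eq_matI) (auto simp: div_mod_less right_diff_distrib)

lemma kronecker_zero_left [simp]: "kronecker (0\<^sub>m a b) B = 0\<^sub>m (a * dim_row B) (b * dim_col B)"
  by (rule eq_matI) (auto simp: div_mod_less)

lemma kronecker_zero_right [simp]: "kronecker A (0\<^sub>m a b) = 0\<^sub>m (dim_row A * a) (dim_col A * b)"
  by (rule eq_matI) (auto simp: div_mod_less)

text \<open>A nonzero entry of \<open>A\<close> places a nonzero multiple of \<open>B\<close> as a
  block of the product. This makes tensoring faithful on morphisms.\<close>

lemma kronecker_eq_zeroD:
  assumes "kronecker A B = 0\<^sub>m (dim_row A * dim_row B) (dim_col A * dim_col B)"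
    and "i < dim_row A" "j < dim_col A" "A $$ (i, j) \<noteq> 0"
  shows "B = 0\<^sub>m (dim_row B) (dim_col B)"
proof (rule eq_matI)
  fix k l assume "k < dim_row (0\<^sub>m (dim_row B) (dim_col B) :: 'a mat)"
    "l < dim_col (0\<^sub>m (dim_row B) (dim_col B) :: 'a mat)"
  then have k: "k < dim_row B" "l < dim_col B" by auto
  have b: "i * dim_row B + k < dim_row A * dim_row B" "j * dim_col B + l < dim_col A * dim_col B"
    using assms k by (auto intro: mult_add_less)
  show "B $$ (k, l) = 0\<^sub>m (dim_row B) (dim_col B) $$ (k, l)"
    using arg_cong[OF assms(1), of "\<lambda>X. X $$ (i * dim_row B + k, j * dim_col B + l)"] b k assms(4)
    by (simp add: field_simps)
qed auto

section \<open>Algebraic representations\<close>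

lemma SL2_D: "g \<in> SL2 \<Longrightarrow> dim_row g = 2 \<and> dim_col g = 2 \<and> det g = 1"
  by (auto simp: SL2_def)

lemma one_SL2 [simp]: "1\<^sub>m 2 \<in> SL2"
  by (auto simp: SL2_def)

lemma mult_SL2 [simp]: "g \<in> SL2 \<Longrightarrow> h \<in> SL2 \<Longrightarrow> g * h \<in> SL2"
  by (auto simp: SL2_def det_mult[of g 2 h])

text \<open>Rectangular on purpose: the square case describes representations, the general case the
  cocycles of extensions.\<close>

definition regular_mat :: "nat \<Rightarrow> nat \<Rightarrow> ('a :: field mat \<Rightarrow> 'a mat) \<Rightarrow> bool" where
  "regular_mat n m c \<longleftrightarrow> (\<forall>g\<in>SL2. c g \<in> carrier_mat n m) \<and>
     (\<forall>i<n. \<forall>j<m. \<exists>f\<in>regular_functions. \<forall>g\<in>SL2. c g $$ (i, j) = f g)"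

lemma regular_matD: "regular_mat n m c \<Longrightarrow> g \<in> SL2 \<Longrightarrow> dim_row (c g) = n \<and> dim_col (c g) = m"
  by (auto simp: regular_mat_def)

lemma regular_mat_entry:
  "regular_mat n m c \<Longrightarrow> i < n \<Longrightarrow> j < m \<Longrightarrow> \<exists>f\<in>regular_functions. \<forall>g\<in>SL2. c g $$ (i, j) = f g"
  by (auto simp: regular_mat_def)

lemma regular_sum:
  "(\<And>k. k < n \<Longrightarrow> f k \<in> regular_functions) \<Longrightarrow> (\<lambda>g. \<Sum>k<(n::nat). f k g) \<in> regular_functions"
proof (induction n)
  case (Suc n)
  have "(\<lambda>g. (\<Sum>k<n. f k g) + f n g) \<in> regular_functions"
    using Suc by (intro regular_functions.add) auto
  then show ?case by simp
qed (simp add: regular_functions.const)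

lemma regular_mat_cong:
  "regular_mat n m c \<Longrightarrow> (\<And>g. g \<in> SL2 \<Longrightarrow> c g = d g) \<Longrightarrow> regular_mat n m d"
  unfolding regular_mat_def by auto

lemma regular_mat_const: "A \<in> carrier_mat n m \<Longrightarrow> regular_mat n m (\<lambda>_. A)"
  by (auto simp: regular_mat_def intro!: bexI[OF _ regular_functions.const])

lemma regular_mat_add:
  assumes "regular_mat n m c" "regular_mat n m d"
  shows "regular_mat n m (\<lambda>g. c g + d g)"
  unfolding regular_mat_def
proof (intro conjI ballI allI impI)
  fix i j assume ij: "i < n" "j < m"
  obtain f h where "f \<in> regular_functions" "\<forall>g\<in>SL2. c g $$ (i, j) = f g"
    "h \<in> regular_functions" "\<forall>g\<in>SL2. d g $$ (i, j) = h g"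
    using assms[THEN regular_mat_entry, OF ij] by blast
  then show "\<exists>f\<in>regular_functions. \<forall>g\<in>SL2. (c g + d g) $$ (i, j) = f g"
    using ij assms[THEN regular_matD]
    by (intro bexI[OF _ regular_functions.add[of f h]]) auto
qed (use assms in \<open>auto simp: regular_mat_def\<close>)

lemma regular_mat_smult:
  assumes "regular_mat n m c"
  shows "regular_mat n m (\<lambda>g. a \<cdot>\<^sub>m c g)"
  unfolding regular_mat_def
proof (intro conjI ballI allI impI)
  fix i j assume ij: "i < n" "j < m"
  obtain f where "f \<in> regular_functions" "\<forall>g\<in>SL2. c g $$ (i, j) = f g"
    using assms[THEN regular_mat_entry, OF ij] by blast
  then show "\<exists>f\<in>regular_functions. \<forall>g\<in>SL2. (a \<cdot>\<^sub>m c g) $$ (i, j) = f g"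
    using ij assms[THEN regular_matD]
    by (intro bexI[OF _ regular_functions.mult[OF regular_functions.const[of a], of f]]) auto
qed (use assms in \<open>auto simp: regular_mat_def\<close>)

lemma regular_mat_minus:
  assumes "regular_mat n m c" "regular_mat n m d"
  shows "regular_mat n m (\<lambda>g. c g - d g)"
  by (rule regular_mat_cong[OF regular_mat_add[OF assms(1) regular_mat_smult[OF assms(2), of "-1"]]],
      rule eq_matI) (use assms[THEN regular_matD] in auto)

lemma regular_mat_mult:
  assumes "regular_mat n m c" "regular_mat m l d"
  shows "regular_mat n l (\<lambda>g. c g * d g)"
  unfolding regular_mat_def
proof (intro conjI ballI allI impI)
  fix i j assume ij: "i < n" "j < l"
  have "\<forall>k. k < m \<longrightarrow> (\<exists>f\<in>regular_functions. \<forall>g\<in>SL2. c g $$ (i, k) * d g $$ (k, j) = f g)"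
  proof (intro allI impI)
    fix k assume k: "k < m"
    obtain f h where "f \<in> regular_functions" "\<forall>g\<in>SL2. c g $$ (i, k) = f g"
      "h \<in> regular_functions" "\<forall>g\<in>SL2. d g $$ (k, j) = h g"
      using regular_mat_entry[OF assms(1) ij(1) k] regular_mat_entry[OF assms(2) k ij(2)] by blast
    then show "\<exists>f\<in>regular_functions. \<forall>g\<in>SL2. c g $$ (i, k) * d g $$ (k, j) = f g"
      by (intro bexI[OF _ regular_functions.mult[of f h]]) auto
  qed
  then obtain F where F: "\<And>k. k < m \<Longrightarrow> F k \<in> regular_functions"
    "\<And>k g. k < m \<Longrightarrow> g \<in> SL2 \<Longrightarrow> c g $$ (i, k) * d g $$ (k, j) = F k g"
    by metis
  show "\<exists>f\<in>regular_functions. \<forall>g\<in>SL2. (c g * d g) $$ (i, j) = f g"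
    using ij assms[THEN regular_matD] F
    by (intro bexI[OF _ regular_sum[of m F]]) (auto simp: mult_index simp del: index_mult_mat(1))
qed (use assms in \<open>auto simp: regular_mat_def\<close>)

lemma regular_mat_kronecker:
  assumes "regular_mat n m c" "regular_mat k l d"
  shows "regular_mat (n * k) (m * l) (\<lambda>g. kronecker (c g) (d g))"
  unfolding regular_mat_def
proof (intro conjI ballI allI impI)
  fix i j assume ij: "i < n * k" "j < m * l"
  note b = div_mod_less[OF ij(1)] div_mod_less[OF ij(2)]
  obtain f h where "f \<in> regular_functions" "\<forall>g\<in>SL2. c g $$ (i div k, j div l) = f g"
      "h \<in> regular_functions" "\<forall>g\<in>SL2. d g $$ (i mod k, j mod l) = h g"
    using regular_mat_entry[OF assms(1), of "i div k" "j div l"]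
      regular_mat_entry[OF assms(2), of "i mod k" "j mod l"] b by blast
  then show "\<exists>f\<in>regular_functions. \<forall>g\<in>SL2. kronecker (c g) (d g) $$ (i, j) = f g"
    using ij b assms[THEN regular_matD]
    by (intro bexI[OF _ regular_functions.mult[of f h]]) auto
next
  fix g :: "'a mat" assume "g \<in> SL2"
  then show "kronecker (c g) (d g) \<in> carrier_mat (n * k) (m * l)"
    using regular_matD[OF assms(1)] regular_matD[OF assms(2)] by (intro carrier_matI) auto
qed

lemma regular_mat_transpose:
  assumes "regular_mat n m c"
  shows "regular_mat m n (\<lambda>g. transpose_mat (c g))"
  unfolding regular_mat_def
proof (intro conjI ballI allI impI)
  fix i j assume ij: "i < m" "j < n"
  obtain f where "f \<in> regular_functions" "\<forall>g\<in>SL2. c g $$ (j, i) = f g"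
    using assms[THEN regular_mat_entry, OF ij(2,1)] by blast
  then show "\<exists>f\<in>regular_functions. \<forall>g\<in>SL2. transpose_mat (c g) $$ (i, j) = f g"
    using ij assms[THEN regular_matD] by (intro bexI[of _ f]) auto
qed (use assms in \<open>auto simp: regular_mat_def\<close>)

text \<open>Meant for two substitutions, the Frobenius map and inversion, under which regular
  functions pull back to regular functions.\<close>

lemma regular_mat_comp:
  assumes "regular_mat n m c" "\<And>g. g \<in> SL2 \<Longrightarrow> \<theta> g \<in> SL2"
    "\<And>f. f \<in> regular_functions \<Longrightarrow> \<exists>h\<in>regular_functions. \<forall>g\<in>SL2. f (\<theta> g) = h g"
  shows "regular_mat n m (\<lambda>g. c (\<theta> g))"
  unfolding regular_mat_def
proof (intro conjI ballI allI impI)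
  fix i j assume ij: "i < n" "j < m"
  obtain f where f: "f \<in> regular_functions" "\<forall>g\<in>SL2. c g $$ (i, j) = f g"
    using assms(1)[THEN regular_mat_entry, OF ij] by blast
  then show "\<exists>f\<in>regular_functions. \<forall>g\<in>SL2. c (\<theta> g) $$ (i, j) = f g"
    using assms(2) assms(3)[OF f(1)] by auto
qed (use assms in \<open>auto simp: regular_mat_def\<close>)

lemma algebraic_rep_alt:
  "algebraic_rep \<rho> \<longleftrightarrow> regular_mat (rep_dim \<rho>) (rep_dim \<rho>) \<rho> \<and> \<rho> (1\<^sub>m 2) = 1\<^sub>m (rep_dim \<rho>) \<and>
     (\<forall>g\<in>SL2. \<forall>h\<in>SL2. \<rho> (g * h) = \<rho> g * \<rho> h)"
  unfolding algebraic_rep_def regular_mat_def by auto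

lemma algebraic_repI:
  assumes "regular_mat d d \<rho>" "\<rho> (1\<^sub>m 2) = 1\<^sub>m d"
    "\<And>g h. g \<in> SL2 \<Longrightarrow> h \<in> SL2 \<Longrightarrow> \<rho> (g * h) = \<rho> g * \<rho> h"
  shows "algebraic_rep \<rho>" "rep_dim \<rho> = d"
  using assms by (auto simp: algebraic_rep_alt rep_dim_def)

lemma algebraic_rep_regular: "algebraic_rep \<rho> \<Longrightarrow> regular_mat (rep_dim \<rho>) (rep_dim \<rho>) \<rho>"
  and algebraic_rep_one: "algebraic_rep \<rho> \<Longrightarrow> \<rho> (1\<^sub>m 2) = 1\<^sub>m (rep_dim \<rho>)"
  and algebraic_rep_mult: "algebraic_rep \<rho> \<Longrightarrow> g \<in> SL2 \<Longrightarrow> h \<in> SL2 \<Longrightarrow> \<rho> (g * h) = \<rho> g * \<rho> h"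
  by (auto simp: algebraic_rep_alt)

lemma algebraic_rep_dims [simp]:
  "algebraic_rep \<rho> \<Longrightarrow> g \<in> SL2 \<Longrightarrow> dim_row (\<rho> g) = rep_dim \<rho>"
  "algebraic_rep \<rho> \<Longrightarrow> g \<in> SL2 \<Longrightarrow> dim_col (\<rho> g) = rep_dim \<rho>"
  by (auto simp: algebraic_rep_def)

section \<open>Equivariant maps, tensor products and retracts\<close>

lemma rep_hom_dims:
  "rep_hom \<rho> \<sigma> A \<Longrightarrow> dim_row A = rep_dim \<sigma>"
  "rep_hom \<rho> \<sigma> A \<Longrightarrow> dim_col A = rep_dim \<rho>"
  by (auto simp: rep_hom_def)

lemma rep_hom_eq: "rep_hom \<rho> \<sigma> A \<Longrightarrow> g \<in> SL2 \<Longrightarrow> A * \<rho> g = \<sigma> g * A"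
  by (auto simp: rep_hom_def)

lemma rep_homI:
  assumes "dim_row A = rep_dim \<sigma>" "dim_col A = rep_dim \<rho>" "\<And>g. g \<in> SL2 \<Longrightarrow> A * \<rho> g = \<sigma> g * A"
  shows "rep_hom \<rho> \<sigma> A"
  using assms by (auto simp: rep_hom_def)

lemma rep_hom_one: "algebraic_rep \<rho> \<Longrightarrow> rep_hom \<rho> \<rho> (1\<^sub>m (rep_dim \<rho>))"
  by (rule rep_homI) auto

lemma rep_hom_zero:
  "algebraic_rep \<rho> \<Longrightarrow> algebraic_rep \<sigma> \<Longrightarrow> rep_hom \<rho> \<sigma> (0\<^sub>m (rep_dim \<sigma>) (rep_dim \<rho>))"
  by (rule rep_homI) auto

lemma rep_hom_comp:
  assumes "algebraic_rep \<rho>" "algebraic_rep \<sigma>" "algebraic_rep \<tau>"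
    and "rep_hom \<sigma> \<tau> B" "rep_hom \<rho> \<sigma> A"
  shows "rep_hom \<rho> \<tau> (B * A)"
proof (rule rep_homI)
  fix g :: "'a mat" assume g: "g \<in> SL2"
  have "B * A * \<rho> g = B * (A * \<rho> g)"
    using assms g by (simp add: mat_mult_assoc rep_hom_dims)
  also have "\<dots> = B * \<sigma> g * A"
    using assms g by (simp add: rep_hom_eq[OF assms(5) g] mat_mult_assoc rep_hom_dims)
  finally show "B * A * \<rho> g = \<tau> g * (B * A)"
    using assms g by (simp add: rep_hom_eq[OF assms(4) g] mat_mult_assoc rep_hom_dims)
qed (use assms in \<open>auto simp: rep_hom_dims\<close>)

lemma rep_hom_add:
  assumes "algebraic_rep \<rho>" "algebraic_rep \<sigma>" "rep_hom \<rho> \<sigma> A" "rep_hom \<rho> \<sigma> B"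
  shows "rep_hom \<rho> \<sigma> (A + B)"
  using assms by (intro rep_homI) (auto simp: rep_hom_dims rep_hom_eq mat_ring)

lemma rep_hom_diff:
  assumes "algebraic_rep \<rho>" "algebraic_rep \<sigma>" "rep_hom \<rho> \<sigma> A" "rep_hom \<rho> \<sigma> B"
  shows "rep_hom \<rho> \<sigma> (A - B)"
  using assms by (intro rep_homI) (auto simp: rep_hom_dims rep_hom_eq mat_ring)

lemma rep_hom_smult:
  assumes "algebraic_rep \<rho>" "algebraic_rep \<sigma>" "rep_hom \<rho> \<sigma> A"
  shows "rep_hom \<rho> \<sigma> (c \<cdot>\<^sub>m A)"
  using assms by (intro rep_homI) (auto simp: rep_hom_dims rep_hom_eq mat_smult_left mat_smult_right)

lemma rep_dim_tensor [simp]: "rep_dim (tensor \<rho> \<sigma>) = rep_dim \<rho> * rep_dim \<sigma>"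
  by (auto simp: tensor_def rep_dim_def)

lemma algebraic_rep_tensor [simp]:
  assumes "algebraic_rep \<rho>" "algebraic_rep \<sigma>"
  shows "algebraic_rep (tensor \<rho> \<sigma>)"
proof (rule algebraic_repI)
  show "regular_mat (rep_dim \<rho> * rep_dim \<sigma>) (rep_dim \<rho> * rep_dim \<sigma>) (tensor \<rho> \<sigma>)"
    unfolding tensor_def using assms by (intro regular_mat_kronecker algebraic_rep_regular)
qed (use assms in \<open>auto simp: tensor_def algebraic_rep_one algebraic_rep_mult kronecker_mult\<close>)

lemma rep_hom_tensor:
  assumes "algebraic_rep \<rho>" "algebraic_rep \<sigma>" "algebraic_rep \<rho>'" "algebraic_rep \<sigma>'"
    and "rep_hom \<rho> \<sigma> A" "rep_hom \<rho>' \<sigma>' B"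
  shows "rep_hom (tensor \<rho> \<rho>') (tensor \<sigma> \<sigma>') (kronecker A B)"
proof (rule rep_homI)
  fix g :: "'a mat" assume g: "g \<in> SL2"
  show "kronecker A B * tensor \<rho> \<rho>' g = tensor \<sigma> \<sigma>' g * kronecker A B"
    using assms g
    by (simp add: tensor_def rep_hom_dims kronecker_mult[symmetric] rep_hom_eq[OF assms(5)] rep_hom_eq[OF assms(6)])
qed (use assms in \<open>auto simp: rep_hom_dims\<close>)

definition trivial_rep :: "'a :: field rep" where
  "trivial_rep = (\<lambda>_. 1\<^sub>m 1)"

lemma algebraic_rep_trivial [simp]: "algebraic_rep trivial_rep"
  and rep_dim_trivial [simp]: "rep_dim trivial_rep = 1"
proof -
  have "regular_mat 1 1 trivial_rep"
    unfolding trivial_rep_def by (intro regular_mat_const) auto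
  then show "algebraic_rep trivial_rep" "rep_dim trivial_rep = 1"
    using algebraic_repI[of 1 trivial_rep] by (auto simp: trivial_rep_def)
qed

lemma tensor_assoc: "tensor (tensor \<rho> \<sigma>) \<tau> = tensor \<rho> (tensor \<sigma> \<tau>)"
  by (simp add: tensor_def kronecker_assoc)

lemma tensor_trivial_left [simp]: "tensor trivial_rep \<rho> = \<rho>"
  and tensor_trivial_right [simp]: "tensor \<rho> trivial_rep = \<rho>"
  by (simp_all add: tensor_def trivial_rep_def del: One_nat_def)

lemma tensor_power_0: "tensor_power \<rho> 0 = trivial_rep"
  by (simp add: trivial_rep_def)

lemma algebraic_rep_tensor_power [simp]:
  "algebraic_rep \<rho> \<Longrightarrow> algebraic_rep (tensor_power \<rho> k)"
  by (induction k) (auto simp: tensor_power_0 simp del: tensor_power.simps(1))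

lemma rep_dim_tensor_power [simp]: "rep_dim (tensor_power \<rho> k) = rep_dim \<rho> ^ k"
  by (induction k) (auto simp: tensor_power_0 simp del: tensor_power.simps(1))

lemma tensor_power_add:
  "tensor_power \<rho> (a + b) = tensor (tensor_power \<rho> a) (tensor_power \<rho> b)"
  by (induction a) (auto simp: tensor_power_0 tensor_assoc simp del: tensor_power.simps(1))

text \<open>The same as a direct summand up to isomorphism, since the idempotent
  \<open>\<iota> * \<pi>\<close> splits, but without naming a complement. Retracts compose and
  tensor directly.\<close>

definition retract :: "'a :: field rep \<Rightarrow> 'a rep \<Rightarrow> bool" where
  "retract M N \<longleftrightarrow> (\<exists>\<iota> \<pi>. rep_hom N M \<iota> \<and> rep_hom M N \<pi> \<and> \<pi> * \<iota> = 1\<^sub>m (rep_dim N))"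

lemma retract_refl: "algebraic_rep M \<Longrightarrow> retract M M"
  unfolding retract_def by (intro exI[of _ "1\<^sub>m (rep_dim M)"]) (auto simp: rep_hom_one)

lemma cancel_mid:
  fixes A :: "'a :: semiring_1 mat"
  assumes "A * B = 1\<^sub>m n" "dim_col A = dim_row B" "dim_col B = n" "dim_row C = n"
  shows "A * (B * C) = C"
  using assms by (simp add: mat_mult_assoc[symmetric])

lemma cancel_mid_zero:
  fixes A :: "'a :: semiring_1 mat"
  assumes "A * B = 0\<^sub>m m n" "dim_col A = dim_row B" "dim_col B = n" "dim_row C = n" "dim_row A = m"
  shows "A * (B * C) = 0\<^sub>m m (dim_col C)"
  using assms by (simp add: mat_mult_assoc[symmetric])

lemma retract_trans:
  assumes alg: "algebraic_rep L" "algebraic_rep M" "algebraic_rep N"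
    and "retract L M" "retract M N"
  shows "retract L N"
proof -
  obtain i p where 1: "rep_hom M L i" "rep_hom L M p" "p * i = 1\<^sub>m (rep_dim M)"
    using assms by (auto simp: retract_def)
  obtain j q where 2: "rep_hom N M j" "rep_hom M N q" "q * j = 1\<^sub>m (rep_dim N)"
    using assms by (auto simp: retract_def)
  have "rep_hom N L (i * j)" "rep_hom L N (q * p)"
    using 1 2 alg by (blast intro: rep_hom_comp)+
  moreover have "(q * p) * (i * j) = 1\<^sub>m (rep_dim N)"
    using 1 2 by (simp add: rep_hom_dims mat_mult_assoc cancel_mid[OF 1(3)])
  ultimately show ?thesis
    unfolding retract_def by blast
qed

lemma retract_tensor:
  assumes alg: "algebraic_rep M" "algebraic_rep N" "algebraic_rep M'" "algebraic_rep N'"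
    and "retract M N" "retract M' N'"
  shows "retract (tensor M M') (tensor N N')"
proof -
  obtain i p where 1: "rep_hom N M i" "rep_hom M N p" "p * i = 1\<^sub>m (rep_dim N)"
    using assms by (auto simp: retract_def)
  obtain j q where 2: "rep_hom N' M' j" "rep_hom M' N' q" "q * j = 1\<^sub>m (rep_dim N')"
    using assms by (auto simp: retract_def)
  have "kronecker p q * kronecker i j = 1\<^sub>m (rep_dim N * rep_dim N')"
    using 1 2 by (simp add: kronecker_mult[symmetric] rep_hom_dims)
  then show ?thesis
    unfolding retract_def using 1 2 alg
    by (intro exI[of _ "kronecker i j"] exI[of _ "kronecker p q"]) (auto simp: rep_hom_tensor)
qed

text \<open>Permutation matrix of the flip of two tensor factors: the row index is decoded in base
  \<open>m\<close> and re-encoded in base \<open>n\<close> with its digits exchanged.\<close>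

definition swap_mat :: "nat \<Rightarrow> nat \<Rightarrow> 'a :: field mat" where
  "swap_mat m n = mat (n * m) (m * n) (\<lambda>(i, j). if j = (i mod m) * n + i div m then 1 else 0)"

lemma dim_swap_mat [simp]: "dim_row (swap_mat m n) = n * m" "dim_col (swap_mat m n) = m * n"
  by (auto simp: swap_mat_def)

lemma swap_index_iff:
  assumes "(i :: nat) < n * m" "j < m * n"
  shows "j = (i mod m) * n + i div m \<longleftrightarrow> i = (j mod n) * m + j div n"
  using div_mod_less[OF assms(1)] div_mod_less[OF assms(2)] by auto

lemma swap_index_less: "(i :: nat) < n * m \<Longrightarrow> (i mod m) * n + i div m < m * n"
  by (intro mult_add_less) (auto dest: div_mod_less)

lemma swap_mat_mult:
  assumes "dim_row A = m * n" "i < n * m" "j < dim_col A"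
  shows "(swap_mat m n * A) $$ (i, j) = A $$ ((i mod m) * n + i div m, j)"
proof -
  have "(swap_mat m n * A) $$ (i, j) = (\<Sum>k<m*n. swap_mat m n $$ (i, k) * A $$ (k, j))"
    using assms by (subst mult_index) auto
  also have "\<dots> = (\<Sum>k<m*n. if k = (i mod m) * n + i div m then A $$ (k, j) else 0)"
    using assms by (intro sum.cong refl) (simp add: swap_mat_def)
  finally show ?thesis using swap_index_less[OF assms(2)] by simp
qed

lemma mult_swap_mat:
  assumes "dim_col A = n * m" "i < dim_row A" "j < m * n"
  shows "(A * swap_mat m n) $$ (i, j) = A $$ (i, (j mod n) * m + j div n)"
proof -
  have "(A * swap_mat m n) $$ (i, j) =
      (\<Sum>k<n*m. A $$ (i, k) * swap_mat m n $$ (k, j))"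
    using assms by (subst mult_index) auto
  also have "\<dots> = (\<Sum>k<n*m. if k = (j mod n) * m + j div n then A $$ (i, k) else 0)"
    using assms(3) by (intro sum.cong refl) (simp add: swap_mat_def swap_index_iff)
  finally show ?thesis using swap_index_less[OF assms(3)] by simp
qed

lemma rep_hom_swap:
  assumes "algebraic_rep M" "algebraic_rep N"
  shows "rep_hom (tensor M N) (tensor N M) (swap_mat (rep_dim M) (rep_dim N))"
proof (rule rep_homI)
  fix g :: "'a mat" assume g: "g \<in> SL2"
  let ?m = "rep_dim M" and ?n = "rep_dim N"
  show "swap_mat ?m ?n * tensor M N g = tensor N M g * swap_mat ?m ?n"
  proof (rule eq_matI)
    fix i j assume "i < dim_row (tensor N M g * swap_mat ?m ?n)" "j < dim_col (tensor N M g * swap_mat ?m ?n)"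
    then have ij: "i < ?n * ?m" "j < ?m * ?n" using assms g by (auto simp: tensor_def)
    note l = div_mod_less[OF ij(1)] div_mod_less[OF ij(2)] swap_index_less[OF ij(1)] swap_index_less[OF ij(2)]
    have "(swap_mat ?m ?n * tensor M N g) $$ (i, j) = M g $$ (i mod ?m, j div ?n) * N g $$ (i div ?m, j mod ?n)"
      and "(tensor N M g * swap_mat ?m ?n) $$ (i, j) = N g $$ (i div ?m, j mod ?n) * M g $$ (i mod ?m, j div ?n)"
      using assms g ij l by (auto simp: swap_mat_mult mult_swap_mat tensor_def simp del: index_mult_mat(1))
    then show "(swap_mat ?m ?n * tensor M N g) $$ (i, j) = (tensor N M g * swap_mat ?m ?n) $$ (i, j)"
      by (simp only: mult.commute)
  qed (use assms g in \<open>auto simp: tensor_def\<close>)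
qed auto

lemma swap_mat_swap_mat: "swap_mat m n * swap_mat n m = (1\<^sub>m (n * m) :: 'a :: field mat)"
proof (rule eq_matI)
  fix i j assume "i < dim_row (1\<^sub>m (n * m) :: 'a mat)" "j < dim_col (1\<^sub>m (n * m) :: 'a mat)"
  then have ij: "i < n * m" "j < n * m" by auto
  show "(swap_mat m n * swap_mat n m) $$ (i, j) = (1\<^sub>m (n * m) :: 'a mat) $$ (i, j)"
    using ij div_mod_less[OF ij(1)] swap_index_less[OF ij(1)]
    by (subst swap_mat_mult) (auto simp: swap_mat_def)
qed auto

lemma retract_swap:
  assumes "algebraic_rep M" "algebraic_rep N"
  shows "retract (tensor M N) (tensor N M)"
  unfolding retract_def
  by (intro exI[of _ "swap_mat (rep_dim N) (rep_dim M)"] exI[of _ "swap_mat (rep_dim M) (rep_dim N)"])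
     (simp add: rep_hom_swap assms swap_mat_swap_mat)

section \<open>Direct sums and decompositions\<close>

text \<open>Rank factorisation by peeling: subtracting a suitable idempotent of rank one leaves an
  idempotent with fewer nonzero rows.\<close>

lemma idempotent_factor_aux:
  fixes e :: "'a :: field mat"
  assumes "e \<in> carrier_mat n n" "e * e = e" "card {i. i < n \<and> (\<exists>j<n. e $$ (i, j) \<noteq> 0)} = k"
  shows "\<exists>r \<iota> \<pi>. \<iota> \<in> carrier_mat n r \<and> \<pi> \<in> carrier_mat r n \<and> \<iota> * \<pi> = e \<and> \<pi> * \<iota> = 1\<^sub>m r"
  using assms
proof (induction k arbitrary: e rule: less_induct)
  case (less k)
  show ?case
  proof (cases "\<exists>i<n. \<exists>j<n. e $$ (i, j) \<noteq> 0")
    case False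
    have "0\<^sub>m n 0 * 0\<^sub>m 0 n = e" by (rule eq_matI) (use False less.prems in auto)
    then show ?thesis
      by (intro exI[of _ 0] exI[of _ "0\<^sub>m n 0"] exI[of _ "0\<^sub>m 0 n"]) auto
  next
    case True
    then obtain i0 j0 where ij: "i0 < n" "j0 < n" "e $$ (i0, j0) \<noteq> 0" by blast
    \<comment> \<open>A nonzero entry serves as pivot. Its column \<open>v\<close> and its scaled
      row \<open>w\<close> satisfy \<open>w * v = 1\<close> because \<open>e\<close> is
      idempotent.\<close>
    define c where "c = e $$ (i0, j0)"
    define v where "v = mat n 1 (\<lambda>(i, j). e $$ (i, j0))"
    define w where "w = mat 1 n (\<lambda>(i, j). e $$ (i0, j) / c)"
    define e' where "e' = e - v * w"
    have d [simp]: "dim_row v = n" "dim_col v = 1" "dim_row w = 1" "dim_col w = n" "dim_row e = n" "dim_col e = n"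
      "dim_row e' = n" "dim_col e' = n"
      using less.prems by (auto simp: v_def w_def e'_def)
    have ee: "(\<Sum>k<n. e $$ (i, k) * e $$ (k, j)) = e $$ (i, j)" if "i < n" "j < n" for i j
      using arg_cong[OF less.prems(2), of "\<lambda>X. X $$ (i, j)"] that by (simp add: mult_index del: index_mult_mat(1))
    have ev: "e * v = v"
      by (rule eq_matI) (auto simp: mult_index v_def ee ij simp del: index_mult_mat(1))
    have we: "w * e = w"
      by (rule eq_matI) (auto simp: mult_index w_def ee ij sum_divide_distrib[symmetric] simp del: index_mult_mat(1))
    have wv: "w * v = 1\<^sub>m 1"
      by (rule eq_matI) (use ij in \<open>auto simp: mult_index w_def v_def ee c_def sum_divide_distrib[symmetric] simp del: index_mult_mat(1)\<close>)
    have e'v: "e' * v = 0\<^sub>m n 1" and we': "w * e' = 0\<^sub>m 1 n"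
      unfolding e'_def by (simp_all add: mat_ring ev we wv cancel_mid[OF wv])
    have "e' * e' = e' * (e - v * w)"
      by (subst (2) e'_def) (rule refl)
    also have "\<dots> = e' * e - e' * v * w"
      by (simp add: mat_diff_left mat_mult_assoc)
    also have "\<dots> = e' * e"
      by (simp add: e'v)
    also have "\<dots> = e'"
      unfolding e'_def using less.prems(2) we by (simp add: mat_ring)
    finally have idem: "e' * e' = e'" .
    have e'_ent: "e' $$ (i, j) = e $$ (i, j) - e $$ (i, j0) * (e $$ (i0, j) / c)" if "i < n" "j < n" for i j
      using that by (simp add: e'_def mult_index v_def w_def del: index_mult_mat(1))
    \<comment> \<open>The pivot row becomes zero and zero rows stay zero, so the induction measure
      drops.\<close>
    have "{i. i < n \<and> (\<exists>j<n. e' $$ (i, j) \<noteq> 0)} \<subset> {i. i < n \<and> (\<exists>j<n. e $$ (i, j) \<noteq> 0)}"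
    proof (rule psubsetI)
      show "{i. i < n \<and> (\<exists>j<n. e' $$ (i, j) \<noteq> 0)} \<subseteq> {i. i < n \<and> (\<exists>j<n. e $$ (i, j) \<noteq> 0)}"
      proof -
        have "e' $$ (i, j) = 0" if "i < n" "j < n" "\<forall>j<n. e $$ (i, j) = 0" for i j
          using that ij by (simp add: e'_ent)
        then show ?thesis by blast
      qed
      have "i0 \<notin> {i. i < n \<and> (\<exists>j<n. e' $$ (i, j) \<noteq> 0)}"
        using ij by (auto simp: e'_ent c_def)
      then show "{i. i < n \<and> (\<exists>j<n. e' $$ (i, j) \<noteq> 0)} \<noteq> {i. i < n \<and> (\<exists>j<n. e $$ (i, j) \<noteq> 0)}"
        using ij by blast
    qed
    then have "card {i. i < n \<and> (\<exists>j<n. e' $$ (i, j) \<noteq> 0)} < k"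
      unfolding less.prems(3)[symmetric] by (intro psubset_card_mono) auto
    moreover have "e' \<in> carrier_mat n n" by (intro carrier_matI) auto
    ultimately have "\<exists>r \<iota> \<pi>. \<iota> \<in> carrier_mat n r \<and> \<pi> \<in> carrier_mat r n \<and> \<iota> * \<pi> = e' \<and> \<pi> * \<iota> = 1\<^sub>m r"
      using less.IH idem by blast
    then obtain r \<iota> \<pi> where IH: "\<iota> \<in> carrier_mat n r" "\<pi> \<in> carrier_mat r n"
      "\<iota> * \<pi> = e'" "\<pi> * \<iota> = 1\<^sub>m r" by blast
    then have [simp]: "dim_row \<iota> = n" "dim_col \<iota> = r" "dim_row \<pi> = r" "dim_col \<pi> = n" by auto
    have "\<pi> * v = \<pi> * \<iota> * (\<pi> * v)" by (simp add: IH(4))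
    also have "\<dots> = \<pi> * (e' * v)" by (simp add: mat_mult_assoc IH(3)[symmetric])
    finally have pv: "\<pi> * v = 0\<^sub>m r 1" by (simp add: e'v)
    have "w * \<iota> = (w * \<iota>) * (\<pi> * \<iota>)" by (simp add: IH(4))
    also have "\<dots> = w * (\<iota> * \<pi>) * \<iota>" by (simp add: mat_mult_assoc)
    finally have wi: "w * \<iota> = 0\<^sub>m 1 r" by (simp add: we' IH(3))
    \<comment> \<open>The rank-one part is put in front of the factorisation of \<open>e'\<close>;
      by \<open>pv\<close> and \<open>wi\<close> the two parts are orthogonal.\<close>
    define I where "I = mat n (Suc r) (\<lambda>(i, j). if j = 0 then v $$ (i, 0) else \<iota> $$ (i, j - 1))"
    define P where "P = mat (Suc r) n (\<lambda>(i, j). if i = 0 then w $$ (0, j) else \<pi> $$ (i - 1, j))"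
    have "I * P = e"
    proof (rule eq_matI)
      fix i j assume "i < dim_row e" "j < dim_col e"
      then have ij: "i < n" "j < n" by auto
      have "(I * P) $$ (i, j) = (v * w) $$ (i, j) + (\<iota> * \<pi>) $$ (i, j)"
        using ij by (simp add: I_def P_def mult_index sum.lessThan_Suc_shift del: index_mult_mat(1) sum.lessThan_Suc)
      then show "(I * P) $$ (i, j) = e $$ (i, j)"
        using ij by (simp add: IH(3) e'_def del: index_mult_mat(1))
    qed (auto simp: I_def P_def)
    moreover have "P * I = 1\<^sub>m (Suc r)"
    proof (rule eq_matI)
      fix i j assume "i < dim_row (1\<^sub>m (Suc r) :: 'a mat)" "j < dim_col (1\<^sub>m (Suc r) :: 'a mat)"
      then have ij: "i < Suc r" "j < Suc r" by auto
      have "(P * I) $$ (i, j) = (if i = 0 then if j = 0 then (w * v) $$ (0, 0) else (w * \<iota>) $$ (0, j - 1)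
        else if j = 0 then (\<pi> * v) $$ (i - 1, 0) else (\<pi> * \<iota>) $$ (i - 1, j - 1))"
        using ij by (auto simp: I_def P_def mult_index simp del: index_mult_mat(1))
      then show "(P * I) $$ (i, j) = 1\<^sub>m (Suc r) $$ (i, j)"
        using ij by (auto simp: wv wi pv IH(4) simp del: index_mult_mat(1) One_nat_def)
    qed (auto simp: I_def P_def)
    ultimately show ?thesis
      by (intro exI[of _ "Suc r"] exI[of _ I] exI[of _ P]) (auto simp: I_def P_def)
  qed
qed

lemma idempotent_factor:
  fixes e :: "'a :: field mat"
  assumes "e \<in> carrier_mat n n" "e * e = e"
  obtains r \<iota> \<pi> where "\<iota> \<in> carrier_mat n r" "\<pi> \<in> carrier_mat r n" "\<iota> * \<pi> = e" "\<pi> * \<iota> = 1\<^sub>m r"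
  using idempotent_factor_aux[OF assms refl] by blast

text \<open>The image carries the action \<open>\<pi> * (\<rho> g * \<iota>)\<close>, which is
  multiplicative because \<open>\<iota> * \<pi> = e\<close> commutes with the action.\<close>

lemma idempotent_split:
  assumes alg: "algebraic_rep \<rho>" and e: "rep_hom \<rho> \<rho> e" "e * e = e"
  obtains \<sigma> \<iota> \<pi> where "algebraic_rep \<sigma>" "rep_hom \<sigma> \<rho> \<iota>" "rep_hom \<rho> \<sigma> \<pi>"
    "\<pi> * \<iota> = 1\<^sub>m (rep_dim \<sigma>)" "\<iota> * \<pi> = e"
proof -
  have "e \<in> carrier_mat (rep_dim \<rho>) (rep_dim \<rho>)" using e by (auto simp: rep_hom_def)
  from idempotent_factor[OF this e(2)] obtain r \<iota> \<pi> where
    IP: "\<iota> \<in> carrier_mat (rep_dim \<rho>) r" "\<pi> \<in> carrier_mat r (rep_dim \<rho>)" "\<iota> * \<pi> = e" "\<pi> * \<iota> = 1\<^sub>m r" .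
  then have [simp]: "dim_row \<iota> = rep_dim \<rho>" "dim_col \<iota> = r" "dim_row \<pi> = r" "dim_col \<pi> = rep_dim \<rho>" by auto
  define \<sigma> where "\<sigma> = (\<lambda>g. \<pi> * (\<rho> g * \<iota>))"
  have eg: "\<iota> * (\<pi> * (\<rho> g * X)) = \<rho> g * (\<iota> * (\<pi> * X))" if "g \<in> SL2" "dim_row X = rep_dim \<rho>" for g X
  proof -
    have "\<iota> * (\<pi> * (\<rho> g * X)) = (\<iota> * \<pi>) * \<rho> g * X"
      using that alg by (simp add: mat_mult_assoc)
    also have "\<dots> = \<rho> g * (\<iota> * \<pi>) * X"
      using rep_hom_eq[OF e(1), of g] IP(3) that by simp
    finally show ?thesis using that alg by (simp add: mat_mult_assoc)
  qed
  have pi_e: "\<pi> * (\<iota> * X) = X" if "dim_row X = r" for X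
    using that by (intro cancel_mid[OF IP(4)]) auto
  have "regular_mat r r \<sigma>"
    unfolding \<sigma>_def using IP alg
    by (intro regular_mat_mult[of _ "rep_dim \<rho>"] regular_mat_const algebraic_rep_regular) auto
  moreover have "\<sigma> (1\<^sub>m 2) = 1\<^sub>m r"
    using alg IP by (simp add: \<sigma>_def algebraic_rep_one)
  moreover have "\<sigma> (g * h) = \<sigma> g * \<sigma> h" if "g \<in> SL2" "h \<in> SL2" for g h
    using that alg
    by (simp add: \<sigma>_def algebraic_rep_mult mat_mult_assoc eg) (simp add: pi_e IP(4))
  ultimately have s: "algebraic_rep \<sigma>" "rep_dim \<sigma> = r" by (auto intro: algebraic_repI)
  have "rep_hom \<sigma> \<rho> \<iota>" "rep_hom \<rho> \<sigma> \<pi>"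
  proof -
    show "rep_hom \<sigma> \<rho> \<iota>"
      by (rule rep_homI) (use s alg in \<open>auto simp: \<sigma>_def eg pi_e IP(4)\<close>)
    show "rep_hom \<rho> \<sigma> \<pi>"
    proof (rule rep_homI)
      fix g :: "'a mat" assume g: "g \<in> SL2"
      have "\<sigma> g * \<pi> = \<pi> * (e * \<rho> g)"
        using alg g by (simp add: \<sigma>_def mat_mult_assoc IP(3) rep_hom_eq[OF e(1)])
      also have "\<dots> = \<pi> * \<rho> g"
        using alg g by (simp add: IP(3)[symmetric] mat_mult_assoc pi_e)
      finally show "\<pi> * \<rho> g = \<sigma> g * \<pi>" ..
    qed (use s in auto)
  qed
  with s IP show ?thesis by (intro that[of \<sigma> \<iota> \<pi>]) auto
qed

text \<open>A direct sum recorded by inclusions and projections, free of bases and block matrices;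
  by \<open>biprod_iso\<close> it determines \<open>M\<close> up to isomorphism.\<close>

definition biprod :: "'a :: field rep \<Rightarrow> 'a rep \<Rightarrow> 'a rep \<Rightarrow> bool" where
  "biprod M N N' \<longleftrightarrow> (\<exists>\<iota> \<pi> \<iota>' \<pi>'. rep_hom N M \<iota> \<and> rep_hom M N \<pi> \<and> rep_hom N' M \<iota>' \<and> rep_hom M N' \<pi>'
     \<and> \<pi> * \<iota> = 1\<^sub>m (rep_dim N) \<and> \<pi>' * \<iota>' = 1\<^sub>m (rep_dim N')
     \<and> \<pi> * \<iota>' = 0\<^sub>m (rep_dim N) (rep_dim N') \<and> \<pi>' * \<iota> = 0\<^sub>m (rep_dim N') (rep_dim N)
     \<and> \<iota> * \<pi> + \<iota>' * \<pi>' = 1\<^sub>m (rep_dim M))"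

lemma rep_iso_iff:
  assumes "algebraic_rep \<rho>" "algebraic_rep \<sigma>"
  shows "rep_iso \<rho> \<sigma> \<longleftrightarrow> (\<exists>A B. rep_hom \<rho> \<sigma> A \<and> rep_hom \<sigma> \<rho> B \<and>
    B * A = 1\<^sub>m (rep_dim \<rho>) \<and> A * B = 1\<^sub>m (rep_dim \<sigma>))"
proof
  assume "rep_iso \<rho> \<sigma>"
  then obtain A B where A: "rep_hom \<rho> \<sigma> A" and sq: "dim_col A = dim_row A"
    and B: "A * B = 1\<^sub>m (dim_row A)" "B * A = 1\<^sub>m (dim_row B)"
    unfolding rep_iso_def invertible_mat_def inverts_mat_def by auto
  have [simp]: "dim_row A = rep_dim \<sigma>" "dim_col A = rep_dim \<rho>" "rep_dim \<rho> = rep_dim \<sigma>"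
    "dim_col B = rep_dim \<sigma>" "dim_row B = rep_dim \<rho>"
    using A sq arg_cong[OF B(1), of dim_col] arg_cong[OF B(2), of dim_col] by (auto simp: rep_hom_dims)
  have "rep_hom \<sigma> \<rho> B"
  proof (rule rep_homI)
    fix g :: "'a mat" assume g: "g \<in> SL2"
    have "B * \<sigma> g = B * \<sigma> g * (A * B)" using assms g B by simp
    also have "\<dots> = B * (\<sigma> g * A) * B" using assms g by (simp add: mat_mult_assoc)
    also have "\<dots> = B * (A * \<rho> g) * B" using rep_hom_eq[OF A g] by simp
    also have "\<dots> = (B * A) * \<rho> g * B" using assms g by (simp add: mat_mult_assoc)
    finally show "B * \<sigma> g = \<rho> g * B" using assms g B by simp
  qed auto
  then show "\<exists>A B. rep_hom \<rho> \<sigma> A \<and> rep_hom \<sigma> \<rho> B \<and> B * A = 1\<^sub>m (rep_dim \<rho>) \<and> A * B = 1\<^sub>m (rep_dim \<sigma>)"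
    using A B by auto
next
  assume "\<exists>A B. rep_hom \<rho> \<sigma> A \<and> rep_hom \<sigma> \<rho> B \<and> B * A = 1\<^sub>m (rep_dim \<rho>) \<and> A * B = 1\<^sub>m (rep_dim \<sigma>)"
  then obtain A B where A: "rep_hom \<rho> \<sigma> A" and B: "rep_hom \<sigma> \<rho> B"
    and BA: "B * A = 1\<^sub>m (rep_dim \<rho>)" and AB: "A * B = 1\<^sub>m (rep_dim \<sigma>)" by blast
  have c: "A \<in> carrier_mat (rep_dim \<sigma>) (rep_dim \<rho>)" "B \<in> carrier_mat (rep_dim \<rho>) (rep_dim \<sigma>)"
    using A B by (auto simp: rep_hom_def)
  have "rep_dim \<sigma> = rep_dim \<rho>"
  proof -
    \<comment> \<open>Mutually inverse matrices must be square: if \<open>m < n\<close>, padding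
      both factors with zeros to size \<open>n\<close> keeps their product, but the padded
      \<open>Q\<close> has a zero row and so determinant zero.\<close>
    have le: "n \<le> m" if "P \<in> carrier_mat n m" "Q \<in> carrier_mat m n" "P * Q = 1\<^sub>m n" for P Q :: "'a mat" and n m
    proof (rule ccontr)
      assume nm: "\<not> n \<le> m"
      define P' where "P' = mat n n (\<lambda>(i, j). if j < m then P $$ (i, j) else 0)"
      define Q' where "Q' = mat n n (\<lambda>(i, j). if i < m then Q $$ (i, j) else 0)"
      have "P' * Q' = P * Q"
      proof (rule eq_matI)
        fix i j assume "i < dim_row (P * Q)" "j < dim_col (P * Q)"
        then have ij: "i < n" "j < n" using that by auto
        have "(P' * Q') $$ (i, j) = (\<Sum>k<n. if k < m then P $$ (i, k) * Q $$ (k, j) else 0)"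
          using ij by (subst mult_index) (auto simp: P'_def Q'_def intro!: sum.cong)
        also have "\<dots> = (\<Sum>k<m. P $$ (i, k) * Q $$ (k, j))"
          using nm by (intro sum.mono_neutral_cong_right) auto
        also have "\<dots> = (P * Q) $$ (i, j)"
          using ij that(1,2) by (subst mult_index) auto
        finally show "(P' * Q') $$ (i, j) = (P * Q) $$ (i, j)" .
      qed (use that in \<open>auto simp: P'_def Q'_def\<close>)
      then have "det P' * det Q' = 1"
        using that det_mult[of P' n Q'] by (simp add: P'_def Q'_def)
      moreover have "det Q' = 0"
        using nm laplace_expansion_row[of Q' n m] by (simp add: Q'_def)
      ultimately show False by simp
    qed
    show ?thesis using le[OF c AB] le[OF c(2,1) BA] by simp
  qed
  then have "invertible_mat A"
    using c AB BA by (auto simp: invertible_mat_def inverts_mat_def)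
  then show "rep_iso \<rho> \<sigma>" using A by (auto simp: rep_iso_def)
qed

lemma biprod_iso:
  assumes alg: "algebraic_rep M" "algebraic_rep M'" "algebraic_rep N" "algebraic_rep N'"
    and "biprod M N N'" "biprod M' N N'"
  shows "rep_iso M M'"
proof -
  obtain i p i' p' where 1: "rep_hom N M i" "rep_hom M N p" "rep_hom N' M i'" "rep_hom M N' p'"
    "p * i = 1\<^sub>m (rep_dim N)" "p' * i' = 1\<^sub>m (rep_dim N')"
    "p * i' = 0\<^sub>m (rep_dim N) (rep_dim N')" "p' * i = 0\<^sub>m (rep_dim N') (rep_dim N)"
    "i * p + i' * p' = 1\<^sub>m (rep_dim M)"
    using assms unfolding biprod_def by blast
  obtain j q j' q' where 2: "rep_hom N M' j" "rep_hom M' N q" "rep_hom N' M' j'" "rep_hom M' N' q'"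
    "q * j = 1\<^sub>m (rep_dim N)" "q' * j' = 1\<^sub>m (rep_dim N')"
    "q * j' = 0\<^sub>m (rep_dim N) (rep_dim N')" "q' * j = 0\<^sub>m (rep_dim N') (rep_dim N)"
    "j * q + j' * q' = 1\<^sub>m (rep_dim M')"
    using assms unfolding biprod_def by blast
  note d [simp] = 1(1-4)[THEN rep_hom_dims(1)] 1(1-4)[THEN rep_hom_dims(2)]
    2(1-4)[THEN rep_hom_dims(1)] 2(1-4)[THEN rep_hom_dims(2)]
  have "rep_hom M M' (j * p + j' * p')" "rep_hom M' M (i * q + i' * q')"
    using alg 1 2 by (auto intro!: rep_hom_add intro: rep_hom_comp)
  moreover have "(i * q + i' * q') * (j * p + j' * p') = 1\<^sub>m (rep_dim M)"
    by (simp add: mat_ring cancel_mid[OF 2(5)] cancel_mid[OF 2(6)] cancel_mid_zero[OF 2(7)] cancel_mid_zero[OF 2(8)] 1(9))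
  moreover have "(j * p + j' * p') * (i * q + i' * q') = 1\<^sub>m (rep_dim M')"
    by (simp add: mat_ring cancel_mid[OF 1(5)] cancel_mid[OF 1(6)] cancel_mid_zero[OF 1(7)] cancel_mid_zero[OF 1(8)] 2(9))
  ultimately show ?thesis
    using rep_iso_iff[OF alg(1,2)] by blast
qed

lemma biprod_rep_iso:
  assumes alg: "algebraic_rep M" "algebraic_rep M'" "algebraic_rep N" "algebraic_rep N'" "algebraic_rep L" "algebraic_rep L'"
    and "biprod M N N'" "rep_iso N L" "rep_iso N' L'"
  shows "biprod M L L'"
proof -
  obtain i p i' p' where 1: "rep_hom N M i" "rep_hom M N p" "rep_hom N' M i'" "rep_hom M N' p'"
    "p * i = 1\<^sub>m (rep_dim N)" "p' * i' = 1\<^sub>m (rep_dim N')"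
    "p * i' = 0\<^sub>m (rep_dim N) (rep_dim N')" "p' * i = 0\<^sub>m (rep_dim N') (rep_dim N)"
    "i * p + i' * p' = 1\<^sub>m (rep_dim M)"
    using assms unfolding biprod_def by blast
  obtain A B where 2: "rep_hom N L A" "rep_hom L N B" "B * A = 1\<^sub>m (rep_dim N)" "A * B = 1\<^sub>m (rep_dim L)"
    using assms rep_iso_iff[of N L] by auto
  obtain A' B' where 3: "rep_hom N' L' A'" "rep_hom L' N' B'" "B' * A' = 1\<^sub>m (rep_dim N')" "A' * B' = 1\<^sub>m (rep_dim L')"
    using assms rep_iso_iff[of N' L'] by auto
  note d [simp] = 1(1-4)[THEN rep_hom_dims(1)] 1(1-4)[THEN rep_hom_dims(2)]
    2(1-2)[THEN rep_hom_dims(1)] 2(1-2)[THEN rep_hom_dims(2)] 3(1-2)[THEN rep_hom_dims(1)] 3(1-2)[THEN rep_hom_dims(2)]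
  have "rep_hom L M (i * B)" "rep_hom M L (A * p)" "rep_hom L' M (i' * B')" "rep_hom M L' (A' * p')"
    using alg 1 2 3 by (blast intro: rep_hom_comp)+
  moreover have "(A * p) * (i * B) = 1\<^sub>m (rep_dim L)" "(A' * p') * (i' * B') = 1\<^sub>m (rep_dim L')"
    "(A * p) * (i' * B') = 0\<^sub>m (rep_dim L) (rep_dim L')" "(A' * p') * (i * B) = 0\<^sub>m (rep_dim L') (rep_dim L)"
    by (simp_all add: mat_mult_assoc cancel_mid[OF 1(5)] cancel_mid[OF 1(6)] cancel_mid_zero[OF 1(7)] cancel_mid_zero[OF 1(8)] 2 3)
  moreover have "(i * B) * (A * p) + (i' * B') * (A' * p') = 1\<^sub>m (rep_dim M)"
    by (simp add: mat_mult_assoc cancel_mid[OF 2(3)] cancel_mid[OF 3(3)] 1(9))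
  ultimately show ?thesis
    unfolding biprod_def by blast
qed

text \<open>Splits \<open>e\<close> and \<open>1 - e\<close> separately. The mixed composites vanish
  because they contain \<open>e * (1 - e)\<close> or \<open>(1 - e) * e\<close>; the last two
  conclusions translate a zero summand back into a trivial idempotent.\<close>

lemma idempotent_biprod:
  assumes alg: "algebraic_rep \<rho>" and e: "rep_hom \<rho> \<rho> e" "e * e = e"
  obtains \<sigma> \<tau> where "algebraic_rep \<sigma>" "algebraic_rep \<tau>" "biprod \<rho> \<sigma> \<tau>"
    "rep_dim \<sigma> = 0 \<longrightarrow> e = 0\<^sub>m (rep_dim \<rho>) (rep_dim \<rho>)" "rep_dim \<tau> = 0 \<longrightarrow> e = 1\<^sub>m (rep_dim \<rho>)"
proof -
  let ?d = "rep_dim \<rho>"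
  have [simp]: "dim_row e = ?d" "dim_col e = ?d" using e by (auto simp: rep_hom_dims)
  have e': "rep_hom \<rho> \<rho> (1\<^sub>m ?d - e)" "(1\<^sub>m ?d - e) * (1\<^sub>m ?d - e) = 1\<^sub>m ?d - e"
    using alg e by (auto intro!: rep_hom_diff rep_hom_one simp: mat_ring)
  obtain \<sigma> i p where 1: "algebraic_rep \<sigma>" "rep_hom \<sigma> \<rho> i" "rep_hom \<rho> \<sigma> p"
    "p * i = 1\<^sub>m (rep_dim \<sigma>)" "i * p = e" by (rule idempotent_split[OF alg e])
  obtain \<tau> j q where 2: "algebraic_rep \<tau>" "rep_hom \<tau> \<rho> j" "rep_hom \<rho> \<tau> q"
    "q * j = 1\<^sub>m (rep_dim \<tau>)" "j * q = 1\<^sub>m ?d - e" by (rule idempotent_split[OF alg e'])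
  note d [simp] = 1(2-3)[THEN rep_hom_dims(1)] 1(2-3)[THEN rep_hom_dims(2)]
     2(2-3)[THEN rep_hom_dims(1)] 2(2-3)[THEN rep_hom_dims(2)]
  have "p * j = p * ((i * p) * ((j * q) * j))"
    by (simp add: mat_mult_assoc 2(4) cancel_mid[OF 1(4)])
  also have "\<dots> = p * (e * (1\<^sub>m ?d - e)) * j"
    unfolding 1(5) 2(5) by (simp add: mat_mult_assoc)
  also have "\<dots> = 0\<^sub>m (rep_dim \<sigma>) (rep_dim \<tau>)" by (simp add: mat_ring e)
  finally have pj: "p * j = 0\<^sub>m (rep_dim \<sigma>) (rep_dim \<tau>)" .
  have "q * i = q * ((j * q) * ((i * p) * i))"
    by (simp add: mat_mult_assoc 1(4) cancel_mid[OF 2(4)])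
  also have "\<dots> = q * ((1\<^sub>m ?d - e) * e) * i"
    unfolding 1(5) 2(5) by (simp add: mat_mult_assoc)
  also have "\<dots> = 0\<^sub>m (rep_dim \<tau>) (rep_dim \<sigma>)" by (simp add: mat_ring e)
  finally have qi: "q * i = 0\<^sub>m (rep_dim \<tau>) (rep_dim \<sigma>)" .
  have "i * p + j * q = 1\<^sub>m ?d" unfolding 1(5) 2(5) by (rule eq_matI) auto
  then have bp: "biprod \<rho> \<sigma> \<tau>"
    unfolding biprod_def using 1 2 pj qi by blast
  have s0: "rep_dim \<sigma> = 0 \<longrightarrow> e = 0\<^sub>m ?d ?d"
    unfolding 1(5)[symmetric] by (auto intro!: eq_matI simp: mult_index simp del: index_mult_mat(1))
  have "rep_dim \<tau> = 0 \<longrightarrow> j * q = 0\<^sub>m ?d ?d"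
    by (auto intro!: eq_matI simp: mult_index simp del: index_mult_mat(1))
  then have t0: "rep_dim \<tau> = 0 \<longrightarrow> e = 1\<^sub>m ?d"
    unfolding 2(5) by (auto simp: diff_eq_zero_mat_iff)
  show ?thesis by (rule that[OF 1(1) 2(1) bp s0 t0])
qed

section \<open>Block sums through coordinate inclusions and projections\<close>

definition inl_mat :: "nat \<Rightarrow> nat \<Rightarrow> 'a :: field mat" where
  "inl_mat a b = mat (a + b) a (\<lambda>(i, j). if i = j then 1 else 0)"

definition inr_mat :: "nat \<Rightarrow> nat \<Rightarrow> 'a :: field mat" where
  "inr_mat a b = mat (a + b) b (\<lambda>(i, j). if i = a + j then 1 else 0)"

definition prl_mat :: "nat \<Rightarrow> nat \<Rightarrow> 'a :: field mat" where
  "prl_mat a b = mat a (a + b) (\<lambda>(i, j). if j = i then 1 else 0)"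

definition prr_mat :: "nat \<Rightarrow> nat \<Rightarrow> 'a :: field mat" where
  "prr_mat a b = mat b (a + b) (\<lambda>(i, j). if j = a + i then 1 else 0)"

lemma dim_incl_proj [simp]:
  "dim_row (inl_mat a b) = a + b" "dim_col (inl_mat a b) = a"
  "dim_row (inr_mat a b) = a + b" "dim_col (inr_mat a b) = b"
  "dim_row (prl_mat a b) = a" "dim_col (prl_mat a b) = a + b"
  "dim_row (prr_mat a b) = b" "dim_col (prr_mat a b) = a + b"
  by (auto simp: inl_mat_def inr_mat_def prl_mat_def prr_mat_def)

lemma mult_delta_sum_right:
  fixes f :: "nat \<Rightarrow> 'a :: semiring_1"
  shows "(\<Sum>k<n. f k * (if k = j then 1 else 0)) = (if j < n then f j else 0)"
  by (simp add: if_distrib[of "(*) _"] cong: if_cong)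

lemma mult_delta_sum_left:
  fixes f :: "nat \<Rightarrow> 'a :: semiring_1"
  shows "(\<Sum>k<n. (if k = j then 1 else 0) * f k) = (if j < n then f j else 0)"
proof -
  have "(\<Sum>k<n. (if k = j then 1 else 0) * f k) = (\<Sum>k<n. if k = j then f k else 0)"
    by (intro sum.cong) auto
  then show ?thesis by simp
qed

lemma mult_inl:
  assumes "dim_col X = a + b" "i < dim_row X" "j < a"
  shows "(X * inl_mat a b) $$ (i, j) = X $$ (i, j)"
proof -
  have "(X * inl_mat a b) $$ (i, j) = (\<Sum>k<a+b. X $$ (i, k) * inl_mat a b $$ (k, j))"
    using assms by (subst mult_index) auto
  also have "\<dots> = (\<Sum>k<a+b. X $$ (i, k) * (if k = j then 1 else 0))"
    using assms by (intro sum.cong) (auto simp: inl_mat_def)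
  finally show ?thesis using assms by (simp add: mult_delta_sum_right)
qed

lemma mult_inr:
  assumes "dim_col X = a + b" "i < dim_row X" "j < b"
  shows "(X * inr_mat a b) $$ (i, j) = X $$ (i, a + j)"
proof -
  have "(X * inr_mat a b) $$ (i, j) = (\<Sum>k<a+b. X $$ (i, k) * inr_mat a b $$ (k, j))"
    using assms by (subst mult_index) auto
  also have "\<dots> = (\<Sum>k<a+b. X $$ (i, k) * (if k = a + j then 1 else 0))"
    using assms by (intro sum.cong) (auto simp: inr_mat_def)
  finally show ?thesis using assms by (simp add: mult_delta_sum_right)
qed

lemma prl_mult:
  assumes "dim_row X = a + b" "i < a" "j < dim_col X"
  shows "(prl_mat a b * X) $$ (i, j) = X $$ (i, j)"
proof -
  have "(prl_mat a b * X) $$ (i, j) = (\<Sum>k<a+b. prl_mat a b $$ (i, k) * X $$ (k, j))"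
    using assms by (subst mult_index) auto
  also have "\<dots> = (\<Sum>k<a+b. (if k = i then 1 else 0) * X $$ (k, j))"
    using assms by (intro sum.cong) (auto simp: prl_mat_def)
  finally show ?thesis using assms by (simp add: mult_delta_sum_left)
qed

lemma prr_mult:
  assumes "dim_row X = a + b" "i < b" "j < dim_col X"
  shows "(prr_mat a b * X) $$ (i, j) = X $$ (a + i, j)"
proof -
  have "(prr_mat a b * X) $$ (i, j) = (\<Sum>k<a+b. prr_mat a b $$ (i, k) * X $$ (k, j))"
    using assms by (subst mult_index) auto
  also have "\<dots> = (\<Sum>k<a+b. (if k = a + i then 1 else 0) * X $$ (k, j))"
    using assms by (intro sum.cong) (auto simp: prr_mat_def)
  finally show ?thesis using assms by (simp add: mult_delta_sum_left)
qed

lemma inl_mult: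
  assumes "dim_row X = a" "i < a + b" "j < dim_col X"
  shows "(inl_mat a b * X) $$ (i, j) = (if i < a then X $$ (i, j) else 0)"
proof -
  have "(inl_mat a b * X) $$ (i, j) = (\<Sum>k<a. inl_mat a b $$ (i, k) * X $$ (k, j))"
    using assms by (subst mult_index) auto
  also have "\<dots> = (\<Sum>k<a. (if k = i then 1 else 0) * X $$ (k, j))"
    using assms by (intro sum.cong) (auto simp: inl_mat_def)
  finally show ?thesis using assms by (simp add: mult_delta_sum_left)
qed

lemma inr_mult:
  assumes "dim_row X = b" "i < a + b" "j < dim_col X"
  shows "(inr_mat a b * X) $$ (i, j) = (if i < a then 0 else X $$ (i - a, j))"
proof -
  have "(inr_mat a b * X) $$ (i, j) = (\<Sum>k<b. inr_mat a b $$ (i, k) * X $$ (k, j))"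
    using assms by (subst mult_index) auto
  also have "\<dots> = (if i < a then 0 else (\<Sum>k<b. (if k = i - a then 1 else 0) * X $$ (k, j)))"
    using assms by (auto simp: inr_mat_def intro!: sum.cong sum.neutral)
  finally show ?thesis using assms by (cases "i < a") (auto simp: mult_delta_sum_left simp del: index_mult_mat(1))
qed

lemma mult_prl:
  assumes "dim_col X = a" "i < dim_row X" "j < a + b"
  shows "(X * prl_mat a b) $$ (i, j) = (if j < a then X $$ (i, j) else 0)"
proof -
  have "(X * prl_mat a b) $$ (i, j) = (\<Sum>k<a. X $$ (i, k) * prl_mat a b $$ (k, j))"
    using assms by (subst mult_index) auto
  also have "\<dots> = (\<Sum>k<a. X $$ (i, k) * (if k = j then 1 else 0))"
    using assms by (intro sum.cong) (auto simp: prl_mat_def)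
  finally show ?thesis using assms by (simp add: mult_delta_sum_right)
qed

lemma mult_prr:
  assumes "dim_col X = b" "i < dim_row X" "j < a + b"
  shows "(X * prr_mat a b) $$ (i, j) = (if j < a then 0 else X $$ (i, j - a))"
proof -
  have "(X * prr_mat a b) $$ (i, j) = (\<Sum>k<b. X $$ (i, k) * prr_mat a b $$ (k, j))"
    using assms by (subst mult_index) auto
  also have "\<dots> = (if j < a then 0 else (\<Sum>k<b. X $$ (i, k) * (if k = j - a then 1 else 0)))"
    using assms by (auto simp: prr_mat_def intro!: sum.cong sum.neutral)
  finally show ?thesis using assms by (cases "j < a") (auto simp: mult_delta_sum_right simp del: index_mult_mat(1))
qed

lemmas incl_proj_mult = mult_inl mult_inr prl_mult prr_mult inl_mult inr_mult mult_prl mult_prr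

lemma
  assumes alg: "algebraic_rep \<sigma>" "algebraic_rep \<tau>"
    and M: "\<And>g. g \<in> SL2 \<Longrightarrow> M g = four_block_mat (\<sigma> g) (0\<^sub>m (rep_dim \<sigma>) (rep_dim \<tau>)) (0\<^sub>m (rep_dim \<tau>) (rep_dim \<sigma>)) (\<tau> g)"
  shows algebraic_rep_four_block: "algebraic_rep M"
    and rep_dim_four_block: "rep_dim M = rep_dim \<sigma> + rep_dim \<tau>"
    and biprod_four_block: "biprod M \<sigma> \<tau>"
proof -
  let ?a = "rep_dim \<sigma>" and ?b = "rep_dim \<tau>"
  have reg: "regular_mat (?a + ?b) (?a + ?b) M"
    unfolding regular_mat_def
  proof (intro conjI ballI allI impI)
    fix g :: "'a mat" assume g: "g \<in> SL2"
    then show "M g \<in> carrier_mat (?a + ?b) (?a + ?b)"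
      unfolding M[OF g] using alg by (intro carrier_matI) auto
  next
    fix i j assume ij: "i < ?a + ?b" "j < ?a + ?b"
    consider "i < ?a" "j < ?a" | "i \<ge> ?a" "j \<ge> ?a" | "i < ?a" "j \<ge> ?a" | "i \<ge> ?a" "j < ?a" by linarith
    then show "\<exists>f\<in>regular_functions. \<forall>g\<in>SL2. M g $$ (i, j) = f g"
    proof cases
      case 1
      then show ?thesis
        using regular_mat_entry[OF algebraic_rep_regular[OF alg(1)], of i j] ij alg by (auto simp: M)
    next
      case 2
      then show ?thesis
        using regular_mat_entry[OF algebraic_rep_regular[OF alg(2)], of "i - ?a" "j - ?a"] ij alg by (auto simp: M)
    next
      case 3
      then show ?thesis using ij alg by (intro bexI[OF _ regular_functions.const[of 0]]) (auto simp: M)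
    next
      case 4
      then show ?thesis using ij alg by (intro bexI[OF _ regular_functions.const[of 0]]) (auto simp: M)
    qed
  qed
  moreover have "M (1\<^sub>m 2) = 1\<^sub>m (?a + ?b)"
    using alg by (simp add: M algebraic_rep_one)
  moreover have "M (g * h) = M g * M h" if "g \<in> SL2" "h \<in> SL2" for g h
  proof -
    have "\<And>x. x \<in> SL2 \<Longrightarrow> \<sigma> x \<in> carrier_mat ?a ?a" "\<And>x. x \<in> SL2 \<Longrightarrow> \<tau> x \<in> carrier_mat ?b ?b"
      using alg by (auto simp: algebraic_rep_def)
    then show ?thesis
      using that alg
      by (simp add: M algebraic_rep_mult mult_four_block_mat[of _ ?a ?a _ ?b _ ?b _ _ ?a _ ?b])
  qed
  ultimately show alg': "algebraic_rep M" and dim: "rep_dim M = ?a + ?b"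
    by (auto intro: algebraic_repI)
  let ?i = "inl_mat ?a ?b :: 'a mat" and ?j = "inr_mat ?a ?b :: 'a mat"
    and ?p = "prl_mat ?a ?b :: 'a mat" and ?q = "prr_mat ?a ?b :: 'a mat"
  have "rep_hom \<sigma> M ?i" "rep_hom M \<sigma> ?p" "rep_hom \<tau> M ?j" "rep_hom M \<tau> ?q"
    using alg alg'
    by (auto intro!: rep_homI eq_matI simp: dim incl_proj_mult M simp del: index_mult_mat(1))
  moreover have "?p * ?i = 1\<^sub>m ?a" "?q * ?j = 1\<^sub>m ?b" "?p * ?j = 0\<^sub>m ?a ?b" "?q * ?i = 0\<^sub>m ?b ?a"
    by (auto intro!: eq_matI simp: prl_mult prr_mult simp del: index_mult_mat(1)) (auto simp: inl_mat_def inr_mat_def)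
  moreover have "?i * ?p + ?j * ?q = 1\<^sub>m (rep_dim M)"
    by (auto intro!: eq_matI simp: dim inl_mult inr_mult simp del: index_mult_mat(1)) (auto simp: prl_mat_def prr_mat_def)
  ultimately show "biprod M \<sigma> \<tau>"
    unfolding biprod_def by blast
qed

lemma rep_dim_direct_sum_Nil [simp]: "rep_dim (direct_sum []) = 0"
  by (simp add: direct_sum_def rep_dim_def)

lemma algebraic_rep_direct_sum_Nil [simp]: "algebraic_rep (direct_sum [])"
  unfolding algebraic_rep_def by (auto simp: direct_sum_def rep_dim_def intro!: eq_matI)

lemma direct_sum_append:
  assumes "algebraic_rep (direct_sum \<sigma>s)" "algebraic_rep (direct_sum \<tau>s)" "g \<in> SL2"
  shows "direct_sum (\<sigma>s @ \<tau>s) g = four_block_mat (direct_sum \<sigma>s g)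
    (0\<^sub>m (rep_dim (direct_sum \<sigma>s)) (rep_dim (direct_sum \<tau>s)))
    (0\<^sub>m (rep_dim (direct_sum \<tau>s)) (rep_dim (direct_sum \<sigma>s))) (direct_sum \<tau>s g)"
  using algebraic_rep_dims[OF assms(1,3)] algebraic_rep_dims[OF assms(2,3)]
  by (simp add: direct_sum_def diag_block_mat_append Let_def)

lemma direct_sum_singleton [simp]: "direct_sum [\<sigma>] = \<sigma>"
  by (simp add: direct_sum_def del: diag_block_mat.simps)

lemma algebraic_rep_direct_sum:
  "\<forall>\<sigma>\<in>set \<sigma>s. algebraic_rep \<sigma> \<Longrightarrow> algebraic_rep (direct_sum \<sigma>s)"
proof (induction \<sigma>s)
  case (Cons \<sigma> \<sigma>s)
  then have "algebraic_rep (direct_sum [\<sigma>])" "algebraic_rep (direct_sum \<sigma>s)" by auto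
  from algebraic_rep_four_block[OF this direct_sum_append[OF this]] show ?case by simp
qed simp

lemma biprod_direct_sum_append:
  assumes "\<forall>\<sigma>\<in>set \<sigma>s. algebraic_rep \<sigma>" "\<forall>\<sigma>\<in>set \<tau>s. algebraic_rep \<sigma>"
  shows "biprod (direct_sum (\<sigma>s @ \<tau>s)) (direct_sum \<sigma>s) (direct_sum \<tau>s)"
  using biprod_four_block[OF _ _ direct_sum_append] algebraic_rep_direct_sum assms by blast

lemma rep_dim_direct_sum_append:
  assumes "\<forall>\<sigma>\<in>set \<sigma>s. algebraic_rep \<sigma>" "\<forall>\<sigma>\<in>set \<tau>s. algebraic_rep \<sigma>"
  shows "rep_dim (direct_sum (\<sigma>s @ \<tau>s)) = rep_dim (direct_sum \<sigma>s) + rep_dim (direct_sum \<tau>s)"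
  using rep_dim_four_block[OF _ _ direct_sum_append] algebraic_rep_direct_sum assms by blast

lemma rep_iso_refl: "algebraic_rep \<rho> \<Longrightarrow> rep_iso \<rho> \<rho>"
  using rep_iso_iff[of \<rho> \<rho>] rep_hom_one[of \<rho>] by (metis dim_one_mat(2) right_mult_one_mat')

lemma rep_iso_rep_dim: "rep_iso \<rho> \<sigma> \<Longrightarrow> rep_dim \<rho> = rep_dim \<sigma>"
  by (auto simp: rep_iso_def invertible_mat_def rep_hom_dims)

text \<open>Gives meaning to the choice in \<open>num_summands\<close>. Proper summands have smaller
  dimension, and the zero module has the empty decomposition.\<close>

lemma indecomposable_decomposition_exists:
  "algebraic_rep \<rho> \<Longrightarrow> \<exists>\<rho>s. indecomposable_decomposition \<rho> \<rho>s"
proof (induction "rep_dim \<rho>" arbitrary: \<rho> rule: less_induct)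
  case less
  consider "rep_dim \<rho> = 0" | "indecomposable \<rho>" | "rep_dim \<rho> > 0" "\<not> indecomposable \<rho>" by auto
  then show ?case
  proof cases
    case 1
    have "rep_iso \<rho> (direct_sum [])"
      unfolding rep_iso_iff[OF less.prems algebraic_rep_direct_sum_Nil]
      by (rule exI[of _ "0\<^sub>m 0 0"], rule exI[of _ "0\<^sub>m 0 0"])
         (use 1 less.prems in \<open>auto intro!: rep_homI eq_matI\<close>)
    then show ?thesis
      by (intro exI[of _ "[]"]) (simp add: indecomposable_decomposition_def)
  next
    case 2
    then show ?thesis
      using less.prems
      by (intro exI[of _ "[\<rho>]"]) (simp add: indecomposable_decomposition_def rep_iso_refl)
  next
    case 3
    then obtain \<sigma> \<tau> where st: "algebraic_rep \<sigma>" "algebraic_rep \<tau>" "rep_iso \<rho> (direct_sum [\<sigma>, \<tau>])"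
      "rep_dim \<sigma> > 0" "rep_dim \<tau> > 0"
      using less.prems unfolding indecomposable_def by auto
    have alg2: "algebraic_rep (direct_sum [\<sigma>, \<tau>])"
      using st by (intro algebraic_rep_direct_sum) auto
    have dim: "rep_dim \<rho> = rep_dim \<sigma> + rep_dim \<tau>"
      using rep_iso_rep_dim[OF st(3)] rep_dim_direct_sum_append[of "[\<sigma>]" "[\<tau>]"] st by simp
    obtain \<sigma>s \<tau>s where s: "indecomposable_decomposition \<sigma> \<sigma>s" "indecomposable_decomposition \<tau> \<tau>s"
      using less.hyps[of \<sigma>] less.hyps[of \<tau>] st dim by auto
    have as: "\<forall>\<sigma>\<in>set \<sigma>s. algebraic_rep \<sigma>" "\<forall>\<sigma>\<in>set \<tau>s. algebraic_rep \<sigma>"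
      using s by (auto simp: indecomposable_decomposition_def indecomposable_def)
    note alg = as[THEN algebraic_rep_direct_sum]
    have alg3: "algebraic_rep (direct_sum (\<sigma>s @ \<tau>s))"
      using as by (intro algebraic_rep_direct_sum) auto
    have "biprod (direct_sum [\<sigma>, \<tau>]) \<sigma> \<tau>"
      using biprod_direct_sum_append[of "[\<sigma>]" "[\<tau>]"] st by simp
    then have "biprod (direct_sum [\<sigma>, \<tau>]) (direct_sum \<sigma>s) (direct_sum \<tau>s)"
      using biprod_rep_iso st s alg alg2 unfolding indecomposable_decomposition_def by blast
    then have iso: "rep_iso (direct_sum [\<sigma>, \<tau>]) (direct_sum (\<sigma>s @ \<tau>s))"
      using biprod_iso[OF alg2 alg3 alg _ biprod_direct_sum_append[OF as]] by blast
    have "rep_iso \<rho> (direct_sum (\<sigma>s @ \<tau>s))"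
    proof -
      obtain A B where 1: "rep_hom \<rho> (direct_sum [\<sigma>, \<tau>]) A" "rep_hom (direct_sum [\<sigma>, \<tau>]) \<rho> B"
         "B * A = 1\<^sub>m (rep_dim \<rho>)" "A * B = 1\<^sub>m (rep_dim (direct_sum [\<sigma>, \<tau>]))"
        using st(3) rep_iso_iff[OF less.prems alg2] by blast
      obtain C D where 2: "rep_hom (direct_sum [\<sigma>, \<tau>]) (direct_sum (\<sigma>s @ \<tau>s)) C" "rep_hom (direct_sum (\<sigma>s @ \<tau>s)) (direct_sum [\<sigma>, \<tau>]) D"
         "D * C = 1\<^sub>m (rep_dim (direct_sum [\<sigma>, \<tau>]))" "C * D = 1\<^sub>m (rep_dim (direct_sum (\<sigma>s @ \<tau>s)))"
        using iso rep_iso_iff[OF alg2 alg3] by blast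
      note d = 1(1-2)[THEN rep_hom_dims(1)] 1(1-2)[THEN rep_hom_dims(2)]
         2(1-2)[THEN rep_hom_dims(1)] 2(1-2)[THEN rep_hom_dims(2)]
      have "rep_hom \<rho> (direct_sum (\<sigma>s @ \<tau>s)) (C * A)" "rep_hom (direct_sum (\<sigma>s @ \<tau>s)) \<rho> (B * D)"
        using 1 2 less.prems alg2 alg3 by (blast intro: rep_hom_comp)+
      moreover have "(B * D) * (C * A) = 1\<^sub>m (rep_dim \<rho>)"
        by (simp add: d mat_mult_assoc cancel_mid[OF 2(3)] 1)
      moreover have "(C * A) * (B * D) = 1\<^sub>m (rep_dim (direct_sum (\<sigma>s @ \<tau>s)))"
        by (simp add: d mat_mult_assoc cancel_mid[OF 1(4)] 2)
      ultimately show ?thesis using rep_iso_iff[OF less.prems alg3] by blast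
    qed
    then show ?thesis
      using s by (intro exI[of _ "\<sigma>s @ \<tau>s"]) (auto simp: indecomposable_decomposition_def)
  qed
qed

section \<open>Local endomorphism rings\<close>

text \<open>The form in which indecomposability is used and proved: no quantification over
  representations, and the zero module is allowed.\<close>

definition trivial_idempotents :: "'a :: field rep \<Rightarrow> bool" where
  "trivial_idempotents \<rho> \<longleftrightarrow> (\<forall>e. rep_hom \<rho> \<rho> e \<longrightarrow> e * e = e \<longrightarrow>
     e = 0\<^sub>m (rep_dim \<rho>) (rep_dim \<rho>) \<or> e = 1\<^sub>m (rep_dim \<rho>))"

lemma indecomposable_trivial_idempotents:
  assumes "indecomposable \<rho>"
  shows "trivial_idempotents \<rho>"
  unfolding trivial_idempotents_def
proof (intro allI impI)
  fix e assume e: "rep_hom \<rho> \<rho> e" "e * e = e"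
  have alg: "algebraic_rep \<rho>" using assms by (simp add: indecomposable_def)
  from idempotent_biprod[OF alg e] obtain \<sigma> \<tau> where st: "algebraic_rep \<sigma>" "algebraic_rep \<tau>" "biprod \<rho> \<sigma> \<tau>"
    "rep_dim \<sigma> = 0 \<longrightarrow> e = 0\<^sub>m (rep_dim \<rho>) (rep_dim \<rho>)" "rep_dim \<tau> = 0 \<longrightarrow> e = 1\<^sub>m (rep_dim \<rho>)" .
  have "biprod (direct_sum [\<sigma>, \<tau>]) \<sigma> \<tau>" "algebraic_rep (direct_sum [\<sigma>, \<tau>])"
    using biprod_direct_sum_append[of "[\<sigma>]" "[\<tau>]"] st(1,2) by (auto intro!: algebraic_rep_direct_sum)
  then have "rep_iso \<rho> (direct_sum [\<sigma>, \<tau>])"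
    using biprod_iso alg st by blast
  moreover have "rep_iso \<rho> (direct_sum [\<sigma>, \<tau>]) \<longrightarrow> rep_dim \<sigma> = 0 \<or> rep_dim \<tau> = 0"
    using assms st(1,2) unfolding indecomposable_def by simp
  ultimately show "e = 0\<^sub>m (rep_dim \<rho>) (rep_dim \<rho>) \<or> e = 1\<^sub>m (rep_dim \<rho>)"
    using st(4,5) by argo
qed

lemma pow_mat_comm:
  fixes A :: "'a :: semiring_1 mat"
  assumes "dim_row A = n" "dim_col A = n" "dim_row B = n" "dim_col B = n" "A * B = B * A"
  shows "A ^\<^sub>m k * B = B * A ^\<^sub>m k"
proof (induction k)
  case (Suc k)
  have "A ^\<^sub>m Suc k * B = A ^\<^sub>m k * (B * A)"
    using assms by (simp add: mat_mult_assoc)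
  also have "\<dots> = B * A ^\<^sub>m Suc k"
    using assms Suc by (simp add: mat_mult_assoc[symmetric])
  finally show ?case .
qed (use assms in simp)

lemma pow_mat_mult_commuting:
  fixes A :: "'a :: semiring_1 mat"
  assumes [simp]: "dim_row A = n" "dim_col A = n" "dim_row B = n" "dim_col B = n" and AB: "A * B = B * A"
  shows "(A * B) ^\<^sub>m k = B ^\<^sub>m k * A ^\<^sub>m k"
proof (induction k)
  case (Suc k)
  have "(A * B) ^\<^sub>m Suc k = B ^\<^sub>m k * A ^\<^sub>m k * (A * B)"
    by (simp only: pow_mat.simps(2) Suc)
  also have "\<dots> = B ^\<^sub>m k * (A ^\<^sub>m k * (B * A))"
    unfolding AB by (simp add: mat_mult_assoc)
  also have "A ^\<^sub>m k * (B * A) = B * (A ^\<^sub>m k * A)"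
    using pow_mat_comm[of A n B k] AB by (simp add: mat_mult_assoc[symmetric] del: pow_mat.simps)
  finally show ?case by (simp add: mat_mult_assoc)
qed simp

text \<open>A polynomial evaluated at a matrix, coefficients from the lowest degree upwards, so that
  an initial run of zeros factors out a power of the matrix.\<close>

fun horner_mat :: "nat \<Rightarrow> 'a :: field list \<Rightarrow> 'a mat \<Rightarrow> 'a mat" where
  "horner_mat n [] A = 0\<^sub>m n n"
| "horner_mat n (c # cs) A = c \<cdot>\<^sub>m 1\<^sub>m n + A * horner_mat n cs A"

lemma dim_horner_mat [simp]:
  "dim_row A = n \<Longrightarrow> dim_row (horner_mat n cs A) = n" "dim_col (horner_mat n cs A) = n"
  by (induction cs) auto

lemma horner_mat_index:
  assumes "dim_row A = n" "dim_col A = n" "i < n" "j < n"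
  shows "horner_mat n cs A $$ (i, j) = (\<Sum>k<length cs. cs ! k * (A ^\<^sub>m k) $$ (i, j))"
  using assms(3,4)
proof (induction cs arbitrary: i j)
  case (Cons c cs)
  have "(A * horner_mat n cs A) $$ (i, j) = (\<Sum>l<n. A $$ (i, l) * (\<Sum>k<length cs. cs ! k * (A ^\<^sub>m k) $$ (l, j)))"
    using Cons assms by (subst mult_index) auto
  also have "\<dots> = (\<Sum>k<length cs. cs ! k * (\<Sum>l<n. A $$ (i, l) * (A ^\<^sub>m k) $$ (l, j)))"
    unfolding sum_distrib_left by (subst sum.swap) (simp add: mult_ac)
  also have "\<dots> = (\<Sum>k<length cs. cs ! k * (A ^\<^sub>m Suc k) $$ (i, j))"
  proof (rule sum.cong[OF refl])
    fix k
    have "(A ^\<^sub>m Suc k) $$ (i, j) = (A * A ^\<^sub>m k) $$ (i, j)"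
      using assms pow_mat_comm[of A n A k] by simp
    also have "\<dots> = (\<Sum>l<n. A $$ (i, l) * (A ^\<^sub>m k) $$ (l, j))"
      using assms Cons by (subst mult_index) auto
    finally show "cs ! k * (\<Sum>l<n. A $$ (i, l) * (A ^\<^sub>m k) $$ (l, j)) = cs ! k * (A ^\<^sub>m Suc k) $$ (i, j)" by simp
  qed
  finally show ?case
    using Cons.prems assms by (simp add: sum.lessThan_Suc_shift del: sum.lessThan_Suc index_mult_mat(1) pow_mat.simps(2))
qed simp

lemma horner_mat_shift:
  assumes "dim_row A = n" "dim_col A = n" "\<forall>c\<in>set cs. c = 0"
  shows "horner_mat n (cs @ ds) A = A ^\<^sub>m length cs * horner_mat n ds A"
  using assms(3)
proof (induction cs)
  case (Cons c cs)
  have "horner_mat n ((c # cs) @ ds) A = A * (A ^\<^sub>m length cs * horner_mat n ds A)"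
    using Cons assms by (auto intro!: eq_matI)
  also have "\<dots> = A ^\<^sub>m Suc (length cs) * horner_mat n ds A"
    using assms pow_mat_comm[of A n A "length cs"] by (simp add: mat_mult_assoc[symmetric])
  finally show ?case by simp
qed (use assms in simp)

text \<open>The \<open>n * n + 1\<close> powers of \<open>A\<close> starting with the identity are
  linearly dependent, since a matrix of size \<open>n\<close> has only \<open>n * n\<close>
  entries.\<close>

lemma annihilating_horner:
  fixes A :: "'a :: field mat"
  assumes [simp]: "dim_row A = n" "dim_col A = n"
  obtains cs where "\<exists>c\<in>set cs. c \<noteq> 0" "horner_mat n cs A = 0\<^sub>m n n"
proof -
  define K where "K = Suc (n * n)"
  \<comment> \<open>Column \<open>i\<close> lists the entries of the \<open>i\<close>-th power. The
    final zero row makes the matrix square and singular, so a kernel vector exists.\<close>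
  define Z where "Z = mat K K (\<lambda>(p, i). if p < n * n then (A ^\<^sub>m i) $$ (p div n, p mod n) else 0)"
  have Z: "Z \<in> carrier_mat K K" by (simp add: Z_def)
  have "det Z = 0"
    using laplace_expansion_row[OF Z, of "n * n"] by (simp add: K_def Z_def)
  then obtain v where v: "v \<in> carrier_vec K" "v \<noteq> 0\<^sub>v K" "Z *\<^sub>v v = 0\<^sub>v K"
    using det_0_iff_vec_prod_zero_field[OF Z] by blast
  define cs where "cs = map (\<lambda>i. v $ i) [0..<K]"
  have "\<exists>i<K. v $ i \<noteq> 0"
    using v(1,2) by (metis carrier_vecD eq_vecI index_zero_vec)
  then have "\<exists>c\<in>set cs. c \<noteq> 0" by (auto simp: cs_def)
  moreover have "horner_mat n cs A = 0\<^sub>m n n"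
  proof (rule eq_matI)
    fix i j assume "i < dim_row (0\<^sub>m n n :: 'a mat)" "j < dim_col (0\<^sub>m n n :: 'a mat)"
    then have ij: "i < n" "j < n" by auto
    define p where "p = i * n + j"
    have p: "p < n * n" "p div n = i" "p mod n = j"
      using ij by (auto simp: p_def intro: mult_add_less)
    have "0 = (Z *\<^sub>v v) $ p" using v p by (simp add: K_def)
    also have "\<dots> = (\<Sum>k<K. Z $$ (p, k) * v $ k)"
      using p v(1) by (auto simp: Z_def K_def scalar_prod_def lessThan_atLeast0 intro!: sum.cong)
    also have "\<dots> = (\<Sum>k<K. cs ! k * (A ^\<^sub>m k) $$ (i, j))"
      using p by (intro sum.cong) (auto simp: Z_def K_def cs_def mult.commute simp del: upt_Suc)
    also have "\<dots> = horner_mat n cs A $$ (i, j)"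
      using ij by (simp add: horner_mat_index cs_def)
    finally show "horner_mat n cs A $$ (i, j) = 0\<^sub>m n n $$ (i, j)" using ij by simp
  qed auto
  ultimately show ?thesis using that by blast
qed

lemma rep_hom_horner:
  "algebraic_rep \<rho> \<Longrightarrow> rep_hom \<rho> \<rho> \<phi> \<Longrightarrow> rep_hom \<rho> \<rho> (horner_mat (rep_dim \<rho>) cs \<phi>)"
  by (induction cs) (auto intro!: rep_hom_add rep_hom_smult rep_hom_one rep_hom_zero intro: rep_hom_comp)

lemma rep_hom_pow: "algebraic_rep \<rho> \<Longrightarrow> rep_hom \<rho> \<rho> \<phi> \<Longrightarrow> rep_hom \<rho> \<rho> (\<phi> ^\<^sub>m k)"
  by (induction k) (auto intro: rep_hom_comp rep_hom_one simp: rep_hom_dims)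

lemma horner_mat_comm:
  fixes A :: "'a :: field mat"
  assumes [simp]: "dim_row A = n" "dim_col A = n"
  shows "A * horner_mat n cs A = horner_mat n cs A * A"
proof (induction cs)
  case (Cons c cs)
  show ?case by (simp add: mat_ring mat_smult_left mat_smult_right Cons[symmetric])
qed simp

text \<open>Fitting's lemma as an equation. If \<open>c\<close> is the lowest nonzero coefficient of
  an annihilating polynomial, in degree \<open>N\<close>, then
  \<open>\<phi>^N * (c + \<phi> * h) = 0\<close>, so \<open>\<psi> = - h / c\<close> undoes one
  factor \<open>\<phi>\<close> after \<open>\<phi>^N\<close>. Being a polynomial in
  \<open>\<phi>\<close>, it is equivariant and commutes with \<open>\<phi>\<close>.\<close>

lemma strongly_regular_endomorphism:
  assumes alg: "algebraic_rep \<rho>" and phi: "rep_hom \<rho> \<rho> \<phi>"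
  obtains N \<psi> where "rep_hom \<rho> \<rho> \<psi>" "\<phi> * \<psi> = \<psi> * \<phi>" "\<phi> ^\<^sub>m N * (\<phi> * \<psi>) = \<phi> ^\<^sub>m N"
proof -
  let ?d = "rep_dim \<rho>"
  have [simp]: "dim_row \<phi> = ?d" "dim_col \<phi> = ?d" using phi by (auto simp: rep_hom_dims)
  obtain cs where cs: "\<exists>c\<in>set cs. c \<noteq> 0" "horner_mat ?d cs \<phi> = 0\<^sub>m ?d ?d"
    by (rule annihilating_horner[of \<phi> ?d]) auto
  then obtain ys c zs where s: "cs = ys @ c # zs" "c \<noteq> 0" "\<forall>y\<in>set ys. \<not> y \<noteq> 0"
    using split_list_first_prop[of cs "\<lambda>c. c \<noteq> 0"] by blast
  define h where "h = horner_mat ?d zs \<phi>"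
  define N where "N = length ys"
  have [simp]: "dim_row h = ?d" "dim_col h = ?d" by (simp_all add: h_def)
  define \<psi> where "\<psi> = (- inverse c) \<cdot>\<^sub>m h"
  have "0\<^sub>m ?d ?d = \<phi> ^\<^sub>m N * (c \<cdot>\<^sub>m 1\<^sub>m ?d + \<phi> * h)"
    using cs(2) horner_mat_shift[of \<phi> ?d ys "c # zs"] s by (simp add: h_def N_def)
  also have "\<dots> = c \<cdot>\<^sub>m \<phi> ^\<^sub>m N + \<phi> ^\<^sub>m N * (\<phi> * h)"
    by (simp add: mat_ring mat_smult_left)
  finally have z: "0\<^sub>m ?d ?d = c \<cdot>\<^sub>m \<phi> ^\<^sub>m N + \<phi> ^\<^sub>m N * (\<phi> * h)" .
  have "\<phi> ^\<^sub>m N * (\<phi> * \<psi>) = (- inverse c) \<cdot>\<^sub>m (\<phi> ^\<^sub>m N * (\<phi> * h))"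
    by (simp add: \<psi>_def mat_smult_left)
  also have "\<dots> = \<phi> ^\<^sub>m N"
  proof (rule eq_matI)
    fix i j assume "i < dim_row (\<phi> ^\<^sub>m N)" "j < dim_col (\<phi> ^\<^sub>m N)"
    then have ij: "i < ?d" "j < ?d" by (auto split: if_splits)
    then have "0 = c * (\<phi> ^\<^sub>m N) $$ (i, j) + (\<phi> ^\<^sub>m N * (\<phi> * h)) $$ (i, j)"
      using arg_cong[OF z, of "\<lambda>X. X $$ (i, j)"] by (simp del: index_mult_mat(1))
    then have "(\<phi> ^\<^sub>m N * (\<phi> * h)) $$ (i, j) = - (c * (\<phi> ^\<^sub>m N) $$ (i, j))"
      by (metis add_eq_0_iff)
    then show "((- inverse c) \<cdot>\<^sub>m (\<phi> ^\<^sub>m N * (\<phi> * h))) $$ (i, j) = (\<phi> ^\<^sub>m N) $$ (i, j)"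
      using ij s(2) by (simp del: index_mult_mat(1))
  qed auto
  finally have "\<phi> ^\<^sub>m N * (\<phi> * \<psi>) = \<phi> ^\<^sub>m N" .
  moreover have "\<phi> * \<psi> = \<psi> * \<phi>"
    unfolding \<psi>_def h_def by (simp add: mat_smult_left mat_smult_right horner_mat_comm)
  moreover have "rep_hom \<rho> \<rho> \<psi>"
    unfolding \<psi>_def h_def using alg phi by (intro rep_hom_smult rep_hom_horner)
  ultimately show ?thesis using that by blast
qed

definition rep_unit :: "'a :: field rep \<Rightarrow> 'a mat \<Rightarrow> bool" where
  "rep_unit \<rho> \<phi> \<longleftrightarrow> rep_hom \<rho> \<rho> \<phi> \<and> (\<exists>\<psi>. rep_hom \<rho> \<rho> \<psi> \<and> \<phi> * \<psi> = 1\<^sub>m (rep_dim \<rho>) \<and> \<psi> * \<phi> = 1\<^sub>m (rep_dim \<rho>))"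

text \<open>With \<open>w = \<phi> * \<psi>\<close> from Fitting's lemma,
  \<open>\<phi>^N * w = \<phi>^N\<close> makes \<open>w^N\<close> idempotent. If it is zero, then
  \<open>\<phi>^N = \<phi>^N * w^N\<close> is zero; if it is the identity, then \<open>w\<close> is
  the identity and \<open>\<psi>\<close> inverts \<open>\<phi>\<close>.\<close>

lemma unit_or_nilpotent:
  assumes alg: "algebraic_rep \<rho>" and ti: "trivial_idempotents \<rho>" and phi: "rep_hom \<rho> \<rho> \<phi>"
  shows "rep_unit \<rho> \<phi> \<or> (\<exists>N. \<phi> ^\<^sub>m N = 0\<^sub>m (rep_dim \<rho>) (rep_dim \<rho>))"
proof -
  let ?d = "rep_dim \<rho>"
  obtain N \<psi> where h: "rep_hom \<rho> \<rho> \<psi>" "\<phi> * \<psi> = \<psi> * \<phi>" "\<phi> ^\<^sub>m N * (\<phi> * \<psi>) = \<phi> ^\<^sub>m N"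
    by (rule strongly_regular_endomorphism[OF alg phi])
  have [simp]: "dim_row \<phi> = ?d" "dim_col \<phi> = ?d" "dim_row \<psi> = ?d" "dim_col \<psi> = ?d"
    using phi h by (auto simp: rep_hom_dims)
  define w where "w = \<phi> * \<psi>"
  define e where "e = w ^\<^sub>m N"
  have [simp]: "dim_row w = ?d" "dim_col w = ?d" "dim_row e = ?d" "dim_col e = ?d"
    by (auto simp: w_def e_def)
  have e: "e = \<psi> ^\<^sub>m N * \<phi> ^\<^sub>m N"
    unfolding e_def w_def by (rule pow_mat_mult_commuting) (auto simp: h)
  have ew: "e * w = e"
    unfolding e w_def by (simp add: mat_mult_assoc h(3))
  have powN: "X * w ^\<^sub>m k = X" if "X * w = X" "dim_col X = ?d" for X k
    using that
  proof (induction k)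
    case (Suc k)
    have "X * w ^\<^sub>m Suc k = X * w ^\<^sub>m k * w" using Suc.prems by (simp add: mat_mult_assoc)
    then show ?case using Suc by simp
  qed auto
  have "e * e = e" using powN[OF ew, of N] unfolding e_def by (simp add: e_def[symmetric])
  moreover have wh: "rep_hom \<rho> \<rho> w" unfolding w_def using alg phi h by (blast intro: rep_hom_comp)
  moreover have "rep_hom \<rho> \<rho> e" unfolding e_def using alg wh by (rule rep_hom_pow)
  ultimately consider "e = 0\<^sub>m ?d ?d" | "e = 1\<^sub>m ?d"
    using ti unfolding trivial_idempotents_def by blast
  then show ?thesis
  proof cases
    case 1
    have "\<phi> ^\<^sub>m N = \<phi> ^\<^sub>m N * w ^\<^sub>m N" using powN[of "\<phi> ^\<^sub>m N" N] h(3) by (simp add: w_def)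
    then have "\<phi> ^\<^sub>m N = 0\<^sub>m ?d ?d" using 1 by (simp add: e_def[symmetric])
    then show ?thesis by blast
  next
    case 2
    then have "w = 1\<^sub>m ?d" using ew by simp
    then show ?thesis
      unfolding rep_unit_def using phi h by (auto simp: w_def)
  qed
qed

lemma rep_unit_mult:
  assumes alg: "algebraic_rep \<rho>" and "rep_unit \<rho> a" "rep_unit \<rho> b"
  shows "rep_unit \<rho> (a * b)"
proof -
  obtain a' b' where h: "rep_hom \<rho> \<rho> a" "rep_hom \<rho> \<rho> b" "rep_hom \<rho> \<rho> a'" "rep_hom \<rho> \<rho> b'"
    "a * a' = 1\<^sub>m (rep_dim \<rho>)" "a' * a = 1\<^sub>m (rep_dim \<rho>)" "b * b' = 1\<^sub>m (rep_dim \<rho>)" "b' * b = 1\<^sub>m (rep_dim \<rho>)"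
    using assms unfolding rep_unit_def by blast
  note d = h(1-4)[THEN rep_hom_dims(1)] h(1-4)[THEN rep_hom_dims(2)]
  have "rep_hom \<rho> \<rho> (a * b)" "rep_hom \<rho> \<rho> (b' * a')" using alg h by (blast intro: rep_hom_comp)+
  moreover have "(a * b) * (b' * a') = 1\<^sub>m (rep_dim \<rho>)"
    by (simp add: d mat_mult_assoc cancel_mid[OF h(7)] h)
  moreover have "(b' * a') * (a * b) = 1\<^sub>m (rep_dim \<rho>)"
    by (simp add: d mat_mult_assoc cancel_mid[OF h(6)] h)
  ultimately show ?thesis unfolding rep_unit_def by blast
qed

text \<open>The last nonzero power of \<open>a\<close> is annihilated by \<open>a\<close>, hence
  fixed by every power of \<open>1 - a\<close>.\<close>

lemma not_nilpotent_both:
  fixes a :: "'a :: field mat"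
  assumes [simp]: "dim_row a = d" "dim_col a = d" and "d > 0"
    and "a ^\<^sub>m N = 0\<^sub>m d d" "(1\<^sub>m d - a) ^\<^sub>m M = 0\<^sub>m d d"
  shows False
proof -
  define k where "k = (LEAST k. a ^\<^sub>m k = 0\<^sub>m d d)"
  have k: "a ^\<^sub>m k = 0\<^sub>m d d" unfolding k_def using assms(4) by (rule LeastI)
  have "(1\<^sub>m d :: 'a mat) \<noteq> 0\<^sub>m d d"
    using \<open>d > 0\<close> by (metis index_one_mat(1) index_zero_mat(1) zero_neq_one)
  then have "k \<noteq> 0" using k by (metis assms(1) pow_mat.simps(1))
  then obtain l where l: "k = Suc l" by (cases k) auto
  define x where "x = a ^\<^sub>m l"
  have x: "x \<noteq> 0\<^sub>m d d" using not_less_Least[of l "\<lambda>k. a ^\<^sub>m k = 0\<^sub>m d d"] l by (auto simp: k_def x_def)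
  have [simp]: "dim_row x = d" "dim_col x = d" by (simp_all add: x_def)
  have xa: "x * a = 0\<^sub>m d d" using k l by (simp add: x_def)
  have "x * (1\<^sub>m d - a) ^\<^sub>m m = x" for m
  proof (induction m)
    case (Suc m)
    have "x * (1\<^sub>m d - a) ^\<^sub>m Suc m = x * (1\<^sub>m d - a) ^\<^sub>m m * (1\<^sub>m d - a)"
      by (simp add: mat_mult_assoc)
    also have "\<dots> = x" unfolding Suc by (simp add: mat_diff_left xa)
    finally show ?case .
  qed simp
  from this[of M] x show False using assms(5) by simp
qed

text \<open>The endomorphism ring is local: after division by the sum, the terms become
  \<open>a\<close> and \<open>1 - a\<close>. Each is a unit or nilpotent, and not both are
  nilpotent.\<close>

lemma rep_unit_add:
  assumes alg: "algebraic_rep \<rho>" and ti: "trivial_idempotents \<rho>" and "rep_dim \<rho> > 0"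
    and a: "rep_hom \<rho> \<rho> a" and b: "rep_hom \<rho> \<rho> b" and u: "rep_unit \<rho> (a + b)"
  shows "rep_unit \<rho> a \<or> rep_unit \<rho> b"
proof (rule ccontr)
  assume n: "\<not> (rep_unit \<rho> a \<or> rep_unit \<rho> b)"
  let ?d = "rep_dim \<rho>"
  define s where "s = a + b"
  obtain u where u: "rep_hom \<rho> \<rho> u" "s * u = 1\<^sub>m ?d" "u * s = 1\<^sub>m ?d" "rep_hom \<rho> \<rho> s"
    using assms unfolding rep_unit_def s_def by blast
  note d [simp] = a[THEN rep_hom_dims(1)] a[THEN rep_hom_dims(2)] b[THEN rep_hom_dims(1)] b[THEN rep_hom_dims(2)]
    u(1,4)[THEN rep_hom_dims(1)] u(1,4)[THEN rep_hom_dims(2)]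
  have su: "rep_unit \<rho> s" using u by (auto simp: rep_unit_def)
  have h: "rep_hom \<rho> \<rho> (u * a)" "rep_hom \<rho> \<rho> (u * b)" using alg u a b by (blast intro: rep_hom_comp)+
  have na: "\<not> rep_unit \<rho> (u * a)" "\<not> rep_unit \<rho> (u * b)"
    using rep_unit_mult[OF alg su, of "u * a"] rep_unit_mult[OF alg su, of "u * b"] n
    by (auto simp: cancel_mid[OF u(2)])
  have "u * a + u * b = 1\<^sub>m ?d" using u(3) by (simp add: s_def mat_ring)
  then have ub: "u * b = 1\<^sub>m ?d - u * a"
  proof -
    have "u * b = (u * a + u * b) - u * a" by (rule eq_matI) (auto simp del: index_mult_mat(1))
    then show ?thesis using \<open>u * a + u * b = 1\<^sub>m ?d\<close> by simp
  qed
  obtain N M where "(u * a) ^\<^sub>m N = 0\<^sub>m ?d ?d" "(u * b) ^\<^sub>m M = 0\<^sub>m ?d ?d"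
    using unit_or_nilpotent[OF alg ti h(1)] unit_or_nilpotent[OF alg ti h(2)] na by blast
  then show False
    using not_nilpotent_both[of "u * a" ?d N M] assms(3) by (simp add: ub)
qed

section \<open>The exchange argument\<close>

text \<open>The idempotents need not add up to the identity, so such families pass from a retract to
  the ambient module.\<close>

definition orth_idems :: "'a :: field rep \<Rightarrow> 'i set \<Rightarrow> ('i \<Rightarrow> 'a mat) \<Rightarrow> bool" where
  "orth_idems M I e \<longleftrightarrow> (\<forall>i\<in>I. rep_hom M M (e i) \<and> e i \<noteq> 0\<^sub>m (rep_dim M) (rep_dim M) \<and> e i * e i = e i \<and>
     (\<forall>j\<in>I. i \<noteq> j \<longrightarrow> e i * e j = 0\<^sub>m (rep_dim M) (rep_dim M)))"

text \<open>The identity is the sum of the \<open>e j\<close> and their complement. Compressed to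
  \<open>Y\<close>, the sum is the identity, so by locality one compressed term is a unit.\<close>

lemma exchange_idempotent:
  assumes alg: "algebraic_rep M" "algebraic_rep Y" and ti: "trivial_idempotents Y" and Y: "rep_dim Y > 0"
    and i: "rep_hom Y M \<iota>" and p: "rep_hom M Y \<pi>" and pi: "\<pi> * \<iota> = 1\<^sub>m (rep_dim Y)"
    and fin: "finite J" and e: "\<And>j. j \<in> J \<Longrightarrow> rep_hom M M (e j)" "\<And>j. j \<in> J \<Longrightarrow> e j * e j = e j"
      "\<And>j k. j \<in> J \<Longrightarrow> k \<in> J \<Longrightarrow> j \<noteq> k \<Longrightarrow> e j * e k = 0\<^sub>m (rep_dim M) (rep_dim M)"
  shows "\<exists>h. rep_hom M M h \<and> rep_unit Y (\<pi> * h * \<iota>) \<and>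
     ((\<forall>j\<in>J. e j * h = 0\<^sub>m (rep_dim M) (rep_dim M)) \<or> (\<exists>j\<in>J. h = e j))"
proof -
  let ?m = "rep_dim M"
  note [simp] = i[THEN rep_hom_dims(1)] i[THEN rep_hom_dims(2)] p[THEN rep_hom_dims(1)] p[THEN rep_hom_dims(2)]
  \<comment> \<open>\<open>f\<close> is the identity minus the sum of the \<open>e j\<close> over
    \<open>J'\<close>, built by single subtractions and described through its products with the
    idempotents.\<close>
  have "\<exists>f. rep_hom M M f \<and> (\<forall>j\<in>J'. e j * f = 0\<^sub>m ?m ?m) \<and> (\<forall>j\<in>J-J'. e j * f = e j) \<and>
     (rep_unit Y (\<pi> * f * \<iota>) \<or> (\<exists>j\<in>J. rep_unit Y (\<pi> * e j * \<iota>)))" if "J' \<subseteq> J" for J'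
    using finite_subset[OF that fin] that
  proof (induction J' rule: finite_induct)
    case empty
    have "rep_unit Y (\<pi> * 1\<^sub>m ?m * \<iota>)"
      using rep_hom_one[OF alg(2)] pi by (auto simp: rep_unit_def)
    then show ?case
      using alg by (intro exI[of _ "1\<^sub>m ?m"]) (auto simp: rep_hom_one e(1)[THEN rep_hom_dims(2)])
  next
    case (insert j J')
    then obtain f where f: "rep_hom M M f" "\<And>i. i \<in> J' \<Longrightarrow> e i * f = 0\<^sub>m ?m ?m" "\<And>i. i \<in> J - J' \<Longrightarrow> e i * f = e i"
       "rep_unit Y (\<pi> * f * \<iota>) \<or> (\<exists>j\<in>J. rep_unit Y (\<pi> * e j * \<iota>))" by blast
    have j: "j \<in> J" "j \<notin> J'" using insert by auto
    note [simp] = f(1)[THEN rep_hom_dims(1)] f(1)[THEN rep_hom_dims(2)]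
    have [simp]: "dim_row (e i) = ?m" "dim_col (e i) = ?m" if "i \<in> J" for i
      using e(1)[OF that] by (auto simp: rep_hom_dims)
    have d: "e i * (f - e j) = e i * f - e i * e j" if "i \<in> J" for i
      using that j by (simp add: mat_diff_left)
    have "rep_hom M M (f - e j)" using alg f e j by (intro rep_hom_diff) auto
    moreover have "e i * (f - e j) = 0\<^sub>m ?m ?m" if "i \<in> insert j J'" for i
    proof (cases "i = j")
      case True
      then show ?thesis using d[OF j(1)] f(3)[of j] e(2)[OF j(1)] j by simp
    next
      case False
      then show ?thesis using d[of i] f(2)[of i] e(3)[of i j] that insert.prems j by auto
    qed
    moreover have "e i * (f - e j) = e i" if "i \<in> J - insert j J'" for i
      using d[of i] f(3)[of i] e(3)[of i j] that j by auto
    moreover have "rep_unit Y (\<pi> * (f - e j) * \<iota>) \<or> (\<exists>j\<in>J. rep_unit Y (\<pi> * e j * \<iota>))"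
    proof (cases "rep_unit Y (\<pi> * f * \<iota>)")
      case True
      have "\<pi> * f * \<iota> = \<pi> * (f - e j) * \<iota> + \<pi> * e j * \<iota>"
        using j by (simp add: mat_ring) (rule eq_matI, auto simp del: index_mult_mat(1))
      moreover have "rep_hom Y Y (\<pi> * (f - e j) * \<iota>)" "rep_hom Y Y (\<pi> * e j * \<iota>)"
        using \<open>rep_hom M M (f - e j)\<close> e(1)[OF j(1)] alg i p by (blast intro: rep_hom_comp)+
      ultimately show ?thesis using rep_unit_add[OF alg(2) ti Y] True j by metis
    qed (use f in blast)
    ultimately show ?case by blast
  qed
  from this[of J] obtain f where f: "rep_hom M M f" "\<forall>j\<in>J. e j * f = 0\<^sub>m ?m ?m"
    "rep_unit Y (\<pi> * f * \<iota>) \<or> (\<exists>j\<in>J. rep_unit Y (\<pi> * e j * \<iota>))" by auto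
  then show ?thesis using e(1) by blast
qed

text \<open>The image of \<open>h\<close> contains a copy of \<open>Y\<close> that can replace
  \<open>Y\<close> as a complement of \<open>M'\<close>. Idempotents annihilating \<open>h\<close>
  do not see this copy, so they survive the passage to \<open>M'\<close>.\<close>

lemma exchange_step:
  assumes alg: "algebraic_rep M" "algebraic_rep Y" "algebraic_rep M'"
    and i: "rep_hom Y M \<iota>" and p: "rep_hom M Y \<pi>" and i': "rep_hom M' M \<iota>'" and p': "rep_hom M M' \<pi>'"
    and pi: "\<pi> * \<iota> = 1\<^sub>m (rep_dim Y)" and compl: "\<iota> * \<pi> + \<iota>' * \<pi>' = 1\<^sub>m (rep_dim M)"
    and h: "rep_hom M M h" and u: "rep_unit Y (\<pi> * h * \<iota>)"
    and e: "orth_idems M I e" "\<And>j. j \<in> I \<Longrightarrow> e j * h = 0\<^sub>m (rep_dim M) (rep_dim M)"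
  shows "\<exists>f. orth_idems M' I f"
proof -
  let ?m = "rep_dim M" and ?y = "rep_dim Y" and ?n = "rep_dim M'"
  obtain v where v: "rep_hom Y Y v" "(\<pi> * h * \<iota>) * v = 1\<^sub>m ?y" "v * (\<pi> * h * \<iota>) = 1\<^sub>m ?y"
    using u unfolding rep_unit_def by blast
  note d [simp] = i[THEN rep_hom_dims(1)] i[THEN rep_hom_dims(2)] p[THEN rep_hom_dims(1)] p[THEN rep_hom_dims(2)]
    i'[THEN rep_hom_dims(1)] i'[THEN rep_hom_dims(2)] p'[THEN rep_hom_dims(1)] p'[THEN rep_hom_dims(2)]
    h[THEN rep_hom_dims(1)] h[THEN rep_hom_dims(2)] v(1)[THEN rep_hom_dims(1)] v(1)[THEN rep_hom_dims(2)]
  \<comment> \<open>A projection with \<open>\<pi> * q = \<pi>\<close> whose image lies in that of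
    \<open>h\<close>. Hence \<open>1 - q\<close> is killed by \<open>\<pi>\<close> and factors
    through \<open>M'\<close>, while \<open>e j * q = 0\<close>.\<close>
  define q where "q = h * (\<iota> * (v * \<pi>))"
  have dq [simp]: "dim_row q = ?m" "dim_col q = ?m" by (simp_all add: q_def)
  define r where "r = 1\<^sub>m ?m - q"
  have dr [simp]: "dim_row r = ?m" "dim_col r = ?m" by (simp_all add: r_def)
  have qh: "rep_hom M M q" unfolding q_def using alg h i p v by (blast intro: rep_hom_comp)
  have rh: "rep_hom M M r" unfolding r_def using alg qh by (intro rep_hom_diff rep_hom_one)
  have de [simp]: "dim_row (e j) = ?m" "dim_col (e j) = ?m" if "j \<in> I" for j
    using e(1) that by (auto simp: orth_idems_def rep_hom_dims)
  have eq: "e j * q = 0\<^sub>m ?m ?m" if "j \<in> I" for j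
    using that e(2)[OF that] by (simp add: q_def mat_mult_assoc[symmetric])
  have er: "e j * r = e j" if "j \<in> I" for j
    using that eq[OF that] by (simp add: r_def mat_diff_left)
  have "\<pi> * q = (\<pi> * h * \<iota>) * v * \<pi>" by (simp add: q_def mat_mult_assoc)
  then have pq: "\<pi> * q = \<pi>" using v by simp
  then have pr: "\<pi> * r = 0\<^sub>m ?y ?m" by (simp add: r_def mat_diff_left)
  have "r = (\<iota> * \<pi> + \<iota>' * \<pi>') * r" by (simp add: compl)
  also have "\<dots> = \<iota>' * (\<pi>' * r)" by (simp add: mat_ring pr)
  finally have r: "\<iota>' * (\<pi>' * r) = r" ..
  define f where "f j = \<pi>' * r * (e j * \<iota>')" for j
  have df [simp]: "dim_row (f j) = ?n" "dim_col (f j) = ?n" if "j \<in> I" for j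
    using that by (simp_all add: f_def)
  have ff: "f j * f k = \<pi>' * r * (e j * e k * \<iota>')" if "j \<in> I" "k \<in> I" for j k
  proof -
    have "f j * f k = \<pi>' * r * (e j * ((\<iota>' * (\<pi>' * r)) * (e k * \<iota>')))"
      using that by (simp add: f_def mat_mult_assoc)
    also have "\<dots> = \<pi>' * r * ((e j * r) * (e k * \<iota>'))"
      using that unfolding r by (simp add: mat_mult_assoc)
    finally show ?thesis using that by (simp add: er mat_mult_assoc)
  qed
  have "orth_idems M' I f"
    unfolding orth_idems_def
  proof (intro ballI conjI impI)
    fix j assume j: "j \<in> I"
    have ej: "rep_hom M M (e j)" "e j * e j = e j" "e j \<noteq> 0\<^sub>m ?m ?m" using e(1) j by (auto simp: orth_idems_def)
    show "rep_hom M' M' (f j)" unfolding f_def using alg ej rh p' i' by (blast intro: rep_hom_comp)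
    show "f j * f j = f j" using ff[OF j j] ej by (simp add: f_def)
    show "f j \<noteq> 0\<^sub>m ?n ?n"
    proof
      assume z: "f j = 0\<^sub>m ?n ?n"
      have "e j = e j * (r * (e j * r))"
        using j er ej by (simp add: mat_mult_assoc[symmetric])
      also have "r * (e j * r) = (\<iota>' * (\<pi>' * r)) * (e j * (\<iota>' * (\<pi>' * r)))" by (simp only: r)
      also have "\<dots> = \<iota>' * f j * (\<pi>' * r)" using j by (simp add: f_def mat_mult_assoc)
      also have "\<dots> = 0\<^sub>m ?m ?m" by (simp add: z)
      finally show False using ej j by simp
    qed
    fix k assume k: "k \<in> I" "j \<noteq> k"
    then have "e j * e k = 0\<^sub>m ?m ?m" using e(1) j by (auto simp: orth_idems_def)
    then show "f j * f k = 0\<^sub>m ?n ?n" using ff[OF j k(1)] by simp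
  qed
  then show ?thesis by blast
qed

lemma orth_idems_subset: "orth_idems M I e \<Longrightarrow> J \<subseteq> I \<Longrightarrow> orth_idems M J e"
  unfolding orth_idems_def by blast

text \<open>Each indecomposable summand removed from the list uses up at most one
  idempotent.\<close>

lemma card_orth_idems_le:
  assumes "\<forall>\<sigma>\<in>set \<sigma>s. indecomposable \<sigma>" "orth_idems (direct_sum \<sigma>s) I e" "finite I"
  shows "card I \<le> length \<sigma>s"
  using assms
proof (induction \<sigma>s arbitrary: I e)
  case Nil
  have "I = {}"
  proof (rule ccontr)
    assume "I \<noteq> {}"
    then obtain i where i: "i \<in> I" by blast
    then have h: "rep_hom (direct_sum []) (direct_sum []) (e i)" "e i \<noteq> 0\<^sub>m 0 0"
      using Nil by (auto simp: orth_idems_def)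
    moreover have "e i = 0\<^sub>m 0 0"
      by (rule eq_matI) (use rep_hom_dims[OF h(1)] in auto)
    ultimately show False by blast
  qed
  then show ?case by simp
next
  case (Cons Y \<sigma>s)
  let ?M = "direct_sum (Y # \<sigma>s)" and ?M' = "direct_sum \<sigma>s"
  have Y: "algebraic_rep Y" "rep_dim Y > 0" "trivial_idempotents Y"
    using Cons.prems(1) indecomposable_trivial_idempotents by (auto simp: indecomposable_def)
  have as: "\<forall>\<sigma>\<in>set \<sigma>s. algebraic_rep \<sigma>" using Cons.prems(1) by (auto simp: indecomposable_def)
  have algM: "algebraic_rep ?M" "algebraic_rep ?M'" using Y as by (auto intro!: algebraic_rep_direct_sum)
  have "biprod ?M Y ?M'" using biprod_direct_sum_append[of "[Y]" \<sigma>s] Y as by simp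
  then obtain \<iota> \<pi> \<iota>' \<pi>' where b: "rep_hom Y ?M \<iota>" "rep_hom ?M Y \<pi>" "rep_hom ?M' ?M \<iota>'" "rep_hom ?M ?M' \<pi>'"
     "\<pi> * \<iota> = 1\<^sub>m (rep_dim Y)" "\<iota> * \<pi> + \<iota>' * \<pi>' = 1\<^sub>m (rep_dim ?M)"
    unfolding biprod_def by blast
  obtain h where h: "rep_hom ?M ?M h" "rep_unit Y (\<pi> * h * \<iota>)"
    "(\<forall>j\<in>I. e j * h = 0\<^sub>m (rep_dim ?M) (rep_dim ?M)) \<or> (\<exists>j\<in>I. h = e j)"
    using exchange_idempotent[OF algM(1) Y(1,3,2) b(1,2,5) Cons.prems(3), of e] Cons.prems(2)
    unfolding orth_idems_def by blast
  obtain j where j: "\<forall>i\<in>I - {j}. e i * h = 0\<^sub>m (rep_dim ?M) (rep_dim ?M)"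
  proof (cases "\<exists>j\<in>I. h = e j")
    case True
    then obtain j where "j \<in> I" "h = e j" by blast
    then show ?thesis using that[of j] Cons.prems(2) unfolding orth_idems_def by blast
  next
    case False
    \<comment> \<open>Here the complement of all idempotents was exchanged, so none is lost and the
      index to discard is arbitrary.\<close>
    then show ?thesis using that[of undefined] h(3) by blast
  qed
  have "\<exists>f. orth_idems ?M' (I - {j}) f"
    by (rule exchange_step[OF algM(1) Y(1) algM(2) b h(1,2) orth_idems_subset[OF Cons.prems(2)]]) (use j in auto)
  then have "card (I - {j}) \<le> length \<sigma>s" using Cons by (metis finite_Diff list.set_intros(2))
  then show ?case using card_Diff1_le[of I j] by (cases "j \<in> I") (auto simp: Cons.prems(3) card_Diff_singleton_if)
qed

lemma decomposition_num_summands: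
  assumes "algebraic_rep M"
  obtains \<sigma>s where "indecomposable_decomposition M \<sigma>s" "num_summands M = length \<sigma>s"
  using someI_ex[OF indecomposable_decomposition_exists[OF assms]] unfolding num_summands_def by blast

lemma orth_idems_dims:
  assumes "orth_idems M I e" "i \<in> I"
  shows "dim_row (e i) = rep_dim M" "dim_col (e i) = rep_dim M"
  using assms unfolding orth_idems_def by (blast dest: rep_hom_dims)+

lemma orth_idems_transport:
  assumes alg: "algebraic_rep M" "algebraic_rep N" and h: "rep_hom N M \<iota>" "rep_hom M N \<pi>"
    and pi: "\<pi> * \<iota> = 1\<^sub>m (rep_dim N)" and e: "orth_idems N I e"
  shows "orth_idems M I (\<lambda>i. \<iota> * (e i * \<pi>))"
proof -
  note [simp] = h[THEN rep_hom_dims(1)] h[THEN rep_hom_dims(2)]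
  have de [simp]: "dim_row (e j) = rep_dim N" "dim_col (e j) = rep_dim N" if "j \<in> I" for j
    using orth_idems_dims[OF e] that by auto
  have m: "\<iota> * (e i * \<pi>) * (\<iota> * (e j * \<pi>)) = \<iota> * (e i * e j * \<pi>)" if "i \<in> I" "j \<in> I" for i j
    using that by (simp add: mat_mult_assoc cancel_mid[OF pi])
  show ?thesis
    unfolding orth_idems_def
  proof (intro ballI conjI impI)
    fix i assume i: "i \<in> I"
    have ei: "rep_hom N N (e i)" "e i * e i = e i" "e i \<noteq> 0\<^sub>m (rep_dim N) (rep_dim N)"
      using e i by (auto simp: orth_idems_def)
    show "rep_hom M M (\<iota> * (e i * \<pi>))" using alg h ei by (blast intro: rep_hom_comp)
    show "\<iota> * (e i * \<pi>) * (\<iota> * (e i * \<pi>)) = \<iota> * (e i * \<pi>)" using m[OF i i] ei by simp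
    show "\<iota> * (e i * \<pi>) \<noteq> 0\<^sub>m (rep_dim M) (rep_dim M)"
    proof
      assume z: "\<iota> * (e i * \<pi>) = 0\<^sub>m (rep_dim M) (rep_dim M)"
      have "e i = \<pi> * (\<iota> * (e i * \<pi>)) * \<iota>" using i by (simp add: mat_mult_assoc cancel_mid[OF pi] pi)
      also have "\<dots> = 0\<^sub>m (rep_dim N) (rep_dim N)" unfolding z by simp
      finally show False using ei by blast
    qed
    fix j assume j: "j \<in> I" "i \<noteq> j"
    then have "e i * e j = 0\<^sub>m (rep_dim N) (rep_dim N)" using e i by (auto simp: orth_idems_def)
    then show "\<iota> * (e i * \<pi>) * (\<iota> * (e j * \<pi>)) = 0\<^sub>m (rep_dim M) (rep_dim M)"
      using m[OF i j(1)] by simp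
  qed
qed

text \<open>The source of the lower bounds: any orthogonal family counts, whichever decomposition
  \<open>num_summands\<close> has chosen.\<close>

lemma card_le_num_summands:
  assumes alg: "algebraic_rep M" and e: "orth_idems M I e" "finite I"
  shows "card I \<le> num_summands M"
proof -
  obtain \<sigma>s where s: "indecomposable_decomposition M \<sigma>s" "num_summands M = length \<sigma>s"
    by (rule decomposition_num_summands[OF alg])
  then have ind: "\<forall>\<sigma>\<in>set \<sigma>s. indecomposable \<sigma>" and iso: "rep_iso M (direct_sum \<sigma>s)"
    by (auto simp: indecomposable_decomposition_def)
  have algD: "algebraic_rep (direct_sum \<sigma>s)"
    using ind by (intro algebraic_rep_direct_sum) (auto simp: indecomposable_def)
  obtain A B where "rep_hom M (direct_sum \<sigma>s) A" "rep_hom (direct_sum \<sigma>s) M B" "B * A = 1\<^sub>m (rep_dim M)"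
    using iso rep_iso_iff[OF alg algD] by blast
  from orth_idems_transport[OF algD alg this e(1)]
  show ?thesis using card_orth_idems_le[OF ind _ e(2)] s by auto
qed

lemma orth_idems_direct_sum:
  assumes "\<forall>\<sigma>\<in>set \<sigma>s. indecomposable \<sigma>"
  shows "\<exists>e. orth_idems (direct_sum \<sigma>s) {..<length \<sigma>s} e"
  using assms
proof (induction \<sigma>s)
  case Nil
  then show ?case by (auto simp: orth_idems_def)
next
  case (Cons Y \<sigma>s)
  let ?M = "direct_sum (Y # \<sigma>s)" and ?M' = "direct_sum \<sigma>s"
  have Y: "algebraic_rep Y" "rep_dim Y > 0" using Cons.prems by (auto simp: indecomposable_def)
  have as: "\<forall>\<sigma>\<in>set \<sigma>s. algebraic_rep \<sigma>" using Cons.prems by (auto simp: indecomposable_def)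
  have algM: "algebraic_rep ?M" "algebraic_rep ?M'" using Y as by (auto intro!: algebraic_rep_direct_sum)
  have "biprod ?M Y ?M'" using biprod_direct_sum_append[of "[Y]" \<sigma>s] Y as by simp
  then obtain \<iota> \<pi> \<iota>' \<pi>' where b: "rep_hom Y ?M \<iota>" "rep_hom ?M Y \<pi>" "rep_hom ?M' ?M \<iota>'" "rep_hom ?M ?M' \<pi>'"
     "\<pi> * \<iota> = 1\<^sub>m (rep_dim Y)" "\<pi>' * \<iota>' = 1\<^sub>m (rep_dim ?M')"
     "\<pi> * \<iota>' = 0\<^sub>m (rep_dim Y) (rep_dim ?M')" "\<pi>' * \<iota> = 0\<^sub>m (rep_dim ?M') (rep_dim Y)"
    unfolding biprod_def by blast
  note [simp] = b(1-4)[THEN rep_hom_dims(1)] b(1-4)[THEN rep_hom_dims(2)]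
  obtain e where e: "orth_idems ?M' {..<length \<sigma>s} e" using Cons by auto
  have "(1\<^sub>m (rep_dim Y) :: 'a mat) \<noteq> 0\<^sub>m (rep_dim Y) (rep_dim Y)"
    using Y(2) by (metis index_one_mat(1) index_zero_mat(1) zero_neq_one)
  then have "orth_idems Y {()} (\<lambda>_. 1\<^sub>m (rep_dim Y))"
    using Y by (auto simp: orth_idems_def rep_hom_one)
  note t1 = orth_idems_transport[OF algM(1) Y(1) b(1,2,5) this]
  note t2 = orth_idems_transport[OF algM b(3,4,6) e]
  have de [simp]: "dim_row (e j) = rep_dim ?M'" "dim_col (e j) = rep_dim ?M'" if "j < length \<sigma>s" for j
    using orth_idems_dims[OF e] that by auto
  define f where "f i = (case i of 0 \<Rightarrow> \<iota> * (1\<^sub>m (rep_dim Y) * \<pi>) | Suc j \<Rightarrow> \<iota>' * (e j * \<pi>'))" for i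
  have "orth_idems ?M {..<length (Y # \<sigma>s)} f"
    unfolding orth_idems_def
  proof (intro ballI)
    fix i assume i: "i \<in> {..<length (Y # \<sigma>s)}"
    have z1: "\<iota> * \<pi> * (\<iota>' * (e j * \<pi>')) = 0\<^sub>m (rep_dim ?M) (rep_dim ?M)"
       "\<iota>' * (e j * \<pi>') * (\<iota> * \<pi>) = 0\<^sub>m (rep_dim ?M) (rep_dim ?M)" if "j < length \<sigma>s" for j
      using that by (simp_all add: mat_mult_assoc cancel_mid_zero[OF b(7)] cancel_mid_zero[OF b(8)])
    show "rep_hom ?M ?M (f i) \<and> f i \<noteq> 0\<^sub>m (rep_dim ?M) (rep_dim ?M) \<and> f i * f i = f i \<and>
       (\<forall>j\<in>{..<length (Y # \<sigma>s)}. i \<noteq> j \<longrightarrow> f i * f j = 0\<^sub>m (rep_dim ?M) (rep_dim ?M))"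
      using i t1 t2 z1 by (auto simp: f_def orth_idems_def split: nat.splits)
  qed
  then show ?case by blast
qed

lemma orth_idems_num_summands:
  assumes alg: "algebraic_rep M"
  shows "\<exists>e. orth_idems M {..<num_summands M} e"
proof -
  obtain \<sigma>s where s: "indecomposable_decomposition M \<sigma>s" "num_summands M = length \<sigma>s"
    by (rule decomposition_num_summands[OF alg])
  then have ind: "\<forall>\<sigma>\<in>set \<sigma>s. indecomposable \<sigma>" and iso: "rep_iso M (direct_sum \<sigma>s)"
    by (auto simp: indecomposable_decomposition_def)
  have algD: "algebraic_rep (direct_sum \<sigma>s)"
    using ind by (intro algebraic_rep_direct_sum) (auto simp: indecomposable_def)
  obtain A B where "rep_hom (direct_sum \<sigma>s) M B" "rep_hom M (direct_sum \<sigma>s) A" "A * B = 1\<^sub>m (rep_dim (direct_sum \<sigma>s))"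
    using iso rep_iso_iff[OF alg algD] by blast
  from orth_idems_transport[OF alg algD this]
  show ?thesis using orth_idems_direct_sum[OF ind] s by auto
qed

text \<open>Orthogonal retracts embed jointly as a direct sum, but the sum is not formed and need
  not exhaust \<open>M\<close>.\<close>

definition orth_family :: "'a :: field rep \<Rightarrow> 'i set \<Rightarrow> ('i \<Rightarrow> 'a rep) \<Rightarrow> bool" where
  "orth_family M I N \<longleftrightarrow> (\<exists>\<iota> \<pi>. \<forall>i\<in>I. rep_hom (N i) M (\<iota> i) \<and> rep_hom M (N i) (\<pi> i) \<and>
     (\<forall>j\<in>I. \<pi> i * \<iota> j = (if i = j then 1\<^sub>m (rep_dim (N i)) else 0\<^sub>m (rep_dim (N i)) (rep_dim (N j)))))"

text \<open>Every member contributes as many idempotents as it has summands; those of different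
  members are orthogonal because the members are.\<close>

lemma num_summands_orth_family:
  assumes alg: "algebraic_rep M" "\<And>i. i \<in> I \<Longrightarrow> algebraic_rep (N i)" and fin: "finite I"
    and "orth_family M I N"
  shows "(\<Sum>i\<in>I. num_summands (N i)) \<le> num_summands M"
proof -
  obtain \<iota> \<pi> where h: "\<And>i. i \<in> I \<Longrightarrow> rep_hom (N i) M (\<iota> i)" "\<And>i. i \<in> I \<Longrightarrow> rep_hom M (N i) (\<pi> i)"
    "\<And>i. i \<in> I \<Longrightarrow> \<pi> i * \<iota> i = 1\<^sub>m (rep_dim (N i))"
    "\<And>i j. i \<in> I \<Longrightarrow> j \<in> I \<Longrightarrow> i \<noteq> j \<Longrightarrow> \<pi> i * \<iota> j = 0\<^sub>m (rep_dim (N i)) (rep_dim (N j))"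
    using assms(4) unfolding orth_family_def by (metis (full_types))
  have "\<forall>i\<in>I. \<exists>e. orth_idems (N i) {..<num_summands (N i)} e"
    using alg(2) orth_idems_num_summands by blast
  then obtain e where e: "\<And>i. i \<in> I \<Longrightarrow> orth_idems (N i) {..<num_summands (N i)} (e i)" by metis
  have [simp]: "dim_row (e i k) = rep_dim (N i)" "dim_col (e i k) = rep_dim (N i)" if "i \<in> I" "k < num_summands (N i)" for i k
    using orth_idems_dims[OF e[OF that(1)]] that(2) by auto
  have [simp]: "dim_row (\<iota> i) = rep_dim M" "dim_col (\<iota> i) = rep_dim (N i)"
    "dim_row (\<pi> i) = rep_dim (N i)" "dim_col (\<pi> i) = rep_dim M" if "i \<in> I" for i
    using h(1,2)[OF that] by (auto simp: rep_hom_dims)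
  let ?f = "\<lambda>(i, k). \<iota> i * (e i k * \<pi> i)"
  let ?I = "SIGMA i:I. {..<num_summands (N i)}"
  have t: "orth_idems M {..<num_summands (N i)} (\<lambda>k. \<iota> i * (e i k * \<pi> i))" if "i \<in> I" for i
    using orth_idems_transport[OF alg h(1-3) e] that by blast
  have "orth_idems M ?I ?f"
    unfolding orth_idems_def
  proof (intro ballI)
    fix p assume p: "p \<in> ?I"
    then obtain i k where ik: "p = (i, k)" "i \<in> I" "k < num_summands (N i)" by auto
    have "?f p * ?f q = 0\<^sub>m (rep_dim M) (rep_dim M)" if q: "q \<in> ?I" "p \<noteq> q" for q
    proof -
      obtain j l where jl: "q = (j, l)" "j \<in> I" "l < num_summands (N j)" using q by auto
      show ?thesis
      proof (cases "i = j")
        case True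
        then show ?thesis using t[OF ik(2)] ik jl q by (auto simp: orth_idems_def)
      next
        case False
        then show ?thesis using ik jl cancel_mid_zero[OF h(4)[OF ik(2) jl(2) False]]
          by (simp add: mat_mult_assoc)
      qed
    qed
    then show "rep_hom M M (?f p) \<and> ?f p \<noteq> 0\<^sub>m (rep_dim M) (rep_dim M) \<and> ?f p * ?f p = ?f p \<and>
      (\<forall>q\<in>?I. p \<noteq> q \<longrightarrow> ?f p * ?f q = 0\<^sub>m (rep_dim M) (rep_dim M))"
      using t[OF ik(2)] ik by (auto simp: orth_idems_def)
  qed
  from card_le_num_summands[OF alg(1) this] fin show ?thesis by simp
qed

lemma orth_family_tensor:
  assumes alg: "algebraic_rep M" "\<And>i. i \<in> I \<Longrightarrow> algebraic_rep (N i)" "algebraic_rep L" "algebraic_rep L'"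
    and "orth_family M I N"
  shows "orth_family (tensor L (tensor M L')) I (\<lambda>i. tensor L (tensor (N i) L'))"
proof -
  obtain \<iota> \<pi> where h: "\<And>i. i \<in> I \<Longrightarrow> rep_hom (N i) M (\<iota> i)" "\<And>i. i \<in> I \<Longrightarrow> rep_hom M (N i) (\<pi> i)"
    "\<And>i j. i \<in> I \<Longrightarrow> j \<in> I \<Longrightarrow> \<pi> i * \<iota> j = (if i = j then 1\<^sub>m (rep_dim (N i)) else 0\<^sub>m (rep_dim (N i)) (rep_dim (N j)))"
    using assms(5) unfolding orth_family_def by blast
  let ?k = "\<lambda>A. kronecker (1\<^sub>m (rep_dim L)) (kronecker A (1\<^sub>m (rep_dim L')))"
  have "rep_hom (tensor L (tensor (N i) L')) (tensor L (tensor M L')) (?k (\<iota> i))"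
    "rep_hom (tensor L (tensor M L')) (tensor L (tensor (N i) L')) (?k (\<pi> i))" if "i \<in> I" for i
    using h(1,2)[OF that] alg that by (auto intro!: rep_hom_tensor rep_hom_one)
  moreover have "?k (\<pi> i) * ?k (\<iota> j) = (if i = j then 1\<^sub>m (rep_dim (tensor L (tensor (N i) L'))) else
     0\<^sub>m (rep_dim (tensor L (tensor (N i) L'))) (rep_dim (tensor L (tensor (N j) L'))))" if "i \<in> I" "j \<in> I" for i j
    using h(3)[OF that] rep_hom_dims[OF h(1)[OF that(2)]] rep_hom_dims[OF h(2)[OF that(1)]]
    by (auto simp: kronecker_mult[symmetric])
  ultimately show ?thesis
    unfolding orth_family_def
    by (intro exI[of _ "\<lambda>i. ?k (\<iota> i)"] exI[of _ "\<lambda>i. ?k (\<pi> i)"] ballI conjI) simp_all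
qed

lemma num_summands_retract:
  assumes "algebraic_rep M" "algebraic_rep N" "retract M N"
  shows "num_summands N \<le> num_summands M"
proof -
  obtain \<iota> \<pi> where "rep_hom N M \<iota>" "rep_hom M N \<pi>" "\<pi> * \<iota> = 1\<^sub>m (rep_dim N)"
    using assms unfolding retract_def by blast
  from orth_idems_transport[OF assms(1,2) this] orth_idems_num_summands[OF assms(2)]
  obtain e where "orth_idems M {..<num_summands N} e" by blast
  from card_le_num_summands[OF assms(1) this] show ?thesis by simp
qed

lemma num_summands_pos:
  assumes "algebraic_rep M" "rep_dim M > 0"
  shows "num_summands M \<ge> 1"
proof -
  have "(1\<^sub>m (rep_dim M) :: 'a mat) \<noteq> 0\<^sub>m (rep_dim M) (rep_dim M)"
    using assms(2) by (metis index_one_mat(1) index_zero_mat(1) zero_neq_one)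
  then have "orth_idems M {()} (\<lambda>_. 1\<^sub>m (rep_dim M))"
    using assms by (auto simp: orth_idems_def rep_hom_one)
  from card_le_num_summands[OF assms(1) this] show ?thesis by simp
qed

section \<open>Frobenius twists\<close>

definition frob :: "'a :: field mat \<Rightarrow> 'a mat" where
  "frob g = map_mat (\<lambda>x. x ^ 2) g"

definition twist :: "'a :: field rep \<Rightarrow> 'a rep" where
  "twist \<rho> = (\<lambda>g. \<rho> (frob g))"

lemma twist_tensor: "twist (tensor \<rho> \<sigma>) = tensor (twist \<rho>) (twist \<sigma>)"
  by (simp add: twist_def tensor_def)

lemma twist_trivial [simp]: "twist trivial_rep = trivial_rep"
  by (simp add: twist_def trivial_rep_def)

lemma frob_one [simp]: "frob (1\<^sub>m n) = 1\<^sub>m n"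
  by (rule eq_matI) (auto simp: frob_def)

lemma rep_dim_twist [simp]: "rep_dim (twist \<rho>) = rep_dim \<rho>"
  by (simp add: rep_dim_def twist_def)

definition natural_rep :: "'a :: field rep" where
  "natural_rep = (\<lambda>g. g)"

lemma rep_dim_natural [simp]: "rep_dim natural_rep = 2"
  by (simp add: rep_dim_def natural_rep_def)

lemma algebraic_rep_natural [simp]: "algebraic_rep natural_rep"
proof (rule algebraic_repI)
  show "regular_mat 2 2 natural_rep"
    unfolding regular_mat_def natural_rep_def
    by (auto simp: SL2_def intro!: bexI[OF _ regular_functions.entry])
qed (auto simp: natural_rep_def)

locale char_two =
  fixes ty :: "'a :: alg_closed_field itself"
  assumes two_eq_zero: "(2 :: 'a) = 0"
begin

lemma add_self [simp]: "x + x = 0" for x :: 'a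
  using two_eq_zero by (metis mult_2 mult_zero_left)

lemma uminus_eq: "- x = x" for x :: 'a
  by (metis add_self add_eq_0_iff)

lemma square_add: "(x + y) ^ 2 = x ^ 2 + y ^ 2" for x y :: 'a
  by (simp add: power2_sum two_eq_zero)

lemma square_hom: "comm_ring_hom (\<lambda>x :: 'a. x ^ 2)"
  by unfold_locales (auto simp: square_add power_mult_distrib)

lemma square_inj: "x ^ 2 = y ^ 2 \<longleftrightarrow> x = y" for x y :: 'a
  by (metis power2_eq_iff uminus_eq)

lemma square_root_exists: "\<exists>y. y ^ 2 = x" for x :: 'a
  using nth_root_exists[of 2 x] by auto

lemma frob_SL2 [simp]: "g \<in> SL2 \<Longrightarrow> frob g \<in> SL2" for g :: "'a mat"
  using comm_ring_hom.hom_det[OF square_hom, of g] by (auto simp: SL2_def frob_def)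

lemma frob_mult:
  "g \<in> SL2 \<Longrightarrow> h \<in> SL2 \<Longrightarrow> frob (g * h) = frob g * frob h" for g h :: "'a mat"
  using semiring_hom.mat_hom_mult[OF comm_ring_hom.axioms(1)[OF square_hom, THEN ring_hom.axioms(1)]]
  by (auto simp: SL2_def frob_def)

text \<open>Entrywise square roots work: the determinant of the root squares to 1, and squaring is
  injective. Surjectivity lets maps between twists descend to maps between the original
  modules.\<close>

lemma frob_surj: "g \<in> SL2 \<Longrightarrow> \<exists>h\<in>SL2. frob h = g" for g :: "'a mat"
proof -
  assume g: "g \<in> SL2"
  define r where "r x = (SOME y. y ^ 2 = x)" for x :: 'a
  have r: "r x ^ 2 = x" for x
    unfolding r_def using someI_ex[OF square_root_exists] .
  let ?h = "map_mat r g"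
  have f: "frob ?h = g" by (rule eq_matI) (auto simp: frob_def r)
  have "det g = (det ?h) ^ 2"
    using comm_ring_hom.hom_det[OF square_hom, of ?h] f by (simp add: frob_def)
  then have "(det ?h) ^ 2 = 1 ^ 2" using g by (simp add: SL2_def)
  then have "det ?h = 1" unfolding square_inj .
  then have "?h \<in> SL2" using g by (auto simp: SL2_def)
  then show ?thesis using f by blast
qed

lemma algebraic_rep_twist [simp]:
  fixes \<rho> :: "'a rep"
  assumes "algebraic_rep \<rho>"
  shows "algebraic_rep (twist \<rho>)"
proof (rule algebraic_repI)
  have reg: "\<exists>h\<in>regular_functions. \<forall>g\<in>SL2. f (frob g) = h g" if "f \<in> regular_functions" for f :: "'a mat \<Rightarrow> 'a"
    using that
  proof induction
    case (const c)
    then show ?case by (intro bexI[OF _ regular_functions.const[of c]]) auto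
  next
    case (entry i j)
    then show ?case
      by (intro bexI[OF _ regular_functions.mult[OF regular_functions.entry[of i j] regular_functions.entry[of i j]]])
         (auto simp: frob_def SL2_def power2_eq_square)
  next
    case (add f h)
    then obtain f' h' where "f' \<in> regular_functions" "h' \<in> regular_functions"
      "\<forall>g\<in>SL2. f (frob g) = f' g" "\<forall>g\<in>SL2. h (frob g) = h' g" by blast
    then show ?case by (intro bexI[OF _ regular_functions.add[of f' h']]) auto
  next
    case (mult f h)
    then obtain f' h' where "f' \<in> regular_functions" "h' \<in> regular_functions"
      "\<forall>g\<in>SL2. f (frob g) = f' g" "\<forall>g\<in>SL2. h (frob g) = h' g" by blast
    then show ?case by (intro bexI[OF _ regular_functions.mult[of f' h']]) auto
  qed
  show "regular_mat (rep_dim \<rho>) (rep_dim \<rho>) (twist \<rho>)"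
    unfolding twist_def
    using regular_mat_comp[where \<theta> = frob, OF algebraic_rep_regular[OF assms] frob_SL2 reg] by blast
qed (use assms in \<open>auto simp: twist_def frob_mult algebraic_rep_one algebraic_rep_mult\<close>)

lemma rep_hom_twist:
  "rep_hom \<rho> \<sigma> A \<Longrightarrow> rep_hom (twist \<rho>) (twist \<sigma>) A" for \<rho> \<sigma> :: "'a rep"
  by (rule rep_homI) (simp_all add: rep_hom_dims, simp add: twist_def rep_hom_eq)

lemma retract_twist: "retract M N \<Longrightarrow> retract (twist M) (twist N)" for M N :: "'a rep"
  unfolding retract_def by (metis rep_hom_twist rep_dim_twist)

lemma rep_hom_untwist:
  "algebraic_rep \<rho> \<Longrightarrow> algebraic_rep \<sigma> \<Longrightarrow> rep_hom (twist \<rho>) (twist \<sigma>) A \<Longrightarrow> rep_hom \<rho> \<sigma> A" for \<rho> \<sigma> :: "'a rep"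
proof (rule rep_homI)
  fix g :: "'a mat" assume h: "rep_hom (twist \<rho>) (twist \<sigma>) A" and "g \<in> SL2"
  then obtain h' where "h' \<in> SL2" "frob h' = g" using frob_surj by blast
  then show "A * \<rho> g = \<sigma> g * A" using rep_hom_eq[OF h, of h'] by (simp add: twist_def)
qed (auto simp: rep_hom_dims)

text \<open>Idempotents of \<open>N\<close> are equivariant for its twist as well, and tensoring
  them with the identity of a nonzero \<open>L\<close> keeps them nonzero and orthogonal.\<close>

lemma num_summands_tensor_twist:
  fixes N L :: "'a rep"
  assumes alg: "algebraic_rep N" "algebraic_rep L" and "rep_dim L > 0"
  shows "num_summands N \<le> num_summands (tensor L (twist N))"
proof -
  obtain e where e: "orth_idems N {..<num_summands N} e"
    using orth_idems_num_summands[OF alg(1)] by blast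
  have "orth_idems (tensor L (twist N)) {..<num_summands N} (\<lambda>i. kronecker (1\<^sub>m (rep_dim L)) (e i))"
    unfolding orth_idems_def
  proof (intro ballI conjI impI)
    fix i assume i: "i \<in> {..<num_summands N}"
    have ei: "rep_hom N N (e i)" "e i * e i = e i" "e i \<noteq> 0\<^sub>m (rep_dim N) (rep_dim N)"
      using e i by (auto simp: orth_idems_def)
    have d [simp]: "dim_row (e i) = rep_dim N" "dim_col (e i) = rep_dim N" using ei by (auto simp: rep_hom_dims)
    show "rep_hom (tensor L (twist N)) (tensor L (twist N)) (kronecker (1\<^sub>m (rep_dim L)) (e i))"
      using alg ei by (intro rep_hom_tensor rep_hom_one rep_hom_twist) auto
    show "kronecker (1\<^sub>m (rep_dim L)) (e i) * kronecker (1\<^sub>m (rep_dim L)) (e i) = kronecker (1\<^sub>m (rep_dim L)) (e i)"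
      using ei by (simp add: kronecker_mult[symmetric])
    show "kronecker (1\<^sub>m (rep_dim L)) (e i) \<noteq> 0\<^sub>m (rep_dim (tensor L (twist N))) (rep_dim (tensor L (twist N)))"
      using kronecker_eq_zeroD[of "1\<^sub>m (rep_dim L)" "e i" 0 0] ei assms(3) by auto
    fix j assume j: "j \<in> {..<num_summands N}" "i \<noteq> j"
    then have "e i * e j = 0\<^sub>m (rep_dim N) (rep_dim N)" "dim_row (e j) = rep_dim N"
      using e i orth_idems_dims[OF e j(1)] by (auto simp: orth_idems_def)
    then show "kronecker (1\<^sub>m (rep_dim L)) (e i) * kronecker (1\<^sub>m (rep_dim L)) (e j) = 0\<^sub>m (rep_dim (tensor L (twist N))) (rep_dim (tensor L (twist N)))"
      by (simp add: kronecker_mult[symmetric])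
  qed
  from card_le_num_summands[OF _ this] alg show ?thesis by simp
qed

end

section \<open>The tensor cube of the natural module\<close>

lemma less_two: "i < 2 \<longleftrightarrow> i = 0 \<or> i = (1 :: nat)"
  and less_four: "i < 4 \<longleftrightarrow> i = 0 \<or> i = (1 :: nat) \<or> i = 2 \<or> i = 3"
  and less_eight: "i < 8 \<longleftrightarrow> i = 0 \<or> i = (1 :: nat) \<or> i = 2 \<or> i = 3 \<or> i = 4 \<or> i = 5 \<or> i = 6 \<or> i = 7"
  by auto

lemma sum_less_two: "(\<Sum>k<2. f k) = f 0 + f (1 :: nat)"
  and sum_less_four: "(\<Sum>k<4. f k) = f 0 + f (1 :: nat) + f 2 + f 3"
  and sum_less_eight: "(\<Sum>k<8. f k) = f 0 + f (1 :: nat) + f 2 + f 3 + f 4 + f 5 + f 6 + f 7"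
  by (simp_all add: eval_nat_numeral)

lemma det_carrier_one: "A \<in> carrier_mat 1 1 \<Longrightarrow> det A = A $$ (0, 0)"
proof -
  assume A: "A \<in> carrier_mat 1 1"
  then have "upper_triangular A" by auto
  from det_upper_triangular[OF this A] show ?thesis using A by (simp add: diag_mat_def)
qed

lemma det_carrier_two:
  assumes g: "g \<in> carrier_mat 2 2"
  shows "det g = g $$ (0, 0) * g $$ (1, 1) - g $$ (0, 1) * g $$ (1, 0)"
proof -
  have c: "mat_delete g 0 i \<in> carrier_mat 1 1" for i using g by (intro carrier_matI) auto
  have "det g = (\<Sum>j<2. g $$ (0, j) * cofactor g 0 j)"
    using laplace_expansion_row[OF g, of 0] by simp
  also have "\<dots> = g $$ (0, 0) * g $$ (1, 1) - g $$ (0, 1) * g $$ (1, 0)"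
    unfolding sum_less_two cofactor_def det_carrier_one[OF c] using g by (simp add: mat_delete_def)
  finally show ?thesis .
qed

lemma det_two:
  "g \<in> SL2 \<Longrightarrow> g $$ (0, 0) * g $$ (1, 1) - g $$ (0, 1) * g $$ (1, 0) = 1"
  using det_carrier_two[of g] by (auto simp: SL2_def)

text \<open>The symplectic form of the natural module and, below, its dual tensor; in characteristic
  two the minus signs disappear.\<close>

definition ev_mat :: "'a :: field mat" where
  "ev_mat = mat_of_rows_list 4 [[0, 1, 1, 0]]"

definition coev_mat :: "'a :: field mat" where
  "coev_mat = mat_of_rows_list 1 [[0], [1], [1], [0]]"

text \<open>The matrix \<open>square_incl\<close> sends \<open>v \<otimes> w\<^sup>F\<close> to \<open>w \<otimes> v \<otimes> w\<close> for basis vectors \<open>w\<close>. It is equivariant only up to the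
  images of \<open>coev_mat\<close>, which \<open>sym_proj\<close> kills. It serves to prove that \<open>sym_incl\<close> is equivariant.\<close>

definition sym_incl :: "'a :: field mat" where
  "sym_incl = mat_of_rows_list 4 [[1, 0, 0, 0], [0, 0, 1, 0], [0, 0, 1, 0], [0, 1, 0, 0], [0, 0, 1, 0], [0, 1, 0, 0], [0, 1, 0, 0], [0, 0, 0, 1]]"

text \<open>The transpose of \<open>sym_incl\<close>, whose image is the space of symmetric tensors.
  Their product scales the weight spaces by 1 or 3, so in characteristic two it is the
  identity.\<close>

definition sym_proj :: "'a :: field mat" where
  "sym_proj = mat_of_rows_list 8 [[1, 0, 0, 0, 0, 0, 0, 0], [0, 0, 0, 1, 0, 1, 1, 0], [0, 1, 1, 0, 1, 0, 0, 0], [0, 0, 0, 0, 0, 0, 0, 1]]"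

definition square_incl :: "'a :: field mat" where
  "square_incl = mat_of_rows_list 4 [[1, 0, 0, 0], [0, 0, 0, 0], [0, 0, 1, 0], [0, 0, 0, 0], [0, 0, 0, 0], [0, 1, 0, 0], [0, 0, 0, 0], [0, 0, 0, 1]]"

lemma dim_explicit [simp]:
  "dim_row ev_mat = 1" "dim_col ev_mat = 4" "dim_row coev_mat = 4" "dim_col coev_mat = 1"
  "dim_row sym_incl = 8" "dim_col sym_incl = 4" "dim_row sym_proj = 4" "dim_col sym_proj = 8"
  "dim_row square_incl = 8" "dim_col square_incl = 4"
  by (auto simp: ev_mat_def coev_mat_def sym_incl_def sym_proj_def square_incl_def mat_of_rows_list_def)

lemmas explicit_defs = ev_mat_def coev_mat_def sym_incl_def sym_proj_def square_incl_def mat_of_rows_list_def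

lemmas small_mat = mult_index less_two less_four less_eight sum_less_two sum_less_four sum_less_eight

context char_two
begin

lemma det_two': "g \<in> SL2 \<Longrightarrow> g $$ (0, 0) * g $$ (Suc 0, Suc 0) + g $$ (0, Suc 0) * g $$ (Suc 0, 0) = 1" for g :: "'a mat"
  using det_two[of g] by (metis One_nat_def diff_conv_add_uminus uminus_eq)

lemma ev_hom: "rep_hom (tensor natural_rep natural_rep) trivial_rep (ev_mat :: 'a mat)"
proof (rule rep_homI)
  fix g :: "'a mat" assume g: "g \<in> SL2"
  then have [simp]: "dim_row g = 2" "dim_col g = 2" by (auto simp: SL2_def)
  show "ev_mat * tensor natural_rep natural_rep g = trivial_rep g * ev_mat"
    unfolding tensor_def natural_rep_def trivial_rep_def
    using det_two'[OF g]
    by (intro eq_matI) (auto simp: small_mat explicit_defs mult.commute add.commute simp del: index_mult_mat(1))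
qed auto

lemma coev_hom: "rep_hom trivial_rep (tensor natural_rep natural_rep) (coev_mat :: 'a mat)"
proof (rule rep_homI)
  fix g :: "'a mat" assume g: "g \<in> SL2"
  then have [simp]: "dim_row g = 2" "dim_col g = 2" by (auto simp: SL2_def)
  show "coev_mat * trivial_rep g = tensor natural_rep natural_rep g * coev_mat"
    unfolding tensor_def natural_rep_def trivial_rep_def
    using det_two'[OF g]
    by (intro eq_matI) (auto simp: small_mat explicit_defs mult.commute add.commute simp del: index_mult_mat(1))
qed auto

lemma snake:
  "kronecker ev_mat (1\<^sub>m 2) * kronecker (1\<^sub>m 2) coev_mat = (1\<^sub>m 2 :: 'a mat)"
  "kronecker (1\<^sub>m 2) ev_mat * kronecker coev_mat (1\<^sub>m 2) = (1\<^sub>m 2 :: 'a mat)"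
  by (rule eq_matI; auto simp: small_mat explicit_defs two_eq_zero simp del: index_mult_mat(1))+

text \<open>Both composites contain the loop \<open>ev_mat * coev_mat\<close>, whose value is 2 = 0.
  Together with \<open>snake\<close> this dictates the crossed pairing of inclusions and projections
  in \<open>cube_family\<close>.\<close>

lemma ev_coev:
  "kronecker ev_mat (1\<^sub>m 2) * kronecker coev_mat (1\<^sub>m 2) = (0\<^sub>m 2 2 :: 'a mat)"
  "kronecker (1\<^sub>m 2) ev_mat * kronecker (1\<^sub>m 2) coev_mat = (0\<^sub>m 2 2 :: 'a mat)"
  by (rule eq_matI; auto simp: small_mat explicit_defs two_eq_zero simp del: index_mult_mat(1))+

lemma sym_relations:
  "sym_proj * sym_incl = (1\<^sub>m 4 :: 'a mat)"
  "sym_proj * square_incl = (1\<^sub>m 4 :: 'a mat)"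
  "sym_proj * kronecker (1\<^sub>m 2) coev_mat = (0\<^sub>m 4 2 :: 'a mat)"
  "sym_proj * kronecker coev_mat (1\<^sub>m 2) = (0\<^sub>m 4 2 :: 'a mat)"
  "kronecker ev_mat (1\<^sub>m 2) * sym_incl = (0\<^sub>m 2 4 :: 'a mat)"
  "kronecker (1\<^sub>m 2) ev_mat * sym_incl = (0\<^sub>m 2 4 :: 'a mat)"
  by (rule eq_matI; auto simp: small_mat explicit_defs two_eq_zero simp del: index_mult_mat(1))+

text \<open>The three pieces, of dimensions 2, 2 and 4, exhaust the cube. This serves twice: to make
  the third idempotent equivariant, and to generate tensor powers by words.\<close>

lemma cube_complete:
  "kronecker (1\<^sub>m 2) coev_mat * kronecker ev_mat (1\<^sub>m 2) +
     (kronecker coev_mat (1\<^sub>m 2) * kronecker (1\<^sub>m 2) ev_mat + sym_incl * sym_proj) = (1\<^sub>m 8 :: 'a mat)"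
  by (rule eq_matI; auto simp: small_mat explicit_defs two_eq_zero simp del: index_mult_mat(1))

text \<open>Squaring is additive up to cross terms, here of the form
  \<open>x \<otimes> v \<otimes> y + y \<otimes> v \<otimes> x\<close> for the basis
  \<open>x\<close>, \<open>y\<close>. In characteristic two this is the sum of the images of
  \<open>v\<close> under the two coevaluations.\<close>

lemma square_incl_almost_equivariant:
  fixes g :: "'a mat"
  assumes "g \<in> SL2"
  shows "kronecker g (kronecker g g) * square_incl = square_incl * kronecker g (frob g) +
    (kronecker (1\<^sub>m 2) coev_mat + kronecker coev_mat (1\<^sub>m 2)) *
      mat 2 4 (\<lambda>(r, c). g $$ (0, c mod 2) * g $$ (1, c mod 2) * g $$ (r, c div 2))"
proof -
  have [simp]: "dim_row g = 2" "dim_col g = 2" using assms by (auto simp: SL2_def)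
  show ?thesis
    by (rule eq_matI; auto simp: small_mat explicit_defs frob_def power2_eq_square mult_ac simp del: index_mult_mat(1))
qed

end

text \<open>The ideal of maps that factor through a finite direct sum of members of
  \<open>\<X>\<close>, presented as sums of composites so that the direct sums need not be
  formed.\<close>

inductive thru :: "'a :: field rep set \<Rightarrow> 'a rep \<Rightarrow> 'a rep \<Rightarrow> 'a mat \<Rightarrow> bool" for \<X> \<rho> \<sigma> where
  thru_zero: "thru \<X> \<rho> \<sigma> (0\<^sub>m (rep_dim \<sigma>) (rep_dim \<rho>))"
| thru_add: "thru \<X> \<rho> \<sigma> A \<Longrightarrow> X \<in> \<X> \<Longrightarrow> rep_hom \<rho> X \<alpha> \<Longrightarrow> rep_hom X \<sigma> \<beta> \<Longrightarrow> thru \<X> \<rho> \<sigma> (A + \<beta> * \<alpha>)"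

lemma thru_dims:
  assumes "thru \<X> \<rho> \<sigma> A"
  shows "dim_row A = rep_dim \<sigma>" "dim_col A = rep_dim \<rho>"
  using assms by (induction) (auto simp: rep_hom_dims)

lemma thru_single:
  assumes "X \<in> \<X>" "rep_hom \<rho> X \<alpha>" "rep_hom X \<sigma> \<beta>"
  shows "thru \<X> \<rho> \<sigma> (\<beta> * \<alpha>)"
  using thru_add[OF thru_zero assms] assms by (simp add: rep_hom_dims)

lemma thru_plus:
  assumes "thru \<X> \<rho> \<sigma> B" "thru \<X> \<rho> \<sigma> A"
  shows "thru \<X> \<rho> \<sigma> (A + B)"
  using assms(1)
proof induction
  case thru_zero
  then show ?case using assms(2) by (simp add: thru_dims)
next
  case (thru_add B X \<alpha> \<beta>)
  have "A + (B + \<beta> * \<alpha>) = (A + B) + \<beta> * \<alpha>"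
    using thru_add thru_dims[OF assms(2)] thru_dims[OF thru_add(1)]
    by (intro eq_matI) (auto simp: rep_hom_dims simp del: index_mult_mat(1))
  then show ?case using thru.thru_add thru_add by metis
qed

lemma thru_comp:
  assumes alg: "algebraic_rep \<rho>" "algebraic_rep \<sigma>" "algebraic_rep \<rho>'" "algebraic_rep \<sigma>'" "\<And>X. X \<in> \<X> \<Longrightarrow> algebraic_rep X"
    and "rep_hom \<rho>' \<rho> C" "rep_hom \<sigma> \<sigma>' D" "thru \<X> \<rho> \<sigma> A"
  shows "thru \<X> \<rho>' \<sigma>' (D * A * C)"
  using assms(8)
proof induction
  case thru_zero
  then show ?case using assms(6,7) by (simp add: rep_hom_dims thru.thru_zero)
next
  case (thru_add A X \<alpha> \<beta>)
  have "D * (A + \<beta> * \<alpha>) * C = D * A * C + (D * \<beta>) * (\<alpha> * C)"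
    using thru_add assms(6,7) thru_dims[OF thru_add(1)] by (simp add: mat_ring rep_hom_dims)
  moreover have "rep_hom \<rho>' X (\<alpha> * C)" "rep_hom X \<sigma>' (D * \<beta>)"
    using thru_add assms by (blast intro: rep_hom_comp)+
  ultimately show ?case using thru.thru_add thru_add by metis
qed

lemma thru_trans:
  assumes alg: "algebraic_rep \<rho>" "algebraic_rep \<sigma>" "\<And>X. X \<in> \<X> \<Longrightarrow> algebraic_rep X" "\<And>Y. Y \<in> \<Y> \<Longrightarrow> algebraic_rep Y"
    and id: "\<And>X. X \<in> \<X> \<Longrightarrow> thru \<Y> X X (1\<^sub>m (rep_dim X))" and "thru \<X> \<rho> \<sigma> A"
  shows "thru \<Y> \<rho> \<sigma> A"
  using assms(6)
proof induction
  case thru_zero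
  then show ?case by (rule thru.thru_zero)
next
  case (thru_add A X \<alpha> \<beta>)
  have "thru \<Y> \<rho> \<sigma> (\<beta> * 1\<^sub>m (rep_dim X) * \<alpha>)"
    using thru_comp[OF alg(3) alg(3) alg(1,2,4)] thru_add id by blast
  then show ?case using thru_plus thru_add by (simp add: rep_hom_dims)
qed

lemma thru_tensor_left:
  assumes alg: "algebraic_rep \<rho>" "algebraic_rep \<sigma>" "algebraic_rep L" "\<And>X. X \<in> \<X> \<Longrightarrow> algebraic_rep X"
    and "thru \<X> \<rho> \<sigma> A" "\<And>X. X \<in> \<X> \<Longrightarrow> tensor L X \<in> \<Y>"
  shows "thru \<Y> (tensor L \<rho>) (tensor L \<sigma>) (kronecker (1\<^sub>m (rep_dim L)) A)"
  using assms(5)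
proof induction
  case thru_zero
  then show ?case using thru.thru_zero[of \<Y> "tensor L \<rho>" "tensor L \<sigma>"] by simp
next
  case (thru_add A X \<alpha> \<beta>)
  have "kronecker (1\<^sub>m (rep_dim L)) (A + \<beta> * \<alpha>) = kronecker (1\<^sub>m (rep_dim L)) A +
      kronecker (1\<^sub>m (rep_dim L)) \<beta> * kronecker (1\<^sub>m (rep_dim L)) \<alpha>"
    using thru_add thru_dims[OF thru_add(1)]
    by (simp add: kronecker_add_right kronecker_mult[symmetric] rep_hom_dims)
  moreover have "rep_hom (tensor L \<rho>) (tensor L X) (kronecker (1\<^sub>m (rep_dim L)) \<alpha>)"
    "rep_hom (tensor L X) (tensor L \<sigma>) (kronecker (1\<^sub>m (rep_dim L)) \<beta>)"
    using alg thru_add by (auto intro!: rep_hom_tensor rep_hom_one)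
  ultimately show ?case using thru.thru_add thru_add assms(6) by metis
qed

text \<open>The letter at position \<open>i\<close> is the exponent of \<open>V\<close> in its
  \<open>i\<close>-fold Frobenius twist, so every tensor product of twisted powers of
  \<open>V\<close> is named by its list of exponents.\<close>

fun word_rep :: "nat list \<Rightarrow> 'a :: field rep" where
  "word_rep [] = trivial_rep"
| "word_rep (s # ss) = tensor (tensor_power natural_rep s) (twist (word_rep ss))"

lemma rep_dim_word_rep [simp]: "rep_dim (word_rep ss) = 2 ^ sum_list ss"
  by (induction ss) (auto simp: power_add)

text \<open>Tensor products merge powers of \<open>V\<close> with equal twist. There are no carries,
  so lengths combine by maximum and not by sum.\<close>

fun add_words :: "nat list \<Rightarrow> nat list \<Rightarrow> nat list" where
  "add_words [] ts = ts"
| "add_words ss [] = ss"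
| "add_words (s # ss) (t # ts) = (s + t) # add_words ss ts"

lemma sum_list_add_words [simp]: "sum_list (add_words ss ts) = sum_list ss + sum_list ts"
  by (induction ss ts rule: add_words.induct) auto

lemma length_add_words [simp]: "length (add_words ss ts) = max (length ss) (length ts)"
  by (induction ss ts rule: add_words.induct) auto

context char_two
begin

abbreviation V :: "'a rep" where "V \<equiv> natural_rep"

lemma algebraic_rep_word_rep [simp]: "algebraic_rep (word_rep ss :: 'a rep)"
  by (induction ss) auto

lemma tensor_power_snoc: "tensor (tensor_power \<rho> k) \<rho> = tensor_power \<rho> (Suc k)" for \<rho> :: "'a rep"
  using tensor_power_add[of \<rho> k 1] by (simp add: tensor_power_0 del: tensor_power.simps(1))

lemma tensor_snoc: "tensor (tensor_power \<rho> k) (tensor \<rho> \<sigma>) = tensor (tensor_power \<rho> (Suc k)) \<sigma>" for \<rho> \<sigma> :: "'a rep"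
  by (simp only: tensor_power_snoc[symmetric] tensor_assoc)

lemma cube_homs:
  "rep_hom V (tensor V (tensor V V)) (kronecker (1\<^sub>m 2) coev_mat)"
  "rep_hom V (tensor V (tensor V V)) (kronecker coev_mat (1\<^sub>m 2))"
  "rep_hom (tensor V (tensor V V)) V (kronecker ev_mat (1\<^sub>m 2))"
  "rep_hom (tensor V (tensor V V)) V (kronecker (1\<^sub>m 2) ev_mat)"
  "rep_hom (tensor V (twist V)) (tensor V (tensor V V)) sym_incl"
  "rep_hom (tensor V (tensor V V)) (tensor V (twist V)) sym_proj"
proof -
  let ?K = "tensor V (tensor V V)" and ?T = "tensor V (twist V)"
  have one: "rep_hom V V (1\<^sub>m 2)" using rep_hom_one[of V] by simp
  show 1: "rep_hom V ?K (kronecker (1\<^sub>m 2) coev_mat)"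
    using rep_hom_tensor[OF _ _ _ _ one coev_hom] by simp
  show 2: "rep_hom V ?K (kronecker coev_mat (1\<^sub>m 2))"
    using rep_hom_tensor[OF _ _ _ _ coev_hom one] by (simp add: tensor_assoc)
  show 3: "rep_hom ?K V (kronecker ev_mat (1\<^sub>m 2))"
    using rep_hom_tensor[OF _ _ _ _ ev_hom one] by (simp add: tensor_assoc)
  show 4: "rep_hom ?K V (kronecker (1\<^sub>m 2) ev_mat)"
    using rep_hom_tensor[OF _ _ _ _ one ev_hom] by simp
  let ?P = "kronecker (1\<^sub>m 2) coev_mat * kronecker ev_mat (1\<^sub>m 2) + kronecker coev_mat (1\<^sub>m 2) * kronecker (1\<^sub>m 2) ev_mat :: 'a mat"
  \<comment> \<open>The third idempotent is equivariant as the complement of two equivariant ones,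
    even before its factors are known to be.\<close>
  have "rep_hom ?K ?K (1\<^sub>m 8 - ?P)"
    using 1 2 3 4 rep_hom_one[of ?K] by (intro rep_hom_diff rep_hom_add rep_hom_comp[of ?K V ?K]) auto
  moreover have "sym_incl * sym_proj = 1\<^sub>m 8 - ?P"
    unfolding cube_complete[symmetric] by (rule eq_matI) (auto simp del: index_mult_mat(1) index_kronecker)
  ultimately have e: "rep_hom ?K ?K (sym_incl * sym_proj)" by simp
  show 5: "rep_hom ?T ?K sym_incl"
  proof (rule rep_homI)
    fix g :: "'a mat" assume g: "g \<in> SL2"
    then have [simp]: "dim_row g = 2" "dim_col g = 2" "dim_row (frob g) = 2" "dim_col (frob g) = 2"
      by (auto simp: SL2_def frob_def)
    define D where "D = mat 2 4 (\<lambda>(r, c). g $$ (0, c mod 2) * g $$ (1, c mod 2) * g $$ (r, c div 2))"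
    have [simp]: "dim_row D = 2" "dim_col D = 4" by (simp_all add: D_def)
    have K: "?K g = kronecker g (kronecker g g)" and T: "?T g = kronecker g (frob g)"
      by (simp_all add: tensor_def natural_rep_def twist_def)
    have "?K g * sym_incl = ?K g * (sym_incl * sym_proj) * square_incl"
      using g by (simp add: mat_mult_assoc sym_relations)
    also have "\<dots> = sym_incl * sym_proj * (?K g * square_incl)"
      using g rep_hom_eq[OF e g] by (simp add: mat_mult_assoc[symmetric])
    also have "\<dots> = sym_incl * (sym_proj * square_incl * ?T g +
        (sym_proj * kronecker (1\<^sub>m 2) coev_mat + sym_proj * kronecker coev_mat (1\<^sub>m 2)) * D)"
      unfolding K T square_incl_almost_equivariant[OF g, folded D_def]
      by (simp add: mat_ring)
    also have "\<dots> = sym_incl * ?T g"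
      unfolding sym_relations T by simp
    finally show "sym_incl * ?T g = ?K g * sym_incl" ..
  qed auto
  show "rep_hom ?K ?T sym_proj"
  proof (rule rep_homI)
    fix g :: "'a mat" assume g: "g \<in> SL2"
    have dK: "dim_row (?K g) = 8" "dim_col (?K g) = 8" "dim_row (?T g) = 4" "dim_col (?T g) = 4"
      using algebraic_rep_dims[of ?K g] algebraic_rep_dims[of ?T g] g by auto
    have "sym_proj * ?K g = sym_proj * (sym_incl * sym_proj * ?K g)"
      using dK by (simp add: mat_mult_assoc cancel_mid[OF sym_relations(1)])
    also have "\<dots> = sym_proj * ((?K g * sym_incl) * sym_proj)"
      using dK rep_hom_eq[OF e g] by (simp add: mat_mult_assoc)
    also have "\<dots> = ?T g * sym_proj"
      unfolding rep_hom_eq[OF 5 g, symmetric] using dK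
      by (simp add: mat_mult_assoc cancel_mid[OF sym_relations(1)])
    finally show "sym_proj * ?K g = ?T g * sym_proj" .
  qed auto
qed

text \<open>The inclusion using the coevaluation on one side is paired with the evaluation on the
  other side: crossed pairs give zigzags, uncrossed pairs give loops.\<close>

lemma cube_family:
  "orth_family (tensor V (tensor V V)) {0, 1, 2 :: nat} (\<lambda>i. if i = 2 then tensor V (twist V) else V)"
  unfolding orth_family_def
  by (rule exI[of _ "\<lambda>i. if i = 0 then kronecker (1\<^sub>m 2) coev_mat else if i = 1 then kronecker coev_mat (1\<^sub>m 2) else sym_incl"],
      rule exI[of _ "\<lambda>i. if i = 0 then kronecker ev_mat (1\<^sub>m 2) else if i = 1 then kronecker (1\<^sub>m 2) ev_mat else sym_proj"])
     (simp add: cube_homs snake ev_coev sym_relations)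

text \<open>By Donkin's tensor product formula the word with letters \<open>a_i\<close> is
  \<open>T(n)\<close> for \<open>n\<close> the sum of \<open>a_i * 2^i\<close>; every natural number
  has exactly one expansion with digits 1 and 2.\<close>

definition tilting_words :: "'a rep set" where
  "tilting_words = {word_rep w | w. set w \<subseteq> {1, 2}}"

lemma algebraic_rep_tilting_words: "X \<in> tilting_words \<Longrightarrow> algebraic_rep X"
  by (auto simp: tilting_words_def)

text \<open>The identity lies in the ideal of maps through words, which says that \<open>R\<close>
  is a direct summand of a finite sum of words.\<close>

definition word_generated :: "'a rep \<Rightarrow> bool" where
  "word_generated R \<longleftrightarrow> algebraic_rep R \<and> thru tilting_words R R (1\<^sub>m (rep_dim R))"

lemma word_generated_word_rep:
  assumes "set w \<subseteq> {1, 2}"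
  shows "word_generated (word_rep w)"
proof -
  let ?W = "word_rep w :: 'a rep"
  have "?W \<in> tilting_words" using assms unfolding tilting_words_def by blast
  moreover have "rep_hom ?W ?W (1\<^sub>m (rep_dim ?W))"
    by (rule rep_hom_one) simp
  ultimately have "thru tilting_words ?W ?W (1\<^sub>m (rep_dim ?W) * 1\<^sub>m (rep_dim ?W))"
    by (blast intro: thru_single)
  then show ?thesis by (simp add: word_generated_def)
qed

lemma word_generated_thru:
  assumes "algebraic_rep R" "thru \<X> R R (1\<^sub>m (rep_dim R))" "\<And>X. X \<in> \<X> \<Longrightarrow> word_generated X"
  shows "word_generated R"
  using thru_trans[OF assms(1,1) _ algebraic_rep_tilting_words _ assms(2)] assms(1,3)
  unfolding word_generated_def by blast

text \<open>Completeness of the cube decomposition writes the identity as a sum of three maps, each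
  through one of the modules in \<open>g\<close>.\<close>

lemma word_generated_cube:
  assumes alg: "algebraic_rep L" "algebraic_rep L'"
    and g: "word_generated (tensor L (tensor V L'))" "word_generated (tensor L (tensor (tensor V (twist V)) L'))"
  shows "word_generated (tensor L (tensor (tensor V (tensor V V)) L'))"
proof -
  let ?K = "tensor V (tensor V V)" and ?k = "\<lambda>A :: 'a mat. kronecker (1\<^sub>m (rep_dim L)) (kronecker A (1\<^sub>m (rep_dim L')))"
  let ?R = "tensor L (tensor ?K L')"
  let ?X = "{tensor L (tensor V L'), tensor L (tensor (tensor V (twist V)) L')}"
  have h: "rep_hom (tensor L (tensor N L')) (tensor L (tensor N' L')) (?k A)"
    if "rep_hom N N' A" "algebraic_rep N" "algebraic_rep N'" for N N' A
    using that alg by (intro rep_hom_tensor rep_hom_one) auto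
  have t: "thru ?X ?R ?R (?k B * ?k A)"
    if "rep_hom ?K N A" "rep_hom N ?K B" "N = V \<or> N = tensor V (twist V)" for N A B
  proof (rule thru_single[of "tensor L (tensor N L')"])
    have N: "algebraic_rep N" using that by auto
    show "rep_hom ?R (tensor L (tensor N L')) (?k A)" using that N by (intro h) auto
    show "rep_hom (tensor L (tensor N L')) ?R (?k B)" using that N by (intro h) auto
  qed (use that in auto)
  have k: "?k (A + B) = ?k A + ?k B" if "dim_row A = dim_row B" "dim_col A = dim_col B" for A B :: "'a mat"
    using that by (simp add: kronecker_add_left kronecker_add_right)
  have km: "?k (A * B) = ?k A * ?k B" if "dim_col A = dim_row B" for A B :: "'a mat"
    using that by (simp add: kronecker_mult[symmetric])
  have "1\<^sub>m (rep_dim ?R) = ?k (1\<^sub>m 8)" by (simp add: mult_ac)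
  also have "\<dots> = ?k (kronecker (1\<^sub>m 2) coev_mat) * ?k (kronecker ev_mat (1\<^sub>m 2)) +
     (?k (kronecker coev_mat (1\<^sub>m 2)) * ?k (kronecker (1\<^sub>m 2) ev_mat) + ?k sym_incl * ?k sym_proj)"
    unfolding cube_complete[symmetric] by (simp add: k km)
  finally have "1\<^sub>m (rep_dim ?R) = \<dots>" .
  moreover have "thru ?X ?R ?R \<dots>"
    by (intro thru_plus t[where N = V] t[where N = "tensor V (twist V)"] cube_homs) auto
  ultimately have "thru ?X ?R ?R (1\<^sub>m (rep_dim ?R))" by simp
  then show ?thesis using word_generated_thru[of ?R ?X] alg g by auto
qed

lemma word_generated_tensor_twist:
  assumes "word_generated R" "a = 1 \<or> a = 2"
  shows "word_generated (tensor (tensor_power V a) (twist R))"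
proof -
  have R: "algebraic_rep R" "thru tilting_words R R (1\<^sub>m (rep_dim R))" using assms by (auto simp: word_generated_def)
  have tw: "thru (twist ` \<X>) (twist \<rho>) (twist \<sigma>) A" if "thru \<X> \<rho> \<sigma> A" for \<X> and \<rho> \<sigma> :: "'a rep" and A
    using that
  proof induction
    case thru_zero
    then show ?case using thru.thru_zero[of "twist ` \<X>" "twist \<rho>" "twist \<sigma>"] by simp
  next
    case (thru_add A X \<alpha> \<beta>)
    then show ?case by (blast intro: thru.thru_add rep_hom_twist)
  qed
  have "thru tilting_words (tensor (tensor_power V a) (twist R)) (tensor (tensor_power V a) (twist R))
     (kronecker (1\<^sub>m (rep_dim (tensor_power V a))) (1\<^sub>m (rep_dim R)))"
  proof (rule thru_tensor_left[OF _ _ _ _ tw[OF R(2)]])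
    fix X assume "X \<in> twist ` tilting_words"
    then obtain w where "X = twist (word_rep w)" "set w \<subseteq> {1, 2}" by (auto simp: tilting_words_def)
    then show "tensor (tensor_power V a) X \<in> tilting_words"
      using assms(2) unfolding tilting_words_def by (auto intro!: exI[of _ "a # w"])
  qed (use R algebraic_rep_tilting_words in auto)
  then show ?thesis using R by (simp add: word_generated_def)
qed

text \<open>A cube step on the untwisted exponent \<open>a\<close> lowers it by 2 and raises the
  twisted exponent \<open>c\<close> by 0 or 1, so \<open>2 * c + a\<close> never grows. Once
  \<open>a\<close> is 1 or 2, it is a legal letter, and \<open>c < n\<close> hands the twisted
  factor to the outer induction.\<close>

lemma word_generated_tensor_power: "word_generated (tensor_power V n)"
proof (induction n rule: less_induct)
  case (less n)
  have *: "word_generated (tensor (tensor_power V a) (twist (tensor_power V c)))" if "a \<ge> 1" "2 * c + a \<le> n" for a c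
    using that
  proof (induction a arbitrary: c rule: less_induct)
    case (less a)
    show ?case
    proof (cases "a \<le> 2")
      case True
      then show ?thesis using less.prems \<open>\<And>m. m < n \<Longrightarrow> word_generated (tensor_power V m)\<close>[of c]
        by (intro word_generated_tensor_twist) auto
    next
      case False
      define b where "b = a - 3"
      have a: "a = b + 3" using False by (simp add: b_def)
      have "word_generated (tensor (tensor_power V b) (tensor V (twist (tensor_power V c))))"
        "word_generated (tensor (tensor_power V b) (tensor (tensor V (twist V)) (twist (tensor_power V c))))"
        unfolding tensor_assoc[of V] tensor_snoc twist_tensor[symmetric] tensor_power.simps(2)[of V c, symmetric]
        using less.IH[of "Suc b" c] less.IH[of "Suc b" "Suc c"] less.prems a by auto
      then have "word_generated (tensor (tensor_power V b) (tensor (tensor V (tensor V V)) (twist (tensor_power V c))))"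
        by (intro word_generated_cube) auto
      moreover have "tensor (tensor_power V b) (tensor V (tensor V V)) = tensor_power V a"
        unfolding a tensor_snoc tensor_power_snoc by (simp only: numeral_3_eq_3 add_Suc_right add_0_right)
      ultimately show ?thesis by (simp add: tensor_assoc[symmetric])
    qed
  qed
  show ?case
  proof (cases "n = 0")
    case True
    then show ?thesis using word_generated_word_rep[of "[]"] by (simp add: tensor_power_0 del: tensor_power.simps(1))
  next
    case False
    then show ?thesis using *[of n 0] by (simp add: tensor_power_0 del: tensor_power.simps(1))
  qed
qed

text \<open>Exchanging the two middle factors brings equal twists together; the tails are treated
  inside the twist by induction.\<close>

lemma retract_add_words:
  "retract (tensor (word_rep ss) (word_rep ts)) (word_rep (add_words ss ts) :: 'a rep)"
proof (induction ss ts rule: add_words.induct)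
  case (3 s ss t ts)
  let ?A = "tensor_power V s" and ?B = "tensor_power V t"
    and ?M = "twist (word_rep ss :: 'a rep)" and ?N = "twist (word_rep ts :: 'a rep)"
  have "retract (tensor (tensor ?A ?M) (tensor ?B ?N)) (tensor ?A (tensor (tensor ?B ?M) ?N))"
    unfolding tensor_assoc[of ?A] tensor_assoc[of ?M ?B ?N, symmetric]
    by (intro retract_tensor retract_refl retract_swap) auto
  from retract_trans[OF _ _ _ this]
  have tr: "retract (tensor (tensor ?A ?M) (tensor ?B ?N)) L"
    if "algebraic_rep L" "retract (tensor ?A (tensor (tensor ?B ?M) ?N)) L" for L
    using that by simp
  have "retract (tensor ?A (tensor (tensor ?B ?M) ?N)) (tensor (tensor_power V (s + t)) (twist (word_rep (add_words ss ts))))"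
    unfolding tensor_assoc[of ?B] tensor_power_add tensor_assoc[of ?A ?B]
    using retract_twist[OF 3]
    by (intro retract_tensor retract_refl) (auto simp: twist_tensor)
  from tr[OF _ this] show ?case by simp
qed (auto intro: retract_refl)

end

section \<open>Counting summands\<close>

text \<open>Equal to \<open>2^(-q)\<close> times the sum of
  \<open>binomial(q, i) * f (j + i)\<close>, by Pascal's rule.\<close>

fun avg :: "nat \<Rightarrow> (nat \<Rightarrow> real) \<Rightarrow> nat \<Rightarrow> real" where
  "avg 0 f j = f j"
| "avg (Suc q) f j = (avg q f j + avg q f (Suc j)) / 2"

section \<open>Binomial averages and the numerical recursion\<close>

lemma avg_mono:
  "(\<And>i. j \<le> i \<Longrightarrow> i \<le> j + q \<Longrightarrow> f i \<le> g i) \<Longrightarrow> avg q f j \<le> avg q g j"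
proof (induction q arbitrary: j)
  case (Suc q)
  have "avg q f j \<le> avg q g j" "avg q f (Suc j) \<le> avg q g (Suc j)"
    by (rule Suc.IH, rule Suc.prems, simp_all)+
  then show ?case by simp
qed simp

lemma avg_const: "avg q (\<lambda>_. c) j = c"
  by (induction q arbitrary: j) auto

lemma avg_scale: "avg q (\<lambda>i. c * f i) j = c * avg q f j"
  by (induction q arbitrary: j) (auto simp: algebra_simps add_divide_distrib)

lemma avg_shift: "avg q (\<lambda>i. f (Suc i)) j = avg q f (Suc j)"
  by (induction q arbitrary: j) auto

text \<open>Pairs each index with its neighbour before averaging, so that the odd and the even
  recursion can be used together.\<close>

lemma avg_Suc: "avg (Suc q) f j = avg q (\<lambda>i. (f i + f (Suc i)) / 2) j"
proof (induction q arbitrary: j)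
  case (Suc q)
  show ?case unfolding avg.simps(2)[of "Suc q"] Suc.IH by simp
qed simp

text \<open>Jensen's inequality for the binomial distribution, whose mean is
  \<open>j + q / 2\<close>. Only fair binary steps occur, so midpoint convexity suffices.\<close>

lemma avg_midpoint_convex:
  assumes "\<And>x y. x \<ge> 0 \<Longrightarrow> y \<ge> 0 \<Longrightarrow> f ((x + y) / 2) \<le> (f x + f y) / 2"
  shows "f (real j + real q / 2) \<le> avg q (\<lambda>i. f (real i)) j"
proof (induction q arbitrary: j)
  case (Suc q)
  have "f (real j + real (Suc q) / 2) = f (((real j + real q / 2) + (real (Suc j) + real q / 2)) / 2)"
    by (rule arg_cong[of _ _ f]) (simp add: field_simps)
  also have "\<dots> \<le> (f (real j + real q / 2) + f (real (Suc j) + real q / 2)) / 2"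
    by (rule assms) auto
  also have "\<dots> \<le> avg (Suc q) (\<lambda>i. f (real i)) j"
    using Suc.IH[of j] Suc.IH[of "Suc j"] by simp
  finally show ?case .
qed simp

lemma nonzero_cases: "(s :: nat) \<noteq> 0 \<Longrightarrow> \<exists>q a. s = 2 * q + a \<and> (a = 1 \<or> a = 2)"
  by presburger

text \<open>The inequality between arithmetic and geometric mean, used once inside the decreasing
  power and once for the two powers.\<close>

lemma powr_neg_midpoint:
  fixes x y \<delta> :: real
  assumes "x > 0" "y > 0" "\<delta> \<ge> 0"
  shows "((x + y) / 2) powr (- \<delta>) \<le> (x powr (- \<delta>) + y powr (- \<delta>)) / 2"
proof -
  define a b where "a = x powr (- \<delta> / 2)" and "b = y powr (- \<delta> / 2)"
  have ab: "a ^ 2 = x powr (- \<delta>)" "b ^ 2 = y powr (- \<delta>)"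
    unfolding a_def b_def by (simp_all add: power2_eq_square powr_add[symmetric])
  have "((x + y) / 2) powr (- \<delta>) \<le> (sqrt (x * y)) powr (- \<delta>)"
    using assms arith_geo_mean_sqrt[of x y] by (intro powr_mono2') auto
  also have "sqrt (x * y) powr (- \<delta>) = a * b"
    using assms by (simp add: a_def b_def powr_half_sqrt[symmetric] powr_powr powr_mult)
  also have "a * b \<le> (a ^ 2 + b ^ 2) / 2"
    using sum_squares_bound[of a b] by simp
  finally show ?thesis by (simp add: ab)
qed

text \<open>The constant \<open>1/3\<close> is forced: shifting \<open>j\<close> to \<open>(j - 1) / 4\<close> must be compensated by
  \<open>4 s - 1 = s\<close>. The factor \<open>8/3\<close> is the inverse of the mean of \<open>1/2\<close> and \<open>1/4\<close>.\<close>

lemma avg_recursion_lower_bound: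
  fixes \<eta> :: "nat \<Rightarrow> real"
  assumes \<delta>: "\<delta> \<ge> 0" "4 powr \<delta> = 8 / 3"
    and \<eta>: "\<eta> 0 \<ge> 1" "\<And>q. \<eta> (2 * q + 1) \<ge> avg q \<eta> 0 / 2" "\<And>q. \<eta> (2 * q + 2) \<ge> avg q \<eta> 0 / 4"
  shows "avg j \<eta> 0 \<ge> (1 / 3) powr \<delta> * (real j + 1 / 3) powr (- \<delta>)"
proof (induction j rule: less_induct)
  case (less j)
  let ?c = "(1 / 3) powr \<delta> :: real"
  have c0: "?c \<ge> 0" by simp
  have c1: "?c * (1 / 3) powr (- \<delta>) = 1"
    by (simp add: powr_add[symmetric])
  show ?case
  proof (cases j)
    case 0
    then show ?thesis using \<eta>(1) c1 by simp
  next
    case (Suc m)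
    \<comment> \<open>The target for the mean of two neighbours: 3/8 times the claimed bound at
      \<open>x / 2\<close>, the halving being that from \<open>2 * q + a\<close> to
      \<open>q\<close>.\<close>
    define F where "F x = 3 / 8 * ?c * (x / 2 + 1 / 3) powr (- \<delta>)" for x :: real
    have anti: "(y :: real) powr (- \<delta>) \<le> x powr (- \<delta>)" if "0 < x" "x \<le> y" for x y
      using that \<delta>(1) by (intro powr_mono2') auto
    \<comment> \<open>Of \<open>i\<close> and \<open>i + 1\<close> one is odd and one even, so half
      of 1/2 and half of 1/4 add up to 3/8. Where the two averages differ, both estimates are
      lowered to the later one.\<close>
    have key: "F (real i) \<le> (\<eta> i + \<eta> (Suc i)) / 2" if "i \<le> m" for i
    proof -
      consider "i = 0" | p where "i = 2 * p + 1" | p where "i = 2 * p + 2"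
      proof (cases "even i")
        case True
        then obtain p where "i = 2 * p" by blast
        then show ?thesis using that(1) that(3)[of "p - 1"] by (cases p) auto
      next
        case False
        then show ?thesis using that(2) by (auto elim: oddE)
      qed
      then show ?thesis
      proof cases
        case 1
        \<comment> \<open>At the origin \<open>F\<close> equals 3/8, and \<open>\<eta> 0\<close>
          alone already contributes 1/2.\<close>
        have "\<eta> (Suc 0) \<ge> 0" using \<eta>(2)[of 0] \<eta>(1) by simp
        then show ?thesis using 1 c1 \<eta>(1) by (simp add: F_def)
      next
        case (2 p)
        have IH: "avg p \<eta> 0 \<ge> ?c * (real p + 1 / 3) powr (- \<delta>)"
          using less.IH[of p] 2 \<open>i \<le> m\<close> Suc by simp
        have "F (real i) \<le> 3 / 8 * (?c * (real p + 1 / 3) powr (- \<delta>))"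
          unfolding F_def mult.assoc using 2 c0 by (intro mult_left_mono anti) auto
        also have "\<dots> \<le> 3 / 8 * avg p \<eta> 0" using IH by simp
        also have "\<dots> \<le> (\<eta> i + \<eta> (Suc i)) / 2" using \<eta>(2,3)[of p] 2 by simp
        finally show ?thesis .
      next
        case (3 p)
        have IH: "avg p \<eta> 0 \<ge> ?c * (real p + 1 / 3) powr (- \<delta>)"
          "avg (Suc p) \<eta> 0 \<ge> ?c * (real (Suc p) + 1 / 3) powr (- \<delta>)"
          using less.IH[of p] less.IH[of "Suc p"] 3 \<open>i \<le> m\<close> Suc by simp_all
        have F: "F (real i) = 3 / 8 * (?c * (real (Suc p) + 1 / 3) powr (- \<delta>))"
          unfolding F_def using 3 by (simp add: add_divide_distrib)
        have "?c * (real (Suc p) + 1 / 3) powr (- \<delta>) \<le> ?c * (real p + 1 / 3) powr (- \<delta>)"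
          using c0 by (intro mult_left_mono anti) auto
        then have "3 / 8 * (?c * (real (Suc p) + 1 / 3) powr (- \<delta>)) \<le> avg p \<eta> 0 / 8 + avg (Suc p) \<eta> 0 / 4"
          using IH by linarith
        also have "\<dots> \<le> (\<eta> i + \<eta> (Suc i)) / 2"
          using \<eta>(3)[of p] \<eta>(2)[of "Suc p"] 3 by (simp del: avg.simps)
        finally show ?thesis unfolding F .
      qed
    qed
    have "?c * (real j + 1 / 3) powr (- \<delta>) = F (real 0 + real m / 2)"
    proof -
      have "(real 0 + real m / 2) / 2 + 1 / 3 = (real j + 1 / 3) / 4" using Suc by (simp add: field_simps)
      then have e: "F (real 0 + real m / 2) = ?c * (3 / 8 * ((real j + 1 / 3) / 4) powr (- \<delta>))"
        unfolding F_def by (simp only: mult_ac)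
      have "(t / 4) powr (- \<delta>) = 4 powr \<delta> * t powr (- \<delta>)" if "t \<ge> 0" for t :: real
        using that by (simp add: powr_divide powr_minus field_simps)
      from this[of "real j + 1 / 3"]
      have "3 / 8 * ((real j + 1 / 3) / 4) powr (- \<delta>) = (real j + 1 / 3) powr (- \<delta>)"
        unfolding \<delta>(2) by simp
      then show ?thesis unfolding e by (simp only:)
    qed
    also have "\<dots> \<le> avg m (\<lambda>i. F (real i)) 0"
    proof (rule avg_midpoint_convex)
      fix x y :: real assume xy: "x \<ge> 0" "y \<ge> 0"
      have e: "((x + y) / 2) / 2 + 1 / 3 = ((x / 2 + 1 / 3) + (y / 2 + 1 / 3)) / 2" by (simp add: field_simps)
      have "(((x + y) / 2) / 2 + 1 / 3) powr (- \<delta>) \<le> ((x / 2 + 1 / 3) powr (- \<delta>) + (y / 2 + 1 / 3) powr (- \<delta>)) / 2"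
        unfolding e using xy \<delta>(1) by (intro powr_neg_midpoint) auto
      then have "F ((x + y) / 2) \<le> 3 / 8 * ?c * (((x / 2 + 1 / 3) powr (- \<delta>) + (y / 2 + 1 / 3) powr (- \<delta>)) / 2)"
        unfolding F_def using c0 by (intro mult_left_mono) auto
      then show "F ((x + y) / 2) \<le> (F x + F y) / 2" unfolding F_def by (simp add: algebra_simps)
    qed
    also have "\<dots> \<le> avg m (\<lambda>i. (\<eta> i + \<eta> (Suc i)) / 2) 0"
      by (rule avg_mono) (use key in auto)
    also have "\<dots> = avg j \<eta> 0" unfolding Suc avg_Suc ..
    finally show ?thesis .
  qed
qed

context char_two
begin

text \<open>Each of \<open>q\<close> cube steps removes two factors \<open>V\<close>, leaving a
  factor 2 or one new factor \<open>V\<close> inside the twist. Choosing the latter \<open>j\<close>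
  times gives \<open>binomial(q, j) * 2^(q - j)\<close> copies of the leftover \<open>a\<close>-th
  power tensored with the twist of \<open>V^j \<otimes> N\<close>; in terms of \<open>avg\<close>
  these are the stated weights.\<close>

lemma num_summands_power_twist:
  assumes a: "a = 1 \<or> a = 2" and N: "algebraic_rep N"
  shows "real (num_summands (tensor (tensor_power V (2 * q + a)) (twist N))) \<ge>
    4 ^ q * avg q (\<lambda>j. real (num_summands (tensor (tensor_power V j) N)) / 2 ^ j) 0"
  using N
proof (induction q arbitrary: N)
  case 0
  then show ?case
    using num_summands_tensor_twist[of N "tensor_power V a"] by (simp add: tensor_power_0 del: tensor_power.simps(1))
next
  case (Suc q)
  let ?\<eta> = "\<lambda>N j. real (num_summands (tensor (tensor_power V j) N)) / 2 ^ j"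
  \<comment> \<open>The exponent that remains beside the cube: \<open>b + 3 = 2 * Suc q + a\<close>
    and \<open>b + 1 = 2 * q + a\<close>.\<close>
  define b where "b = 2 * q + a - 1"
  have b: "Suc b = 2 * q + a" using a by (auto simp: b_def)
  let ?B = "tensor_power V b" and ?X = "tensor (tensor_power V (2 * q + a)) (twist N)"
    and ?Y = "tensor (tensor_power V (2 * q + a)) (twist (tensor V N))"
  have alg: "algebraic_rep N" by fact
  have eX: "tensor ?B (tensor V (twist N)) = ?X" unfolding tensor_snoc b ..
  have eY: "tensor ?B (tensor (tensor V (twist V)) (twist N)) = ?Y"
    unfolding tensor_assoc[of V] tensor_snoc b twist_tensor ..
  have eZ: "tensor ?B (tensor (tensor V (tensor V V)) (twist N)) = tensor (tensor_power V (2 * Suc q + a)) (twist N)"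
    unfolding tensor_assoc[of V] tensor_snoc b by simp
  have "(\<Sum>i\<in>{0, 1, 2 :: nat}. num_summands (tensor ?B (tensor (if i = 2 then tensor V (twist V) else V) (twist N))))
     \<le> num_summands (tensor ?B (tensor (tensor V (tensor V V)) (twist N)))"
    by (rule num_summands_orth_family[OF _ _ _ orth_family_tensor[OF _ _ _ _ cube_family]]) (use alg in auto)
  then have le: "2 * real (num_summands ?X) + real (num_summands ?Y) \<le>
      real (num_summands (tensor (tensor_power V (2 * Suc q + a)) (twist N)))"
    by (simp add: eX eY eZ)
  \<comment> \<open>An additional \<open>V\<close> inside the twist shifts \<open>j\<close> by one;
    the factor 2 comes from the normalisation by \<open>2^j\<close>.\<close>
  have "?\<eta> (tensor V N) = (\<lambda>j. 2 * ?\<eta> N (Suc j))"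
    by (rule ext) (simp add: tensor_snoc del: tensor_power.simps)
  then have IHY: "real (num_summands ?Y) \<ge> 4 ^ q * (2 * avg q (?\<eta> N) (Suc 0))"
    using Suc.IH[of "tensor V N"] alg avg_scale[of q 2 "\<lambda>j. ?\<eta> N (Suc j)"] avg_shift[of q "?\<eta> N"] by simp
  have IHX: "real (num_summands ?X) \<ge> 4 ^ q * avg q (?\<eta> N) 0" using Suc by blast
  have "4 ^ Suc q * avg (Suc q) (?\<eta> N) 0 = 2 * (4 ^ q * avg q (?\<eta> N) 0) + 4 ^ q * (2 * avg q (?\<eta> N) (Suc 0))"
    by (simp add: field_simps)
  also have "\<dots> \<le> real (num_summands (tensor (tensor_power V (2 * Suc q + a)) (twist N)))"
    using le IHX IHY by linarith
  finally show ?case .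
qed

lemma num_summands_power_lower_bound:
  assumes \<delta>: "\<delta> \<ge> 0" "4 powr \<delta> = 8 / 3"
  shows "real (num_summands (tensor_power V s)) \<ge> (1 / 3) powr \<delta> / 4 * (real s + 1) powr (- \<delta>) * 2 ^ s"
proof -
  let ?\<eta> = "\<lambda>j. real (num_summands (tensor_power V j)) / 2 ^ j"
  let ?c = "(1 / 3) powr \<delta> :: real"
  have p: "real (num_summands (tensor_power V (2 * q + a))) \<ge> 4 ^ q * avg q ?\<eta> 0" if "a = 1 \<or> a = 2" for q a
    using num_summands_power_twist[OF that, of trivial_rep q] by simp
  have \<eta>0: "?\<eta> 0 \<ge> 1"
    using num_summands_pos[of "trivial_rep :: 'a rep"] by (simp add: tensor_power_0 del: tensor_power.simps(1))
  have L: "avg q ?\<eta> 0 \<ge> ?c * (real q + 1 / 3) powr (- \<delta>)" for q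
  proof (rule avg_recursion_lower_bound[where \<eta> = ?\<eta>, OF \<delta> \<eta>0])
    fix q
    have "?\<eta> (2 * q + 1) \<ge> 4 ^ q * avg q ?\<eta> 0 / 2 ^ (2 * q + 1)"
      using p[of 1 q] by (intro divide_right_mono) auto
    then show "?\<eta> (2 * q + 1) \<ge> avg q ?\<eta> 0 / 2" by (simp add: power_mult)
    have "?\<eta> (2 * q + 2) \<ge> 4 ^ q * avg q ?\<eta> 0 / 2 ^ (2 * q + 2)"
      using p[of 2 q] by (intro divide_right_mono) auto
    then show "?\<eta> (2 * q + 2) \<ge> avg q ?\<eta> 0 / 4" by (simp add: power_mult power_add)
  qed
  have c: "0 \<le> ?c" "?c \<le> 1" using \<delta>(1) by (auto simp: powr_le1)
  show ?thesis
  proof (cases "s = 0")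
    case True
    then show ?thesis using \<eta>0 c by simp
  next
    case False
    obtain q a where s: "s = 2 * q + a" "a = 1 \<or> a = 2"
      using False nonzero_cases by blast
    \<comment> \<open>Attained for \<open>a = 2\<close>; this is the 1/4 in the constant.\<close>
    have le: "(2 :: real) ^ s \<le> 4 * 4 ^ q" using s(2) unfolding s(1) by (auto simp: power_add power_mult)
    have "?c / 4 * (real s + 1) powr (- \<delta>) * 2 ^ s \<le> ?c / 4 * (real q + 1 / 3) powr (- \<delta>) * (4 * 4 ^ q)"
      using c \<delta>(1) s le by (intro mult_mono powr_mono2') auto
    also have "\<dots> = 4 ^ q * (?c * (real q + 1 / 3) powr (- \<delta>))" by simp
    also have "\<dots> \<le> 4 ^ q * avg q ?\<eta> 0" using L[of q] by (intro mult_left_mono) auto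
    also have "\<dots> \<le> real (num_summands (tensor_power V s))" using p[OF s(2), of q] s(1) by simp
    finally show ?thesis .
  qed
qed

text \<open>Only the last letter is treated with the sharp bound; the other ones cost a factor of four each,
  which is harmless because the length of the word will be bounded.\<close>

lemma num_summands_word_lower_bound:
  assumes \<delta>: "\<delta> \<ge> 0" "4 powr \<delta> = 8 / 3"
  shows "real (num_summands (word_rep ss :: 'a rep)) \<ge>
    (1 / 3) powr \<delta> * (1 / 4) ^ length ss * (real (sum_list ss) + 1) powr (- \<delta>) * 2 ^ sum_list ss"
\<comment> \<open>On the length and not on the list: the first two letters are merged into
  \<open>j + t\<close>, giving a shorter word that is no tail of the original.\<close>
proof (induction "length ss" arbitrary: ss)
  case 0
  have "(1 / 3) powr \<delta> \<le> (1 :: real)" using \<delta>(1) by (auto simp: powr_le1)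
  then show ?case using 0 num_summands_pos[of "trivial_rep :: 'a rep"] by simp
next
  case (Suc l)
  let ?c = "(1 / 3) powr \<delta> :: real"
  obtain s ts where ss: "ss = s # ts" using Suc(2) by (cases ss) auto
  show ?case
  proof (cases ts)
    case Nil
    then show ?thesis using num_summands_power_lower_bound[OF \<delta>, of s] ss by simp
  next
    case (Cons t us)
    let ?S = "sum_list ss" and ?T = "sum_list ts"
    \<comment> \<open>The decay is taken at the full letter sum, so one constant serves all
      \<open>j \<le> s\<close> and its binomial average is immediate.\<close>
    define C where "C = ?c * (1 / 4) ^ length ts * (real ?S + 1) powr (- \<delta>) * 2 ^ ?T"
    have C0: "C \<ge> 0" by (simp add: C_def)
    have IH: "real (num_summands (tensor (tensor_power V j) (word_rep ts))) \<ge> C * 2 ^ j" if "j \<le> s" for j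
    proof -
      have e: "tensor (tensor_power V j) (word_rep ts) = (word_rep ((j + t) # us) :: 'a rep)"
        by (simp add: Cons tensor_power_add tensor_assoc)
      have "C * 2 ^ j = ?c * (1 / 4) ^ length ts * (real ?S + 1) powr (- \<delta>) * 2 ^ (j + ?T)"
        by (simp add: C_def power_add)
      also have "\<dots> \<le> ?c * (1 / 4) ^ length ts * (real (j + ?T) + 1) powr (- \<delta>) * 2 ^ (j + ?T)"
        using that \<delta>(1) by (intro mult_right_mono mult_left_mono powr_mono2') (auto simp: ss)
      also have "\<dots> \<le> real (num_summands (word_rep ((j + t) # us) :: 'a rep))"
        using Suc(1)[of "(j + t) # us"] Suc(2) ss Cons by (simp add: add.assoc)
      finally show ?thesis unfolding e .
    qed
    have main: "real (num_summands (word_rep ss :: 'a rep)) \<ge> C / 4 * 2 ^ s"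
    proof (cases "s = 0")
      case True
      have "C / 4 * 2 ^ s \<le> real (num_summands (word_rep ts :: 'a rep))"
        using IH[of 0] True C0 by (simp add: tensor_power_0 del: tensor_power.simps(1))
      also have "\<dots> \<le> real (num_summands (word_rep ss :: 'a rep))"
        using num_summands_tensor_twist[of "word_rep ts" "trivial_rep"] ss True by (simp add: tensor_power_0 del: tensor_power.simps(1))
      finally show ?thesis .
    next
      case False
      obtain q a where s: "s = 2 * q + a" "a = 1 \<or> a = 2"
        using False nonzero_cases by blast
      have le: "(2 :: real) ^ s \<le> 4 * 4 ^ q" using s(2) unfolding s(1) by (auto simp: power_add power_mult)
      have "C / 4 * 2 ^ s \<le> C / 4 * (4 * 4 ^ q)" using C0 le by (intro mult_left_mono) auto
      also have "\<dots> = 4 ^ q * avg q (\<lambda>_. C) 0" by (simp add: avg_const)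
      also have "\<dots> \<le> 4 ^ q * avg q (\<lambda>j. real (num_summands (tensor (tensor_power V j) (word_rep ts))) / 2 ^ j) 0"
        using IH s by (intro mult_left_mono avg_mono) (auto simp: field_simps)
      also have "\<dots> \<le> real (num_summands (tensor (tensor_power V (2 * q + a)) (twist (word_rep ts))))"
        by (rule num_summands_power_twist[OF s(2)]) simp
      finally show ?thesis using s(1) ss by simp
    qed
    have "?c * (1 / 4) ^ length ss * (real ?S + 1) powr (- \<delta>) * 2 ^ ?S = C / 4 * 2 ^ s"
      by (simp add: C_def ss power_add)
    then show ?thesis using main by simp
  qed
qed

lemma real_sum_list: "real (sum_list (map f xs)) = (\<Sum>x\<leftarrow>xs. real (f x))"
  by (induction xs) auto

text \<open>By \<open>split\<close>, one factor \<open>W\<close> at a time is replaced by words, and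
  each word is merged into an accumulated word \<open>ss\<close>. The accumulated length never
  exceeds the maximal length in \<open>ws\<close>, so the constant does not depend on
  \<open>k\<close>; only the letter sum grows, at most linearly.\<close>

lemma tensor_power_lower_bound:
  fixes W :: "'a rep"
  assumes \<delta>: "\<delta> \<ge> 0" "4 powr \<delta> = 8 / 3"
    and W: "algebraic_rep W" and dim: "rep_dim W = (\<Sum>w\<leftarrow>ws. 2 ^ sum_list w)"
    and split: "\<And>L. algebraic_rep L \<Longrightarrow> (\<Sum>w\<leftarrow>ws. num_summands (tensor (word_rep w) L)) \<le> num_summands (tensor W L)"
  shows "\<exists>c>0. \<forall>k\<ge>1. real (num_summands (tensor_power W k)) \<ge> c * real k powr (- \<delta>) * real (rep_dim W) ^ k"
proof -
  obtain R where R: "\<forall>w\<in>set ws. length w \<le> R" using finite_nat_set_iff_bounded_le[of "length ` set ws"] by auto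
  obtain S where S: "\<forall>w\<in>set ws. sum_list w \<le> S" using finite_nat_set_iff_bounded_le[of "sum_list ` set ws"] by auto
  define c where "c = (1 / 3 :: real) powr \<delta> * (1 / 4) ^ R"
  have c: "c > 0" by (simp add: c_def)
  \<comment> \<open>The powers of two in \<open>ss\<close> and the dimension formula for
    \<open>W\<close> make the main factors exact, so that only the letter sum inside the decay needs
    an estimate.\<close>
  have main: "real (num_summands (tensor (tensor_power W k) (word_rep ss))) \<ge>
     c * (real (k * S + sum_list ss) + 1) powr (- \<delta>) * (real (rep_dim W) ^ k * 2 ^ sum_list ss)" if "length ss \<le> R" for k ss
    using that
  proof (induction k arbitrary: ss)
    case 0
    have "c * (real (sum_list ss) + 1) powr (- \<delta>) * 2 ^ sum_list ss \<le>
       (1 / 3) powr \<delta> * (1 / 4) ^ length ss * (real (sum_list ss) + 1) powr (- \<delta>) * 2 ^ sum_list ss"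
      unfolding c_def using 0 by (intro mult_right_mono mult_left_mono power_decreasing) auto
    also have "\<dots> \<le> real (num_summands (word_rep ss :: 'a rep))"
      by (rule num_summands_word_lower_bound[OF \<delta>])
    finally show ?case by (simp add: tensor_power_0 del: tensor_power.simps(1))
  next
    case (Suc k)
    let ?K = "c * (real (Suc k * S + sum_list ss) + 1) powr (- \<delta>)"
    have 1: "?K * (real (rep_dim W) ^ k * 2 ^ sum_list ss) * 2 ^ sum_list w \<le>
        real (num_summands (tensor (word_rep w) (tensor (tensor_power W k) (word_rep ss))))" if w: "w \<in> set ws" for w
    proof -
      let ?w = "word_rep w :: 'a rep" and ?s = "word_rep ss :: 'a rep" and ?P = "tensor_power W k"
      have "retract (tensor (tensor ?w ?P) ?s) (tensor (tensor ?P ?w) ?s)"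
        using W by (intro retract_tensor retract_swap retract_refl) auto
      moreover have "retract (tensor (tensor ?P ?w) ?s) (tensor ?P (word_rep (add_words w ss)))"
        unfolding tensor_assoc using W by (intro retract_tensor retract_add_words retract_refl) auto
      ultimately have "retract (tensor (tensor ?w ?P) ?s) (tensor ?P (word_rep (add_words w ss)))"
        by (rule retract_trans[rotated 3]) (use W in auto)
      then have le: "num_summands (tensor ?P (word_rep (add_words w ss))) \<le> num_summands (tensor ?w (tensor ?P ?s))"
        unfolding tensor_assoc using W by (intro num_summands_retract) auto
      have "?K * (real (rep_dim W) ^ k * 2 ^ sum_list ss) * 2 ^ sum_list w =
          ?K * (real (rep_dim W) ^ k * 2 ^ sum_list (add_words w ss))"
        by (simp add: power_add)
      also have "\<dots> \<le> c * (real (k * S + sum_list (add_words w ss)) + 1) powr (- \<delta>) *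
          (real (rep_dim W) ^ k * 2 ^ sum_list (add_words w ss))"
        using S w c \<delta>(1)
        by (intro mult_right_mono mult_left_mono powr_mono2') (auto simp del: of_nat_add of_nat_mult)
      also have "\<dots> \<le> real (num_summands (tensor ?P (word_rep (add_words w ss))))"
        using R w Suc.prems by (intro Suc.IH) auto
      finally show ?thesis using le by linarith
    qed
    have "?K * (real (rep_dim W) ^ Suc k * 2 ^ sum_list ss) =
       (\<Sum>w\<leftarrow>ws. ?K * (real (rep_dim W) ^ k * 2 ^ sum_list ss) * 2 ^ sum_list w)"
      unfolding sum_list_const_mult using arg_cong[OF dim, of real] by (simp add: real_sum_list mult_ac)
    also have "\<dots> \<le> (\<Sum>w\<leftarrow>ws. real (num_summands (tensor (word_rep w) (tensor (tensor_power W k) (word_rep ss)))))"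
      by (rule sum_list_mono) (rule 1)
    also have "\<dots> \<le> real (num_summands (tensor W (tensor (tensor_power W k) (word_rep ss))))"
      unfolding real_sum_list[symmetric] of_nat_le_iff using W by (intro split) auto
    finally show ?case by (simp add: tensor_assoc)
  qed
  define c' where "c' = c * (real S + 1) powr (- \<delta>)"
  have "real (num_summands (tensor_power W k)) \<ge> c' * real k powr (- \<delta>) * real (rep_dim W) ^ k" if "k \<ge> 1" for k
  proof -
    have "real (k * S) + 1 \<le> (real S + 1) * real k" using that by (simp add: algebra_simps)
    then have "((real S + 1) * real k) powr (- \<delta>) \<le> (real (k * S) + 1) powr (- \<delta>)"
      using \<delta>(1) by (intro powr_mono2') (auto simp del: of_nat_mult)
    then have "(real S + 1) powr (- \<delta>) * real k powr (- \<delta>) \<le> (real (k * S) + 1) powr (- \<delta>)"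
      by (subst (asm) powr_mult) auto
    then have "c' * real k powr (- \<delta>) * real (rep_dim W) ^ k \<le> c * (real (k * S) + 1) powr (- \<delta>) * real (rep_dim W) ^ k"
      unfolding c'_def mult.assoc[of c] using c by (intro mult_right_mono mult_left_mono) auto
    also have "\<dots> \<le> real (num_summands (tensor_power W k))"
      using main[of "[]" k] by simp
    finally show ?thesis .
  qed
  moreover have "c' > 0" unfolding c'_def using c by simp
  ultimately show ?thesis by blast
qed

end

section \<open>Indecomposability of words\<close>

text \<open>Algebraicity is used by restricting representations to polynomial curves in the
  group.\<close>

lemma regular_function_poly:
  fixes f :: "'a :: field mat \<Rightarrow> 'a"
  assumes "f \<in> regular_functions" "\<And>i j. i < 2 \<Longrightarrow> j < 2 \<Longrightarrow> \<exists>P. \<forall>t. g t $$ (i, j) = poly P t"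
  shows "\<exists>P. \<forall>t. f (g t) = poly P t"
  using assms(1)
proof induction
  case (const c)
  then show ?case by (intro exI[of _ "[:c:]"]) simp
next
  case (entry i j)
  then show ?case using assms(2) by blast
next
  case (add f h)
  then obtain P Q where "\<forall>t. f (g t) = poly P t" "\<forall>t. h (g t) = poly Q t" by blast
  then show ?case by (intro exI[of _ "P + Q"]) simp
next
  case (mult f h)
  then obtain P Q where "\<forall>t. f (g t) = poly P t" "\<forall>t. h (g t) = poly Q t" by blast
  then show ?case by (intro exI[of _ "P * Q"]) simp
qed

definition mat2 :: "'a \<Rightarrow> 'a \<Rightarrow> 'a \<Rightarrow> 'a \<Rightarrow> 'a :: field mat" where
  "mat2 a b c d = mat_of_rows_list 2 [[a, b], [c, d]]"

lemma mat2_simps [simp]: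
  "dim_row (mat2 a b c d) = 2" "dim_col (mat2 a b c d) = 2"
  "mat2 a b c d $$ (0, 0) = a" "mat2 a b c d $$ (0, Suc 0) = b"
  "mat2 a b c d $$ (Suc 0, 0) = c" "mat2 a b c d $$ (Suc 0, Suc 0) = d"
  by (simp_all add: mat2_def mat_of_rows_list_def)

lemma mat2_SL2: "mat2 a b c d \<in> SL2 \<longleftrightarrow> a * d - b * c = 1"
proof -
  have "mat2 a b c d \<in> carrier_mat 2 2" by (intro carrier_matI) auto
  from det_carrier_two[OF this] this show ?thesis by (simp add: SL2_def)
qed

lemma frob_mat2: "frob (mat2 a b c d) = mat2 (a ^ 2) (b ^ 2) (c ^ 2) (d ^ 2)"
  by (rule eq_matI) (auto simp: frob_def less_two)

lemma mat2_one: "mat2 1 0 0 1 = 1\<^sub>m 2"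
  by (rule eq_matI) (auto simp: less_two)

lemma infinite_alg_closed_field: "infinite (UNIV :: 'a :: alg_closed_field set)"
proof
  assume fin: "finite (UNIV :: 'a set)"
  let ?P = "1 + (\<Prod>a\<in>UNIV. [:- a, 1:]) :: 'a poly"
  have "poly ?P x = 1" for x
    using fin by (simp add: poly_prod prod_zero_iff)
  moreover have "degree ?P > 0"
  proof -
    have "degree (\<Prod>a\<in>(UNIV :: 'a set). [:- a, 1:]) = card (UNIV :: 'a set)"
      by (subst degree_prod_eq_sum_degree) auto
    moreover have "card (UNIV :: 'a set) > 0" using fin by (simp add: card_gt_0_iff)
    ultimately show ?thesis by (simp add: degree_add_eq_right)
  qed
  ultimately show False using alg_closed_imp_poly_has_root[of ?P] by auto
qed

lemma poly_eq_zero_UNIV: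
  fixes P :: "'a :: alg_closed_field poly"
  assumes "\<And>t. poly P t = 0"
  shows "P = 0"
proof (rule ccontr)
  assume "P \<noteq> 0"
  then have "finite {t. poly P t = 0}" by (rule poly_roots_finite)
  then have "finite (UNIV :: 'a set)" using assms by simp
  then show False using infinite_alg_closed_field by blast
qed

text \<open>An identity valid for all \<open>t\<close> in an infinite field may be compared
  coefficientwise; the linear coefficient takes the place of a derivative.\<close>

lemma commutes_coefficient:
  fixes K :: "'a :: alg_closed_field \<Rightarrow> 'a mat"
  assumes [simp]: "dim_row \<phi> = n" "dim_col \<phi> = n" "dim_row D = n" "dim_col D = n"
    and K: "\<And>t. dim_row (K t) = n" "\<And>t. dim_col (K t) = n"
    and comm: "\<And>t. \<phi> * K t = K t * \<phi>"
    and P: "\<And>i j t. i < n \<Longrightarrow> j < n \<Longrightarrow> K t $$ (i, j) = poly (P i j) t"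
    and D: "\<And>i j. i < n \<Longrightarrow> j < n \<Longrightarrow> D $$ (i, j) = coeff (P i j) 1"
  shows "\<phi> * D = D * \<phi>"
proof (rule eq_matI)
  fix i j assume "i < dim_row (D * \<phi>)" "j < dim_col (D * \<phi>)"
  then have ij: "i < n" "j < n" by auto
  let ?Q = "(\<Sum>k<n. Polynomial.smult (\<phi> $$ (i, k)) (P k j)) - (\<Sum>k<n. Polynomial.smult (\<phi> $$ (k, j)) (P i k))"
  have "poly ?Q t = 0" for t
  proof -
    have "(\<Sum>k<n. \<phi> $$ (i, k) * K t $$ (k, j)) = (\<Sum>k<n. K t $$ (i, k) * \<phi> $$ (k, j))"
      using arg_cong[OF comm[of t], of "\<lambda>X. X $$ (i, j)"] ij K by (simp add: mult_index del: index_mult_mat(1))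
    then show ?thesis using ij by (simp add: poly_sum P mult.commute)
  qed
  then have "?Q = 0" by (rule poly_eq_zero_UNIV)
  then have "coeff ?Q 1 = 0" by simp
  then show "(\<phi> * D) $$ (i, j) = (D * \<phi>) $$ (i, j)"
    using ij by (simp add: mult_index coeff_sum D mult.commute del: index_mult_mat(1))
qed auto

text \<open>The raising element \<open>e\<close> of the Lie algebra acting on
  \<open>V \<otimes> V\<close> as \<open>e \<otimes> 1 + 1 \<otimes> e\<close>;
  \<open>lower_mat\<close> is its counterpart.\<close>

definition raise_mat :: "'a :: field mat" where
  "raise_mat = mat_of_rows_list 4 [[0, 1, 1, 0], [0, 0, 0, 1], [0, 0, 0, 1], [0, 0, 0, 0]]"

definition lower_mat :: "'a :: field mat" where
  "lower_mat = mat_of_rows_list 4 [[0, 0, 0, 0], [1, 0, 0, 0], [1, 0, 0, 0], [0, 1, 1, 0]]"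

text \<open>This and the next two matrices are linear witnesses for \<open>ev_kernel\<close>: a
  section of the form, and preimages under raising and lowering of what remains.\<close>

definition ev_section :: "'a :: field mat" where
  "ev_section = mat_of_rows_list 1 [[0], [1], [0], [0]]"

definition raise_part :: "'a :: field mat" where
  "raise_part = mat_of_rows_list 4 [[0, 0, 0, 0], [1, 0, 0, 0], [0, 0, 0, 0], [0, 0, 1, 0]]"

definition lower_part :: "'a :: field mat" where
  "lower_part = mat_of_rows_list 4 [[0, 0, 0, 0], [0, 0, 0, 1], [0, 0, 0, 0], [0, 0, 0, 0]]"

lemmas raise_lower_defs = raise_mat_def lower_mat_def ev_section_def raise_part_def lower_part_def

lemma dim_raise_lower [simp]:
  "dim_row ev_section = 4" "dim_col ev_section = 1"
  "dim_row raise_part = 4" "dim_col raise_part = 4" "dim_row lower_part = 4" "dim_col lower_part = 4"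
  "dim_row raise_mat = 4" "dim_col raise_mat = 4" "dim_row lower_mat = 4" "dim_col lower_mat = 4"
  by (auto simp: raise_lower_defs mat_of_rows_list_def)

context char_two
begin

text \<open>Frobenius twists have vanishing derivative, so endomorphisms commute with the Lie algebra acting on
  the untwisted factor alone.\<close>

lemma commutes_derivative:
  fixes N :: "'a rep" and U :: "nat \<Rightarrow> nat \<Rightarrow> 'a poly"
  assumes alg: "algebraic_rep N" and \<phi>: "rep_hom (tensor (tensor V V) (twist N)) (tensor (tensor V V) (twist N)) \<phi>"
    and g: "\<And>t. g t \<in> SL2" "\<And>t. frob (g t) = g (t ^ 2)" "g 0 = 1\<^sub>m 2"
    and U: "\<And>i j t. i < 2 \<Longrightarrow> j < 2 \<Longrightarrow> g t $$ (i, j) = poly (U i j) t"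
    and E: "\<And>i j. i < 4 \<Longrightarrow> j < 4 \<Longrightarrow> E $$ (i, j) = coeff (U (i div 2) (j div 2) * U (i mod 2) (j mod 2)) 1"
      "dim_row E = 4" "dim_col E = 4"
  shows "\<phi> * kronecker E (1\<^sub>m (rep_dim N)) = kronecker E (1\<^sub>m (rep_dim N)) * \<phi>"
proof -
  let ?d = "rep_dim N"
  have "\<forall>i j. i < ?d \<and> j < ?d \<longrightarrow> (\<exists>P. \<forall>t. N (g t) $$ (i, j) = poly P t)"
  proof (intro allI impI)
    fix i j assume "i < ?d \<and> j < ?d"
    then obtain f where f: "f \<in> regular_functions" "\<forall>g\<in>SL2. N g $$ (i, j) = f g"
      using regular_mat_entry[OF algebraic_rep_regular[OF alg]] by blast
    then show "\<exists>P. \<forall>t. N (g t) $$ (i, j) = poly P t"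
      using regular_function_poly[OF f(1), of g] U g(1) by metis
  qed
  then obtain Q where Q: "\<And>i j t. i < ?d \<Longrightarrow> j < ?d \<Longrightarrow> N (g t) $$ (i, j) = poly (Q i j) t"
    by metis
  have Q0: "poly (Q i j) 0 = (if i = j then 1 else 0)" if "i < ?d" "j < ?d" for i j
    using Q[OF that, of 0] that g(3) alg by (simp add: algebraic_rep_one)
  define P where "P i j = U (i div ?d div 2) (j div ?d div 2) * U (i div ?d mod 2) (j div ?d mod 2) *
     pcompose (Q (i mod ?d) (j mod ?d)) [:0, 0, 1:]" for i j
  define K where "K t = kronecker (kronecker (g t) (g t)) (N (frob (g t)))" for t
  have [simp]: "dim_row (g t) = 2" "dim_col (g t) = 2" for t using SL2_D[OF g(1)] by auto
  have [simp]: "dim_row (N (g t)) = ?d" "dim_col (N (g t)) = ?d" for t using alg g(1) by auto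
  have Kdim: "dim_row (K t) = 4 * ?d" "dim_col (K t) = 4 * ?d" for t by (simp_all add: K_def g(2))
  \<comment> \<open>Frobenius turns the parameter into its square, so the twisted factor has no
    linear term and enters the product only through its value at 0, the identity.\<close>
  have pc: "coeff (pcompose R [:0, 0, 1:]) (Suc 0) = 0" for R :: "'a poly"
    by (cases R) (simp add: pcompose_pCons)
  show ?thesis
  proof (rule commutes_coefficient[where n = "4 * ?d" and P = P and K = K])
    show "\<phi> * K t = K t * \<phi>" for t
      using rep_hom_eq[OF \<phi> g(1), of t] by (simp add: tensor_def natural_rep_def twist_def K_def)
    fix i j assume ij: "i < 4 * ?d" "j < 4 * ?d"
    note l = div_mod_less[OF ij(1)] div_mod_less[OF ij(2)]
    have l2: "i div ?d div 2 < 2" "j div ?d div 2 < 2" using l by auto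
    show "K t $$ (i, j) = poly (P i j) t" for t
      using ij l l2 by (simp add: K_def P_def g(2) U Q poly_pcompose power2_eq_square)
    show "kronecker E (1\<^sub>m ?d) $$ (i, j) = coeff (P i j) 1"
      using ij l E(2,3) unfolding P_def coeff_mult[of _ "pcompose _ _"]
      by (simp add: E(1) pc Q0)
  qed (use rep_hom_dims[OF \<phi>] E Kdim in auto)
qed

text \<open>Differentiation along the upper and the lower unipotent one-parameter group, on which
  Frobenius squares the parameter.\<close>

lemma commutes_raise_lower:
  fixes N :: "'a rep"
  assumes alg: "algebraic_rep N" and \<phi>: "rep_hom (tensor (tensor V V) (twist N)) (tensor (tensor V V) (twist N)) \<phi>"
  shows "\<phi> * kronecker raise_mat (1\<^sub>m (rep_dim N)) = kronecker raise_mat (1\<^sub>m (rep_dim N)) * \<phi>"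
    and "\<phi> * kronecker lower_mat (1\<^sub>m (rep_dim N)) = kronecker lower_mat (1\<^sub>m (rep_dim N)) * \<phi>"
proof -
  let ?U = "\<lambda>i j. if i = j then 1 else if i = 0 then [:0, 1:] else 0 :: 'a poly"
  show "\<phi> * kronecker raise_mat (1\<^sub>m (rep_dim N)) = kronecker raise_mat (1\<^sub>m (rep_dim N)) * \<phi>"
  proof (rule commutes_derivative[OF alg \<phi>, where g = "\<lambda>t. mat2 1 t 0 1" and U = ?U])
    show "raise_mat $$ (i, j) = coeff (?U (i div 2) (j div 2) * ?U (i mod 2) (j mod 2)) 1" if "i < 4" "j < 4" for i j
      using that unfolding less_four by (elim disjE) (simp_all add: raise_mat_def mat_of_rows_list_def)
    show "mat2 1 t 0 1 $$ (i, j) = poly (?U i j) t" if "i < 2" "j < 2" for i j t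
      using that unfolding less_two by (elim disjE) simp_all
  qed (simp_all add: mat2_SL2 frob_mat2 mat2_one)
  let ?U = "\<lambda>i j. if i = j then 1 else if j = 0 then [:0, 1:] else 0 :: 'a poly"
  show "\<phi> * kronecker lower_mat (1\<^sub>m (rep_dim N)) = kronecker lower_mat (1\<^sub>m (rep_dim N)) * \<phi>"
  proof (rule commutes_derivative[OF alg \<phi>, where g = "\<lambda>t. mat2 1 0 t 1" and U = ?U])
    show "lower_mat $$ (i, j) = coeff (?U (i div 2) (j div 2) * ?U (i mod 2) (j mod 2)) 1" if "i < 4" "j < 4" for i j
      using that unfolding less_four by (elim disjE) (simp_all add: lower_mat_def mat_of_rows_list_def)
    show "mat2 1 0 t 1 $$ (i, j) = poly (?U i j) t" if "i < 2" "j < 2" for i j t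
      using that unfolding less_two by (elim disjE) simp_all
  qed (simp_all add: mat2_SL2 frob_mat2 mat2_one)
qed

text \<open>The square of raising is \<open>2 (e \<otimes> e)\<close>, hence zero. The commutator of
  raising and lowering is the weight operator, which has even eigenvalues on
  \<open>V \<otimes> V\<close>, hence is zero too.\<close>

lemma raise_lower_relations:
  "raise_mat * raise_mat = (0\<^sub>m 4 4 :: 'a mat)"
  "lower_mat * lower_mat = (0\<^sub>m 4 4 :: 'a mat)"
  "lower_mat * raise_mat = (raise_mat * lower_mat :: 'a mat)"
  "ev_mat * raise_mat = (0\<^sub>m 1 4 :: 'a mat)"
  "ev_mat * lower_mat = (0\<^sub>m 1 4 :: 'a mat)"
  by (rule eq_matI; auto simp: small_mat simp del: index_mult_mat(1);
      simp add: explicit_defs raise_lower_defs two_eq_zero)+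

text \<open>Modulo the images of raising and lowering, \<open>V \<otimes> V\<close> is
  one-dimensional, with \<open>ev_mat\<close> as quotient map.\<close>

lemma ev_kernel:
  "ev_section * ev_mat + (raise_mat * raise_part + lower_mat * lower_part) = (1\<^sub>m 4 :: 'a mat)"
  "ev_mat * ev_section = (1\<^sub>m 1 :: 'a mat)"
  by (rule eq_matI; auto simp: small_mat simp del: index_mult_mat(1);
      simp add: explicit_defs raise_lower_defs two_eq_zero)+

text \<open>An idempotent commutes with raising and lowering, so it acts on the quotient by their
  images, a copy of the twist of \<open>N\<close>, where it is 0 or 1. If it is 0 there, its image
  lies in theirs; since they commute and square to zero, its third power vanishes. If it is 1 there,
  this applies to the complement.\<close>

lemma trivial_idempotents_square:
  fixes N :: "'a rep"
  assumes alg: "algebraic_rep N" and ti: "trivial_idempotents N"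
  shows "trivial_idempotents (tensor (tensor V V) (twist N))"
proof -
  let ?R = "tensor (tensor V V) (twist N)" and ?d = "rep_dim N"
  define hat where "hat A = kronecker A (1\<^sub>m ?d)" for A :: "'a mat"
  have hat_mult: "hat A * hat B = hat (A * B)" if "dim_col A = dim_row B" for A B
    using that by (simp add: hat_def kronecker_mult[symmetric])
  have hat_add: "hat (A + B) = hat A + hat B" if "dim_row A = dim_row B" "dim_col A = dim_col B" for A B
    using that by (simp add: hat_def kronecker_add_left)
  have hat_dim [simp]: "dim_row (hat A) = dim_row A * ?d" "dim_col (hat A) = dim_col A * ?d" for A
    by (simp_all add: hat_def)
  have hat_one: "hat (1\<^sub>m n) = 1\<^sub>m (n * ?d)" and hat_zero: "hat (0\<^sub>m n m) = 0\<^sub>m (n * ?d) (m * ?d)" for n m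
    by (simp_all add: hat_def)
  let ?E = "hat raise_mat" and ?F = "hat lower_mat" and ?w = "hat ev_mat" and ?s = "hat ev_section" and ?X = "hat raise_part" and ?Y = "hat lower_part"
  have one: "?s * ?w + (?E * ?X + ?F * ?Y) = 1\<^sub>m (4 * ?d)"
    using arg_cong[OF ev_kernel(1), of hat]
    by (simp add: hat_mult hat_add hat_one)
  have ws: "?w * ?s = 1\<^sub>m ?d"
    using arg_cong[OF ev_kernel(2), of hat] by (simp add: hat_mult hat_one del: One_nat_def)
  have rel: "?E * ?E = 0\<^sub>m (4 * ?d) (4 * ?d)" "?F * ?F = 0\<^sub>m (4 * ?d) (4 * ?d)" "?F * ?E = ?E * ?F"
    "?w * ?E = 0\<^sub>m ?d (4 * ?d)" "?w * ?F = 0\<^sub>m ?d (4 * ?d)"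
    by (simp_all add: hat_mult raise_lower_relations hat_zero)
  have wh: "rep_hom ?R (twist N) ?w"
    using rep_hom_tensor[OF _ _ _ _ ev_hom rep_hom_one[of "twist N"]] alg by (simp add: hat_def)
  have key: "e = 0\<^sub>m (4 * ?d) (4 * ?d) \<or> ?w * e * ?s = 1\<^sub>m ?d" if e: "rep_hom ?R ?R e" "e * e = e" for e
  proof -
    have [simp]: "dim_row e = 4 * ?d" "dim_col e = 4 * ?d" using e by (auto simp: rep_hom_dims)
    have eE: "e * ?E = ?E * e" and eF: "e * ?F = ?F * e"
      using commutes_raise_lower[OF alg e(1)] by (simp_all add: hat_def)
    have eE': "e * (?E * Z) = ?E * (e * Z)" and eF': "e * (?F * Z) = ?F * (e * Z)" if "dim_row Z = 4 * ?d" for Z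
      using that eE eF by (simp_all add: mat_mult_assoc[symmetric])
    have rel': "?E * (?E * Z) = 0\<^sub>m (4 * ?d) (dim_col Z)" "?F * (?F * Z) = 0\<^sub>m (4 * ?d) (dim_col Z)" "?F * (?E * Z) = ?E * (?F * Z)"
      "?w * (?E * Z) = 0\<^sub>m ?d (dim_col Z)" "?w * (?F * Z) = 0\<^sub>m ?d (dim_col Z)" if "dim_row Z = 4 * ?d" for Z
      using that by (simp_all add: mat_mult_assoc[symmetric] rel)
    define \<psi> where "\<psi> = ?w * e * ?s"
    have [simp]: "dim_row \<psi> = ?d" "dim_col \<psi> = ?d" by (simp_all add: \<psi>_def)
    \<comment> \<open>\<open>e\<close> preserves the images of \<open>?E\<close> and
      \<open>?F\<close>, which span the kernel of \<open>?w\<close>, and so descends to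
      \<open>\<psi>\<close>.\<close>
    have we: "?w * e = \<psi> * ?w"
    proof -
      have "?w * e = ?w * e * (?s * ?w + (?E * ?X + ?F * ?Y))" by (simp add: one)
      also have "\<dots> = \<psi> * ?w" by (simp add: \<psi>_def mat_ring eE' eF' rel')
      finally show ?thesis .
    qed
    have "\<psi> * \<psi> = ?w * e * (e * ?s)"
    proof -
      have "\<psi> * \<psi> = (\<psi> * ?w) * (e * ?s)" by (simp add: \<psi>_def mat_mult_assoc)
      then show ?thesis by (simp add: we)
    qed
    also have "\<dots> = ?w * (e * e) * ?s" by (simp add: mat_mult_assoc)
    finally have idem: "\<psi> * \<psi> = \<psi>" by (simp add: e \<psi>_def)
    have "rep_hom (twist N) (twist N) \<psi>"
    proof (rule rep_homI)
      fix g :: "'a mat" assume g: "g \<in> SL2"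
      have dims: "dim_row (twist N g) = ?d" "dim_col (twist N g) = ?d" "dim_row (?R g) = 4 * ?d" "dim_col (?R g) = 4 * ?d"
        using algebraic_rep_dims[of "twist N" g] algebraic_rep_dims[of ?R g] alg g by auto
      have "\<psi> * twist N g = \<psi> * (twist N g * ?w) * ?s" using dims by (simp add: mat_mult_assoc ws)
      also have "\<dots> = \<psi> * (?w * ?R g) * ?s" unfolding rep_hom_eq[OF wh g] ..
      also have "\<dots> = (\<psi> * ?w) * ?R g * ?s" using dims by (simp add: mat_mult_assoc)
      also have "\<dots> = ?w * (e * ?R g) * ?s" unfolding we[symmetric] using dims by (simp add: mat_mult_assoc)
      also have "\<dots> = (?w * ?R g) * e * ?s" unfolding rep_hom_eq[OF e(1) g] using dims by (simp add: mat_mult_assoc)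
      also have "\<dots> = twist N g * \<psi>" unfolding rep_hom_eq[OF wh g] using dims by (simp add: mat_mult_assoc \<psi>_def)
      finally show "\<psi> * twist N g = twist N g * \<psi>" .
    qed auto
    then have "rep_hom N N \<psi>" using rep_hom_untwist[OF alg alg] by blast
    then consider "\<psi> = 0\<^sub>m ?d ?d" | "\<psi> = 1\<^sub>m ?d" using ti idem unfolding trivial_idempotents_def by blast
    then show ?thesis
    proof cases
      case 1
      have "e = (?s * ?w + (?E * ?X + ?F * ?Y)) * e" by (simp add: one)
      also have "\<dots> = ?s * (?w * e) + (?E * (?X * e) + ?F * (?Y * e))" by (simp add: mat_ring)
      also have "\<dots> = ?E * (?X * e) + ?F * (?Y * e)" by (simp add: we 1)
      finally have e1: "e = ?E * (?X * e) + ?F * (?Y * e)" .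
      have e1': "e * Z = ?E * (?X * (e * Z)) + ?F * (?Y * (e * Z))" if "dim_row Z = 4 * ?d" for Z
        by (subst e1) (use that in \<open>simp add: mat_ring\<close>)
      \<comment> \<open>Expanding \<open>e * e\<close> by \<open>e1\<close>, terms with a repeated
        operator vanish and the two mixed ones combine, as the operators commute.\<close>
      define Z where "Z = ?Y * (e * (?X * e)) + ?X * (e * (?Y * e))"
      have [simp]: "dim_row Z = 4 * ?d" "dim_col Z = 4 * ?d" by (simp_all add: Z_def)
      have "e = e * e" by (simp add: e)
      also have "\<dots> = e * (?E * (?X * e) + ?F * (?Y * e))" by (subst (2) e1) simp
      also have "\<dots> = ?E * (e * (?X * e)) + ?F * (e * (?Y * e))" by (simp add: mat_distrib_left eE' eF')
      also have "\<dots> = ?E * (?F * Z)"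
        by (subst e1', simp, subst (3) e1', simp) (simp add: Z_def mat_distrib_left rel')
      finally have e2: "e = ?E * (?F * Z)" .
      have "e = e * e" by (simp add: e)
      also have "\<dots> = e * (?E * (?F * Z))" by (subst (2) e2) simp
      also have "\<dots> = ?E * (?F * (e * Z))" by (simp add: eE' eF')
      \<comment> \<open>Expanding \<open>e\<close> once more puts a third operator beside the
        product of both, which annihilates it.\<close>
      also have "\<dots> = 0\<^sub>m (4 * ?d) (4 * ?d)"
        by (subst e1') (simp_all add: mat_distrib_left rel')
      finally show ?thesis by simp
    qed (simp add: \<psi>_def)
  qed
  show ?thesis
    unfolding trivial_idempotents_def
  proof (intro allI impI)
    fix e assume e: "rep_hom ?R ?R e" "e * e = e"
    have [simp]: "dim_row e = 4 * ?d" "dim_col e = 4 * ?d" using e by (auto simp: rep_hom_dims)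
    have algR: "algebraic_rep ?R" using alg by simp
    show "e = 0\<^sub>m (rep_dim ?R) (rep_dim ?R) \<or> e = 1\<^sub>m (rep_dim ?R)"
    proof (cases "e = 0\<^sub>m (4 * ?d) (4 * ?d)")
      case False
      then have 1: "?w * e * ?s = 1\<^sub>m ?d" using key[OF e] by blast
      let ?f = "1\<^sub>m (4 * ?d) - e"
      have "rep_hom ?R ?R ?f" using rep_hom_diff[OF algR algR rep_hom_one[OF algR] e(1)] by simp
      moreover have "?f * ?f = ?f" by (simp add: mat_ring e)
      ultimately consider "?f = 0\<^sub>m (4 * ?d) (4 * ?d)" | "?w * ?f * ?s = 1\<^sub>m ?d" using key by blast
      then show ?thesis
      proof cases
        case 1
        then show ?thesis by (simp add: diff_eq_zero_mat_iff)
      next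
        case 2
        have "?w * ?f * ?s = ?w * ?s - ?w * e * ?s" by (simp add: mat_ring)
        then have "1\<^sub>m ?d = (0\<^sub>m ?d ?d :: 'a mat)" using 1 2 ws by simp
        then have "?d = 0" by (metis gr0I index_one_mat(1) index_zero_mat(1) zero_neq_one)
        then have "e = 0\<^sub>m (4 * ?d) (4 * ?d)" by (intro eq_matI) auto
        then show ?thesis using False by simp
      qed
    qed simp
  qed
qed

text \<open>Tensoring with a further \<open>V\<close> leads to the square case, and
  \<open>1 \<otimes> e\<close> determines \<open>e\<close>.\<close>

lemma trivial_idempotents_natural:
  fixes N :: "'a rep"
  assumes alg: "algebraic_rep N" and ti: "trivial_idempotents N"
  shows "trivial_idempotents (tensor V (twist N))"
  unfolding trivial_idempotents_def
proof (intro allI impI)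
  let ?R = "tensor V (twist N)"
  let ?d = "rep_dim ?R"
  fix e assume e: "rep_hom ?R ?R e" "e * e = e"
  have [simp]: "dim_row e = ?d" "dim_col e = ?d" using rep_hom_dims[OF e(1)] by auto
  let ?k = "kronecker (1\<^sub>m 2) e"
  have "rep_hom (tensor V ?R) (tensor V ?R) ?k"
    using rep_hom_tensor[OF _ _ _ _ rep_hom_one[of V] e(1)] alg by simp
  moreover have "?k * ?k = ?k" using e by (simp add: kronecker_mult[symmetric])
  ultimately have "?k = 0\<^sub>m (2 * ?d) (2 * ?d) \<or> ?k = 1\<^sub>m (2 * ?d)"
    using trivial_idempotents_square[OF alg ti] unfolding trivial_idempotents_def tensor_assoc by simp
  then show "e = 0\<^sub>m ?d ?d \<or> e = 1\<^sub>m ?d"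
  proof
    assume "?k = 0\<^sub>m (2 * ?d) (2 * ?d)"
    then show ?thesis using kronecker_eq_zeroD[of "1\<^sub>m 2" e 0 0] by simp
  next
    assume "?k = 1\<^sub>m (2 * ?d)"
    then have "kronecker (1\<^sub>m 2) (1\<^sub>m ?d - e) = 0\<^sub>m (2 * ?d) (2 * ?d)"
      by (simp add: kronecker_diff_right)
    then show ?thesis using kronecker_eq_zeroD[of "1\<^sub>m 2" "1\<^sub>m ?d - e" 0 0] by (simp add: diff_eq_zero_mat_iff)
  qed
qed

lemma trivial_idempotents_word_rep:
  "set w \<subseteq> {1, 2} \<Longrightarrow> trivial_idempotents (word_rep w :: 'a rep)"
proof (induction w)
  case Nil
  show ?case
    unfolding trivial_idempotents_def
  proof (intro allI impI)
    fix e :: "'a mat" assume e: "rep_hom (word_rep []) (word_rep []) e" "e * e = e"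
    have [simp]: "dim_row e = 1" "dim_col e = 1" using rep_hom_dims[OF e(1)] by auto
    have "e $$ (0, 0) * e $$ (0, 0) = e $$ (0, 0)"
      using arg_cong[OF e(2), of "\<lambda>X. X $$ (0, 0)"] by (simp add: mult_index del: index_mult_mat(1))
    then have "e $$ (0, 0) = 0 \<or> e $$ (0, 0) = 1" by simp
    then show "e = 0\<^sub>m (rep_dim (word_rep [] :: 'a rep)) (rep_dim (word_rep [] :: 'a rep)) \<or> e = 1\<^sub>m (rep_dim (word_rep [] :: 'a rep))"
      by (auto intro!: eq_matI)
  qed
next
  case (Cons a w)
  then have "a = 1 \<or> a = 2" "trivial_idempotents (word_rep w :: 'a rep)" by auto
  moreover have "tensor_power V 1 = V" "tensor_power V 2 = tensor V V"
    by (simp_all add: numeral_2_eq_2 tensor_power_0 del: tensor_power.simps(1))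
  ultimately show ?case
    using trivial_idempotents_square[of "word_rep w"] trivial_idempotents_natural[of "word_rep w"] by auto
qed

end

section \<open>Extensions\<close>

text \<open>The equation says that the block matrices with diagonal blocks
  \<open>\<sigma> g\<close>, \<open>\<rho> g\<close> and upper right block \<open>c g\<close>
  multiply like the group.\<close>

definition cocycle :: "'a :: field rep \<Rightarrow> 'a rep \<Rightarrow> ('a mat \<Rightarrow> 'a mat) \<Rightarrow> bool" where
  "cocycle \<rho> \<sigma> c \<longleftrightarrow> regular_mat (rep_dim \<sigma>) (rep_dim \<rho>) c \<and>
     (\<forall>g\<in>SL2. \<forall>h\<in>SL2. c (g * h) = \<sigma> g * c h + c g * \<rho> h)"

text \<open>Cocycles modulo coboundaries compute the group of extensions of \<open>\<rho>\<close> by \<open>\<sigma>\<close>.\<close>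

definition ext_trivial :: "'a :: field rep \<Rightarrow> 'a rep \<Rightarrow> bool" where
  "ext_trivial \<rho> \<sigma> \<longleftrightarrow> (\<forall>c. cocycle \<rho> \<sigma> c \<longrightarrow>
     (\<exists>A\<in>carrier_mat (rep_dim \<sigma>) (rep_dim \<rho>). \<forall>g\<in>SL2. c g = \<sigma> g * A - A * \<rho> g))"

lemma cocycle_dims:
  "cocycle \<rho> \<sigma> c \<Longrightarrow> g \<in> SL2 \<Longrightarrow> dim_row (c g) = rep_dim \<sigma>"
  "cocycle \<rho> \<sigma> c \<Longrightarrow> g \<in> SL2 \<Longrightarrow> dim_col (c g) = rep_dim \<rho>"
  unfolding cocycle_def by (auto dest: regular_matD)

lemma cocycle_mult:
  "cocycle \<rho> \<sigma> c \<Longrightarrow> g \<in> SL2 \<Longrightarrow> h \<in> SL2 \<Longrightarrow> c (g * h) = \<sigma> g * c h + c g * \<rho> h"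
  unfolding cocycle_def by blast

lemma ext_trivialD:
  assumes "ext_trivial \<rho> \<sigma>" "cocycle \<rho> \<sigma> c"
  obtains A where "dim_row A = rep_dim \<sigma>" "dim_col A = rep_dim \<rho>" "\<And>g. g \<in> SL2 \<Longrightarrow> c g = \<sigma> g * A - A * \<rho> g"
  using assms unfolding ext_trivial_def by (metis carrier_matD)

lemma ext_trivialI:
  assumes "\<And>c. cocycle \<rho> \<sigma> c \<Longrightarrow> \<exists>A. dim_row A = rep_dim \<sigma> \<and> dim_col A = rep_dim \<rho> \<and> (\<forall>g\<in>SL2. c g = \<sigma> g * A - A * \<rho> g)"
  shows "ext_trivial \<rho> \<sigma>"
  using assms unfolding ext_trivial_def by (metis carrier_matI)

lemma cocycle_coboundary:
  assumes alg: "algebraic_rep \<rho>" "algebraic_rep \<sigma>" and A: "dim_row A = rep_dim \<sigma>" "dim_col A = rep_dim \<rho>"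
  shows "cocycle \<rho> \<sigma> (\<lambda>g. \<sigma> g * A - A * \<rho> g)"
  unfolding cocycle_def
proof (intro conjI ballI)
  show "regular_mat (rep_dim \<sigma>) (rep_dim \<rho>) (\<lambda>g. \<sigma> g * A - A * \<rho> g)"
    using alg A
    by (intro regular_mat_minus regular_mat_mult[OF algebraic_rep_regular regular_mat_const]
        regular_mat_mult[OF regular_mat_const algebraic_rep_regular]) auto
  fix g h :: "'a mat" assume "g \<in> SL2" "h \<in> SL2"
  then show "\<sigma> (g * h) * A - A * \<rho> (g * h) = \<sigma> g * (\<sigma> h * A - A * \<rho> h) + (\<sigma> g * A - A * \<rho> g) * \<rho> h"
    using alg A by (simp add: algebraic_rep_mult mat_ring) (rule eq_matI, auto simp del: index_mult_mat(1))
qed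

lemma cocycle_diff:
  assumes alg: "algebraic_rep \<rho>" "algebraic_rep \<sigma>" and c: "cocycle \<rho> \<sigma> c" and d: "cocycle \<rho> \<sigma> d"
  shows "cocycle \<rho> \<sigma> (\<lambda>g. c g - d g)"
  unfolding cocycle_def
proof (intro conjI ballI)
  show "regular_mat (rep_dim \<sigma>) (rep_dim \<rho>) (\<lambda>g. c g - d g)"
    using c d by (intro regular_mat_minus) (auto simp: cocycle_def)
  fix g h :: "'a mat" assume "g \<in> SL2" "h \<in> SL2"
  then show "c (g * h) - d (g * h) = \<sigma> g * (c h - d h) + (c g - d g) * \<rho> h"
    using alg cocycle_dims[OF c] cocycle_dims[OF d]
    by (simp add: cocycle_mult[OF c] cocycle_mult[OF d] mat_ring) (rule eq_matI, auto simp del: index_mult_mat(1))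
qed

lemma cocycle_comp_left:
  assumes alg: "algebraic_rep \<tau>" "algebraic_rep \<rho>" "algebraic_rep \<sigma>" and c: "cocycle \<tau> \<rho> c" and B: "rep_hom \<rho> \<sigma> B"
  shows "cocycle \<tau> \<sigma> (\<lambda>g. B * c g)"
  unfolding cocycle_def
proof (intro conjI ballI)
  show "regular_mat (rep_dim \<sigma>) (rep_dim \<tau>) (\<lambda>g. B * c g)"
    using c B by (intro regular_mat_mult[OF regular_mat_const]) (auto simp: cocycle_def rep_hom_def)
  fix g h :: "'a mat" assume gh: "g \<in> SL2" "h \<in> SL2"
  have "B * (\<rho> g * c h) = \<sigma> g * (B * c h)"
    using alg gh cocycle_dims[OF c] rep_hom_dims[OF B] rep_hom_eq[OF B gh(1)] by (simp add: mat_mult_assoc[symmetric])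
  then show "B * c (g * h) = \<sigma> g * (B * c h) + B * c g * \<tau> h"
    using alg gh cocycle_dims[OF c] rep_hom_dims[OF B] by (simp add: cocycle_mult[OF c] mat_ring)
qed

lemma cocycle_comp_right:
  assumes alg: "algebraic_rep \<tau>" "algebraic_rep \<rho>" "algebraic_rep \<sigma>" and c: "cocycle \<rho> \<sigma> c" and B: "rep_hom \<tau> \<rho> B"
  shows "cocycle \<tau> \<sigma> (\<lambda>g. c g * B)"
  unfolding cocycle_def
proof (intro conjI ballI)
  show "regular_mat (rep_dim \<sigma>) (rep_dim \<tau>) (\<lambda>g. c g * B)"
    using c B by (intro regular_mat_mult[OF _ regular_mat_const]) (auto simp: cocycle_def rep_hom_def)
  fix g h :: "'a mat" assume gh: "g \<in> SL2" "h \<in> SL2"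
  have "c g * \<rho> h * B = c g * (B * \<tau> h)"
    using alg gh cocycle_dims[OF c] rep_hom_dims[OF B] rep_hom_eq[OF B gh(2)] by (simp add: mat_mult_assoc)
  then show "c (g * h) * B = \<sigma> g * (c h * B) + c g * B * \<tau> h"
    using alg gh cocycle_dims[OF c] rep_hom_dims[OF B] by (simp add: cocycle_mult[OF c] mat_ring)
qed

text \<open>An exact sequence together with linear splittings. \<open>R\<close> and \<open>S\<close>
  are not assumed equivariant; the defect of \<open>S\<close> is the cocycle of the
  extension.\<close>

definition split_exact where
  "split_exact \<rho>' \<rho> \<rho>'' A B R S \<longleftrightarrow> rep_hom \<rho>' \<rho> A \<and> rep_hom \<rho> \<rho>'' B \<and>
     R \<in> carrier_mat (rep_dim \<rho>') (rep_dim \<rho>) \<and> S \<in> carrier_mat (rep_dim \<rho>) (rep_dim \<rho>'') \<and>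
     R * A = 1\<^sub>m (rep_dim \<rho>') \<and> B * S = 1\<^sub>m (rep_dim \<rho>'') \<and> B * A = 0\<^sub>m (rep_dim \<rho>'') (rep_dim \<rho>') \<and>
     A * R + S * B = 1\<^sub>m (rep_dim \<rho>)"

lemma split_exactD:
  assumes "split_exact \<rho>' \<rho> \<rho>'' A B R S"
  shows "rep_hom \<rho>' \<rho> A" "rep_hom \<rho> \<rho>'' B" "dim_row R = rep_dim \<rho>'" "dim_col R = rep_dim \<rho>"
    "dim_row S = rep_dim \<rho>" "dim_col S = rep_dim \<rho>''"
    "dim_row A = rep_dim \<rho>" "dim_col A = rep_dim \<rho>'" "dim_row B = rep_dim \<rho>''" "dim_col B = rep_dim \<rho>"
    "R * A = 1\<^sub>m (rep_dim \<rho>')" "B * S = 1\<^sub>m (rep_dim \<rho>'')" "B * A = 0\<^sub>m (rep_dim \<rho>'') (rep_dim \<rho>')"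
    "A * R + S * B = 1\<^sub>m (rep_dim \<rho>)"
  using assms unfolding split_exact_def by (auto simp: rep_hom_dims)

lemma mat_of_preimages:
  fixes B :: "'a :: field mat"
  assumes B: "B \<in> carrier_mat m n" and C: "C \<in> carrier_mat m k"
    and ex: "\<And>j. j < k \<Longrightarrow> \<exists>v\<in>carrier_vec n. B *\<^sub>v v = col C j"
  obtains S where "S \<in> carrier_mat n k" "B * S = C"
proof -
  obtain v where v: "\<And>j. j < k \<Longrightarrow> v j \<in> carrier_vec n" "\<And>j. j < k \<Longrightarrow> B *\<^sub>v v j = col C j"
    using ex by metis
  define S where "S = mat n k (\<lambda>(i, j). v j $ i)"
  have cS: "col S j = v j" if "j < k" for j
    using v(1)[OF that] that by (intro eq_vecI) (auto simp: S_def)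
  have "B * S = C"
  proof (rule eq_matI)
    fix i j assume "i < dim_row C" "j < dim_col C"
    then have ij: "i < m" "j < k" using C by auto
    have "(B * S) $$ (i, j) = (B *\<^sub>v col S j) $ i" using B ij by (simp add: S_def)
    also have "\<dots> = C $$ (i, j)" using v(2) C ij cS by simp
    finally show "(B * S) $$ (i, j) = C $$ (i, j)" .
  qed (use B C in \<open>auto simp: S_def\<close>)
  then show ?thesis using that[of S] by (simp add: S_def)
qed

lemma short_exact_split_exact:
  fixes \<rho> :: "'a :: field rep"
  assumes "short_exact \<rho>' \<rho> \<rho>''"
  obtains A B R S where "split_exact \<rho>' \<rho> \<rho>'' A B R S"
proof -
  obtain A B where AB: "rep_hom \<rho>' \<rho> A" "rep_hom \<rho> \<rho>'' B"
    and inj: "inj_on (\<lambda>v. A *\<^sub>v v) (carrier_vec (rep_dim \<rho>'))"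
    and ker: "(\<lambda>v. A *\<^sub>v v) ` carrier_vec (rep_dim \<rho>') = mat_kernel B"
    and sur: "(\<lambda>v. B *\<^sub>v v) ` carrier_vec (rep_dim \<rho>) = carrier_vec (rep_dim \<rho>'')"
    using assms unfolding short_exact_def by blast
  let ?d' = "rep_dim \<rho>'" and ?d = "rep_dim \<rho>" and ?d'' = "rep_dim \<rho>''"
  have cA: "A \<in> carrier_mat ?d ?d'" and cB: "B \<in> carrier_mat ?d'' ?d" using AB by (auto simp: rep_hom_def)
  then have [simp]: "dim_row A = ?d" "dim_col A = ?d'" "dim_row B = ?d''" "dim_col B = ?d" by auto
  obtain S where S: "S \<in> carrier_mat ?d ?d''" "B * S = 1\<^sub>m ?d''"
  proof (rule mat_of_preimages[OF cB])
    fix j assume j: "j < ?d''"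
    have "col (1\<^sub>m ?d'') j \<in> (\<lambda>v. B *\<^sub>v v) ` carrier_vec ?d" unfolding sur using j by simp
    then show "\<exists>v\<in>carrier_vec ?d. B *\<^sub>v v = col (1\<^sub>m ?d'') j" by (metis imageE)
  qed auto
  have [simp]: "dim_row S = ?d" "dim_col S = ?d''" using S by auto
  have BC: "B * (1\<^sub>m ?d - S * B) = 0\<^sub>m ?d'' ?d"
    by (simp add: mat_diff_left cancel_mid[OF S(2)])
  \<comment> \<open>The columns of \<open>1 - S * B\<close> lie in the kernel of \<open>B\<close>,
    hence lift through \<open>A\<close>.\<close>
  obtain R where R: "R \<in> carrier_mat ?d' ?d" "A * R = 1\<^sub>m ?d - S * B"
  proof (rule mat_of_preimages[OF cA])
    show "1\<^sub>m ?d - S * B \<in> carrier_mat ?d ?d" by (intro carrier_matI) auto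
    fix j assume j: "j < ?d"
    let ?v = "col (1\<^sub>m ?d - S * B) j"
    have "B *\<^sub>v ?v = col (B * (1\<^sub>m ?d - S * B)) j"
      using j by (intro eq_vecI) auto
    also have "\<dots> = 0\<^sub>v ?d''" unfolding BC using j by simp
    finally have z: "B *\<^sub>v ?v = 0\<^sub>v ?d''" .
    have "?v \<in> carrier_vec ?d" by (rule carrier_vecI) simp
    then have "?v \<in> mat_kernel B" using z by (rule mat_kernelI[OF cB])
    then show "\<exists>v\<in>carrier_vec ?d'. A *\<^sub>v v = ?v" unfolding ker[symmetric] by (metis imageE)
  qed
  have [simp]: "dim_row R = ?d'" "dim_col R = ?d" using R by auto
  have BA: "B * A = 0\<^sub>m ?d'' ?d'"
  proof (rule eq_matI)
    fix i j assume "i < dim_row (0\<^sub>m ?d'' ?d' :: 'a mat)" "j < dim_col (0\<^sub>m ?d'' ?d' :: 'a mat)"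
    then have ij: "i < ?d''" "j < ?d'" by auto
    have "A *\<^sub>v unit_vec ?d' j \<in> mat_kernel B" unfolding ker[symmetric] by auto
    then have "B *\<^sub>v (A *\<^sub>v unit_vec ?d' j) = 0\<^sub>v ?d''" using mat_kernelD[OF cB] by blast
    moreover have "A *\<^sub>v unit_vec ?d' j = col A j"
      using ij by (intro eq_vecI) auto
    ultimately have "B *\<^sub>v col A j = 0\<^sub>v ?d''" by simp
    then have "(B *\<^sub>v col A j) $ i = 0" using ij by simp
    then show "(B * A) $$ (i, j) = 0\<^sub>m ?d'' ?d' $$ (i, j)" using ij by simp
  qed auto
  have ARA: "A * (R * A) = A"
  proof -
    have "A * (R * A) = A * R * A" by (simp add: mat_mult_assoc)
    also have "\<dots> = A" unfolding R(2) by (simp add: mat_diff_right mat_mult_assoc BA)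
    finally show ?thesis .
  qed
  have "R * A = 1\<^sub>m ?d'"
  proof (rule mat_col_eqI)
    fix j assume "j < dim_col (1\<^sub>m ?d' :: 'a mat)"
    then have j: "j < ?d'" by simp
    have "A *\<^sub>v col (R * A) j = col (A * (R * A)) j" using j by (intro eq_vecI) auto
    also have "\<dots> = A *\<^sub>v col (1\<^sub>m ?d') j" unfolding ARA using j by (intro eq_vecI) auto
    finally have e: "A *\<^sub>v col (R * A) j = A *\<^sub>v col (1\<^sub>m ?d') j" .
    have "col (R * A) j \<in> carrier_vec ?d'" "col (1\<^sub>m ?d') j \<in> carrier_vec ?d'"
      by (rule carrier_vecI, simp)+
    with inj_onD[OF inj e] show "col (R * A) j = col (1\<^sub>m ?d') j" by blast
  qed auto
  moreover have "A * R + S * B = 1\<^sub>m ?d" unfolding R(2) by (rule eq_matI) (auto simp del: index_mult_mat(1))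
  ultimately have "split_exact \<rho>' \<rho> \<rho>'' A B R S"
    unfolding split_exact_def using AB R S BA by blast
  then show ?thesis by (rule that)
qed

lemma split_exact_factor:
  assumes "split_exact \<rho>' \<rho> \<rho>'' A B R S" "dim_row X = rep_dim \<rho>" "B * X = 0\<^sub>m (rep_dim \<rho>'') (dim_col X)"
  shows "A * (R * X) = X"
proof -
  note s [simp] = split_exactD[OF assms(1)]
  have "X = (A * R + S * B) * X" using assms(2) by simp
  also have "\<dots> = A * (R * X)" using assms(2,3) by (simp add: mat_distrib_right mat_mult_assoc del: s(14))
  finally show ?thesis ..
qed

text \<open>Values killed by \<open>B\<close> lie in the submodule, and \<open>R\<close> reads them
  off; equivariance of \<open>A\<close> carries the cocycle equation over.\<close>

lemma cocycle_factor_left: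
  assumes alg: "algebraic_rep \<tau>" "algebraic_rep \<rho>'" "algebraic_rep \<rho>" and ex: "split_exact \<rho>' \<rho> \<rho>'' A B R S"
    and c: "cocycle \<tau> \<rho> c" and B: "\<And>g. g \<in> SL2 \<Longrightarrow> B * c g = 0\<^sub>m (rep_dim \<rho>'') (rep_dim \<tau>)"
  shows "cocycle \<tau> \<rho>' (\<lambda>g. R * c g)" and "\<And>g. g \<in> SL2 \<Longrightarrow> A * (R * c g) = c g"
proof -
  note s [simp] = split_exactD(3-10)[OF ex]
  show AR: "A * (R * c g) = c g" if "g \<in> SL2" for g
    using split_exact_factor[OF ex, of "c g"] cocycle_dims[OF c that] B[OF that] by simp
  show "cocycle \<tau> \<rho>' (\<lambda>g. R * c g)"
    unfolding cocycle_def
  proof (intro conjI ballI)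
    show "regular_mat (rep_dim \<rho>') (rep_dim \<tau>) (\<lambda>g. R * c g)"
      using c by (intro regular_mat_mult[OF regular_mat_const]) (auto simp: cocycle_def)
    fix g h :: "'a mat" assume gh: "g \<in> SL2" "h \<in> SL2"
    note d [simp] = cocycle_dims[OF c gh(1)] cocycle_dims[OF c gh(2)]
    have "R * (\<rho> g * c h) = R * (\<rho> g * (A * (R * c h)))" by (simp add: AR[OF gh(2)])
    also have "\<dots> = R * ((\<rho> g * A) * (R * c h))" using alg gh by (simp add: mat_mult_assoc)
    also have "\<dots> = R * ((A * \<rho>' g) * (R * c h))" using rep_hom_eq[OF split_exactD(1)[OF ex] gh(1)] by simp
    also have "\<dots> = \<rho>' g * (R * c h)"
      using alg gh by (simp add: mat_mult_assoc cancel_mid[OF split_exactD(11)[OF ex]])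
    finally show "R * c (g * h) = \<rho>' g * (R * c h) + R * c g * \<tau> h"
      using alg gh by (simp add: cocycle_mult[OF c] mat_ring)
  qed
qed

text \<open>Vanishing on the submodule lets the cocycle descend to the quotient, with
  \<open>S\<close> choosing representatives.\<close>

lemma cocycle_factor_right:
  assumes alg: "algebraic_rep \<rho>''" "algebraic_rep \<sigma>" "algebraic_rep \<rho>" and ex: "split_exact \<rho>' \<rho> \<rho>'' A B R S"
    and c: "cocycle \<rho> \<sigma> c" and A: "\<And>g. g \<in> SL2 \<Longrightarrow> c g * A = 0\<^sub>m (rep_dim \<sigma>) (rep_dim \<rho>')"
  shows "cocycle \<rho>'' \<sigma> (\<lambda>g. c g * S)" and "\<And>g. g \<in> SL2 \<Longrightarrow> c g * S * B = c g"
proof -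
  note s [simp] = split_exactD(3-10)[OF ex]
  show SB: "c g * S * B = c g" if "g \<in> SL2" for g
  proof -
    note d [simp] = cocycle_dims[OF c that]
    have "c g = c g * (A * R + S * B)" by (simp add: split_exactD(14)[OF ex])
    also have "\<dots> = c g * A * R + c g * S * B" by (simp add: mat_distrib_left mat_mult_assoc)
    finally show ?thesis by (simp add: A[OF that])
  qed
  show "cocycle \<rho>'' \<sigma> (\<lambda>g. c g * S)"
    unfolding cocycle_def
  proof (intro conjI ballI)
    show "regular_mat (rep_dim \<sigma>) (rep_dim \<rho>'') (\<lambda>g. c g * S)"
      using c by (intro regular_mat_mult[OF _ regular_mat_const]) (auto simp: cocycle_def)
    fix g h :: "'a mat" assume gh: "g \<in> SL2" "h \<in> SL2"
    note d [simp] = cocycle_dims[OF c gh(1)] cocycle_dims[OF c gh(2)]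
    have "c g * \<rho> h * S = (c g * S * B) * \<rho> h * S" by (simp only: SB[OF gh(1)])
    also have "\<dots> = c g * S * ((B * \<rho> h) * S)" using alg gh by (simp add: mat_mult_assoc)
    also have "\<dots> = c g * S * (\<rho>'' h * (B * S))"
      using alg gh rep_hom_eq[OF split_exactD(2)[OF ex] gh(2)] by (simp add: mat_mult_assoc)
    also have "\<dots> = c g * S * \<rho>'' h" using alg gh by (simp add: split_exactD(12)[OF ex])
    finally show "c (g * h) * S = \<sigma> g * (c h * S) + c g * S * \<rho>'' h"
      using alg gh by (simp add: cocycle_mult[OF c] mat_ring)
  qed
qed

text \<open>The linear lift \<open>S * p\<close> fails to be equivariant by a cocycle with values in
  \<open>\<rho>'\<close>. That cocycle is a coboundary, and subtracting \<open>A * a\<close>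
  corrects the lift without changing its image under \<open>B\<close>.\<close>

lemma lift_hom:
  assumes alg: "algebraic_rep \<tau>" "algebraic_rep \<rho>'" "algebraic_rep \<rho>" "algebraic_rep \<rho>''"
    and ex: "split_exact \<rho>' \<rho> \<rho>'' A B R S" and ext: "ext_trivial \<tau> \<rho>'" and p: "rep_hom \<tau> \<rho>'' p"
  shows "\<exists>q. rep_hom \<tau> \<rho> q \<and> B * q = p"
proof -
  note s [simp] = split_exactD(3-10)[OF ex]
  note hA = split_exactD(1)[OF ex] and hB = split_exactD(2)[OF ex]
  note dp [simp] = rep_hom_dims[OF p]
  define c where "c g = \<rho> g * (S * p) - S * p * \<tau> g" for g
  have c: "cocycle \<tau> \<rho> c" unfolding c_def using alg by (intro cocycle_coboundary) auto
  have Bc: "B * c g = 0\<^sub>m (rep_dim \<rho>'') (rep_dim \<tau>)" if g: "g \<in> SL2" for g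
  proof -
    have "B * (\<rho> g * (S * p)) = \<rho>'' g * (B * (S * p))"
      using alg g rep_hom_eq[OF hB g] by (simp add: mat_mult_assoc[symmetric])
    then show ?thesis
      unfolding c_def using alg g rep_hom_eq[OF p g]
      by (simp add: mat_diff_left mat_mult_assoc cancel_mid[OF split_exactD(12)[OF ex]])
  qed
  note f = cocycle_factor_left[OF alg(1-3) ex c Bc]
  obtain a where a [simp]: "dim_row a = rep_dim \<rho>'" "dim_col a = rep_dim \<tau>"
    and ca: "\<And>g. g \<in> SL2 \<Longrightarrow> R * c g = \<rho>' g * a - a * \<tau> g"
    using ext_trivialD[OF ext f(1)] by blast
  have "rep_hom \<tau> \<rho> (S * p - A * a)"
  proof (rule rep_homI)
    fix g :: "'a mat" assume g: "g \<in> SL2"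
    have "\<rho> g * (S * p) - S * p * \<tau> g = A * (\<rho>' g * a - a * \<tau> g)"
      using f(2)[OF _ g] ca[OF g] by (simp add: c_def)
    also have "\<dots> = \<rho> g * (A * a) - A * a * \<tau> g"
      using alg g rep_hom_eq[OF hA g] by (simp add: mat_diff_left mat_mult_assoc[symmetric])
    finally have e: "\<rho> g * (S * p) - S * p * \<tau> g = \<rho> g * (A * a) - A * a * \<tau> g" .
    show "(S * p - A * a) * \<tau> g = \<rho> g * (S * p - A * a)"
    proof (rule eq_matI)
      fix i j assume "i < dim_row (\<rho> g * (S * p - A * a))" "j < dim_col (\<rho> g * (S * p - A * a))"
      then show "((S * p - A * a) * \<tau> g) $$ (i, j) = (\<rho> g * (S * p - A * a)) $$ (i, j)"
        using arg_cong[OF e, of "\<lambda>X. X $$ (i, j)"] alg g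
        by (simp add: mat_diff_left mat_diff_right algebra_simps del: index_mult_mat(1))
    qed (use alg g in auto)
  qed auto
  moreover have "B * (S * p - A * a) = p"
    by (simp add: mat_diff_left cancel_mid[OF split_exactD(12)[OF ex]] cancel_mid_zero[OF split_exactD(13)[OF ex]])
  ultimately show ?thesis by blast
qed

text \<open>Exactness in the middle of the long exact sequence: a coboundary removes the part seen
  in \<open>\<rho>''\<close>, and what remains comes from \<open>\<rho>'\<close>.\<close>

lemma ext_trivial_extension_right:
  assumes alg: "algebraic_rep \<tau>" "algebraic_rep \<rho>'" "algebraic_rep \<rho>" "algebraic_rep \<rho>''"
    and ex: "split_exact \<rho>' \<rho> \<rho>'' A B R S" and ext: "ext_trivial \<tau> \<rho>'" "ext_trivial \<tau> \<rho>''"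
  shows "ext_trivial \<tau> \<rho>"
proof (rule ext_trivialI)
  fix c assume c: "cocycle \<tau> \<rho> c"
  note s [simp] = split_exactD(3-10)[OF ex]
  note hA = split_exactD(1)[OF ex] and hB = split_exactD(2)[OF ex]
  obtain a where a [simp]: "dim_row a = rep_dim \<rho>''" "dim_col a = rep_dim \<tau>"
    and ca: "\<And>g. g \<in> SL2 \<Longrightarrow> B * c g = \<rho>'' g * a - a * \<tau> g"
    using ext_trivialD[OF ext(2) cocycle_comp_left[OF alg(1,3,4) c hB]] by blast
  define c1 where "c1 g = c g - (\<rho> g * (S * a) - S * a * \<tau> g)" for g
  have c1: "cocycle \<tau> \<rho> c1" unfolding c1_def using alg c by (intro cocycle_diff cocycle_coboundary) auto
  have "B * c1 g = 0\<^sub>m (rep_dim \<rho>'') (rep_dim \<tau>)" if g: "g \<in> SL2" for g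
  proof -
    note d [simp] = cocycle_dims[OF c g]
    have "B * (\<rho> g * (S * a)) = \<rho>'' g * (B * (S * a))"
      using alg g rep_hom_eq[OF hB g] by (simp add: mat_mult_assoc[symmetric])
    then show ?thesis
      unfolding c1_def using alg g ca[OF g]
      by (simp add: mat_diff_left mat_mult_assoc cancel_mid[OF split_exactD(12)[OF ex]])
  qed
  note f = cocycle_factor_left[OF alg(1-3) ex c1 this]
  obtain b where b [simp]: "dim_row b = rep_dim \<rho>'" "dim_col b = rep_dim \<tau>"
    and cb: "\<And>g. g \<in> SL2 \<Longrightarrow> R * c1 g = \<rho>' g * b - b * \<tau> g"
    using ext_trivialD[OF ext(1) f(1)] by blast
  have "c g = \<rho> g * (S * a + A * b) - (S * a + A * b) * \<tau> g" if g: "g \<in> SL2" for g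
  proof -
    note d [simp] = cocycle_dims[OF c g]
    have "A * (\<rho>' g * b) = \<rho> g * (A * b)" using alg g rep_hom_eq[OF hA g] by (simp add: mat_mult_assoc[symmetric])
    then have e: "c1 g = \<rho> g * (A * b) - A * (b * \<tau> g)"
      using f(2)[OF _ g] cb[OF g] alg g by (simp add: mat_diff_left)
    show ?thesis
    proof (rule eq_matI)
      fix i j assume "i < dim_row (\<rho> g * (S * a + A * b) - (S * a + A * b) * \<tau> g)"
        "j < dim_col (\<rho> g * (S * a + A * b) - (S * a + A * b) * \<tau> g)"
      then show "c g $$ (i, j) = (\<rho> g * (S * a + A * b) - (S * a + A * b) * \<tau> g) $$ (i, j)"
        using arg_cong[OF e, of "\<lambda>X. X $$ (i, j)"] alg g
        by (simp add: c1_def mat_distrib_left mat_distrib_right mat_mult_assoc algebra_simps del: index_mult_mat(1))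
    qed (use alg g in auto)
  qed
  then show "\<exists>A. dim_row A = rep_dim \<rho> \<and> dim_col A = rep_dim \<tau> \<and> (\<forall>g\<in>SL2. c g = \<rho> g * A - A * \<tau> g)"
    by (intro exI[of _ "S * a + A * b"]) auto
qed

text \<open>The same in the first argument: a coboundary kills the restriction to
  \<open>\<rho>'\<close>, and the rest descends to \<open>\<rho>''\<close>.\<close>

lemma ext_trivial_extension_left:
  assumes alg: "algebraic_rep \<sigma>" "algebraic_rep \<rho>'" "algebraic_rep \<rho>" "algebraic_rep \<rho>''"
    and ex: "split_exact \<rho>' \<rho> \<rho>'' A B R S" and ext: "ext_trivial \<rho>' \<sigma>" "ext_trivial \<rho>'' \<sigma>"
  shows "ext_trivial \<rho> \<sigma>"
proof (rule ext_trivialI)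
  fix c assume c: "cocycle \<rho> \<sigma> c"
  note s [simp] = split_exactD(3-10)[OF ex]
  note hA = split_exactD(1)[OF ex] and hB = split_exactD(2)[OF ex]
  obtain a where a [simp]: "dim_row a = rep_dim \<sigma>" "dim_col a = rep_dim \<rho>'"
    and ca: "\<And>g. g \<in> SL2 \<Longrightarrow> c g * A = \<sigma> g * a - a * \<rho>' g"
    using ext_trivialD[OF ext(1) cocycle_comp_right[OF alg(2,3,1) c hA]] by blast
  define c1 where "c1 g = c g - (\<sigma> g * (a * R) - a * R * \<rho> g)" for g
  have c1: "cocycle \<rho> \<sigma> c1" unfolding c1_def using alg c by (intro cocycle_diff cocycle_coboundary) auto
  have "c1 g * A = 0\<^sub>m (rep_dim \<sigma>) (rep_dim \<rho>')" if g: "g \<in> SL2" for g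
  proof -
    note d [simp] = cocycle_dims[OF c g]
    have "a * R * \<rho> g * A = a * \<rho>' g"
      using alg g rep_hom_eq[OF hA g, symmetric] by (simp add: mat_mult_assoc cancel_mid[OF split_exactD(11)[OF ex]])
    then show ?thesis
      unfolding c1_def using alg g ca[OF g]
      by (simp add: mat_diff_right mat_mult_assoc split_exactD(11)[OF ex])
  qed
  note f = cocycle_factor_right[OF alg(4,1,3) ex c1 this]
  obtain b where b [simp]: "dim_row b = rep_dim \<sigma>" "dim_col b = rep_dim \<rho>''"
    and cb: "\<And>g. g \<in> SL2 \<Longrightarrow> c1 g * S = \<sigma> g * b - b * \<rho>'' g"
    using ext_trivialD[OF ext(2) f(1)] by blast
  have "c g = \<sigma> g * (a * R + b * B) - (a * R + b * B) * \<rho> g" if g: "g \<in> SL2" for g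
  proof -
    note d [simp] = cocycle_dims[OF c g]
    have "b * \<rho>'' g * B = b * (B * \<rho> g)" using alg g rep_hom_eq[OF hB g] by (simp add: mat_mult_assoc)
    then have e: "c1 g = \<sigma> g * (b * B) - b * (B * \<rho> g)"
      using f(2)[OF _ g] cb[OF g] alg g by (simp add: mat_diff_right mat_mult_assoc)
    show ?thesis
    proof (rule eq_matI)
      fix i j assume "i < dim_row (\<sigma> g * (a * R + b * B) - (a * R + b * B) * \<rho> g)"
        "j < dim_col (\<sigma> g * (a * R + b * B) - (a * R + b * B) * \<rho> g)"
      then show "c g $$ (i, j) = (\<sigma> g * (a * R + b * B) - (a * R + b * B) * \<rho> g) $$ (i, j)"
        using arg_cong[OF e, of "\<lambda>X. X $$ (i, j)"] alg g
        by (simp add: c1_def mat_distrib_left mat_distrib_right mat_mult_assoc algebra_simps del: index_mult_mat(1))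
    qed (use alg g in auto)
  qed
  then show "\<exists>A. dim_row A = rep_dim \<sigma> \<and> dim_col A = rep_dim \<rho> \<and> (\<forall>g\<in>SL2. c g = \<sigma> g * A - A * \<rho> g)"
    by (intro exI[of _ "a * R + b * B"]) auto
qed

section \<open>Induced modules and Weyl modules\<close>

text \<open>A polynomial stands for the binary form of degree \<open>n\<close> with \<open>x\<close>
  set to 1, as in \<open>induced_module\<close>. Substituting \<open>L\<close> for \<open>x\<close>
  and \<open>M\<close> for \<open>y\<close> needs \<open>n\<close> to restore the powers of
  \<open>x\<close>.\<close>

definition subst_form :: "nat \<Rightarrow> 'a :: field poly \<Rightarrow> 'a poly \<Rightarrow> 'a poly \<Rightarrow> 'a poly" where
  "subst_form n L M p = (\<Sum>i\<le>n. Polynomial.smult (coeff p i) (L ^ (n - i) * M ^ i))"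

lemma subst_form_linear_mult:
  assumes "degree p \<le> n"
  shows "subst_form (Suc n) L M ([:u, v:] * p) = (Polynomial.smult u L + Polynomial.smult v M) * subst_form n L M p"
proof -
  have c: "coeff ([:u, v:] * p) i = u * coeff p i + (case i of 0 \<Rightarrow> 0 | Suc k \<Rightarrow> v * coeff p k)" for i
    by (auto simp: coeff_pCons split: nat.splits)
  have 1: "(\<Sum>i\<le>Suc n. Polynomial.smult (u * coeff p i) (L ^ (Suc n - i) * M ^ i)) = Polynomial.smult u L * subst_form n L M p"
  proof -
    have "coeff p (Suc n) = 0" using assms by (intro coeff_eq_0) simp
    then have "(\<Sum>i\<le>Suc n. Polynomial.smult (u * coeff p i) (L ^ (Suc n - i) * M ^ i)) =
        (\<Sum>i\<le>n. Polynomial.smult (u * coeff p i) (L ^ (Suc n - i) * M ^ i))" by simp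
    also have "\<dots> = (\<Sum>i\<le>n. Polynomial.smult u L * Polynomial.smult (coeff p i) (L ^ (n - i) * M ^ i))"
      by (intro sum.cong) (auto simp: Suc_diff_le mult_ac)
    finally show ?thesis by (simp add: subst_form_def sum_distrib_left)
  qed
  have 2: "(\<Sum>i\<le>Suc n. Polynomial.smult (case i of 0 \<Rightarrow> 0 | Suc k \<Rightarrow> v * coeff p k) (L ^ (Suc n - i) * M ^ i)) =
     Polynomial.smult v M * subst_form n L M p"
    unfolding sum.atMost_Suc_shift subst_form_def sum_distrib_left
    by (simp add: mult_ac)
  show ?thesis
    unfolding distrib_right 1[symmetric] 2[symmetric] subst_form_def[of "Suc n"] c
    by (simp only: smult_add_left sum.distrib)
qed

text \<open>The columns of \<open>induced_module\<close> are products of linear forms, so this case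
  yields multiplicativity of the action.\<close>

lemma subst_form_prod_linear:
  "subst_form (a + b) L M ([:u, v:] ^ a * [:u', v':] ^ b) =
     (Polynomial.smult u L + Polynomial.smult v M) ^ a * (Polynomial.smult u' L + Polynomial.smult v' M) ^ b"
proof -
  have d: "degree ([:u, v:] ^ a * [:u', v':] ^ b) \<le> a + b" for a b
  proof -
    have "degree ([:u, v:] ^ a * [:u', v':] ^ b) \<le> degree ([:u, v:] ^ a) + degree ([:u', v':] ^ b)"
      by (rule degree_mult_le)
    also have "\<dots> \<le> degree [:u, v:] * a + degree [:u', v':] * b"
      by (intro add_mono degree_power_le)
    also have "\<dots> \<le> 1 * a + 1 * b" by (intro add_mono mult_right_mono) auto
    finally show ?thesis by simp
  qed
  have base: "subst_form b L M ([:u', v':] ^ b) = (Polynomial.smult u' L + Polynomial.smult v' M) ^ b"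
  proof (induction b)
    case 0
    then show ?case by (simp add: subst_form_def)
  next
    case (Suc b)
    then show ?case using subst_form_linear_mult[of "[:u', v':] ^ b" b L M u' v'] d[of 0 b] by simp
  qed
  show ?thesis
  proof (induction a)
    case 0
    then show ?case using base by simp
  next
    case (Suc a)
    have "[:u, v:] ^ Suc a * [:u', v':] ^ b = [:u, v:] * ([:u, v:] ^ a * [:u', v':] ^ b)"
      by (simp only: power_Suc mult.assoc)
    then show ?case using subst_form_linear_mult[OF d[of a b], of L M u v] Suc
      by (simp only: add_Suc power_Suc mult.assoc)
  qed
qed

lemma regular_coeff_mult:
  assumes "\<And>i. (\<lambda>g. coeff (p g) i) \<in> regular_functions" "\<And>i. (\<lambda>g. coeff (q g) i) \<in> regular_functions"
  shows "(\<lambda>g. coeff (p g * q g) i) \<in> regular_functions"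
  unfolding coeff_mult lessThan_Suc_atMost[symmetric]
  using assms by (intro regular_sum regular_functions.mult)

lemma regular_coeff_power:
  assumes "\<And>i. (\<lambda>g. coeff (p g) i) \<in> regular_functions"
  shows "(\<lambda>g. coeff (p g ^ n) i) \<in> regular_functions"
proof (induction n arbitrary: i)
  case 0
  then show ?case by (simp add: regular_functions.const)
next
  case (Suc n)
  then show ?case using regular_coeff_mult[OF assms, of "\<lambda>g. p g ^ n" i] by simp
qed

lemma regular_coeff_linear:
  assumes "a < 2" "b < 2" "c < 2" "d < 2"
  shows "(\<lambda>g. coeff [:g $$ (a, b), g $$ (c, d):] i) \<in> regular_functions"
proof -
  consider "i = 0" | "i = 1" | k where "i = Suc (Suc k)" by (metis One_nat_def not0_implies_Suc)
  then show ?thesis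
    by cases (simp_all add: regular_functions.const regular_functions.entry assms)
qed

lemma
  shows algebraic_rep_induced [simp]: "algebraic_rep (induced_module n :: 'a :: field rep)"
    and rep_dim_induced [simp]: "rep_dim (induced_module n :: 'a rep) = n + 1"
proof -
  have 1: "regular_mat (n + 1) (n + 1) (induced_module n :: 'a rep)"
    unfolding regular_mat_def induced_module_def
  proof (intro conjI ballI allI impI)
    fix i j assume "i < n + 1" "j < n + 1"
    have "(\<lambda>g :: 'a mat. coeff ([:g $$ (0, 0), g $$ (1, 0):] ^ (n - j) * [:g $$ (0, 1), g $$ (1, 1):] ^ j) i) \<in> regular_functions"
      by (intro regular_coeff_mult regular_coeff_power regular_coeff_linear) auto
    then show "\<exists>f\<in>regular_functions. \<forall>g :: 'a mat\<in>SL2. mat (n + 1) (n + 1) (\<lambda>(i, j).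
       coeff ([:g $$ (0, 0), g $$ (1, 0):] ^ (n - j) * [:g $$ (0, 1), g $$ (1, 1):] ^ j) i) $$ (i, j) = f g"
      using \<open>i < n + 1\<close> \<open>j < n + 1\<close> by (intro bexI) auto
  qed auto
  have 2: "induced_module n (1\<^sub>m 2) = (1\<^sub>m (n + 1) :: 'a mat)"
  proof (rule eq_matI)
    fix i j assume "i < dim_row (1\<^sub>m (n + 1) :: 'a mat)" "j < dim_col (1\<^sub>m (n + 1) :: 'a mat)"
    moreover have "[:0, 1:] ^ j = (Polynomial.monom 1 j :: 'a poly)" by (simp add: monom_altdef)
    ultimately show "induced_module n (1\<^sub>m 2) $$ (i, j) = (1\<^sub>m (n + 1) :: 'a mat) $$ (i, j)"
      by (auto simp: induced_module_def one_pCons[symmetric])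
  qed (auto simp: induced_module_def)
  have 3: "induced_module n (g * h) = induced_module n g * (induced_module n h :: 'a mat)" if gh: "g \<in> SL2" "h \<in> SL2" for g h
  proof (rule eq_matI)
    have [simp]: "dim_row g = 2" "dim_col g = 2" "dim_row h = 2" "dim_col h = 2" using gh SL2_D by auto
    fix i j assume "i < dim_row (induced_module n g * (induced_module n h :: 'a mat))" "j < dim_col (induced_module n g * (induced_module n h :: 'a mat))"
    then have ij: "i < n + 1" "j < n + 1" by (auto simp: induced_module_def)
    then have nj: "n - j + j = n" by simp
    let ?L = "[:g $$ (0, 0), g $$ (1, 0):]" and ?M = "[:g $$ (0, 1), g $$ (1, 1):]"
    let ?p = "[:h $$ (0, 0), h $$ (1, 0):] ^ (n - j) * [:h $$ (0, 1), h $$ (1, 1):] ^ j"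
    have "(induced_module n g * induced_module n h) $$ (i, j) = (\<Sum>k<n+1. coeff (?L ^ (n - k) * ?M ^ k) i * coeff ?p k)"
      using ij by (subst mult_index) (auto simp: induced_module_def)
    also have "\<dots> = coeff (subst_form n ?L ?M ?p) i"
      unfolding subst_form_def lessThan_Suc_atMost[symmetric] coeff_sum by (intro sum.cong) (auto simp: mult.commute)
    also have "subst_form n ?L ?M ?p = (Polynomial.smult (h $$ (0, 0)) ?L + Polynomial.smult (h $$ (1, 0)) ?M) ^ (n - j) *
        (Polynomial.smult (h $$ (0, 1)) ?L + Polynomial.smult (h $$ (1, 1)) ?M) ^ j"
      by (rule subst_form_prod_linear[of "n - j" j, unfolded nj])
    also have "coeff \<dots> i = induced_module n (g * h) $$ (i, j)"
      using ij by (simp add: induced_module_def mult_index sum_less_two mult.commute del: index_mult_mat(1))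
    finally show "induced_module n (g * h) $$ (i, j) = (induced_module n g * induced_module n h) $$ (i, j)" ..
  qed (auto simp: induced_module_def)
  show "algebraic_rep (induced_module n :: 'a rep)" "rep_dim (induced_module n :: 'a rep) = n + 1"
    using algebraic_repI[OF 1 2 3] by auto
qed

section \<open>Inversion and dual modules\<close>

lemma adj_mat_two:
  assumes "g \<in> carrier_mat 2 2"
  shows "adj_mat g = mat2 (g $$ (1, 1)) (- g $$ (0, 1)) (- g $$ (1, 0)) (g $$ (0, 0))"
proof -
  have d: "det (mat_delete g i j) = mat_delete g i j $$ (0, 0)" for i j
    using assms by (intro det_carrier_one carrier_matI) auto
  show ?thesis
    unfolding adj_mat_def cofactor_def d
    using assms by (intro eq_matI) (auto simp: less_two mat_delete_def)
qed

lemma SL2_two_eqI: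
  assumes "g \<in> SL2"
  shows "g = mat2 (g $$ (0, 0)) (g $$ (0, 1)) (g $$ (1, 0)) (g $$ (1, 1))"
  using SL2_D[OF assms] by (intro eq_matI) (auto simp: less_two)

lemma mat2_mult:
  "mat2 a b c d * mat2 a' b' c' d' = mat2 (a * a' + b * c') (a * b' + b * d') (c * a' + d * c') (c * b' + d * d')"
  by (intro eq_matI) (auto simp: mult_index less_two sum_less_two simp del: index_mult_mat(1))

lemma adj_mat2 [simp]: "adj_mat (mat2 a b c d) = mat2 d (- b) (- c) a"
  by (subst adj_mat_two) (simp_all add: carrier_matI)

lemma SL2_cases:
  assumes "g \<in> SL2"
  obtains a b c d where "g = mat2 a b c d" "a * d - b * c = 1"
  using SL2_two_eqI[OF assms] assms mat2_SL2 by metis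

lemma adj_SL2 [simp]: "g \<in> SL2 \<Longrightarrow> adj_mat g \<in> SL2"
  by (erule SL2_cases) (simp add: mat2_SL2 mult.commute)

lemma adj_mult: "g \<in> SL2 \<Longrightarrow> h \<in> SL2 \<Longrightarrow> adj_mat (g * h) = adj_mat h * adj_mat g"
  by (elim SL2_cases) (simp add: mat2_mult algebra_simps)

lemma adj_adj [simp]: "g \<in> SL2 \<Longrightarrow> adj_mat (adj_mat g) = g"
  by (erule SL2_cases) simp

lemma adj_one [simp]: "adj_mat (1\<^sub>m 2) = (1\<^sub>m 2 :: 'a :: field mat)"
proof -
  have "(1\<^sub>m 2 :: 'a mat) = mat2 1 0 0 1" by (rule eq_matI) (auto simp: less_two)
  then show ?thesis by simp
qed

lemma regular_adj:
  assumes "f \<in> regular_functions"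
  shows "\<exists>h\<in>regular_functions. \<forall>g\<in>SL2. f (adj_mat g) = h g"
  using assms
proof induction
  case (const c)
  then show ?case by (intro bexI[OF _ regular_functions.const[of c]]) auto
next
  case (entry i j)
  let ?e = "\<lambda>i j. \<lambda>g :: 'a mat. g $$ (i, j)"
  have n: "(\<lambda>g :: 'a mat. (-1) * g $$ (k, l)) \<in> regular_functions" if "k < 2" "l < 2" for k l
    using that by (intro regular_functions.mult regular_functions.const regular_functions.entry)
  have a: "adj_mat g = mat2 (g $$ (1, 1)) (- g $$ (0, 1)) (- g $$ (1, 0)) (g $$ (0, 0))" if "g \<in> SL2" for g :: "'a mat"
    using that by (intro adj_mat_two) (auto simp: SL2_def)
  consider "i = 0" "j = 0" | "i = 0" "j = 1" | "i = 1" "j = 0" | "i = 1" "j = 1" using entry less_two by auto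
  then show ?case
  proof cases
    case 1
    then show ?thesis by (intro bexI[OF _ regular_functions.entry[of 1 1]]) (auto simp: a)
  next
    case 2
    then show ?thesis by (intro bexI[OF _ n[of 0 1]]) (auto simp: a)
  next
    case 3
    then show ?thesis by (intro bexI[OF _ n[of 1 0]]) (auto simp: a)
  next
    case 4
    then show ?thesis by (intro bexI[OF _ regular_functions.entry[of 0 0]]) (auto simp: a)
  qed
next
  case (add f h)
  then obtain f' h' where "f' \<in> regular_functions" "h' \<in> regular_functions"
    "\<forall>g\<in>SL2. f (adj_mat g) = f' g" "\<forall>g\<in>SL2. h (adj_mat g) = h' g" by blast
  then show ?case by (intro bexI[OF _ regular_functions.add[of f' h']]) auto
next
  case (mult f h)
  then obtain f' h' where "f' \<in> regular_functions" "h' \<in> regular_functions"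
    "\<forall>g\<in>SL2. f (adj_mat g) = f' g" "\<forall>g\<in>SL2. h (adj_mat g) = h' g" by blast
  then show ?case by (intro bexI[OF _ regular_functions.mult[of f' h']]) auto
qed

lemma regular_mat_adj: "regular_mat n m c \<Longrightarrow> regular_mat n m (\<lambda>g. c (adj_mat g))"
  using regular_mat_comp[where \<theta> = adj_mat, OF _ adj_SL2 regular_adj] by blast

lemma transpose_mult_dim: "dim_col A = dim_row B \<Longrightarrow> transpose_mat (A * B) = transpose_mat B * transpose_mat (A :: 'a :: comm_semiring_0 mat)"
  by (rule transpose_mult[of A "dim_row A" "dim_row B" B "dim_col B"]) auto

lemma
  assumes "algebraic_rep \<rho>"
  shows algebraic_rep_dual [simp]: "algebraic_rep (dual_rep \<rho>)"
    and rep_dim_dual [simp]: "rep_dim (dual_rep \<rho>) = rep_dim \<rho>"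
proof -
  have 1: "regular_mat (rep_dim \<rho>) (rep_dim \<rho>) (dual_rep \<rho>)"
    unfolding dual_rep_def using assms by (intro regular_mat_transpose regular_mat_adj algebraic_rep_regular)
  have 2: "dual_rep \<rho> (1\<^sub>m 2) = 1\<^sub>m (rep_dim \<rho>)"
    using assms by (simp add: dual_rep_def algebraic_rep_one)
  have 3: "dual_rep \<rho> (g * h) = dual_rep \<rho> g * dual_rep \<rho> h" if "g \<in> SL2" "h \<in> SL2" for g h
    using that assms by (simp add: dual_rep_def adj_mult algebraic_rep_mult transpose_mult_dim)
  show "algebraic_rep (dual_rep \<rho>)" "rep_dim (dual_rep \<rho>) = rep_dim \<rho>"
    using algebraic_repI[OF 1 2 3] by auto
qed

lemma transpose_add_dim: "dim_row A = dim_row B \<Longrightarrow> dim_col A = dim_col B \<Longrightarrow> transpose_mat (A + B) = transpose_mat A + transpose_mat B"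
  by (rule eq_matI) auto

lemma transpose_minus_dim: "dim_row A = dim_row B \<Longrightarrow> dim_col A = dim_col B \<Longrightarrow> transpose_mat (A - B) = transpose_mat A - transpose_mat B"
  by (rule eq_matI) auto

text \<open>Transposing and inverting the group element dualises an extension, which exchanges the
  two arguments; the splitting changes its sign.\<close>

lemma ext_trivial_dual:
  assumes alg: "algebraic_rep \<sigma>" "algebraic_rep \<tau>" and ext: "ext_trivial (dual_rep \<sigma>) \<tau>"
  shows "ext_trivial (dual_rep \<tau>) \<sigma>"
proof (rule ext_trivialI)
  fix c assume c: "cocycle (dual_rep \<tau>) \<sigma> c"
  have dims: "dim_row (c g) = rep_dim \<sigma>" "dim_col (c g) = rep_dim \<tau>" if "g \<in> SL2" for g
    using cocycle_dims[OF c that] alg by auto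
  have c': "cocycle (dual_rep \<sigma>) \<tau> (\<lambda>g. transpose_mat (c (adj_mat g)))"
    unfolding cocycle_def
  proof (intro conjI ballI)
    show "regular_mat (rep_dim \<tau>) (rep_dim (dual_rep \<sigma>)) (\<lambda>g. transpose_mat (c (adj_mat g)))"
      using c alg unfolding cocycle_def by (intro regular_mat_transpose regular_mat_adj) auto
    fix g h :: "'a mat" assume gh: "g \<in> SL2" "h \<in> SL2"
    have "c (adj_mat (g * h)) = \<sigma> (adj_mat h) * c (adj_mat g) + c (adj_mat h) * transpose_mat (\<tau> g)"
      using gh cocycle_mult[OF c, of "adj_mat h" "adj_mat g"] by (simp add: adj_mult dual_rep_def)
    then show "transpose_mat (c (adj_mat (g * h))) = \<tau> g * transpose_mat (c (adj_mat h)) + transpose_mat (c (adj_mat g)) * dual_rep \<sigma> h"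
      using gh alg dims by (simp add: transpose_add_dim transpose_mult_dim dual_rep_def) (rule comm_add_mat, auto)
  qed
  obtain A where A: "dim_row A = rep_dim \<tau>" "dim_col A = rep_dim \<sigma>"
    "\<And>g. g \<in> SL2 \<Longrightarrow> transpose_mat (c (adj_mat g)) = \<tau> g * A - A * dual_rep \<sigma> g"
    using ext_trivialD[OF ext c'] alg by auto
  have "c g = \<sigma> g * (- transpose_mat A) - (- transpose_mat A) * dual_rep \<tau> g" if g: "g \<in> SL2" for g
  proof -
    have "c g = transpose_mat (transpose_mat (c (adj_mat (adj_mat g))))" using g by simp
    also have "\<dots> = transpose_mat (\<tau> (adj_mat g) * A - A * dual_rep \<sigma> (adj_mat g))"
      by (subst A(3)) (use g in auto)
    also have "\<dots> = transpose_mat A * dual_rep \<tau> g - \<sigma> g * transpose_mat A"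
      using g alg A by (simp add: transpose_minus_dim transpose_mult_dim dual_rep_def)
    also have "\<dots> = \<sigma> g * (- transpose_mat A) - (- transpose_mat A) * dual_rep \<tau> g"
      using g alg A by (intro eq_matI) auto
    finally show ?thesis .
  qed
  then show "\<exists>B. dim_row B = rep_dim \<sigma> \<and> dim_col B = rep_dim (dual_rep \<tau>) \<and> (\<forall>g\<in>SL2. c g = \<sigma> g * B - B * dual_rep \<tau> g)"
    using A alg by (intro exI[of _ "- transpose_mat A"]) auto
qed

section \<open>Vanishing of extensions of Weyl modules by induced modules\<close>

lemma poly_eq_off_zero:
  fixes A B :: "'a :: alg_closed_field poly"
  assumes "\<And>y. y \<noteq> 0 \<Longrightarrow> poly A y = poly B y"
  shows "A = B"
proof -
  have "poly ([:0, 1:] * (A - B)) y = 0" for y using assms[of y] by auto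
  then have "[:0, 1:] * (A - B) = 0" by (rule poly_eq_zero_UNIV)
  then show ?thesis by (simp del: mult_pCons_left)
qed

lemma dim_induced_module [simp]:
  "dim_row (induced_module m g) = m + 1" "dim_col (induced_module m g) = m + 1"
  by (simp_all add: induced_module_def)

text \<open>Row zero reads off the coefficient of \<open>x^m\<close>, the functional on which the
  lower triangular group acts through the character \<open>t^m\<close>.\<close>

lemma induced_module_row_zero:
  assumes "j \<le> m"
  shows "induced_module m g $$ (0, j) = g $$ (0, 0) ^ (m - j) * g $$ (0, 1) ^ j"
  using assms by (simp add: induced_module_def poly_0_coeff_0[symmetric])

lemma induced_module_diagonal:
  fixes x y :: "'a :: field"
  assumes "i \<le> n" "j \<le> n"
  shows "induced_module n (mat2 x 0 0 y) $$ (i, j) = (if i = j then x ^ (n - j) * y ^ j else 0)"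
proof -
  have "[:x:] ^ (n - j) = [:x ^ (n - j):]" by (simp add: poly_const_pow)
  moreover have "[:0, y:] ^ j = Polynomial.monom (y ^ j) j"
  proof -
    have "[:0, y:] = Polynomial.smult y [:0, 1:]" by simp
    then show ?thesis by (simp add: smult_power[symmetric] monom_altdef del: smult_pCons)
  qed
  ultimately show ?thesis using assms by (simp add: induced_module_def)
qed

text \<open>Identifies the induced module as the sections of a line bundle on the projective line:
  such an \<open>f\<close> depends only on the first row \<open>(a, b)\<close>, is given by one
  polynomial where \<open>a \<noteq> 0\<close> and by another where \<open>b \<noteq> 0\<close>, and
  gluing bounds the degree by \<open>m\<close>.\<close>

lemma borel_semi_invariant:
  fixes f :: "'a :: alg_closed_field mat \<Rightarrow> 'a"
  assumes f: "f \<in> regular_functions"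
    and T: "\<And>t g. t \<noteq> 0 \<Longrightarrow> g \<in> SL2 \<Longrightarrow> f (mat2 t 0 0 (1 / t) * g) = t ^ m * f g"
    and L: "\<And>z g. g \<in> SL2 \<Longrightarrow> f (mat2 1 0 z 1 * g) = f g"
  shows "\<exists>A. \<forall>g\<in>SL2. f g = (\<Sum>i\<le>m. A i * (g $$ (0, 0) ^ (m - i) * g $$ (0, 1) ^ i))"
proof -
  have "\<exists>P. \<forall>x. f (mat2 1 x 0 1) = poly P x"
  proof (rule regular_function_poly[OF f])
    fix i j :: nat assume "i < 2" "j < 2"
    then show "\<exists>P. \<forall>x. mat2 1 x 0 1 $$ (i, j) = poly P x"
      by (intro exI[of _ "if i = j then 1 else if i = 0 then [:0, 1:] else 0"]) (auto simp: less_two)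
  qed
  then obtain P where P: "\<And>x. f (mat2 1 x 0 1) = poly P x" by blast
  \<comment> \<open>The second chart, needed for first rows with \<open>a = 0\<close>.\<close>
  have "\<exists>Q. \<forall>y. f (mat2 y 1 (- 1) 0) = poly Q y"
  proof (rule regular_function_poly[OF f])
    fix i j :: nat assume "i < 2" "j < 2"
    then show "\<exists>P. \<forall>y. mat2 y 1 (- 1) 0 $$ (i, j) = poly P y"
      by (intro exI[of _ "if i = 0 then if j = 0 then [:0, 1:] else 1 else if j = 0 then [:- 1:] else 0"]) (auto simp: less_two)
  qed
  then obtain Q where Q: "\<And>y. f (mat2 y 1 (- 1) 0) = poly Q y" by blast
  have E1: "f (mat2 a b c d) = a ^ m * poly P (b / a)" if "a \<noteq> 0" "a * d - b * c = 1" for a b c d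
  proof -
    have "d = (1 + b * c) / a" using that by (simp add: field_simps)
    then have "mat2 a b c d = mat2 a 0 0 (1 / a) * (mat2 1 0 (a * c) 1 * mat2 1 (b / a) 0 1)"
      using that(1) by (simp add: mat2_mult add_divide_distrib ac_simps)
    then show ?thesis using that(1) by (simp add: T L P mat2_SL2)
  qed
  have E2: "f (mat2 a b c d) = b ^ m * poly Q (a / b)" if "b \<noteq> 0" "a * d - b * c = 1" for a b c d
  proof -
    have "c = (a * d - 1) / b" using that by (simp add: field_simps)
    then have "mat2 a b c d = mat2 b 0 0 (1 / b) * (mat2 1 0 (b * d) 1 * mat2 (a / b) 1 (- 1) 0)"
      using that(1) by (simp add: mat2_mult diff_divide_distrib ac_simps)
    then show ?thesis using that(1) by (simp add: T L Q mat2_SL2)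
  qed
  have E3: "poly Q y = y ^ m * poly P (1 / y)" if "y \<noteq> 0" for y
    using E1[OF that, of 0 1 "- 1"] by (simp add: Q)
  \<comment> \<open>If the degree exceeded \<open>m\<close>, the reflected polynomial of
    \<open>P\<close> would be a positive power of \<open>y\<close> times \<open>Q\<close> and would
    vanish at 0, where its value is the leading coefficient.\<close>
  have deg: "degree P \<le> m"
  proof (rule ccontr)
    assume n: "\<not> degree P \<le> m"
    let ?n = "degree P"
    have "Polynomial.monom 1 (?n - m) * Q = reflect_poly P"
    proof (rule poly_eq_off_zero)
      fix y :: 'a assume y: "y \<noteq> 0"
      have "poly (Polynomial.monom 1 (?n - m) * Q) y = y ^ (?n - m) * y ^ m * poly P (1 / y)"
        by (simp add: poly_monom E3[OF y])
      also have "y ^ (?n - m) * y ^ m = y ^ ?n" using n by (simp add: power_add[symmetric])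
      finally show "poly (Polynomial.monom 1 (?n - m) * Q) y = poly (reflect_poly P) y"
        using y by (simp add: poly_reflect_poly_nz inverse_eq_divide)
    qed
    from arg_cong[OF this, of "\<lambda>p. poly p 0"] have "lead_coeff P = 0"
      using n by (simp add: poly_monom power_0_left)
    then show False using n by simp
  qed
  have P_sum: "poly P x = (\<Sum>i\<le>m. coeff P i * x ^ i)" for x
  proof -
    have "poly P x = poly (\<Sum>i\<le>m. Polynomial.monom (coeff P i) i) x"
      by (simp only: poly_as_sum_of_monoms'[OF deg])
    then show ?thesis by (simp add: poly_sum poly_monom)
  qed
  have hom: "y ^ m * poly P (b / y) = (\<Sum>i\<le>m. coeff P i * (y ^ (m - i) * b ^ i))" if "y \<noteq> 0" for y b
    unfolding P_sum sum_distrib_left using that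
    by (intro sum.cong refl) (simp add: power_divide power_diff field_simps)
  have "Q = (\<Sum>i\<le>m. Polynomial.monom (coeff P i) (m - i))"
    by (rule poly_eq_off_zero) (use hom[of _ 1] E3 in \<open>simp add: poly_sum poly_monom\<close>)
  then have Q0: "poly Q 0 = (\<Sum>i\<le>m. coeff P i * 0 ^ (m - i))" by (simp add: poly_sum poly_monom)
  have "f g = (\<Sum>i\<le>m. coeff P i * (g $$ (0, 0) ^ (m - i) * g $$ (0, 1) ^ i))" if g: "g \<in> SL2" for g
  proof -
    obtain a b c d where abcd: "g = mat2 a b c d" "a * d - b * c = 1" by (rule SL2_cases[OF g])
    show ?thesis
    proof (cases "a = 0")
      case False
      then show ?thesis using E1[OF False abcd(2)] hom[OF False, of b] abcd by simp
    next
      case True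
      then have "b \<noteq> 0" using abcd(2) by auto
      then have "f g = b ^ m * poly Q 0" using E2[of b a d c] abcd True by simp
      also have "\<dots> = (\<Sum>i\<le>m. coeff P i * (0 ^ (m - i) * b ^ i))"
        unfolding Q0 sum_distrib_left by (intro sum.cong refl) (auto simp: power_0_left)
      finally show ?thesis using abcd True by simp
    qed
  qed
  then show ?thesis by blast
qed

context char_two
begin

lemma cocycle_row_zero:
  fixes M :: "'a rep"
  assumes alg: "algebraic_rep M" and c: "cocycle M (induced_module m) c" and gh: "g \<in> SL2" "h \<in> SL2" and j: "j < rep_dim M"
  shows "c (g * h) $$ (0, j) = (\<Sum>i\<le>m. g $$ (0, 0) ^ (m - i) * g $$ (0, 1) ^ i * c h $$ (i, j)) +
    (\<Sum>i<rep_dim M. c g $$ (0, i) * M h $$ (i, j))"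
proof -
  have d: "dim_row (c x) = m + 1" "dim_col (c x) = rep_dim M" "dim_row (induced_module m x) = m + 1" "dim_col (induced_module m x) = m + 1"
    if "x \<in> SL2" for x :: "'a mat"
    using cocycle_dims[OF c that] that by simp_all
  have 1: "(induced_module m g * c h) $$ (0, j) = (\<Sum>i\<le>m. g $$ (0, 0) ^ (m - i) * g $$ (0, 1) ^ i * c h $$ (i, j))"
    using gh j d by (subst mult_index) (auto simp: lessThan_Suc_atMost induced_module_row_zero)
  have 2: "(c g * M h) $$ (0, j) = (\<Sum>i<rep_dim M. c g $$ (0, i) * M h $$ (i, j))"
    using gh j d alg by (subst mult_index) auto
  show ?thesis
    unfolding cocycle_mult[OF c gh] 1[symmetric] 2[symmetric]
    using gh j d alg by (subst index_add_mat) auto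
qed

lemma cocycle_row_zero_lower:
  fixes M :: "'a rep"
  assumes alg: "algebraic_rep M" and c: "cocycle M (induced_module m) c" and gh: "mat2 a 0 z d \<in> SL2" "h \<in> SL2" and j: "j < rep_dim M"
  shows "c (mat2 a 0 z d * h) $$ (0, j) = a ^ m * c h $$ (0, j) + (\<Sum>i<rep_dim M. c (mat2 a 0 z d) $$ (0, i) * M h $$ (i, j))"
proof -
  have "(\<Sum>i\<le>m. a ^ (m - i) * 0 ^ i * c h $$ (i, j)) = (\<Sum>i\<le>m. if i = 0 then a ^ m * c h $$ (0, j) else 0)"
    by (intro sum.cong refl) auto
  also have "\<dots> = a ^ m * c h $$ (0, j)" by simp
  finally show ?thesis using cocycle_row_zero[OF alg c gh j] by simp
qed

text \<open>If the two characters differ at some \<open>s\<close>, symmetry in \<open>s\<close> and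
  \<open>t\<close> exhibits \<open>r\<close> as a coboundary. If they agree,
  \<open>r (s * s)\<close> is twice a term, hence zero, and every element is a square.\<close>

lemma torus_character_vanishes:
  fixes r :: "'a \<Rightarrow> 'a"
  assumes r: "\<And>t s. t \<noteq> 0 \<Longrightarrow> s \<noteq> 0 \<Longrightarrow> r (t * s) = t ^ m * r s + r t * \<chi> s"
  shows "\<exists>k. \<forall>t. t \<noteq> 0 \<longrightarrow> r t = t ^ m * k - k * \<chi> t"
proof (cases "\<exists>s. s \<noteq> 0 \<and> s ^ m \<noteq> \<chi> s")
  case True
  then obtain s where s: "s \<noteq> 0" "s ^ m \<noteq> \<chi> s" by blast
  define k where "k = r s / (s ^ m - \<chi> s)"
  have "r t = t ^ m * k - k * \<chi> t" if "t \<noteq> 0" for t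
  proof -
    have "t ^ m * r s + r t * \<chi> s = s ^ m * r t + r s * \<chi> t"
      using r[OF that s(1)] r[OF s(1) that] by (simp add: mult.commute)
    then have "r t * (s ^ m - \<chi> s) = r s * (t ^ m - \<chi> t)" by (simp add: algebra_simps)
    then have "r t = k * (t ^ m - \<chi> t)" using s(2) by (simp add: k_def field_simps)
    then show ?thesis by (simp add: algebra_simps)
  qed
  then show ?thesis by blast
next
  case False
  have "r t = 0" if "t \<noteq> 0" for t
  proof -
    obtain s where s: "s ^ 2 = t" using square_root_exists by blast
    then have s0: "s \<noteq> 0" using that by auto
    then have "\<chi> s = s ^ m" using False by auto
    then show ?thesis using r[OF s0 s0] s by (simp add: power2_eq_square mult.commute)
  qed
  then show ?thesis by (intro exI[of _ 0]) simp
qed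

text \<open>Frobenius reciprocity: an extension by \<open>H\<^sup>0(m)\<close> is split by a functional of weight \<open>m\<close>
  that is invariant under the lower unipotent group. All weights of \<open>M\<close> being at most \<open>m\<close>, the
  invariance is automatic.\<close>

lemma ext_trivial_induced_dominant:
  fixes M :: "'a rep"
  assumes alg: "algebraic_rep M"
    and M: "\<And>t i j. t \<noteq> 0 \<Longrightarrow> i < rep_dim M \<Longrightarrow> j < rep_dim M \<Longrightarrow>
      M (mat2 t 0 0 (1 / t)) $$ (i, j) = (if i = j then t ^ a j * (1 / t) ^ b j else 0)"
    and le: "\<And>j. j < rep_dim M \<Longrightarrow> a j \<le> m + b j"
  shows "ext_trivial M (induced_module m)"
proof (rule ext_trivialI)
  fix c assume c: "cocycle M (induced_module m) c"
  let ?d = "rep_dim M" and ?S = "induced_module m :: 'a rep" and ?T = "\<lambda>t :: 'a. mat2 t 0 0 (1 / t)" and ?L = "\<lambda>z :: 'a. mat2 1 0 z 1"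
  have TL: "t \<noteq> 0 \<Longrightarrow> ?T t \<in> SL2" "?L z \<in> SL2" for t z by (auto simp: mat2_SL2)
  have sumM: "(\<Sum>i<?d. r i * M (?T t) $$ (i, j)) = r j * (t ^ a j * (1 / t) ^ b j)" if "t \<noteq> 0" "j < ?d" for r t j
  proof -
    have "(\<Sum>i<?d. r i * M (?T t) $$ (i, j)) = (\<Sum>i<?d. if i = j then r j * (t ^ a j * (1 / t) ^ b j) else 0)"
      using that by (intro sum.cong refl) (simp add: M)
    then show ?thesis using that by simp
  qed
  have "\<exists>k. \<forall>t. t \<noteq> 0 \<longrightarrow> c (?T t) $$ (0, j) = t ^ m * k - k * (t ^ a j * (1 / t) ^ b j)" if j: "j < ?d" for j
  proof (rule torus_character_vanishes)
    fix t s :: 'a assume ts: "t \<noteq> 0" "s \<noteq> 0"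
    have "?T (t * s) = ?T t * ?T s" by (simp add: mat2_mult)
    then show "c (?T (t * s)) $$ (0, j) = t ^ m * c (?T s) $$ (0, j) + c (?T t) $$ (0, j) * (s ^ a j * (1 / s) ^ b j)"
      using cocycle_row_zero_lower[OF alg c TL(1)[OF ts(1)] TL(1)[OF ts(2)] j] sumM[OF ts(2) j] by simp
  qed
  then obtain k where k: "\<And>t j. t \<noteq> 0 \<Longrightarrow> j < ?d \<Longrightarrow> c (?T t) $$ (0, j) = t ^ m * k j - k j * (t ^ a j * (1 / t) ^ b j)"
    by metis
  \<comment> \<open>Subtracting this coboundary makes row zero of the cocycle vanish on the
    torus.\<close>
  define A0 where "A0 = mat (m + 1) ?d (\<lambda>(i, j). if i = 0 then k j else 0)"
  have [simp]: "dim_row A0 = m + 1" "dim_col A0 = ?d" by (simp_all add: A0_def)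
  define c1 where "c1 g = c g - (?S g * A0 - A0 * M g)" for g
  have c1: "cocycle M ?S c1" unfolding c1_def using alg c by (intro cocycle_diff cocycle_coboundary) auto
  have dc1: "dim_row (c1 g) = m + 1" "dim_col (c1 g) = ?d" if "g \<in> SL2" for g
    using cocycle_dims[OF c1 that] by auto
  have c1T: "c1 (?T t) $$ (0, j) = 0" if t: "t \<noteq> 0" and j: "j < ?d" for t j
  proof -
    have "(?S (?T t) * A0) $$ (0, j) = (\<Sum>i<m+1. ?S (?T t) $$ (0, i) * A0 $$ (i, j))"
      using j by (subst mult_index) auto
    also have "\<dots> = (\<Sum>i<m+1. if i = 0 then t ^ m * k j else 0)"
      using j by (intro sum.cong refl) (auto simp: induced_module_row_zero A0_def)
    finally have 1: "(?S (?T t) * A0) $$ (0, j) = t ^ m * k j" by simp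
    have "(A0 * M (?T t)) $$ (0, j) = (\<Sum>i<?d. k i * M (?T t) $$ (i, j))"
      using j TL(1)[OF t] alg by (subst mult_index) (auto simp: A0_def)
    then have 2: "(A0 * M (?T t)) $$ (0, j) = k j * (t ^ a j * (1 / t) ^ b j)" using sumM[OF t j] by simp
    show ?thesis
      unfolding c1_def using j TL(1)[OF t] alg k[OF t j] 1 2 cocycle_dims[OF c TL(1)[OF t]]
      by (simp del: index_mult_mat(1))
  qed
  have c1_one: "c1 (1\<^sub>m 2) $$ (0, j) = 0" if "j < ?d" for j
    using c1T[of 1 j] that by (simp add: mat2_one)
  have Tact: "c1 (?T t * h) $$ (0, j) = t ^ m * c1 h $$ (0, j)" if "t \<noteq> 0" "h \<in> SL2" "j < ?d" for t h j
    using cocycle_row_zero_lower[OF alg c1 TL(1)[OF that(1)] that(2,3)] c1T[OF that(1)] by simp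
  have c1L: "c1 (?L z) $$ (0, j) = 0" if j: "j < ?d" for z j
  proof -
    obtain f where f: "f \<in> regular_functions" "\<forall>g\<in>SL2. c1 g $$ (0, j) = f g"
      using regular_mat_entry[of "m + 1" ?d c1 0 j] c1 j unfolding cocycle_def by auto
    have "\<exists>P. \<forall>z. f (?L z) = poly P z"
    proof (rule regular_function_poly[OF f(1)])
      fix i j :: nat assume "i < 2" "j < 2"
      then show "\<exists>P. \<forall>z. ?L z $$ (i, j) = poly P z"
        by (intro exI[of _ "if i = j then 1 else if i = 0 then 0 else [:0, 1:]"]) (auto simp: less_two)
    qed
    then obtain P where "\<And>z. f (?L z) = poly P z" by blast
    then have P: "c1 (?L z) $$ (0, j) = poly P z" for z using f(2) TL(2) by auto
    define e where "e = m + b j - a j"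
    have e: "m + b j = e + a j" using le[OF j] by (simp add: e_def)
    have key: "s ^ e * poly P (s ^ 2) = poly P 1" if s: "s \<noteq> 0" for s
    proof -
      have s': "1 / s \<noteq> 0" using s by simp
      \<comment> \<open>Torus conjugation reaches all nonzero parameters from the single element
        with parameter 1, but only through squares, which is why square roots are taken
        below.\<close>
      have "?L (s ^ 2) = ?T (1 / s) * (?L 1 * ?T s)" using s by (simp add: mat2_mult power2_eq_square)
      then have "poly P (s ^ 2) = (1 / s) ^ m * c1 (?L 1 * ?T s) $$ (0, j)"
        using Tact[OF s' _ j, of "?L 1 * ?T s"] TL s by (simp add: P[symmetric])
      also have "c1 (?L 1 * ?T s) $$ (0, j) = poly P 1 * (s ^ a j * (1 / s) ^ b j)"
        using cocycle_row_zero_lower[OF alg c1 TL(2)[of 1] TL(1)[OF s] j] c1T[OF s j] sumM[OF s j]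
        by (simp add: P)
      finally have "s ^ e * poly P (s ^ 2) = poly P 1 * (s ^ (e + a j) * (1 / s) ^ (m + b j))"
        by (simp add: power_add mult_ac)
      also have "s ^ (e + a j) * (1 / s) ^ (m + b j) = 1"
        unfolding e using s by (simp add: power_one_over)
      finally show ?thesis by simp
    qed
    \<comment> \<open>The bound on weights makes \<open>e\<close> a true difference, so both sides
      are polynomials. At 0 the left side is a multiple of \<open>poly P 0 = 0\<close>, forcing the
      constant on the right to vanish.\<close>
    have "Polynomial.monom 1 e * pcompose P [:0, 0, 1:] = [:poly P 1:]"
      by (rule poly_eq_off_zero) (simp add: poly_monom poly_pcompose key power2_eq_square[symmetric])
    from arg_cong[OF this, of "\<lambda>p. poly p 0"] have "0 ^ e * poly P 0 = poly P 1"
      by (simp add: poly_monom poly_pcompose)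
    moreover have P0: "poly P 0 = 0" using P[of 0] c1_one[OF j] by (simp add: mat2_one)
    ultimately have P1: "poly P 1 = 0" by simp
    obtain s where s: "s ^ 2 = z" using square_root_exists by blast
    have "poly P z = 0"
      using key[of s] P0 P1 s by (cases "s = 0") auto
    then show ?thesis using P by simp
  qed
  have Lact: "c1 (?L z * h) $$ (0, j) = c1 h $$ (0, j)" if "h \<in> SL2" "j < ?d" for z h j
    using cocycle_row_zero_lower[OF alg c1 TL(2) that] c1L by simp
  \<comment> \<open>Row zero is now semi-invariant under the lower triangular group, so it is row
    zero of \<open>?S g\<close> times a constant matrix.\<close>
  have "\<exists>A. \<forall>g\<in>SL2. c1 g $$ (0, j) = (\<Sum>i\<le>m. A i * (g $$ (0, 0) ^ (m - i) * g $$ (0, 1) ^ i))" if j: "j < ?d" for j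
  proof -
    obtain f where f: "f \<in> regular_functions" "\<forall>g\<in>SL2. c1 g $$ (0, j) = f g"
      using regular_mat_entry[of "m + 1" ?d c1 0 j] c1 j unfolding cocycle_def by auto
    have "\<exists>A. \<forall>g\<in>SL2. f g = (\<Sum>i\<le>m. A i * (g $$ (0, 0) ^ (m - i) * g $$ (0, 1) ^ i))"
    proof (rule borel_semi_invariant[OF f(1)])
      fix t :: 'a and g :: "'a mat" assume "t \<noteq> 0" "g \<in> SL2"
      then show "f (?T t * g) = t ^ m * f g" using Tact[of t g j] f(2) TL(1)[of t] j by simp
    next
      fix z :: 'a and g :: "'a mat" assume "g \<in> SL2"
      then show "f (?L z * g) = f g" using Lact[of g j z] f(2) TL(2)[of z] j by simp
    qed
    then show ?thesis using f(2) by auto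
  qed
  then obtain A1 where A1: "\<And>g j. j < ?d \<Longrightarrow> g \<in> SL2 \<Longrightarrow> c1 g $$ (0, j) = (\<Sum>i\<le>m. A1 j i * (g $$ (0, 0) ^ (m - i) * g $$ (0, 1) ^ i))"
    by metis
  define A where "A = mat (m + 1) ?d (\<lambda>(i, j). A1 j i)"
  have [simp]: "dim_row A = m + 1" "dim_col A = ?d" by (simp_all add: A_def)
  define c2 where "c2 g = c1 g - (?S g * A - A * M g)" for g
  have c2: "cocycle M ?S c2" unfolding c2_def using alg c1 by (intro cocycle_diff cocycle_coboundary) auto
  have SA: "(?S g * A) $$ (0, j) = c1 g $$ (0, j)" if "g \<in> SL2" "j < ?d" for g j
  proof -
    have "(?S g * A) $$ (0, j) = (\<Sum>i<m+1. ?S g $$ (0, i) * A $$ (i, j))"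
      using that by (subst mult_index) auto
    also have "\<dots> = (\<Sum>i\<le>m. A1 j i * (g $$ (0, 0) ^ (m - i) * g $$ (0, 1) ^ i))"
      using that by (intro sum.cong) (auto simp: induced_module_row_zero A_def mult.commute)
    finally show ?thesis using A1[OF that(2,1)] by simp
  qed
  have A_row: "A $$ (0, j) = 0" if j: "j < ?d" for j
  proof -
    have "(\<Sum>i\<le>m. A1 j i * ((1\<^sub>m 2 :: 'a mat) $$ (0, 0) ^ (m - i) * (1\<^sub>m 2 :: 'a mat) $$ (0, 1) ^ i)) = (\<Sum>i\<le>m. if i = 0 then A1 j 0 else 0)"
      by (intro sum.cong refl) (auto simp: power_0_left)
    then show ?thesis using A1[OF j one_SL2] c1_one[OF j] j by (simp add: A_def)
  qed
  have c2_row: "c2 g $$ (0, j) = 0" if "g \<in> SL2" "j < ?d" for g j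
  proof -
    have "(A * M g) $$ (0, j) = (\<Sum>i<?d. A $$ (0, i) * M g $$ (i, j))"
      using that alg by (subst mult_index) auto
    also have "\<dots> = 0" using A_row by simp
    finally show ?thesis
      unfolding c2_def using that alg SA[OF that] dc1[OF that(1)] by (simp del: index_mult_mat(1))
  qed
  \<comment> \<open>Vanishing of row zero at all translates by upper unipotent elements is a
    polynomial identity whose coefficients are the entries of the column.\<close>
  have c2_zero: "c2 h = 0\<^sub>m (m + 1) ?d" if h: "h \<in> SL2" for h
  proof (rule eq_matI)
    fix i j assume "i < dim_row (0\<^sub>m (m + 1) ?d :: 'a mat)" "j < dim_col (0\<^sub>m (m + 1) ?d :: 'a mat)"
    then have ij: "i \<le> m" "j < ?d" by auto
    have "poly (\<Sum>i\<le>m. Polynomial.monom (c2 h $$ (i, j)) i) x = 0" for x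
    proof -
      have g: "mat2 1 x 0 1 \<in> SL2" by (simp add: mat2_SL2)
      have "(\<Sum>i\<le>m. x ^ i * c2 h $$ (i, j)) = 0"
        using cocycle_row_zero[OF alg c2 g h ij(2)] c2_row[OF mult_SL2[OF g h] ij(2)] c2_row[OF g] by simp
      then show ?thesis by (simp add: poly_sum poly_monom mult.commute)
    qed
    then have "(\<Sum>i\<le>m. Polynomial.monom (c2 h $$ (i, j)) i) = 0" by (rule poly_eq_zero_UNIV)
    then have "coeff (\<Sum>i\<le>m. Polynomial.monom (c2 h $$ (i, j)) i) i = 0" by simp
    then show "c2 h $$ (i, j) = 0\<^sub>m (m + 1) ?d $$ (i, j)" using ij by (simp add: coeff_sum)
  qed (use cocycle_dims[OF c2 h] in auto)
  have "c g = ?S g * (A0 + A) - (A0 + A) * M g" if g: "g \<in> SL2" for g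
  proof (rule eq_matI)
    fix i j assume "i < dim_row (?S g * (A0 + A) - (A0 + A) * M g)" "j < dim_col (?S g * (A0 + A) - (A0 + A) * M g)"
    then have ij: "i < m + 1" "j < ?d" using alg g by auto
    have "c2 g $$ (i, j) = 0" using c2_zero[OF g] ij by simp
    then show "c g $$ (i, j) = (?S g * (A0 + A) - (A0 + A) * M g) $$ (i, j)"
      using ij alg g cocycle_dims[OF c g]
      by (simp add: c2_def c1_def mat_distrib_left mat_distrib_right algebra_simps del: index_mult_mat(1))
  qed (use alg g cocycle_dims[OF c g] in auto)
  then show "\<exists>A. dim_row A = rep_dim ?S \<and> dim_col A = ?d \<and> (\<forall>g\<in>SL2. c g = ?S g * A - A * M g)"
    by (intro exI[of _ "A0 + A"]) auto
qed

text \<open>For \<open>n \<le> m\<close> the weights \<open>2 * j - n\<close> of the Weyl module are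
  at most \<open>m\<close>; the remaining case is dual to one with the indices exchanged.\<close>

lemma ext_trivial_weyl_induced: "ext_trivial (weyl_module n) (induced_module m :: 'a rep)"
proof -
  have le: "ext_trivial (weyl_module n) (induced_module m :: 'a rep)" if "n \<le> m" for n m
    unfolding weyl_module_def
  proof (rule ext_trivial_induced_dominant[where a = "\<lambda>j. j" and b = "\<lambda>j. n - j"])
    fix t :: 'a and i j assume t: "t \<noteq> 0" and "i < rep_dim (dual_rep (induced_module n :: 'a rep))" "j < rep_dim (dual_rep (induced_module n :: 'a rep))"
    then have "i < n + 1" "j < n + 1" by simp_all
    then show "dual_rep (induced_module n) (mat2 t 0 0 (1 / t)) $$ (i, j) = (if i = j then t ^ j * (1 / t) ^ (n - j) else 0)"
      using induced_module_diagonal[of j n i "1 / t" t] by (simp add: dual_rep_def induced_module_def mult.commute)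
  qed (use that in auto)
  show ?thesis
  proof (cases "n \<le> m")
    case False
    then show ?thesis
      using ext_trivial_dual[OF _ _ le[of m n, unfolded weyl_module_def]] by (simp add: weyl_module_def)
  qed (rule le)
qed

lemma ext_trivial_trivial_induced: "ext_trivial trivial_rep (induced_module m :: 'a rep)"
proof (rule ext_trivial_induced_dominant[where a = "\<lambda>_. 0" and b = "\<lambda>_. 0"])
  fix t :: 'a and i j assume "i < rep_dim (trivial_rep :: 'a rep)" "j < rep_dim (trivial_rep :: 'a rep)"
  then have "i < 1" "j < 1" by simp_all
  then show "trivial_rep (mat2 t 0 0 (1 / t)) $$ (i, j) = (if i = j then t ^ 0 * (1 / t) ^ 0 else 0)"
    by (simp add: trivial_rep_def)
qed auto

end

section \<open>The Koszul sequence\<close>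

definition unit_col_mat :: "nat \<Rightarrow> nat \<Rightarrow> (nat \<Rightarrow> nat) \<Rightarrow> 'a :: field mat" where
  "unit_col_mat n k f = mat n k (\<lambda>(r, c). if r = f c then 1 else 0)"

lemma dim_unit_col_mat [simp]: "dim_row (unit_col_mat n k f) = n" "dim_col (unit_col_mat n k f) = k"
  by (simp_all add: unit_col_mat_def)

lemma mult_unit_col_mat:
  assumes "dim_col X = n" "i < dim_row X" "c < k" "f c < n"
  shows "(X * unit_col_mat n k f) $$ (i, c) = X $$ (i, f c)"
proof -
  have "(X * unit_col_mat n k f) $$ (i, c) = (\<Sum>l<n. X $$ (i, l) * unit_col_mat n k f $$ (l, c))"
    using assms by (subst mult_index) auto
  also have "\<dots> = (\<Sum>l<n. X $$ (i, l) * (if l = f c then 1 else 0))"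
    using assms by (intro sum.cong) (auto simp: unit_col_mat_def)
  finally show ?thesis using assms by (simp add: mult_delta_sum_right)
qed

lemma div_mod_mult_add: "(l :: nat) < b \<Longrightarrow> (k * b + l) div b = k" "l < b \<Longrightarrow> (k * b + l) mod b = l"
  by auto

lemma div_mod_add: "(l :: nat) < b \<Longrightarrow> (b + l) div b = 1" "l < b \<Longrightarrow> (b + l) mod b = l"
  using div_mod_mult_add[of l b 1] by auto

context char_two
begin

text \<open>The exact sequence \<open>0 \<rightarrow> H\<^sup>0(m) \<rightarrow> V \<otimes> H\<^sup>0(m+1) \<rightarrow> H\<^sup>0(m+2) \<rightarrow> 0\<close> given by
  \<open>p \<mapsto> x \<otimes> y p - y \<otimes> x p\<close> and by multiplication, with linear splittings.\<close>

definition mult_map :: "nat \<Rightarrow> 'a mat" where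
  "mult_map n = unit_col_mat (n + 2) (2 * (n + 1)) (\<lambda>c. c div (n + 1) + c mod (n + 1))"

text \<open>Each monomial divisible by \<open>x\<close> lifts to \<open>x\<close> times a monomial.
  The exception \<open>y^(n+1)\<close> lifts to \<open>y \<otimes> y^n\<close>, whose index is
  \<open>(n + 1) + n\<close>.\<close>

definition mult_section :: "nat \<Rightarrow> 'a mat" where
  "mult_section n = unit_col_mat (2 * (n + 1)) (n + 2) (\<lambda>c. if c < n + 1 then c else 2 * n + 1)"

text \<open>The two terms are \<open>x\<close> tensor \<open>y\<close> times the monomial and
  \<open>y\<close> tensor \<open>x\<close> times the monomial; in characteristic two their
  difference is a sum.\<close>

definition koszul_map :: "nat \<Rightarrow> 'a mat" where
  "koszul_map m = unit_col_mat (2 * (m + 2)) (m + 1) (\<lambda>c. c + 1) + unit_col_mat (2 * (m + 2)) (m + 1) (\<lambda>c. m + 2 + c)"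

definition koszul_retraction :: "nat \<Rightarrow> 'a mat" where
  "koszul_retraction m = mat (m + 1) (2 * (m + 2)) (\<lambda>(r, c). if c = m + 2 + r then 1 else 0)"

lemma dim_koszul [simp]:
  "dim_row (mult_map n) = n + 2" "dim_col (mult_map n) = 2 * (n + 1)"
  "dim_row (mult_section n) = 2 * (n + 1)" "dim_col (mult_section n) = n + 2"
  "dim_row (koszul_map m) = 2 * (m + 2)" "dim_col (koszul_map m) = m + 1"
  "dim_row (koszul_retraction m) = m + 1" "dim_col (koszul_retraction m) = 2 * (m + 2)"
  by (simp_all add: mult_map_def mult_section_def koszul_map_def koszul_retraction_def)

lemma koszul_retraction_mult:
  assumes "dim_row X = 2 * (m + 2)" "r < m + 1" "j < dim_col X"
  shows "(koszul_retraction m * X) $$ (r, j) = X $$ (m + 2 + r, j)"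
proof -
  have "(koszul_retraction m * X) $$ (r, j) = (\<Sum>l<2*(m+2). koszul_retraction m $$ (r, l) * X $$ (l, j))"
    using assms by (subst mult_index) auto
  also have "\<dots> = (\<Sum>l<2*(m+2). (if l = m + 2 + r then 1 else 0) * X $$ (l, j))"
    using assms by (intro sum.cong) (auto simp: koszul_retraction_def)
  finally show ?thesis using assms by (simp add: mult_delta_sum_left)
qed

lemma mult_koszul_map:
  assumes "dim_col X = 2 * (m + 2)" "i < dim_row X" "c < m + 1"
  shows "(X * koszul_map m) $$ (i, c) = X $$ (i, c + 1) + X $$ (i, m + 2 + c)"
  using assms unfolding koszul_map_def
  by (simp add: mat_distrib_left mult_unit_col_mat del: index_mult_mat(1))

lemma koszul_mult:
  "koszul_retraction m * koszul_map m = 1\<^sub>m (m + 1)"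
  "mult_map n * mult_section n = 1\<^sub>m (n + 2)"
  "mult_map (m + 1) * koszul_map m = 0\<^sub>m (m + 3) (m + 1)"
proof -
  show "koszul_retraction m * koszul_map m = 1\<^sub>m (m + 1)"
    by (rule eq_matI) (auto simp: koszul_retraction_mult koszul_map_def unit_col_mat_def simp del: index_mult_mat(1))
  show "mult_map n * mult_section n = 1\<^sub>m (n + 2)"
  proof (rule eq_matI)
    fix r c assume "r < dim_row (1\<^sub>m (n + 2) :: 'a mat)" "c < dim_col (1\<^sub>m (n + 2) :: 'a mat)"
    then have rc: "r < n + 2" "c < n + 2" by auto
    let ?s = "if c < n + 1 then c else 2 * n + 1"
    have "?s div (n + 1) + ?s mod (n + 1) = c"
    proof (cases "c < n + 1")
      case False
      then have "?s = (n + 1) + n" "c = n + 1" using rc by auto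
      then show ?thesis using div_mod_add[of n "n + 1"] by (simp only:)
    qed simp
    moreover have "(mult_map n * mult_section n) $$ (r, c) = mult_map n $$ (r, ?s)"
      unfolding mult_section_def using rc by (subst mult_unit_col_mat) auto
    ultimately show "(mult_map n * mult_section n) $$ (r, c) = 1\<^sub>m (n + 2) $$ (r, c)"
      using rc by (simp add: mult_map_def unit_col_mat_def del: index_mult_mat(1))
  qed auto
  show "mult_map (m + 1) * koszul_map m = 0\<^sub>m (m + 3) (m + 1)"
  proof (rule eq_matI)
    fix r c assume "r < dim_row (0\<^sub>m (m + 3) (m + 1) :: 'a mat)" "c < dim_col (0\<^sub>m (m + 3) (m + 1) :: 'a mat)"
    then have rc: "r < m + 3" "c < m + 1" by auto
    have "(mult_map (m + 1) * koszul_map m) $$ (r, c) = mult_map (m + 1) $$ (r, c + 1) + mult_map (m + 1) $$ (r, m + 2 + c)"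
      using rc by (intro mult_koszul_map) auto
    then show "(mult_map (m + 1) * koszul_map m) $$ (r, c) = 0\<^sub>m (m + 3) (m + 1) $$ (r, c)"
      using rc div_mod_add[of c "m + 2"] by (simp add: mult_map_def unit_col_mat_def del: index_mult_mat(1))
  qed auto
qed

lemma koszul_complete: "koszul_map m * koszul_retraction m + mult_section (m + 1) * mult_map (m + 1) = 1\<^sub>m (2 * (m + 2))"
proof (rule eq_matI)
  fix r c assume "r < dim_row (1\<^sub>m (2 * (m + 2)) :: 'a mat)" "c < dim_col (1\<^sub>m (2 * (m + 2)) :: 'a mat)"
  then have rc: "r < 2 * (m + 2)" "c < 2 * (m + 2)" by auto
  have k: "c div (m + 2) + c mod (m + 2) < m + 3"
    using div_mod_less[OF rc(2)] by linarith
  have "(mult_section (m + 1) * mult_map (m + 1)) $$ (r, c) = mult_section (m + 1) $$ (r, c div (m + 2) + c mod (m + 2))"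
    unfolding mult_map_def using rc k by (subst mult_unit_col_mat) (auto simp: numeral_3_eq_3 eval_nat_numeral)
  then have S: "(mult_section (m + 1) * mult_map (m + 1)) $$ (r, c) =
      (if r = (if c div (m + 2) + c mod (m + 2) < m + 2 then c div (m + 2) + c mod (m + 2) else 2 * m + 3) then 1 else 0)"
    using rc k by (simp add: mult_section_def unit_col_mat_def eval_nat_numeral)
  have "(koszul_map m * koszul_retraction m) $$ (r, c) = (\<Sum>l<m+1. koszul_map m $$ (r, l) * koszul_retraction m $$ (l, c))"
    using rc by (subst mult_index) auto
  also have "\<dots> = (\<Sum>l<m+1. koszul_map m $$ (r, l) * (if c = m + 2 + l then 1 else 0))"
    using rc by (intro sum.cong) (auto simp: koszul_retraction_def)
  also have "\<dots> = (if m + 2 \<le> c \<and> c < 2 * m + 3 then koszul_map m $$ (r, c - (m + 2)) else 0)"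
  proof (cases "m + 2 \<le> c")
    case True
    then have "(\<Sum>l<m+1. koszul_map m $$ (r, l) * (if c = m + 2 + l then 1 else 0)) =
        (\<Sum>l<m+1. koszul_map m $$ (r, l) * (if l = c - (m + 2) then 1 else 0))"
      by (intro sum.cong) auto
    then show ?thesis using True by (auto simp: mult_delta_sum_right)
  qed auto
  finally have K: "(koszul_map m * koszul_retraction m) $$ (r, c) =
     (if m + 2 \<le> c \<and> c < 2 * m + 3 then koszul_map m $$ (r, c - (m + 2)) else 0)" .
  \<comment> \<open>Basis vectors \<open>x \<otimes> _\<close>, then \<open>y \<otimes> _\<close>
    except the last, then \<open>y \<otimes> y^(m+1)\<close>. In the second kind the section term
    cancels one half of the Koszul term.\<close>
  consider "c < m + 2" | j where "c = m + 2 + j" "j \<le> m" | "c = 2 * m + 3"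
  proof (cases "c < m + 2")
    case False
    then have "c = m + 2 + (c - (m + 2))" by simp
    moreover have "c - (m + 2) \<le> m \<or> c = 2 * m + 3" using False rc(2) by presburger
    ultimately show ?thesis using that(2,3) by blast
  qed (rule that(1))
  then show "(koszul_map m * koszul_retraction m + mult_section (m + 1) * mult_map (m + 1)) $$ (r, c) = 1\<^sub>m (2 * (m + 2)) $$ (r, c)"
  proof cases
    case 1
    then show ?thesis
      using rc S K by (simp del: index_mult_mat(1))
  next
    case (2 j)
    then have "c div (m + 2) = 1" "c mod (m + 2) = j" using div_mod_add[of j "m + 2"] by simp_all
    then show ?thesis
      using rc S K 2
      by (auto simp: koszul_map_def unit_col_mat_def two_eq_zero simp del: index_mult_mat(1))
  next
    case 3
    then have "c = (m + 2) + (m + 1)" by simp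
    then have "c div (m + 2) = 1" "c mod (m + 2) = m + 1" using div_mod_add[of "m + 1" "m + 2"] by (simp_all only:)
    then show ?thesis
      using rc S K 3 by (auto simp del: index_mult_mat(1))
  qed
qed auto

lemma mult_map_hom: "rep_hom (tensor V (induced_module n)) (induced_module (n + 1)) (mult_map n)"
proof (rule rep_homI)
  fix g :: "'a mat" assume g: "g \<in> SL2"
  have [simp]: "dim_row g = 2" "dim_col g = 2" using SL2_D[OF g] by auto
  let ?L = "[:g $$ (0, 0), g $$ (1, 0):]" and ?M = "[:g $$ (0, 1), g $$ (1, 1):]"
  show "mult_map n * tensor V (induced_module n) g = induced_module (n + 1) g * mult_map n"
  proof (rule eq_matI)
    fix r c assume "r < dim_row (induced_module (n + 1) g * mult_map n)" "c < dim_col (induced_module (n + 1) g * mult_map n)"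
    then have rc: "r < n + 2" "c < 2 * (n + 1)" by auto
    define c1 c2 where "c1 = c div (n + 1)" and "c2 = c mod (n + 1)"
    have c12: "c1 < 2" "c2 < n + 1" using div_mod_less[OF rc(2)] by (auto simp: c1_def c2_def)
    then have k: "c div (n + 1) + c mod (n + 1) < n + 1 + 1" unfolding c1_def c2_def by linarith
    let ?p = "?L ^ (n - c2) * ?M ^ c2"
    have degp: "degree ?p \<le> n"
    proof -
      have "degree ?p \<le> degree ?L * (n - c2) + degree ?M * c2"
        by (rule order_trans[OF degree_mult_le]) (intro add_mono degree_power_le)
      also have "\<dots> \<le> 1 * (n - c2) + 1 * c2" by (intro add_mono mult_right_mono) auto
      finally show ?thesis using c12 by simp
    qed
    let ?f = "\<lambda>k l. (if r = k + l then 1 else 0) * (g $$ (k, c1) * coeff ?p l)"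
    have "(mult_map n * tensor V (induced_module n) g) $$ (r, c) = (\<Sum>k<2*(n+1). mult_map n $$ (r, k) * tensor V (induced_module n) g $$ (k, c))"
      using rc by (subst mult_index) (auto simp: tensor_def natural_rep_def)
    also have "\<dots> = (\<Sum>k<2*(n+1). ?f (k div (n + 1)) (k mod (n + 1)))"
      using rc c12 by (intro sum.cong refl)
        (simp add: mult_map_def unit_col_mat_def tensor_def natural_rep_def c1_def c2_def induced_module_def div_mod_less del: div_mult_self1_is_m)
    also have "\<dots> = (\<Sum>k<2. \<Sum>l<n+1. ?f k l)" by (rule sum_div_mod)
    also have "\<dots> = (\<Sum>l<n+1. (if l = r then 1 else 0) * (g $$ (0, c1) * coeff ?p l)) +
        (\<Sum>l<n+1. if r = Suc l then g $$ (1, c1) * coeff ?p l else 0)"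
      unfolding sum_less_two by (intro arg_cong2[of _ _ _ _ "(+)"] sum.cong) auto
    also have "(\<Sum>l<n+1. (if l = r then 1 else 0) * (g $$ (0, c1) * coeff ?p l)) = g $$ (0, c1) * coeff ?p r"
      using degp by (subst mult_delta_sum_left) (auto intro!: coeff_eq_0)
    also have "(\<Sum>l<n+1. if r = Suc l then g $$ (1, c1) * coeff ?p l else 0) = (case r of 0 \<Rightarrow> 0 | Suc k \<Rightarrow> g $$ (1, c1) * coeff ?p k)"
      using rc by (cases r) auto
    also have "g $$ (0, c1) * coeff ?p r + (case r of 0 \<Rightarrow> 0 | Suc k \<Rightarrow> g $$ (1, c1) * coeff ?p k) = coeff ([:g $$ (0, c1), g $$ (1, c1):] * ?p) r"
      by (auto simp: coeff_pCons split: nat.splits)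
    also have "[:g $$ (0, c1), g $$ (1, c1):] * ?p = ?L ^ (n + 1 - (c1 + c2)) * ?M ^ (c1 + c2)"
    proof -
      consider "c1 = 0" | "c1 = 1" using c12 less_two by auto
      then show ?thesis
      proof cases
        case 1
        have "n + 1 - c2 = Suc (n - c2)" using c12 by simp
        then show ?thesis using 1 by (simp only: add_0_left power_Suc mult.assoc)
      next
        case 2
        have "n + 1 - (1 + c2) = n - c2" by simp
        then show ?thesis using 2 by (simp only: power_add power_one_right mult.left_commute)
      qed
    qed
    also have "coeff \<dots> r = induced_module (n + 1) g $$ (r, c1 + c2)"
      using rc c12 by (simp add: induced_module_def)
    also have "\<dots> = (induced_module (n + 1) g * mult_map n) $$ (r, c)"
      unfolding mult_map_def using rc k by (subst mult_unit_col_mat) (auto simp: c1_def c2_def)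
    finally show "(mult_map n * tensor V (induced_module n) g) $$ (r, c) = (induced_module (n + 1) g * mult_map n) $$ (r, c)" .
  qed (auto simp: tensor_def natural_rep_def)
qed auto

text \<open>Since \<open>mult_map\<close> is equivariant and kills the Koszul map,
  \<open>koszul_complete\<close> leaves only the component seen by the retraction to be
  computed.\<close>

lemma koszul_map_hom: "rep_hom (induced_module m) (tensor V (induced_module (m + 1))) (koszul_map m)"
proof (rule rep_homI)
  fix g :: "'a mat" assume g: "g \<in> SL2"
  have dg [simp]: "dim_row g = 2" "dim_col g = 2" using SL2_D[OF g] by auto
  let ?K = "tensor V (induced_module (m + 1))" and ?L = "[:g $$ (0, 0), g $$ (1, 0):]" and ?M = "[:g $$ (0, 1), g $$ (1, 1):]"
  have [simp]: "dim_row (tensor V (induced_module n) g) = 2 * (n + 1)" "dim_col (tensor V (induced_module n) g) = 2 * (n + 1)" for n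
    by (simp_all add: tensor_def natural_rep_def)
  have dK: "dim_row (?K g) = 2 * (m + 2)" "dim_col (?K g) = 2 * (m + 2)" by (simp_all add: tensor_def natural_rep_def)
  have R: "koszul_retraction m * (?K g * koszul_map m) = induced_module m g"
  proof (rule eq_matI)
    fix r c assume "r < dim_row (induced_module m g)" "c < dim_col (induced_module m g)"
    then have rc: "r < m + 1" "c < m + 1" by auto
    have K: "?K g $$ (m + 2 + r, k * (m + 2) + l) = g $$ (1, k) * coeff (?L ^ (m + 1 - l) * ?M ^ l) r" if "k < 2" "l < m + 2" for k l
    proof -
      have i: "m + 2 + r < 2 * (m + 2)" "k * (m + 2) + l < 2 * (m + 2)"
        using rc mult_add_less[OF that] by simp_all
      have dm: "(m + 2 + r) div (m + 2) = 1" "(m + 2 + r) mod (m + 2) = r" "(k * (m + 2) + l) div (m + 2) = k" "(k * (m + 2) + l) mod (m + 2) = l"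
        using rc that div_mod_add[of r "m + 2"] div_mod_mult_add[of l "m + 2" k] by simp_all
      show ?thesis using i dm rc that by (simp add: tensor_def natural_rep_def induced_module_def)
    qed
    have "(koszul_retraction m * (?K g * koszul_map m)) $$ (r, c) = (?K g * koszul_map m) $$ (m + 2 + r, c)"
      by (rule koszul_retraction_mult[OF _ rc(1)]) (simp_all only: index_mult_mat(2,3) dK dim_koszul rc)
    also have "\<dots> = ?K g $$ (m + 2 + r, c + 1) + ?K g $$ (m + 2 + r, m + 2 + c)"
    proof (rule mult_koszul_map[OF dK(2) _ rc(2)])
      show "m + 2 + r < dim_row (?K g)" unfolding dK using rc by presburger
    qed
    also have "\<dots> = g $$ (1, 0) * coeff (?L ^ (m - c) * ?M ^ (c + 1)) r + g $$ (1, 1) * coeff (?L ^ (m + 1 - c) * ?M ^ c) r"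
      using K[of 0 "c + 1"] K[of 1 c] rc by simp
    also have "\<dots> = coeff ((Polynomial.smult (g $$ (1, 0)) ?M + Polynomial.smult (g $$ (1, 1)) ?L) * (?L ^ (m - c) * ?M ^ c)) r"
    proof -
      have "m + 1 - c = Suc (m - c)" using rc by simp
      then have e: "?L ^ (m + 1 - c) * ?M ^ c = ?L * (?L ^ (m - c) * ?M ^ c)" "?L ^ (m - c) * ?M ^ (c + 1) = ?M * (?L ^ (m - c) * ?M ^ c)"
        by (simp_all only: power_Suc power_add power_one_right mult.assoc mult.commute mult.left_commute)
      show ?thesis unfolding e distrib_right by (simp only: coeff_add mult_smult_left coeff_smult)
    qed
    \<comment> \<open>The constant coefficient is the determinant; the linear one is twice a product
      and vanishes.\<close>
    also have "Polynomial.smult (g $$ (1, 0)) ?M + Polynomial.smult (g $$ (1, 1)) ?L = 1"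
      using det_two'[OF g] by (simp add: one_pCons mult.commute add.commute)
    finally show "(koszul_retraction m * (?K g * koszul_map m)) $$ (r, c) = induced_module m g $$ (r, c)"
      using rc by (simp add: induced_module_def)
  qed auto
  have z: "mult_map (m + 1) * (?K g * koszul_map m) = 0\<^sub>m (m + 3) (m + 1)"
  proof -
    have "mult_map (m + 1) * (?K g * koszul_map m) = (mult_map (m + 1) * ?K g) * koszul_map m" by (simp add: mat_mult_assoc)
    also have "\<dots> = induced_module (m + 2) g * (mult_map (m + 1) * koszul_map m)"
      using rep_hom_eq[OF mult_map_hom[of "m + 1"] g] by (simp add: mat_mult_assoc)
    also have "\<dots> = 0\<^sub>m (m + 3) (m + 1)" unfolding koszul_mult(3) by (simp add: eval_nat_numeral)
    finally show ?thesis .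
  qed
  have "?K g * koszul_map m = (koszul_map m * koszul_retraction m + mult_section (m + 1) * mult_map (m + 1)) * (?K g * koszul_map m)"
    unfolding koszul_complete by simp
  also have "\<dots> = koszul_map m * (koszul_retraction m * (?K g * koszul_map m)) + mult_section (m + 1) * (mult_map (m + 1) * (?K g * koszul_map m))"
    by (simp add: mat_distrib_right mat_mult_assoc)
  also have "\<dots> = koszul_map m * induced_module m g"
    unfolding R z by (simp add: eval_nat_numeral)
  finally show "koszul_map m * induced_module m g = ?K g * koszul_map m" ..
qed auto

lemma koszul_split_exact:
  "split_exact (induced_module m) (tensor V (induced_module (m + 1))) (induced_module (m + 2))
     (koszul_map m) (mult_map (m + 1)) (koszul_retraction m) (mult_section (m + 1))"
  unfolding split_exact_def
proof (intro conjI)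
  show "rep_hom (induced_module m) (tensor V (induced_module (m + 1))) (koszul_map m)" by (rule koszul_map_hom)
  show "rep_hom (tensor V (induced_module (m + 1))) (induced_module (m + 2)) (mult_map (m + 1))"
    using mult_map_hom[of "m + 1"] by simp
  show "koszul_map m * koszul_retraction m + mult_section (m + 1) * mult_map (m + 1) = 1\<^sub>m (rep_dim (tensor V (induced_module (m + 1))))"
    unfolding koszul_complete by simp
  show "mult_map (m + 1) * koszul_map m = 0\<^sub>m (rep_dim (induced_module (m + 2) :: 'a rep)) (rep_dim (induced_module m :: 'a rep))"
    unfolding koszul_mult(3) by (simp add: eval_nat_numeral)
  show "mult_map (m + 1) * mult_section (m + 1) = 1\<^sub>m (rep_dim (induced_module (m + 2) :: 'a rep))"
    unfolding koszul_mult(2) by simp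
  show "koszul_retraction m * koszul_map m = 1\<^sub>m (rep_dim (induced_module m :: 'a rep))"
    unfolding koszul_mult(1) by simp
qed (intro carrier_matI; simp)+

end

section \<open>Tilting modules\<close>

lemma has_filtration_algebraic: "has_filtration M \<rho> \<Longrightarrow> algebraic_rep \<rho>"
  by (induction rule: has_filtration.induct) auto

lemma thru_rep_hom:
  assumes "algebraic_rep \<rho>" "algebraic_rep \<sigma>" "\<And>X. X \<in> \<X> \<Longrightarrow> algebraic_rep X" "thru \<X> \<rho> \<sigma> A"
  shows "rep_hom \<rho> \<sigma> A"
  using assms(4)
proof induction
  case thru_zero
  then show ?case using assms by (intro rep_hom_zero)
next
  case (thru_add A X \<alpha> \<beta>)
  then show ?case using assms by (intro rep_hom_add rep_hom_comp[of \<rho> X \<sigma>]) auto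
qed

text \<open>In a local ring a sum is a unit only if one of its terms is, so a single member of the
  class already suffices.\<close>

lemma thru_unit:
  assumes alg: "algebraic_rep Y" "\<And>X. X \<in> \<X> \<Longrightarrow> algebraic_rep X" and ti: "trivial_idempotents Y" and dim: "rep_dim Y > 0"
    and "thru \<X> Y Y A" "rep_unit Y A"
  shows "\<exists>X\<in>\<X>. \<exists>\<alpha> \<beta>. rep_hom Y X \<alpha> \<and> rep_hom X Y \<beta> \<and> rep_unit Y (\<beta> * \<alpha>)"
  using assms(5,6)
proof induction
  case thru_zero
  then obtain \<psi> where "rep_hom Y Y \<psi>" "0\<^sub>m (rep_dim Y) (rep_dim Y) * \<psi> = 1\<^sub>m (rep_dim Y)"
    unfolding rep_unit_def by blast
  then have "0\<^sub>m (rep_dim Y) (rep_dim Y) = (1\<^sub>m (rep_dim Y) :: 'a mat)" by (simp add: rep_hom_dims)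
  then show ?case using dim by (metis index_one_mat(1) index_zero_mat(1) zero_neq_one)
next
  case (thru_add A X \<alpha> \<beta>)
  have "rep_hom Y Y A" "rep_hom Y Y (\<beta> * \<alpha>)"
    using thru_rep_hom[OF alg(1,1,2)] thru_add alg by (auto intro: rep_hom_comp)
  then have "rep_unit Y A \<or> rep_unit Y (\<beta> * \<alpha>)"
    using rep_unit_add[OF alg(1) ti dim] thru_add by blast
  then show ?case using thru_add by blast
qed

text \<open>Representations are functions on all matrices; \<open>induced_module 1\<close> and
  \<open>natural_rep\<close> agree only on the group.\<close>

lemma ext_trivial_cong:
  assumes "\<And>g. g \<in> SL2 \<Longrightarrow> \<tau> g = \<tau>' g" "ext_trivial \<sigma> \<tau>"
  shows "ext_trivial \<sigma> \<tau>'"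
proof -
  have d: "rep_dim \<tau> = rep_dim \<tau>'" using assms(1)[of "1\<^sub>m 2"] by (simp add: rep_dim_def)
  have "cocycle \<sigma> \<tau> c \<longleftrightarrow> cocycle \<sigma> \<tau>' c" for c using assms(1) by (simp add: cocycle_def d)
  then show ?thesis using assms unfolding ext_trivial_def d by simp
qed

lemma ext_trivial_zero_left: "rep_dim \<sigma> = 0 \<Longrightarrow> algebraic_rep \<sigma> \<Longrightarrow> algebraic_rep \<tau> \<Longrightarrow> ext_trivial \<sigma> \<tau>"
  by (rule ext_trivialI, rule exI[of _ "0\<^sub>m (rep_dim \<tau>) 0"]) (auto intro!: eq_matI simp: cocycle_dims)

lemma ext_trivial_zero_right: "rep_dim \<tau> = 0 \<Longrightarrow> algebraic_rep \<sigma> \<Longrightarrow> algebraic_rep \<tau> \<Longrightarrow> ext_trivial \<sigma> \<tau>"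
  by (rule ext_trivialI, rule exI[of _ "0\<^sub>m 0 (rep_dim \<sigma>)"]) (auto intro!: eq_matI simp: cocycle_dims)

context char_two
begin

text \<open>Adjunction for the self-dual module \<open>V\<close>, with \<open>d\<close> the
  dimension of the source; \<open>uncurry_mat\<close> is its inverse by the zigzag
  identities.\<close>

definition curry_mat :: "nat \<Rightarrow> 'a mat \<Rightarrow> 'a mat" where
  "curry_mat d \<phi> = kronecker (1\<^sub>m 2) \<phi> * kronecker coev_mat (1\<^sub>m d)"

definition uncurry_mat :: "nat \<Rightarrow> 'a mat \<Rightarrow> 'a mat" where
  "uncurry_mat e \<theta> = kronecker ev_mat (1\<^sub>m e) * kronecker (1\<^sub>m 2) \<theta>"

lemma rep_hom_uncurry:
  assumes "algebraic_rep \<sigma>" "algebraic_rep \<tau>" "rep_hom \<sigma> (tensor V \<tau>) \<theta>"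
  shows "rep_hom (tensor V \<sigma>) \<tau> (uncurry_mat (rep_dim \<tau>) \<theta>)"
  unfolding uncurry_mat_def
proof (rule rep_hom_comp[where \<sigma> = "tensor V (tensor V \<tau>)"])
  show "rep_hom (tensor V \<sigma>) (tensor V (tensor V \<tau>)) (kronecker (1\<^sub>m 2) \<theta>)"
    using rep_hom_tensor[OF _ _ _ _ rep_hom_one[of V] assms(3)] assms by simp
  show "rep_hom (tensor V (tensor V \<tau>)) \<tau> (kronecker ev_mat (1\<^sub>m (rep_dim \<tau>)))"
    using rep_hom_tensor[OF _ _ _ _ ev_hom rep_hom_one[of \<tau>]] assms by (simp add: tensor_assoc)
qed (use assms in auto)

lemma rep_hom_curry:
  assumes "algebraic_rep \<sigma>" "algebraic_rep \<tau>" "rep_hom (tensor V \<sigma>) \<tau> \<phi>"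
  shows "rep_hom \<sigma> (tensor V \<tau>) (curry_mat (rep_dim \<sigma>) \<phi>)"
  unfolding curry_mat_def
proof (rule rep_hom_comp[where \<sigma> = "tensor V (tensor V \<sigma>)"])
  show "rep_hom (tensor V (tensor V \<sigma>)) (tensor V \<tau>) (kronecker (1\<^sub>m 2) \<phi>)"
    using rep_hom_tensor[OF _ _ _ _ rep_hom_one[of V] assms(3)] assms by simp
  show "rep_hom \<sigma> (tensor V (tensor V \<sigma>)) (kronecker coev_mat (1\<^sub>m (rep_dim \<sigma>)))"
    using rep_hom_tensor[OF _ _ _ _ coev_hom rep_hom_one[of \<sigma>]] assms by (simp add: tensor_assoc)
qed (use assms in auto)

lemma snake_tensor:
  "kronecker (1\<^sub>m 2) (kronecker ev_mat (1\<^sub>m e)) * kronecker coev_mat (1\<^sub>m (2 * e)) = (1\<^sub>m (2 * e) :: 'a mat)"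
  "kronecker ev_mat (1\<^sub>m (2 * e)) * kronecker (1\<^sub>m 2) (kronecker coev_mat (1\<^sub>m e)) = (1\<^sub>m (2 * e) :: 'a mat)"
  unfolding kronecker_one_one[of 2 e, symmetric] kronecker_assoc[symmetric]
  by (simp_all add: kronecker_mult[symmetric] snake del: kronecker_one_one)

lemma curry_uncurry:
  assumes [simp]: "dim_row \<theta> = 2 * e" "dim_col \<theta> = d"
  shows "curry_mat d (uncurry_mat e \<theta>) = \<theta>"
proof -
  have 1: "kronecker (1\<^sub>m 2) (uncurry_mat e \<theta>) = kronecker (1\<^sub>m 2) (kronecker ev_mat (1\<^sub>m e)) * kronecker (1\<^sub>m 2) (kronecker (1\<^sub>m 2) \<theta>)"
    by (simp add: uncurry_mat_def kronecker_mult[symmetric])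
  have "kronecker (1\<^sub>m 2) (kronecker (1\<^sub>m 2) \<theta>) = kronecker (1\<^sub>m 4) \<theta>"
    by (simp add: kronecker_assoc[symmetric])
  then have "kronecker (1\<^sub>m 2) (kronecker (1\<^sub>m 2) \<theta>) * kronecker coev_mat (1\<^sub>m d) = kronecker (coev_mat * 1\<^sub>m 1) (1\<^sub>m (2 * e) * \<theta>)"
    by (simp add: kronecker_mult[symmetric])
  also have "\<dots> = kronecker coev_mat (1\<^sub>m (2 * e)) * \<theta>"
    by (subst kronecker_mult) (simp_all del: One_nat_def)
  finally have 2: "kronecker (1\<^sub>m 2) (kronecker (1\<^sub>m 2) \<theta>) * kronecker coev_mat (1\<^sub>m d) = kronecker coev_mat (1\<^sub>m (2 * e)) * \<theta>" .
  have "curry_mat d (uncurry_mat e \<theta>) = kronecker (1\<^sub>m 2) (kronecker ev_mat (1\<^sub>m e)) * (kronecker (1\<^sub>m 2) (kronecker (1\<^sub>m 2) \<theta>) * kronecker coev_mat (1\<^sub>m d))"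
    unfolding curry_mat_def 1 by (simp add: mat_mult_assoc)
  also have "\<dots> = kronecker (1\<^sub>m 2) (kronecker ev_mat (1\<^sub>m e)) * kronecker coev_mat (1\<^sub>m (2 * e)) * \<theta>"
    unfolding 2 by (simp add: mat_mult_assoc)
  finally show ?thesis by (simp add: snake_tensor)
qed

text \<open>The adjunction of \<open>V\<close> with itself carried over to cocycles, splitting
  included.\<close>

lemma ext_trivial_tensor:
  assumes alg: "algebraic_rep \<sigma>" "algebraic_rep \<tau>" and ext: "ext_trivial \<sigma> (tensor V \<tau>)"
  shows "ext_trivial (tensor V \<sigma>) \<tau>"
proof (rule ext_trivialI)
  fix c assume c: "cocycle (tensor V \<sigma>) \<tau> c"
  let ?d = "rep_dim \<sigma>" and ?e = "rep_dim \<tau>"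
  let ?K = "kronecker coev_mat (1\<^sub>m ?d) :: 'a mat" and ?E = "kronecker ev_mat (1\<^sub>m ?e) :: 'a mat"
  \<comment> \<open>Tensoring the extension with \<open>V\<close> gives the block
    \<open>kronecker g (c g)\<close>; pulling it back along the coevaluation gives an extension of
    \<open>\<sigma>\<close>.\<close>
  define c' where "c' g = kronecker g (c g) * ?K" for g
  have dc [simp]: "dim_row (c g) = ?e" "dim_col (c g) = 2 * ?d" if "g \<in> SL2" for g
    using cocycle_dims[OF c that] by auto
  have dg [simp]: "dim_row g = 2" "dim_col g = 2" if "g \<in> SL2" for g :: "'a mat" using SL2_D[OF that] by auto
  have kr: "kronecker g (X * Y) = kronecker g X * kronecker (1\<^sub>m 2) Y" "kronecker g (X * Y) = kronecker (1\<^sub>m 2) X * kronecker g Y"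
    if "g \<in> SL2" "dim_col X = dim_row Y" for g X Y :: "'a mat"
    using that by (simp_all add: kronecker_mult[symmetric])
  have one_l: "kronecker ev_mat X = X * kronecker ev_mat (1\<^sub>m (dim_col X))" for X :: "'a mat"
    using kronecker_mult[of "1\<^sub>m 1" ev_mat X "1\<^sub>m (dim_col X)"] by (simp del: One_nat_def)
  have one_r: "kronecker coev_mat X = kronecker coev_mat (1\<^sub>m (dim_row X)) * X" for X :: "'a mat"
    using kronecker_mult[of coev_mat "1\<^sub>m 1" "1\<^sub>m (dim_row X)" X] by (simp del: One_nat_def)
  have ev: "?E * kronecker g (kronecker g X) = X * kronecker ev_mat (1\<^sub>m (dim_col X))" if "g \<in> SL2" "dim_row X = ?e" for g X
  proof -
    have "ev_mat * kronecker g g = ev_mat"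
      using rep_hom_eq[OF ev_hom that(1)] by (simp add: tensor_def natural_rep_def trivial_rep_def del: One_nat_def)
    then show ?thesis
      using that one_l[of X] by (simp add: kronecker_assoc[symmetric] kronecker_mult[symmetric])
  qed
  have coev: "kronecker g (kronecker g X) * ?K = kronecker coev_mat (1\<^sub>m (dim_row X)) * X" if "g \<in> SL2" "dim_col X = ?d" for g X
  proof -
    have "kronecker g g * coev_mat = coev_mat"
      using rep_hom_eq[OF coev_hom that(1)] by (simp add: tensor_def natural_rep_def trivial_rep_def del: One_nat_def)
    then show ?thesis
      using that one_r[of X] by (simp add: kronecker_assoc[symmetric] kronecker_mult[symmetric])
  qed
  have c': "cocycle \<sigma> (tensor V \<tau>) c'"
    unfolding cocycle_def
  proof (intro conjI ballI)
    have "regular_mat (2 * ?e) (2 * (2 * ?d)) (\<lambda>g. kronecker g (c g))"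
    proof (rule regular_mat_kronecker)
      show "regular_mat 2 2 (\<lambda>g :: 'a mat. g)" using algebraic_rep_regular[OF algebraic_rep_natural] unfolding rep_dim_natural unfolding natural_rep_def .
      show "regular_mat ?e (2 * ?d) c" using c alg by (simp add: cocycle_def)
    qed
    then show "regular_mat (rep_dim (tensor V \<tau>)) (rep_dim \<sigma>) c'"
      unfolding c'_def by (intro regular_mat_mult[OF _ regular_mat_const]) (auto intro!: carrier_matI)
    fix g h :: "'a mat" assume gh: "g \<in> SL2" "h \<in> SL2"
    have "c' (g * h) = kronecker (g * h) (\<tau> g * c h) * ?K + kronecker (g * h) (c g * tensor V \<sigma> h) * ?K"
      using gh alg by (simp add: c'_def cocycle_mult[OF c] kronecker_add_right mat_distrib_right)
    also have "kronecker (g * h) (\<tau> g * c h) * ?K = tensor V \<tau> g * c' h"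
      using gh alg by (simp add: c'_def tensor_def natural_rep_def kronecker_mult mat_mult_assoc)
    also have "kronecker (g * h) (c g * tensor V \<sigma> h) * ?K = kronecker g (c g) * (kronecker h (kronecker h (\<sigma> h)) * ?K)"
      using gh alg by (simp add: tensor_def natural_rep_def kronecker_mult mat_mult_assoc)
    also have "\<dots> = c' g * \<sigma> h"
      using gh alg by (simp add: coev c'_def mat_mult_assoc)
    finally show "c' (g * h) = tensor V \<tau> g * c' h + c' g * \<sigma> h" .
  qed
  obtain a where a [simp]: "dim_row a = 2 * ?e" "dim_col a = ?d"
    and ca: "\<And>g. g \<in> SL2 \<Longrightarrow> c' g = tensor V \<tau> g * a - a * \<sigma> g"
    using ext_trivialD[OF ext c'] by auto
  have "c g = \<tau> g * uncurry_mat ?e a - uncurry_mat ?e a * tensor V \<sigma> g" if g: "g \<in> SL2" for g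
  proof -
    have "?E * kronecker g (c' g) = ?E * kronecker g (kronecker g (c g)) * kronecker (1\<^sub>m 2) ?K"
      using g unfolding c'_def by (subst kr(1)) (simp_all add: mat_mult_assoc)
    also have "\<dots> = c g * (kronecker ev_mat (1\<^sub>m (2 * ?d)) * kronecker (1\<^sub>m 2) ?K)"
      using g by (simp add: ev mat_mult_assoc)
    also have "\<dots> = c g" using g by (simp add: snake_tensor)
    finally have "c g = ?E * kronecker g (tensor V \<tau> g * a - a * \<sigma> g)" using ca[OF g] by simp
    also have "\<dots> = ?E * kronecker g (kronecker g (\<tau> g) * a) - ?E * kronecker g (a * \<sigma> g)"
      using g alg by (simp add: tensor_def natural_rep_def kronecker_diff_right mat_diff_left)
    also have "?E * kronecker g (kronecker g (\<tau> g) * a) = \<tau> g * uncurry_mat ?e a"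
    proof -
      have "?E * kronecker g (kronecker g (\<tau> g) * a) = ?E * kronecker g (kronecker g (\<tau> g)) * kronecker (1\<^sub>m 2) a"
        using g alg by (subst kr(1)) (simp_all add: mat_mult_assoc)
      then show ?thesis using g alg by (simp add: ev uncurry_mat_def mat_mult_assoc)
    qed
    also have "?E * kronecker g (a * \<sigma> g) = uncurry_mat ?e a * tensor V \<sigma> g"
      using g alg by (subst kr(2)) (simp_all add: uncurry_mat_def tensor_def natural_rep_def mat_mult_assoc)
    finally show ?thesis .
  qed
  then show "\<exists>A. dim_row A = ?e \<and> dim_col A = rep_dim (tensor V \<sigma>) \<and> (\<forall>g\<in>SL2. c g = \<tau> g * A - A * tensor V \<sigma> g)"
    by (intro exI[of _ "uncurry_mat ?e a"]) (auto simp: uncurry_mat_def)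
qed

lemma induced_module_0: "induced_module 0 = (trivial_rep :: 'a rep)"
  by (rule ext, rule eq_matI) (auto simp: induced_module_def trivial_rep_def)

lemma induced_module_1: "g \<in> SL2 \<Longrightarrow> induced_module 1 g = (V g :: 'a mat)"
  using SL2_D[of g] by (intro eq_matI) (auto simp: induced_module_def natural_rep_def less_two)

definition ext_good :: "'a rep \<Rightarrow> bool" where
  "ext_good \<sigma> \<longleftrightarrow> algebraic_rep \<sigma> \<and> (\<forall>m. ext_trivial \<sigma> (induced_module m))"

text \<open>By adjunction it suffices to kill extensions by \<open>V \<otimes> H0(m)\<close>, which
  the Koszul sequence builds from \<open>H0(m - 1)\<close> and \<open>H0(m + 1)\<close>.\<close>

lemma ext_good_natural_tensor:
  assumes "ext_good \<sigma>"
  shows "ext_good (tensor V \<sigma>)"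
proof -
  have alg: "algebraic_rep \<sigma>" and ext: "\<And>m. ext_trivial \<sigma> (induced_module m)" using assms by (auto simp: ext_good_def)
  have "ext_trivial \<sigma> (tensor V (induced_module m))" for m
  proof (cases m)
    case 0
    have "ext_trivial \<sigma> V" using ext_trivial_cong[OF induced_module_1 ext[of 1]] by blast
    then show ?thesis using 0 by (simp add: induced_module_0)
  next
    case (Suc k)
    then show ?thesis
      using ext_trivial_extension_right[OF alg _ _ _ koszul_split_exact[of k] ext ext] by simp
  qed
  then show ?thesis using alg by (auto simp: ext_good_def intro: ext_trivial_tensor)
qed

lemma ext_good_tensor_power: "ext_good (tensor_power V n)"
proof (induction n)
  case 0
  then show ?case by (simp add: ext_good_def ext_trivial_trivial_induced tensor_power_0 del: tensor_power.simps(1))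
next
  case (Suc n)
  then show ?case using ext_good_natural_tensor by simp
qed

lemma weyl_filtration_ext_good:
  assumes "has_filtration weyl_module \<rho>"
  shows "ext_good \<rho>"
  using assms
proof induction
  case (zero \<rho>)
  then show ?case by (simp add: ext_good_def ext_trivial_zero_left)
next
  case (extend \<rho>' \<rho> n)
  obtain A B R S where "split_exact \<rho>' \<rho> (weyl_module n) A B R S"
    by (rule short_exact_split_exact[OF extend.hyps(3)])
  moreover have "algebraic_rep (weyl_module n :: 'a rep)" by (simp add: weyl_module_def)
  ultimately show ?case
    using extend ext_trivial_extension_left ext_trivial_weyl_induced unfolding ext_good_def
    by (metis algebraic_rep_induced)
qed

lemma induced_filtration_ext_trivial:
  assumes "has_filtration induced_module \<rho>" "ext_good \<sigma>"
  shows "ext_trivial \<sigma> \<rho>"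
  using assms(1)
proof induction
  case (zero \<rho>)
  then show ?case using assms(2) by (simp add: ext_good_def ext_trivial_zero_right)
next
  case (extend \<rho>' \<rho> n)
  obtain A B R S where "split_exact \<rho>' \<rho> (induced_module n) A B R S"
    by (rule short_exact_split_exact[OF extend.hyps(3)])
  then show ?case
    using extend ext_trivial_extension_right[of \<sigma> \<rho>' \<rho> "induced_module n"] assms(2) has_filtration_algebraic[OF extend.hyps(1)]
    unfolding ext_good_def by simp
qed

text \<open>Lift along the Koszul sequence to \<open>V \<otimes> H0(n - 1)\<close>, move
  \<open>V\<close> to the source by adjunction, factor by induction and move it back. The source
  changes to \<open>V \<otimes> \<sigma>\<close>, hence the general \<open>\<sigma>\<close>.\<close>

lemma hom_induced_factor:
  assumes "ext_good \<sigma>" "rep_hom \<sigma> (induced_module n) \<phi>"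
  shows "\<exists>\<theta> p. rep_hom \<sigma> (tensor_power V n) \<theta> \<and> rep_hom (tensor_power V n) (induced_module n) p \<and> \<phi> = p * \<theta>"
  using assms
proof (induction n arbitrary: \<sigma> \<phi>)
  case 0
  then have "rep_hom \<sigma> trivial_rep \<phi>" by (simp add: induced_module_0)
  moreover have "\<phi> = 1\<^sub>m 1 * \<phi>" using rep_hom_dims[OF \<open>rep_hom \<sigma> trivial_rep \<phi>\<close>] by (simp del: One_nat_def)
  moreover have "rep_hom trivial_rep trivial_rep (1\<^sub>m 1 :: 'a mat)" using rep_hom_one[of trivial_rep] by (simp del: One_nat_def)
  ultimately show ?case by (auto simp: induced_module_0 tensor_power_0 simp del: tensor_power.simps(1) One_nat_def)
next
  case (Suc n)
  have alg: "algebraic_rep \<sigma>" using Suc.prems by (simp add: ext_good_def)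
  show ?case
  proof (cases n)
    case 0
    have V1: "tensor_power V (Suc n) = V" using 0 by (simp add: tensor_power_0 del: tensor_power.simps(1))
    have d: "dim_row \<phi> = 2" "dim_col \<phi> = rep_dim \<sigma>" using rep_hom_dims[OF Suc.prems(2)] 0 by auto
    have "rep_hom \<sigma> V \<phi>"
      using rep_hom_eq[OF Suc.prems(2)] d 0 induced_module_1 by (intro rep_homI) auto
    moreover have "rep_hom V (induced_module (Suc n)) (1\<^sub>m 2)"
    proof (rule rep_homI)
      fix g :: "'a mat" assume g: "g \<in> SL2"
      have "induced_module (Suc n) g = V g" using induced_module_1[OF g] 0 by simp
      then show "1\<^sub>m 2 * V g = induced_module (Suc n) g * 1\<^sub>m 2" using g by simp
    qed (use 0 in auto)
    moreover have "\<phi> = 1\<^sub>m 2 * \<phi>" using d by simp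
    ultimately show ?thesis unfolding V1 by blast
  next
    case (Suc m)
    have n: "Suc n = m + 2" "n = m + 1" using Suc by auto
    have "rep_hom \<sigma> (induced_module (m + 2)) \<phi>" using Suc.prems(2) unfolding n(1) .
    from lift_hom[OF alg _ _ _ koszul_split_exact _ this] obtain q where
      q: "rep_hom \<sigma> (tensor V (induced_module (m + 1))) q" "mult_map (m + 1) * q = \<phi>"
      using Suc.prems(1) by (auto simp: ext_good_def)
    let ?S = "induced_module (m + 1) :: 'a rep" and ?P = "tensor_power V (m + 1)"
    have "rep_hom (tensor V \<sigma>) ?S (uncurry_mat (rep_dim ?S) q)"
      using q(1) alg by (intro rep_hom_uncurry) auto
    then obtain \<theta>' p' where h: "rep_hom (tensor V \<sigma>) ?P \<theta>'" "rep_hom ?P ?S p'" "uncurry_mat (rep_dim ?S) q = p' * \<theta>'"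
      using Suc.IH[OF ext_good_natural_tensor[OF Suc.prems(1)]] unfolding n(2) by blast
    let ?\<theta> = "curry_mat (rep_dim \<sigma>) \<theta>'"
    have \<theta>: "rep_hom \<sigma> (tensor V ?P) ?\<theta>" using h(1) alg by (intro rep_hom_curry) auto
    have kp: "rep_hom (tensor V ?P) (tensor V ?S) (kronecker (1\<^sub>m 2) p')"
      using rep_hom_tensor[OF _ _ _ _ rep_hom_one[of V] h(2)] by simp
    have mm: "rep_hom (tensor V ?S) (induced_module (m + 2)) (mult_map (m + 1))" using mult_map_hom[of "m + 1"] by simp
    have "q = curry_mat (rep_dim \<sigma>) (p' * \<theta>')"
      unfolding h(3)[symmetric] using rep_hom_dims[OF q(1)] by (subst curry_uncurry) auto
    also have "\<dots> = kronecker (1\<^sub>m 2) p' * ?\<theta>"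
      using rep_hom_dims[OF h(1)] rep_hom_dims[OF h(2)]
      by (simp add: curry_mat_def kronecker_mult[of "1\<^sub>m 2" "1\<^sub>m 2" p' \<theta>', simplified] mat_mult_assoc del: rep_dim_tensor_power)
    finally have "\<phi> = (mult_map (m + 1) * kronecker (1\<^sub>m 2) p') * ?\<theta>"
      using q(2) rep_hom_dims[OF kp] rep_hom_dims[OF \<theta>] rep_hom_dims[OF mm] by (metis mat_mult_assoc)
    moreover have "rep_hom (tensor V ?P) (induced_module (m + 2)) (mult_map (m + 1) * kronecker (1\<^sub>m 2) p')"
      by (rule rep_hom_comp[OF _ _ _ mm kp]) auto
    moreover have "tensor V ?P = tensor_power V (Suc n)" unfolding n(2) by simp
    ultimately show ?thesis using \<theta> unfolding n(1) by (metis n(1))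
  qed
qed

text \<open>Composed with the top quotient, \<open>\<phi>\<close> factors through a power of
  \<open>V\<close>; that factorisation lifts to \<open>W\<close> because extensions of this power by
  the lower part split. The difference maps into the lower part, where induction applies.\<close>

lemma hom_induced_filtration_thru:
  assumes "has_filtration induced_module W" "ext_good \<sigma>" "rep_hom \<sigma> W \<phi>"
  shows "thru (range (tensor_power V)) \<sigma> W \<phi>"
  using assms
proof (induction arbitrary: \<phi>)
  case (zero \<rho>)
  then have "\<phi> = 0\<^sub>m (rep_dim \<rho>) (rep_dim \<sigma>)" by (intro eq_matI) (auto simp: rep_hom_dims)
  then show ?case using thru_zero by metis
next
  case (extend \<rho>' \<rho> n)
  let ?P = "tensor_power V n"
  have alg: "algebraic_rep \<sigma>" "algebraic_rep \<rho>'" "algebraic_rep \<rho>"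
    using extend has_filtration_algebraic[OF extend.hyps(1)] by (auto simp: ext_good_def)
  obtain A B R S where ex: "split_exact \<rho>' \<rho> (induced_module n) A B R S"
    by (rule short_exact_split_exact[OF extend.hyps(3)])
  note s [simp] = split_exactD(3-10)[OF ex]
  note hA = split_exactD(1)[OF ex] and hB = split_exactD(2)[OF ex]
  have "rep_hom \<sigma> (induced_module n) (B * \<phi>)" using alg hB extend.prems by (blast intro: rep_hom_comp algebraic_rep_induced)
  from hom_induced_factor[OF extend.prems(1) this] obtain \<theta> p where
    h: "rep_hom \<sigma> ?P \<theta>" "rep_hom ?P (induced_module n) p" "B * \<phi> = p * \<theta>" by blast
  have "ext_trivial ?P \<rho>'" by (rule induced_filtration_ext_trivial[OF extend.hyps(1) ext_good_tensor_power])
  from lift_hom[OF _ alg(2,3) _ ex this h(2)] obtain q where q: "rep_hom ?P \<rho> q" "B * q = p" by auto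
  note [simp] = rep_hom_dims[OF q(1)] rep_hom_dims[OF h(1)] rep_hom_dims[OF extend.prems(2)]
  define \<psi> where "\<psi> = \<phi> - q * \<theta>"
  have psi: "rep_hom \<sigma> \<rho> \<psi>"
    unfolding \<psi>_def using alg q h extend.prems by (intro rep_hom_diff rep_hom_comp[of \<sigma> ?P \<rho>]) auto
  note [simp] = rep_hom_dims[OF psi]
  have "B * \<psi> = 0\<^sub>m (rep_dim (induced_module n :: 'a rep)) (rep_dim \<sigma>)"
    unfolding \<psi>_def using rep_hom_dims[OF h(2)] by (simp add: mat_diff_left h(3) q(2) mat_mult_assoc[symmetric])
  then have AR: "A * (R * \<psi>) = \<psi>" using split_exact_factor[OF ex, of \<psi>] by simp
  have "rep_hom \<sigma> \<rho>' (R * \<psi>)"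
  proof (rule rep_homI)
    fix g :: "'a mat" assume g: "g \<in> SL2"
    have "R * \<psi> * \<sigma> g = R * (\<rho> g * \<psi>)" using alg g rep_hom_eq[OF psi g] by (simp add: mat_mult_assoc)
    also have "\<dots> = R * (\<rho> g * (A * (R * \<psi>)))" by (simp only: AR)
    also have "\<dots> = R * ((\<rho> g * A) * (R * \<psi>))" using alg g by (simp add: mat_mult_assoc)
    also have "\<dots> = R * ((A * \<rho>' g) * (R * \<psi>))" using rep_hom_eq[OF hA g] by simp
    also have "\<dots> = \<rho>' g * (R * \<psi>)" using alg g by (simp add: mat_mult_assoc cancel_mid[OF split_exactD(11)[OF ex]])
    finally show "R * \<psi> * \<sigma> g = \<rho>' g * (R * \<psi>)" .
  qed auto
  then have "thru (range (tensor_power V)) \<sigma> \<rho>' (R * \<psi>)" using extend.IH extend.prems(1) by blast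
  then have "thru (range (tensor_power V)) \<sigma> \<rho> (A * (R * \<psi>) * 1\<^sub>m (rep_dim \<sigma>))"
    by (intro thru_comp[OF alg(1,2,1,3) _ rep_hom_one[OF alg(1)] hA]) auto
  then have t: "thru (range (tensor_power V)) \<sigma> \<rho> \<psi>" by (simp add: AR)
  have "thru (range (tensor_power V)) \<sigma> \<rho> (\<psi> + q * \<theta>)"
    by (rule thru.thru_add[OF t _ h(1) q(1)]) simp
  moreover have "\<psi> + q * \<theta> = \<phi>" unfolding \<psi>_def by (rule eq_matI) (auto simp del: index_mult_mat(1))
  ultimately show ?case by simp
qed

lemma tilting_word_generated:
  assumes "tilting W"
  shows "word_generated W"
proof -
  have W: "algebraic_rep W" "has_filtration induced_module W" "ext_good W"
    using assms weyl_filtration_ext_good by (auto simp: tilting_def)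
  have "thru (range (tensor_power V)) W W (1\<^sub>m (rep_dim W))"
    using hom_induced_filtration_thru[OF W(2,3) rep_hom_one[OF W(1)]] .
  then show ?thesis using word_generated_thru[OF W(1)] word_generated_tensor_power by blast
qed

text \<open>By locality \<open>Y\<close> is a retract of a single word. The resulting idempotent of
  the word is nonzero, hence the identity, so the two are isomorphic.\<close>

lemma indecomposable_word_generated:
  assumes ind: "indecomposable Y" and gen: "word_generated Y"
  shows "\<exists>w. retract Y (word_rep w) \<and> rep_dim Y = 2 ^ sum_list w"
proof -
  have Y: "algebraic_rep Y" "rep_dim Y > 0" using ind by (auto simp: indecomposable_def)
  note ti = indecomposable_trivial_idempotents[OF ind]
  have "rep_unit Y (1\<^sub>m (rep_dim Y))"
    unfolding rep_unit_def using rep_hom_one[OF Y(1)] by (metis dim_one_mat(1) left_mult_one_mat')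
  then obtain X \<alpha> \<beta> where X: "X \<in> tilting_words" "rep_hom Y X \<alpha>" "rep_hom X Y \<beta>" "rep_unit Y (\<beta> * \<alpha>)"
    using thru_unit[OF Y(1) algebraic_rep_tilting_words ti Y(2)] gen unfolding word_generated_def by blast
  obtain w where w: "X = word_rep w" "set w \<subseteq> {1, 2}" using X(1) by (auto simp: tilting_words_def)
  have algX: "algebraic_rep X" using X(1) by (rule algebraic_rep_tilting_words)
  obtain v where v: "rep_hom Y Y v" "v * (\<beta> * \<alpha>) = 1\<^sub>m (rep_dim Y)" using X(4) unfolding rep_unit_def by blast
  note [simp] = rep_hom_dims[OF X(2)] rep_hom_dims[OF X(3)] rep_hom_dims[OF v(1)]
  let ?b = "v * \<beta>"
  have b: "rep_hom X Y ?b" by (rule rep_hom_comp[OF algX Y(1) Y(1) v(1) X(3)])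
  have ba: "?b * \<alpha> = 1\<^sub>m (rep_dim Y)" using v(2) by (simp add: mat_mult_assoc)
  define e where "e = \<alpha> * ?b"
  have "rep_hom X X e" unfolding e_def by (rule rep_hom_comp[OF algX Y(1) algX X(2) b])
  moreover have "e * e = e"
  proof -
    have "e * e = \<alpha> * (?b * \<alpha>) * ?b" unfolding e_def by (simp add: mat_mult_assoc)
    then show ?thesis by (simp add: ba e_def)
  qed
  ultimately have "e = 0\<^sub>m (rep_dim X) (rep_dim X) \<or> e = 1\<^sub>m (rep_dim X)"
    using trivial_idempotents_word_rep[OF w(2)] w(1) unfolding trivial_idempotents_def by blast
  moreover have "e \<noteq> 0\<^sub>m (rep_dim X) (rep_dim X)"
  proof
    assume "e = 0\<^sub>m (rep_dim X) (rep_dim X)"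
    moreover have "1\<^sub>m (rep_dim Y) = ?b * e * \<alpha>"
    proof -
      have "?b * e * \<alpha> = (?b * \<alpha>) * (?b * \<alpha>)" unfolding e_def by (simp add: mat_mult_assoc)
      then show ?thesis by (simp add: ba)
    qed
    ultimately have "1\<^sub>m (rep_dim Y) = (0\<^sub>m (rep_dim Y) (rep_dim Y) :: 'a mat)" by simp
    then show False using Y(2) by (metis index_one_mat(1) index_zero_mat(1) zero_neq_one)
  qed
  ultimately have ab: "\<alpha> * ?b = 1\<^sub>m (rep_dim X)" by (simp add: e_def)
  have "retract Y X" unfolding retract_def using b X(2) ab by blast
  moreover have "rep_iso Y X" using rep_iso_iff[OF Y(1) algX] X(2) b ab ba by blast
  ultimately show ?thesis using rep_iso_rep_dim w(1) by (metis rep_dim_word_rep)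
qed

text \<open>Keeps exactly what the count needs from the decomposition: the dimension, and the
  inequality after tensoring with an arbitrary module.\<close>

lemma word_decomposition:
  fixes \<sigma>s :: "'a rep list"
  assumes "\<forall>Y\<in>set \<sigma>s. algebraic_rep Y \<and> (\<exists>w. retract Y (word_rep w) \<and> rep_dim Y = 2 ^ sum_list w)"
  shows "\<exists>ws. rep_dim (direct_sum \<sigma>s) = (\<Sum>w\<leftarrow>ws. 2 ^ sum_list w) \<and>
    (\<forall>L. algebraic_rep L \<longrightarrow> (\<Sum>w\<leftarrow>ws. num_summands (tensor (word_rep w) L)) \<le> num_summands (tensor (direct_sum \<sigma>s) L))"
  using assms
proof (induction \<sigma>s)
  case Nil
  then show ?case by (intro exI[of _ "[]"]) auto
next
  case (Cons Y \<sigma>s)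
  let ?M = "direct_sum (Y # \<sigma>s)" and ?D = "direct_sum \<sigma>s"
  obtain w where w: "retract Y (word_rep w)" "rep_dim Y = 2 ^ sum_list w" using Cons.prems by auto
  obtain ws where ws: "rep_dim ?D = (\<Sum>w\<leftarrow>ws. 2 ^ sum_list w)"
    "\<And>L. algebraic_rep L \<Longrightarrow> (\<Sum>w\<leftarrow>ws. num_summands (tensor (word_rep w) L)) \<le> num_summands (tensor ?D L)"
    using Cons by auto
  have as: "algebraic_rep Y" "\<forall>\<sigma>\<in>set \<sigma>s. algebraic_rep \<sigma>" using Cons.prems by auto
  have alg: "algebraic_rep ?M" "algebraic_rep ?D" using as by (auto intro!: algebraic_rep_direct_sum)
  have "biprod ?M Y ?D" using biprod_direct_sum_append[of "[Y]" \<sigma>s] as by simp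
  then obtain \<iota> \<pi> \<iota>' \<pi>' where b: "rep_hom Y ?M \<iota>" "rep_hom ?M Y \<pi>" "rep_hom ?D ?M \<iota>'" "rep_hom ?M ?D \<pi>'"
     "\<pi> * \<iota> = 1\<^sub>m (rep_dim Y)" "\<pi>' * \<iota>' = 1\<^sub>m (rep_dim ?D)"
     "\<pi> * \<iota>' = 0\<^sub>m (rep_dim Y) (rep_dim ?D)" "\<pi>' * \<iota> = 0\<^sub>m (rep_dim ?D) (rep_dim Y)"
    unfolding biprod_def by blast
  have fam: "orth_family ?M {True, False} (\<lambda>b. if b then Y else ?D)"
    unfolding orth_family_def
    by (rule exI[of _ "\<lambda>b. if b then \<iota> else \<iota>'"], rule exI[of _ "\<lambda>b. if b then \<pi> else \<pi>'"]) (simp add: b)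
  have le: "num_summands (tensor (word_rep w) L) + (\<Sum>w\<leftarrow>ws. num_summands (tensor (word_rep w) L)) \<le> num_summands (tensor ?M L)"
    if L: "algebraic_rep L" for L
  proof -
    have "orth_family (tensor trivial_rep (tensor ?M L)) {True, False} (\<lambda>b. tensor trivial_rep (tensor (if b then Y else ?D) L))"
      using as alg L by (intro orth_family_tensor fam) auto
    from num_summands_orth_family[OF _ _ _ this]
    have "num_summands (tensor Y L) + num_summands (tensor ?D L) \<le> num_summands (tensor ?M L)"
      using as alg L by (simp split: if_splits)
    moreover have "num_summands (tensor (word_rep w) L) \<le> num_summands (tensor Y L)"
      using as L w by (intro num_summands_retract retract_tensor retract_refl) auto
    ultimately show ?thesis using ws(2)[OF L] by linarith
  qed
  have "rep_dim ?M = rep_dim Y + rep_dim ?D" using rep_dim_direct_sum_append[of "[Y]" \<sigma>s] as by simp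
  then show ?case using le w ws by (intro exI[of _ "w # ws"]) auto
qed

text \<open>Generation by words passes from \<open>W\<close> to its indecomposable summands, which
  identifies each with a word and supplies the input of
  \<open>tensor_power_lower_bound\<close>.\<close>

lemma tilting_lower_bound:
  fixes W :: "'a rep"
  assumes \<delta>: "\<delta> \<ge> 0" "4 powr \<delta> = 8 / 3" and W: "tilting W"
  shows "\<exists>c>0. \<forall>k\<ge>1. real (b_tensor W k) \<ge> c * real k powr (- \<delta>) * real (rep_dim W) ^ k"
proof -
  have gen: "word_generated W" by (rule tilting_word_generated[OF W])
  then have algW: "algebraic_rep W" by (simp add: word_generated_def)
  obtain \<sigma>s where dec: "indecomposable_decomposition W \<sigma>s" using indecomposable_decomposition_exists[OF algW] by blast
  then have ind: "\<forall>\<sigma>\<in>set \<sigma>s. indecomposable \<sigma>" and iso: "rep_iso W (direct_sum \<sigma>s)"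
    by (auto simp: indecomposable_decomposition_def)
  have as: "\<forall>\<sigma>\<in>set \<sigma>s. algebraic_rep \<sigma>" using ind by (auto simp: indecomposable_def)
  note algD = algebraic_rep_direct_sum[OF as]
  obtain A B where AB: "rep_hom W (direct_sum \<sigma>s) A" "rep_hom (direct_sum \<sigma>s) W B"
    "B * A = 1\<^sub>m (rep_dim W)" "A * B = 1\<^sub>m (rep_dim (direct_sum \<sigma>s))"
    using iso rep_iso_iff[OF algW algD] by blast
  have rWD: "retract W (direct_sum \<sigma>s)" using AB unfolding retract_def by blast
  have gen_retract: "word_generated Y" if Y: "algebraic_rep Y" "retract W Y" for Y
  proof -
    obtain i p where ip: "rep_hom Y W i" "rep_hom W Y p" "p * i = 1\<^sub>m (rep_dim Y)" using Y unfolding retract_def by blast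
    have "thru tilting_words Y Y (p * 1\<^sub>m (rep_dim W) * i)"
      using thru_comp[OF algW algW Y(1,1) algebraic_rep_tilting_words ip(1,2)] gen unfolding word_generated_def by blast
    then show ?thesis using ip Y by (simp add: word_generated_def rep_hom_dims)
  qed
  have "retract (direct_sum \<sigma>s) Y" if "Y \<in> set \<sigma>s" for Y
    using that as
  proof (induction \<sigma>s)
    case (Cons X \<sigma>s)
    have bp: "biprod (direct_sum (X # \<sigma>s)) X (direct_sum \<sigma>s)" using biprod_direct_sum_append[of "[X]" \<sigma>s] Cons.prems by simp
    have alg: "algebraic_rep (direct_sum (X # \<sigma>s))" "algebraic_rep (direct_sum \<sigma>s)" using Cons.prems by (auto intro!: algebraic_rep_direct_sum)
    have r: "retract (direct_sum (X # \<sigma>s)) X" "retract (direct_sum (X # \<sigma>s)) (direct_sum \<sigma>s)"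
      using bp unfolding biprod_def retract_def by blast+
    show ?case
    proof (cases "Y = X")
      case False
      then have "retract (direct_sum \<sigma>s) Y" using Cons by auto
      then show ?thesis using retract_trans[OF alg _ r(2)] Cons.prems by auto
    qed (use r in simp)
  qed simp
  then have "\<forall>Y\<in>set \<sigma>s. algebraic_rep Y \<and> (\<exists>w. retract Y (word_rep w) \<and> rep_dim Y = 2 ^ sum_list w)"
    using indecomposable_word_generated gen_retract retract_trans[OF algW algD _ rWD] ind as by blast
  from word_decomposition[OF this] obtain ws where ws: "rep_dim (direct_sum \<sigma>s) = (\<Sum>w\<leftarrow>ws. 2 ^ sum_list w)"
    "\<And>L. algebraic_rep L \<Longrightarrow> (\<Sum>w\<leftarrow>ws. num_summands (tensor (word_rep w) L)) \<le> num_summands (tensor (direct_sum \<sigma>s) L)"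
    by blast
  have "(\<Sum>w\<leftarrow>ws. num_summands (tensor (word_rep w) L)) \<le> num_summands (tensor W L)" if L: "algebraic_rep L" for L
  proof -
    have "num_summands (tensor (direct_sum \<sigma>s) L) \<le> num_summands (tensor W L)"
      using algW algD L rWD by (intro num_summands_retract retract_tensor retract_refl) auto
    then show ?thesis using ws(2)[OF L] by linarith
  qed
  moreover have "rep_dim W = (\<Sum>w\<leftarrow>ws. 2 ^ sum_list w)" using rep_iso_rep_dim[OF iso] ws(1) by simp
  ultimately show ?thesis
    unfolding b_tensor_def using tensor_power_lower_bound[OF \<delta> algW] by blast
qed

end

theorem theorem6p1:
  fixes W :: "'a :: alg_closed_field rep" and \<delta> :: real
  assumes "CHAR('a) = 2"
    and "\<delta> = 3 / 2 - ln 3 / (2 * ln 2)"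
    and "tilting W"
  shows "\<exists>c>0. \<forall>k\<ge>1. real (b_tensor W k) \<ge> c * real k powr (- \<delta>) * real (rep_dim W) ^ k"
proof -
  have "(2 :: 'a) = 0" using of_nat_CHAR[where 'a = 'a] assms(1) by simp
  then interpret char_two "TYPE('a)" by unfold_locales
  \<comment> \<open>Twice \<open>\<delta> * ln 2\<close> is \<open>3 * ln 2 - ln 3\<close>; this is
    the condition that one passage from \<open>k\<close> to \<open>k / 4\<close> is balanced by the
    factor 3/8.\<close>
  have e: "\<delta> * ln 4 = ln (8 / 3)"
  proof -
    have "ln (4 :: real) = 2 * ln 2" "ln (8 :: real) = 3 * ln 2"
      using ln_realpow[of "2 :: real" 2] ln_realpow[of "2 :: real" 3] by simp_all
    then show ?thesis unfolding assms(2) by (simp add: ln_div field_simps)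
  qed
  then have "4 powr \<delta> = 8 / 3" by (simp add: powr_def)
  moreover have "\<delta> \<ge> 0"
  proof -
    have "0 \<le> \<delta> * ln 4" unfolding e by (rule ln_ge_zero) simp
    then show ?thesis by (simp add: zero_le_mult_iff)
  qed
  ultimately show ?thesis using tilting_lower_bound assms(3) by blast
qed

end
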